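(* For each integer $k\ge1$, the relation $\omega_1\not\rightarrow^*[(\omega_1;\omega_1)]_{k\text{-bdd}}$ is consistent (relative to the consistency of ZFC) with Martin's Axiom together with $\mathrm{MA}_{\aleph_1}$ (equivalently, with $\mathrm{MA}+\neg\mathrm{CH}$).
   Context: $[X]^2$ is the set of two-element subsets of $X$. A function $c:[\omega_1]^2\to C$ is $k$-bounded if $|c^{-1}\{\xi\}|\le k$ for each $\xi\in C$. For sets $A,B$ of ordinals put $[A;B]=\{\{\alpha,\beta\}:\alpha\in A,\ \beta\in B,\ \alpha<\beta\}$. The relation $\omega_1\not\rightarrow^*[(\omega_1;\omega_1)]_{k\text{-bdd}}$ says: there is a $k$-bounded colouring $c$ of $[\omega_1]^2$ such that for all $A,B\subseteq\omega_1$ of order type $\omega_1$ there is $\xi\in\operatorname{ran}(c)$ with $|[A;B]\cap c^{-1}\{\xi\}|\ge k$. *)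

theory Defs
  imports Main
begin

section \<open>First-order logic in the language of set theory\<close>

text \<open>
  Formulas use de Bruijn indices. The only terms are variables, so that instantiating a
  quantifier is a renaming of free variables.
\<close>

datatype fm = FMem nat nat | FEq nat nat | FFalse | FImp fm fm | FAll fm

primrec ren :: "(nat \<Rightarrow> nat) \<Rightarrow> fm \<Rightarrow> fm" where
  "ren f (FMem i j) = FMem (f i) (f j)"
| "ren f (FEq i j) = FEq (f i) (f j)"
| "ren f FFalse = FFalse"
| "ren f (FImp p q) = FImp (ren f p) (ren f q)"
| "ren f (FAll p) = FAll (ren (case_nat 0 (\<lambda>i. Suc (f i))) p)"

definition inst :: "fm \<Rightarrow> nat \<Rightarrow> fm" where
  "inst p i = ren (case_nat i (\<lambda>j. j)) p"

text \<open>All free variables of the formula have an index below \<open>n\<close>.\<close>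

primrec free_below :: "nat \<Rightarrow> fm \<Rightarrow> bool" where
  "free_below n (FMem i j) \<longleftrightarrow> i < n \<and> j < n"
| "free_below n (FEq i j) \<longleftrightarrow> i < n \<and> j < n"
| "free_below n FFalse \<longleftrightarrow> True"
| "free_below n (FImp p q) \<longleftrightarrow> free_below n p \<and> free_below n q"
| "free_below n (FAll p) \<longleftrightarrow> free_below (Suc n) p"

text \<open>Classical natural deduction with equality, from a possibly infinite set of hypotheses.\<close>

inductive provable :: "fm set \<Rightarrow> fm \<Rightarrow> bool" (infix \<open>\<turnstile>\<close> 40) where
  hyp: "p \<in> \<Gamma> \<Longrightarrow> \<Gamma> \<turnstile> p"
| impI: "insert p \<Gamma> \<turnstile> q \<Longrightarrow> \<Gamma> \<turnstile> FImp p q"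
| impE: "\<Gamma> \<turnstile> FImp p q \<Longrightarrow> \<Gamma> \<turnstile> p \<Longrightarrow> \<Gamma> \<turnstile> q"
| raa: "insert (FImp p FFalse) \<Gamma> \<turnstile> FFalse \<Longrightarrow> \<Gamma> \<turnstile> p"
| allI: "ren Suc ` \<Gamma> \<turnstile> p \<Longrightarrow> \<Gamma> \<turnstile> FAll p"
| allE: "\<Gamma> \<turnstile> FAll p \<Longrightarrow> \<Gamma> \<turnstile> inst p i"
| eq_refl: "\<Gamma> \<turnstile> FEq i i"
| eq_subst: "\<Gamma> \<turnstile> FEq i j \<Longrightarrow> \<Gamma> \<turnstile> inst p i \<Longrightarrow> \<Gamma> \<turnstile> inst p j"

definition consistent :: "fm set \<Rightarrow> bool" where
  "consistent T \<longleftrightarrow> \<not> (T \<turnstile> FFalse)"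


section \<open>Named binders\<close>

text \<open>
  To write concrete formulas legibly, a formula is presented as a function of the number \<open>d\<close> of
  enclosing quantifiers. Inside such a presentation a variable is denoted by its level, i.e. by
  the number of quantifiers enclosing its binder; at depth \<open>d\<close> the variable of level \<open>x\<close> has
  de Bruijn index \<open>d - Suc x\<close>. A quantifier met at depth \<open>d\<close> passes the level \<open>d\<close> to its body.
  A sentence is obtained by taking \<open>d = 0\<close>.
\<close>

type_synonym var = nat
type_synonym form = "nat \<Rightarrow> fm"

definition sentence :: "form \<Rightarrow> fm" where
  "sentence F = F 0"

definition f_mem :: "var \<Rightarrow> var \<Rightarrow> form" (infix \<open>\<^bold>\<in>\<close> 50) where
  "(x \<^bold>\<in> y) = (\<lambda>d. FMem (d - Suc x) (d - Suc y))"

definition f_eq :: "var \<Rightarrow> var \<Rightarrow> form" (infix \<open>\<^bold>=\<close> 50) where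
  "(x \<^bold>= y) = (\<lambda>d. FEq (d - Suc x) (d - Suc y))"

definition f_imp :: "form \<Rightarrow> form \<Rightarrow> form" (infixr \<open>\<^bold>\<longrightarrow>\<close> 25) where
  "(F \<^bold>\<longrightarrow> G) = (\<lambda>d. FImp (F d) (G d))"

definition f_not :: "form \<Rightarrow> form" (\<open>\<^bold>\<not> _\<close> [40] 40) where
  "(\<^bold>\<not> F) = (F \<^bold>\<longrightarrow> (\<lambda>d. FFalse))"

definition f_or :: "form \<Rightarrow> form \<Rightarrow> form" (infixr \<open>\<^bold>\<or>\<close> 30) where
  "(F \<^bold>\<or> G) = (\<^bold>\<not> F \<^bold>\<longrightarrow> G)"

definition f_and :: "form \<Rightarrow> form \<Rightarrow> form" (infixr \<open>\<^bold>\<and>\<close> 35) where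
  "(F \<^bold>\<and> G) = (\<^bold>\<not> (F \<^bold>\<longrightarrow> \<^bold>\<not> G))"

definition f_iff :: "form \<Rightarrow> form \<Rightarrow> form" (infixr \<open>\<^bold>\<longleftrightarrow>\<close> 25) where
  "(F \<^bold>\<longleftrightarrow> G) = ((F \<^bold>\<longrightarrow> G) \<^bold>\<and> (G \<^bold>\<longrightarrow> F))"

definition f_all :: "(var \<Rightarrow> form) \<Rightarrow> form" (binder \<open>\<^bold>\<forall>\<close> 10) where
  "(\<^bold>\<forall>x. F x) = (\<lambda>d. FAll (F d (Suc d)))"

definition f_ex :: "(var \<Rightarrow> form) \<Rightarrow> form" (binder \<open>\<^bold>\<exists>\<close> 10) where
  "(\<^bold>\<exists>x. F x) = (\<^bold>\<not> (\<^bold>\<forall>x. \<^bold>\<not> F x))"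

text \<open>The formula \<open>p\<close> with its free variable of index \<open>i\<close> replaced by the variable of level \<open>v i\<close>.\<close>

definition f_plug :: "fm \<Rightarrow> (nat \<Rightarrow> var) \<Rightarrow> form" where
  "f_plug p v = (\<lambda>d. ren (\<lambda>i. d - Suc (v i)) p)"


section \<open>Basic set-theoretic notions\<close>

definition is_subset :: "var \<Rightarrow> var \<Rightarrow> form" (infix \<open>\<^bold>\<subseteq>\<close> 50) where
  "x \<^bold>\<subseteq> y = (\<^bold>\<forall>z. z \<^bold>\<in> x \<^bold>\<longrightarrow> z \<^bold>\<in> y)"

definition is_empty :: "var \<Rightarrow> form" where
  "is_empty x = (\<^bold>\<forall>z. \<^bold>\<not> z \<^bold>\<in> x)"

definition is_upair :: "var \<Rightarrow> var \<Rightarrow> var \<Rightarrow> form" where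
  "is_upair x y p = (\<^bold>\<forall>z. z \<^bold>\<in> p \<^bold>\<longleftrightarrow> z \<^bold>= x \<^bold>\<or> z \<^bold>= y)"

definition is_pair :: "var \<Rightarrow> var \<Rightarrow> var \<Rightarrow> form" where
  "is_pair x y p = (\<^bold>\<exists>u v. is_upair x x u \<^bold>\<and> is_upair x y v \<^bold>\<and> is_upair u v p)"

definition pair_in :: "var \<Rightarrow> var \<Rightarrow> var \<Rightarrow> form" where
  "pair_in x y r = (\<^bold>\<exists>p. is_pair x y p \<^bold>\<and> p \<^bold>\<in> r)"

definition is_inter :: "var \<Rightarrow> var \<Rightarrow> var \<Rightarrow> form" where
  "is_inter x y i = (\<^bold>\<forall>z. z \<^bold>\<in> i \<^bold>\<longleftrightarrow> z \<^bold>\<in> x \<^bold>\<and> z \<^bold>\<in> y)"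

definition is_power :: "var \<Rightarrow> var \<Rightarrow> form" where
  "is_power x p = (\<^bold>\<forall>z. z \<^bold>\<in> p \<^bold>\<longleftrightarrow> z \<^bold>\<subseteq> x)"

definition is_succ :: "var \<Rightarrow> var \<Rightarrow> form" where
  "is_succ x s = (\<^bold>\<forall>z. z \<^bold>\<in> s \<^bold>\<longleftrightarrow> z \<^bold>\<in> x \<^bold>\<or> z \<^bold>= x)"

definition is_fun :: "var \<Rightarrow> var \<Rightarrow> var \<Rightarrow> form" where
  "is_fun f A B =
     ((\<^bold>\<forall>p. p \<^bold>\<in> f \<^bold>\<longrightarrow> (\<^bold>\<exists>x y. x \<^bold>\<in> A \<^bold>\<and> y \<^bold>\<in> B \<^bold>\<and> is_pair x y p)) \<^bold>\<and>
      (\<^bold>\<forall>x. x \<^bold>\<in> A \<^bold>\<longrightarrow> (\<^bold>\<exists>y. pair_in x y f)) \<^bold>\<and>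
      (\<^bold>\<forall>x y z. pair_in x y f \<^bold>\<and> pair_in x z f \<^bold>\<longrightarrow> y \<^bold>= z))"

definition is_injective :: "var \<Rightarrow> form" where
  "is_injective f = (\<^bold>\<forall>x y z. pair_in x z f \<^bold>\<and> pair_in y z f \<^bold>\<longrightarrow> x \<^bold>= y)"

definition in_range :: "var \<Rightarrow> var \<Rightarrow> form" where
  "in_range y f = (\<^bold>\<exists>x. pair_in x y f)"

definition is_onto :: "var \<Rightarrow> var \<Rightarrow> form" where
  "is_onto f B = (\<^bold>\<forall>y. y \<^bold>\<in> B \<^bold>\<longrightarrow> in_range y f)"

definition card_le :: "var \<Rightarrow> var \<Rightarrow> form" where
  "card_le A B = (\<^bold>\<exists>f. is_fun f A B \<^bold>\<and> is_injective f)"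

definition card_less :: "var \<Rightarrow> var \<Rightarrow> form" where
  "card_less A B = (card_le A B \<^bold>\<and> \<^bold>\<not> card_le B A)"

definition card_eq :: "var \<Rightarrow> var \<Rightarrow> form" where
  "card_eq A B = (\<^bold>\<exists>f. is_fun f A B \<^bold>\<and> is_injective f \<^bold>\<and> is_onto f B)"

definition is_transitive :: "var \<Rightarrow> form" where
  "is_transitive x = (\<^bold>\<forall>y. y \<^bold>\<in> x \<^bold>\<longrightarrow> y \<^bold>\<subseteq> x)"

text \<open>By the axiom of foundation, the ordinals are the transitive sets of transitive sets.\<close>

definition is_ordinal :: "var \<Rightarrow> form" where
  "is_ordinal x = (is_transitive x \<^bold>\<and> (\<^bold>\<forall>y. y \<^bold>\<in> x \<^bold>\<longrightarrow> is_transitive y))"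

definition is_cardinal :: "var \<Rightarrow> form" where
  "is_cardinal x = (is_ordinal x \<^bold>\<and> (\<^bold>\<forall>y. y \<^bold>\<in> x \<^bold>\<longrightarrow> \<^bold>\<not> card_eq y x))"

definition is_inductive :: "var \<Rightarrow> form" where
  "is_inductive x =
     ((\<^bold>\<exists>z. is_empty z \<^bold>\<and> z \<^bold>\<in> x) \<^bold>\<and>
      (\<^bold>\<forall>y. y \<^bold>\<in> x \<^bold>\<longrightarrow> (\<^bold>\<exists>s. is_succ y s \<^bold>\<and> s \<^bold>\<in> x)))"

definition is_omega :: "var \<Rightarrow> form" where
  "is_omega w = (\<^bold>\<forall>n. n \<^bold>\<in> w \<^bold>\<longleftrightarrow> (\<^bold>\<forall>x. is_inductive x \<^bold>\<longrightarrow> n \<^bold>\<in> x))"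

definition is_countable :: "var \<Rightarrow> form" where
  "is_countable x = (\<^bold>\<exists>w. is_omega w \<^bold>\<and> card_le x w)"

definition is_omega1 :: "var \<Rightarrow> form" where
  "is_omega1 w =
     (is_ordinal w \<^bold>\<and> \<^bold>\<not> is_countable w \<^bold>\<and> (\<^bold>\<forall>a. a \<^bold>\<in> w \<^bold>\<longrightarrow> is_countable a))"

text \<open>The von Neumann numeral of the metatheoretic natural number \<open>k\<close>.\<close>

primrec is_numeral :: "nat \<Rightarrow> var \<Rightarrow> form" where
  "is_numeral 0 = (\<lambda>x. is_empty x)"
| "is_numeral (Suc k) = (\<lambda>x. \<^bold>\<exists>y. is_numeral k y \<^bold>\<and> is_succ y x)"

definition card_at_most :: "var \<Rightarrow> nat \<Rightarrow> form" where
  "card_at_most x k = (\<^bold>\<exists>n. is_numeral k n \<^bold>\<and> card_le x n)"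

definition card_at_least :: "var \<Rightarrow> nat \<Rightarrow> form" where
  "card_at_least x k = (\<^bold>\<exists>n. is_numeral k n \<^bold>\<and> card_le n x)"


section \<open>ZFC\<close>

definition extensionality :: form where
  "extensionality = (\<^bold>\<forall>x y. (\<^bold>\<forall>z. z \<^bold>\<in> x \<^bold>\<longleftrightarrow> z \<^bold>\<in> y) \<^bold>\<longrightarrow> x \<^bold>= y)"

definition foundation :: form where
  "foundation =
     (\<^bold>\<forall>x. \<^bold>\<not> is_empty x \<^bold>\<longrightarrow> (\<^bold>\<exists>y. y \<^bold>\<in> x \<^bold>\<and> (\<^bold>\<forall>z. z \<^bold>\<in> x \<^bold>\<longrightarrow> \<^bold>\<not> z \<^bold>\<in> y)))"

definition pairing :: form where
  "pairing = (\<^bold>\<forall>x y. \<^bold>\<exists>p. is_upair x y p)"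

definition union :: form where
  "union = (\<^bold>\<forall>x. \<^bold>\<exists>u. \<^bold>\<forall>z. z \<^bold>\<in> u \<^bold>\<longleftrightarrow> (\<^bold>\<exists>y. y \<^bold>\<in> x \<^bold>\<and> z \<^bold>\<in> y))"

definition power_set :: form where
  "power_set = (\<^bold>\<forall>x. \<^bold>\<exists>p. is_power x p)"

definition infinity :: form where
  "infinity = (\<^bold>\<exists>x. is_inductive x)"

definition choice :: form where
  "choice =
     (\<^bold>\<forall>a. (\<^bold>\<forall>x. x \<^bold>\<in> a \<^bold>\<longrightarrow> \<^bold>\<not> is_empty x) \<^bold>\<longrightarrow>
       (\<^bold>\<exists>f b. is_fun f a b \<^bold>\<and> (\<^bold>\<forall>x y. pair_in x y f \<^bold>\<longrightarrow> y \<^bold>\<in> x)))"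

text \<open>
  The instances of the two schemas have \<open>n\<close> parameters, which are the variables of levels
  \<open>0, \<dots>, n - 1\<close>. The formula \<open>p\<close> has these and one (separation) or two (replacement)
  distinguished free variables, of lowest index.
\<close>

definition separation :: "nat \<Rightarrow> fm \<Rightarrow> fm" where
  "separation n p =
     (FAll ^^ n)
       ((\<^bold>\<forall>a. \<^bold>\<exists>b. \<^bold>\<forall>x. x \<^bold>\<in> b \<^bold>\<longleftrightarrow> x \<^bold>\<in> a \<^bold>\<and> f_plug p (case_nat x (\<lambda>i. i))) n)"

definition replacement :: "nat \<Rightarrow> fm \<Rightarrow> fm" where
  "replacement n p =
     (let P = (\<lambda>x y. f_plug p (case_nat x (case_nat y (\<lambda>i. i)))) in
      (FAll ^^ n)
       (((\<^bold>\<forall>x y z. P x y \<^bold>\<and> P x z \<^bold>\<longrightarrow> y \<^bold>= z) \<^bold>\<longrightarrow>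
         (\<^bold>\<forall>a. \<^bold>\<exists>b. \<^bold>\<forall>y. y \<^bold>\<in> b \<^bold>\<longleftrightarrow> (\<^bold>\<exists>x. x \<^bold>\<in> a \<^bold>\<and> P x y))) n))"

definition ZFC :: "fm set" where
  "ZFC =
     sentence ` {extensionality, foundation, pairing, union, power_set, infinity, choice} \<union>
     {separation n p | n p. free_below (n + 1) p} \<union>
     {replacement n p | n p. free_below (n + 2) p}"


section \<open>Martin's Axiom and the Continuum Hypothesis\<close>

text \<open>\<open>(x, y) \<in> r\<close> means that the condition \<open>x\<close> is below (stronger than) \<open>y\<close>.\<close>

definition is_partial_order :: "var \<Rightarrow> var \<Rightarrow> form" where
  "is_partial_order P r =
     ((\<^bold>\<forall>x. x \<^bold>\<in> P \<^bold>\<longrightarrow> pair_in x x r) \<^bold>\<and>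
      (\<^bold>\<forall>x y. x \<^bold>\<in> P \<^bold>\<and> y \<^bold>\<in> P \<^bold>\<and> pair_in x y r \<^bold>\<and> pair_in y x r \<^bold>\<longrightarrow> x \<^bold>= y) \<^bold>\<and>
      (\<^bold>\<forall>x y z. x \<^bold>\<in> P \<^bold>\<and> y \<^bold>\<in> P \<^bold>\<and> z \<^bold>\<in> P \<^bold>\<and> pair_in x y r \<^bold>\<and> pair_in y z r \<^bold>\<longrightarrow>
         pair_in x z r))"

definition compatible :: "var \<Rightarrow> var \<Rightarrow> var \<Rightarrow> var \<Rightarrow> form" where
  "compatible P r x y = (\<^bold>\<exists>z. z \<^bold>\<in> P \<^bold>\<and> pair_in z x r \<^bold>\<and> pair_in z y r)"

definition is_antichain :: "var \<Rightarrow> var \<Rightarrow> var \<Rightarrow> form" where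
  "is_antichain P r A =
     (A \<^bold>\<subseteq> P \<^bold>\<and>
      (\<^bold>\<forall>x y. x \<^bold>\<in> A \<^bold>\<and> y \<^bold>\<in> A \<^bold>\<and> \<^bold>\<not> x \<^bold>= y \<^bold>\<longrightarrow> \<^bold>\<not> compatible P r x y))"

definition is_ccc :: "var \<Rightarrow> var \<Rightarrow> form" where
  "is_ccc P r = (\<^bold>\<forall>A. is_antichain P r A \<^bold>\<longrightarrow> is_countable A)"

definition is_dense :: "var \<Rightarrow> var \<Rightarrow> var \<Rightarrow> form" where
  "is_dense P r D =
     (D \<^bold>\<subseteq> P \<^bold>\<and> (\<^bold>\<forall>x. x \<^bold>\<in> P \<^bold>\<longrightarrow> (\<^bold>\<exists>y. y \<^bold>\<in> D \<^bold>\<and> pair_in y x r)))"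

definition is_filter :: "var \<Rightarrow> var \<Rightarrow> var \<Rightarrow> form" where
  "is_filter P r G =
     (G \<^bold>\<subseteq> P \<^bold>\<and> \<^bold>\<not> is_empty G \<^bold>\<and>
      (\<^bold>\<forall>x y. x \<^bold>\<in> G \<^bold>\<and> y \<^bold>\<in> P \<^bold>\<and> pair_in x y r \<^bold>\<longrightarrow> y \<^bold>\<in> G) \<^bold>\<and>
      (\<^bold>\<forall>x y. x \<^bold>\<in> G \<^bold>\<and> y \<^bold>\<in> G \<^bold>\<longrightarrow>
         (\<^bold>\<exists>z. z \<^bold>\<in> G \<^bold>\<and> pair_in z x r \<^bold>\<and> pair_in z y r)))"

definition MA_at :: "var \<Rightarrow> form" where
  "MA_at \<kappa> =
     (\<^bold>\<forall>P r S.
        \<^bold>\<not> is_empty P \<^bold>\<and> is_partial_order P r \<^bold>\<and> is_ccc P r \<^bold>\<and>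
        (\<^bold>\<forall>D. D \<^bold>\<in> S \<^bold>\<longrightarrow> is_dense P r D) \<^bold>\<and> card_le S \<kappa> \<^bold>\<longrightarrow>
        (\<^bold>\<exists>G. is_filter P r G \<^bold>\<and> (\<^bold>\<forall>D. D \<^bold>\<in> S \<^bold>\<longrightarrow> (\<^bold>\<exists>x. x \<^bold>\<in> D \<^bold>\<and> x \<^bold>\<in> G))))"

text \<open>\<open>c\<close> is the power set of \<open>\<omega>\<close>; it need not be a cardinal, since only its size matters.\<close>

definition is_continuum :: "var \<Rightarrow> form" where
  "is_continuum c = (\<^bold>\<exists>w. is_omega w \<^bold>\<and> is_power w c)"

definition MA :: form where
  "MA =
     (\<^bold>\<forall>\<kappa> c. is_cardinal \<kappa> \<^bold>\<and> is_continuum c \<^bold>\<and> card_less \<kappa> c \<^bold>\<longrightarrow> MA_at \<kappa>)"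

definition MA_aleph1 :: form where
  "MA_aleph1 = (\<^bold>\<exists>w. is_omega1 w \<^bold>\<and> MA_at w)"

definition CH :: form where
  "CH = (\<^bold>\<exists>c w. is_continuum c \<^bold>\<and> is_omega1 w \<^bold>\<and> card_eq c w)"


section \<open>The negative partition relation for bounded colourings\<close>

definition is_two_subsets :: "var \<Rightarrow> var \<Rightarrow> form" where
  "is_two_subsets X T =
     (\<^bold>\<forall>s. s \<^bold>\<in> T \<^bold>\<longleftrightarrow> (\<^bold>\<exists>x y. x \<^bold>\<in> X \<^bold>\<and> y \<^bold>\<in> X \<^bold>\<and> \<^bold>\<not> x \<^bold>= y \<^bold>\<and> is_upair x y s))"

text \<open>\<open>R = [A;B]\<close>; the order of the ordinals is membership.\<close>

definition is_increasing_pairs :: "var \<Rightarrow> var \<Rightarrow> var \<Rightarrow> form" where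
  "is_increasing_pairs A B R =
     (\<^bold>\<forall>s. s \<^bold>\<in> R \<^bold>\<longleftrightarrow> (\<^bold>\<exists>\<alpha> \<beta>. \<alpha> \<^bold>\<in> A \<^bold>\<and> \<beta> \<^bold>\<in> B \<^bold>\<and> \<alpha> \<^bold>\<in> \<beta> \<^bold>\<and> is_upair \<alpha> \<beta> s))"

definition is_fibre :: "var \<Rightarrow> var \<Rightarrow> var \<Rightarrow> form" where
  "is_fibre c \<xi> F = (\<^bold>\<forall>s. s \<^bold>\<in> F \<^bold>\<longleftrightarrow> pair_in s \<xi> c)"

definition has_order_type :: "var \<Rightarrow> var \<Rightarrow> form" where
  "has_order_type A w =
     (\<^bold>\<exists>f. is_fun f w A \<^bold>\<and> is_onto f A \<^bold>\<and>
        (\<^bold>\<forall>x y u v. pair_in x u f \<^bold>\<and> pair_in y v f \<^bold>\<longrightarrow> (x \<^bold>\<in> y \<^bold>\<longleftrightarrow> u \<^bold>\<in> v)))"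

definition is_bounded_colouring :: "nat \<Rightarrow> var \<Rightarrow> var \<Rightarrow> form" where
  "is_bounded_colouring k w c =
     (\<^bold>\<exists>T C. is_two_subsets w T \<^bold>\<and> is_fun c T C \<^bold>\<and>
        (\<^bold>\<forall>\<xi>. \<xi> \<^bold>\<in> C \<^bold>\<longrightarrow> (\<^bold>\<exists>F. is_fibre c \<xi> F \<^bold>\<and> card_at_most F k)))"

definition not_arrow_star :: "nat \<Rightarrow> form" where
  "not_arrow_star k =
     (\<^bold>\<exists>w c. is_omega1 w \<^bold>\<and> is_bounded_colouring k w c \<^bold>\<and>
        (\<^bold>\<forall>A B. A \<^bold>\<subseteq> w \<^bold>\<and> B \<^bold>\<subseteq> w \<^bold>\<and> has_order_type A w \<^bold>\<and> has_order_type B w \<^bold>\<longrightarrow>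
           (\<^bold>\<exists>\<xi>. in_range \<xi> c \<^bold>\<and>
              (\<^bold>\<exists>R F I. is_increasing_pairs A B R \<^bold>\<and> is_fibre c \<xi> F \<^bold>\<and> is_inter R F I \<^bold>\<and>
                 card_at_least I k))))"

end

theory Submission
 imports Defs "HOL-Library.Countable_Set"
begin

notation iff (infixr "<->" 25)

text \<open>
 A consistent theory ZFC has a model on the natural numbers. It need not be well-founded, so forcing is
 developed inside an arbitrary countable model, with a generic filter found outside of it.

 Two collapses lead to a model of CH in which \<open>2\<^bsup>\<aleph>1\<^esup> = \<aleph>2\<close>. By CH one can list in type \<open>\<omega>1\<close> the countable
 systems of distinct points \<open>a(\<xi>, l, s)\<close>, for \<open>l < k\<close> and \<open>s\<close> a finite binary string. The colouring gives, for each
 \<open>b < \<omega>1\<close>, each system listed before \<open>b\<close> and each row \<open>\<xi> < b\<close>, the same colour to the \<open>k\<close> pairs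
 \<open>{a(\<xi>, l, s\<^sub>l), b}\<close> for suitable strings \<open>s\<^sub>l\<close> of length \<open>m + 1\<close>, where \<open>m\<close> is the place of the system in an
 enumeration of \<open>b\<close>. The doubling of the number of strings at each length leaves enough room to make all
 these choices distinct.

 This colouring works in every ccc extension. Suppose a condition forces \<open>A\<close> and \<open>B\<close> to be uncountable
 and to contain no colour class of size \<open>k\<close>. Recursively pick \<open>b\<^sub>\<eta>\<close> and a descending sequence \<open>r\<^sub>\<eta>\<^sup>n\<close> of
 conditions below one that forces \<open>b\<^sub>\<eta> \<in> B\<close>, which decide infinitely many points of \<open>A\<close> above \<open>b\<^sub>\<eta>\<close>; these points are row
 \<open>\<eta>\<close> of a system, whose restriction to the rows before \<open>\<eta>\<close> is listed before \<open>b\<^sub>\<eta>\<close>. For uncountably many \<open>\<eta>\<close> the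
 place \<open>m\<close> of this restriction is the same, and then a common extension of \<open>r\<^sub>\<xi>\<^sup>n\<close> and \<open>r\<^sub>\<eta>\<^sup>n\<close>, for \<open>n\<close> large
 enough depending on \<open>m\<close>, would force a colour class; so these conditions form an uncountable antichain.

 Finally, a finite support iteration of length \<open>\<omega>2\<close> is ccc and forces MA, and a continuum of size at
 most \<open>\<aleph>2\<close>. It suffices to iterate preorders on \<open>\<omega>1\<close>: a condition is a finite partial function from \<open>\<omega>2\<close>
 to \<open>\<omega>1\<close>, and other orders are handled by a Loewenheim-Skolem argument.
\<close>

subsection \<open>Renamings and semantics\<close>

text \<open>The natural numbers of the model may be nonstandard, so its recursions and inductions
  have to be carried out inside it. Every class to which an axiom schema of the model is applied
  must be certified as definable with parameters, whence the hypotheses \<open>DP\<close>,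
  \<open>DF\<close> and the collection \<open>dfn\<close>. Countability of the model serves to list
  its dense sets by the natural numbers of the metatheory.

  The colouring is fixed in advance and has to anticipate the constructions made later below the
  conditions of any ccc order. CH makes this possible: the initial parts of such a construction are
  countable, hence already occur in the list of systems. The length \<open>m + 1\<close> of the
  strings comes from a halving argument: a demand of a system with index \<open>m\<close> starts
  with 2^(m+1) candidates and is halved once at each of the levels \<open>m\<close>, ..., 0, which
  leaves one. The second collapse leaves only \<omega>2 many names for relations on \<omega>1 at
  bounded stages, so that one list of length \<omega>2 can treat each of them at arbitrarily late
  stages.\<close>

lemma ren_ren: "ren f (ren g p) = ren (f \<circ> g) p"
proof (induction p arbitrary: f g)
 case (FAll p)
 have "case_nat 0 (%i. Suc (f i)) \<circ> case_nat 0 (%i. Suc (g i)) = case_nat 0 (%i. Suc ((f \<circ> g) i))"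
  by (auto split: nat.split)
 thus ?case by (simp only: ren.simps FAll.IH)
qed auto

primrec fv :: "fm => nat set" where
 "fv (FMem i j) = {i, j}"
| "fv (FEq i j) = {i, j}"
| "fv FFalse = {}"
| "fv (FImp p q) = fv p \<union> fv q"
| "fv (FAll p) = {i. Suc i \<in> fv p}"

lemma finite_fv: "finite (fv p)"
proof (induction p)
 case (FAll p)
 have "{i. Suc i \<in> fv p} = Suc -` fv p" by auto
 thus ?case using FAll by (simp add: finite_vimageI)
qed auto

lemma ren_cong: "(!!i. i \<in> fv p ==> f i = g i) ==> ren f p = ren g p"
proof (induction p arbitrary: f g)
 case (FAll p)
 have "ren (case_nat 0 (%i. Suc (f i))) p = ren (case_nat 0 (%i. Suc (g i))) p"
  using FAll.prems by (intro FAll.IH) (auto split: nat.split)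
 thus ?case by simp
next
 case (FImp p q)
 have "ren f p = ren g p" "ren f q = ren g q" using FImp.prems by (auto intro!: FImp.IH)
 thus ?case by simp
qed simp_all

lemma ren_id: "ren (%i. i) p = p"
proof (induction p)
 case (FAll p)
 have "case_nat 0 (%i. Suc i) = (%i. i)" by (auto split: nat.split)
 thus ?case using FAll by simp
qed auto

lemma fv_ren: "fv (ren f p) = f ` fv p"
proof (induction p arbitrary: f)
 case (FAll p)
 have "{i. Suc i \<in> case_nat 0 (%i. Suc (f i)) ` fv p} = f ` {i. Suc i \<in> fv p}" (is "?A = ?B")
 proof
  show "?A <= ?B"
  proof
   fix i assume "i \<in> ?A"
   then obtain j where "j \<in> fv p" "Suc i = case_nat 0 (%i. Suc (f i)) j" by auto
   thus "i \<in> ?B" by (cases j) auto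
  qed
  show "?B <= ?A"
  proof
   fix i assume "i \<in> ?B"
   then obtain j where j: "Suc j \<in> fv p" "i = f j" by auto
   have "Suc i = case_nat 0 (%i. Suc (f i)) (Suc j)" using j by simp
   thus "i \<in> ?A" using j(1) by blast
  qed
 qed
 thus ?case using FAll by simp
qed auto

primrec sat :: "('a => 'a => bool) => (nat => 'a) => fm => bool" where
 "sat E e (FMem i j) = E (e i) (e j)"
| "sat E e (FEq i j) = (e i = e j)"
| "sat E e FFalse = False"
| "sat E e (FImp p q) = (sat E e p --> sat E e q)"
| "sat E e (FAll p) = (ALL x. sat E (case_nat x e) p)"

lemma case_nat_comp: "(%i. case_nat x e (case_nat 0 (%i. Suc (f i)) i)) = case_nat x (%i. e (f i))"
 by (auto split: nat.split)

lemma sat_ren: "sat E e (ren f p) = sat E (%i. e (f i)) p"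
 by (induction p arbitrary: f e) (auto simp: case_nat_comp)

lemma sat_cong: "(!!i. i \<in> fv p ==> e i = e' i) ==> sat E e p = sat E e' p"
proof (induction p arbitrary: e e')
 case (FAll p)
 have "sat E (case_nat x e) p = sat E (case_nat x e') p" for x
  using FAll.prems by (intro FAll.IH) (auto split: nat.split)
 thus ?case by simp
next
 case (FImp p q)
 have "sat E e p = sat E e' p" "sat E e q = sat E e' q" using FImp.prems by (auto intro!: FImp.IH)
 thus ?case by simp
qed simp_all

lemma sat_inst: "sat E e (inst p i) = sat E (case_nat (e i) e) p"
proof -
 have "(%j. e (case_nat i (%j. j) j)) = case_nat (e i) e" by (auto split: nat.split)
 thus ?thesis by (simp add: inst_def sat_ren)
qed

lemma soundness: "\<Gamma> \<turnstile> p ==> (!!q. q \<in> \<Gamma> ==> sat E e q) ==> sat E e p"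
proof (induction arbitrary: e rule: provable.induct)
 case (allI \<Gamma> p)
 have "sat E (case_nat x e) p" for x
  using allI.prems by (intro allI.IH) (auto simp: sat_ren)
 thus ?case by simp
next
 case (eq_subst \<Gamma> i j p)
 hence "e i = e j" "sat E (case_nat (e i) e) p" using eq_subst.IH(2)[of e] eq_subst.IH(1)[of e] by (simp_all add: sat_inst)
 thus ?case by (simp add: sat_inst)
next
 case (raa p \<Gamma>)
 show ?case
 proof (rule ccontr)
  assume "~ sat E e p"
  hence "sat E e FFalse" using raa.prems by (intro raa.IH) auto
  thus False by simp
 qed
qed (auto simp: sat_inst)

lemma consistentI: "(!!p. p \<in> T ==> sat E e p) ==> consistent T"
 using soundness[of T FFalse E e] by (auto simp: consistent_def)

subsection \<open>Completeness\<close>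

lemma weakening: "\<Gamma> \<turnstile> p ==> \<Gamma> <= \<Delta> ==> \<Delta> \<turnstile> p"
proof (induction arbitrary: \<Delta> rule: provable.induct)
 case (impI p \<Gamma> q) thus ?case by (metis insert_mono provable.impI)
next
 case (raa p \<Gamma>) thus ?case by (metis insert_mono provable.raa)
next
 case (allI \<Gamma> p) thus ?case by (metis image_mono provable.allI)
next
 case (impE \<Gamma> p q) thus ?case by (meson provable.impE)
next
 case (eq_subst \<Gamma> i j p) thus ?case by (meson provable.eq_subst)
qed (auto intro: provable.hyp provable.allE provable.eq_refl)

lemma ren_inst: "ren f (inst p i) = inst (ren (case_nat 0 (%i. Suc (f i))) p) (f i)"
proof -
 have "f \<circ> case_nat i (%j. j) = case_nat (f i) (%j. j) \<circ> case_nat 0 (%i. Suc (f i))"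
  by (auto split: nat.split)
 thus ?thesis by (simp add: inst_def ren_ren)
qed

lemma provable_ren: "\<Gamma> \<turnstile> p ==> ren f ` \<Gamma> \<turnstile> ren f p"
proof (induction arbitrary: f rule: provable.induct)
 case (impI p \<Gamma> q) thus ?case by (metis image_insert provable.impI ren.simps(4))
next
 case (impE \<Gamma> p q) thus ?case by (metis provable.impE ren.simps(4))
next
 case (raa p \<Gamma>)
 have "insert (FImp (ren f p) FFalse) (ren f ` \<Gamma>) \<turnstile> FFalse"
  using raa.IH[of f] by simp
 thus ?case by (rule provable.raa)
next
 case (allI \<Gamma> p)
 have "ren (case_nat 0 (%i. Suc (f i))) ` ren Suc ` \<Gamma> = ren Suc ` ren f ` \<Gamma>"
 proof -
  have "ren (case_nat 0 (%i. Suc (f i))) (ren Suc q) = ren Suc (ren f q)" for q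
   unfolding ren_ren by (rule ren_cong) simp
  thus ?thesis by (auto simp: image_image)
 qed
 thus ?case using allI.IH[of "case_nat 0 (%i. Suc (f i))"] by (auto intro: provable.allI)
next
 case (allE \<Gamma> p i)
 have "ren f ` \<Gamma> \<turnstile> FAll (ren (case_nat 0 (%i. Suc (f i))) p)" using allE.IH[of f] by simp
 thus ?case unfolding ren_inst by (rule provable.allE)
next
 case (eq_subst \<Gamma> i j p)
 have "ren f ` \<Gamma> \<turnstile> FEq (f i) (f j)" using eq_subst.IH(1)[of f] by simp
 thus ?case using eq_subst.IH(2)[of f] unfolding ren_inst by (rule provable.eq_subst)
qed (auto intro: provable.hyp provable.eq_refl)

abbreviation neg :: "fm => fm" where "neg p \<equiv> FImp p FFalse"

lemma provable_compact: "\<Gamma> \<turnstile> p ==> EX \<Delta>. finite \<Delta> & \<Delta> <= \<Gamma> & \<Delta> \<turnstile> p"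
proof (induction rule: provable.induct)
 case (hyp p \<Gamma>)
 thus ?case by (intro exI[of _ "{p}"]) (auto intro: provable.hyp)
next
 case (impI p \<Gamma> q)
 then obtain \<Delta> where "finite \<Delta>" "\<Delta> <= insert p \<Gamma>" "\<Delta> \<turnstile> q" by auto
 moreover have "insert p (\<Delta> - {p}) \<turnstile> q" by (rule weakening[OF \<open>\<Delta> \<turnstile> q\<close>]) auto
 ultimately show ?case by (intro exI[of _ "\<Delta> - {p}"]) (auto intro: provable.impI)
next
 case (impE \<Gamma> p q)
 then obtain \<Delta> \<Delta>' where "finite \<Delta>" "\<Delta> <= \<Gamma>" "\<Delta> \<turnstile> FImp p q" "finite \<Delta>'" "\<Delta>' <= \<Gamma>" "\<Delta>' \<turnstile> p" by auto
 thus ?case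
  by (intro exI[of _ "\<Delta> \<union> \<Delta>'"]) (meson provable.impE weakening Un_upper1 Un_upper2 finite_UnI Un_least)
next
 case (raa p \<Gamma>)
 then obtain \<Delta> where "finite \<Delta>" "\<Delta> <= insert (neg p) \<Gamma>" "\<Delta> \<turnstile> FFalse" by auto
 moreover have "insert (neg p) (\<Delta> - {neg p}) \<turnstile> FFalse" by (rule weakening[OF \<open>\<Delta> \<turnstile> FFalse\<close>]) auto
 ultimately show ?case by (intro exI[of _ "\<Delta> - {neg p}"]) (auto intro: provable.raa)
next
 case (allI \<Gamma> p)
 then obtain \<Delta> where D: "finite \<Delta>" "\<Delta> <= ren Suc ` \<Gamma>" "\<Delta> \<turnstile> p" by auto
 then obtain \<Delta>' where "\<Delta>' <= \<Gamma>" "finite \<Delta>'" "\<Delta> = ren Suc ` \<Delta>'" by (meson finite_subset_image)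
 thus ?case using D by (intro exI[of _ \<Delta>']) (auto intro!: provable.allI)
next
 case (allE \<Gamma> p i)
 thus ?case by (meson provable.allE)
next
 case (eq_refl \<Gamma> i)
 thus ?case by (intro exI[of _ "{}"]) (auto intro: provable.eq_refl)
next
 case (eq_subst \<Gamma> i j p)
 then obtain \<Delta> \<Delta>' where "finite \<Delta>" "\<Delta> <= \<Gamma>" "\<Delta> \<turnstile> FEq i j" "finite \<Delta>'" "\<Delta>' <= \<Gamma>" "\<Delta>' \<turnstile> inst p i" by auto
 thus ?case
  by (intro exI[of _ "\<Delta> \<union> \<Delta>'"]) (meson provable.eq_subst weakening Un_upper1 Un_upper2 finite_UnI Un_least)
qed

instance fm :: countable
 by countable_datatype

lemma consistent_witness:
 assumes con: "consistent \<Gamma>" and mem: "neg (FAll p) \<in> \<Gamma>" and fresh: "!!q. q \<in> \<Gamma> ==> c \<notin> fv q"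
 shows "consistent (insert (neg (inst p c)) \<Gamma>)"
proof (rule ccontr)
 assume "~ ?thesis"
 hence "\<Gamma> \<turnstile> inst p c" by (auto simp: consistent_def intro: provable.raa)
 \<comment> \<open>This renaming turns \<open>inst p c\<close> back into \<open>p\<close> and,
   \<open>c\<close> being fresh, agrees with \<open>Suc\<close> on \<Gamma>, so the rule for
   \<open>FAll\<close> applies to the renamed derivation.\<close>
 define f where "f = (%i. if i = c then 0 else Suc i)"
 have r: "ren f ` \<Gamma> \<turnstile> ren f (inst p c)" using \<open>\<Gamma> \<turnstile> inst p c\<close> by (rule provable_ren)
 have "c \<notin> fv (FAll p)" using fresh[OF mem] by simp
 hence "ren f (inst p c) = ren (%i. i) p"
  unfolding inst_def ren_ren by (intro ren_cong) (auto simp: f_def split: nat.split)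
 moreover have "ren f q = ren Suc q" if "q \<in> \<Gamma>" for q
  using fresh[OF that] by (intro ren_cong) (auto simp: f_def)
 hence "ren f ` \<Gamma> = ren Suc ` \<Gamma>" by (auto simp: image_iff)
 ultimately have "\<Gamma> \<turnstile> FAll p" using r by (auto simp: ren_id intro: provable.allI)
 hence "\<Gamma> \<turnstile> FFalse" using mem by (meson provable.hyp provable.impE)
 thus False using con by (simp add: consistent_def)
qed

text \<open>The odd variables are kept free to serve as Henkin constants.\<close>

lemma henkin_extension:
 assumes con: "consistent T" and fresh: "!!q i. q \<in> T ==> odd i ==> i \<notin> fv q"
 shows "EX S. T <= S & consistent S & (ALL p. p \<in> S | neg p \<in> S) &
      (ALL p. neg (FAll p) \<in> S --> (EX c. neg (inst p c) \<in> S))"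
proof -
 define fresh_for where "fresh_for = (%F. SOME c. odd c & (ALL q:F. c \<notin> fv q))"
 have ff: "odd (fresh_for F) & (ALL q:F. fresh_for F \<notin> fv q)" if "finite F" for F
 proof -
  have "infinite {c::nat. odd c}"
   by (metis (no_types, lifting) even_Suc infinite_nat_iff_unbounded_le lessI less_or_eq_imp_le mem_Collect_eq)
  moreover have "finite (\<Union>q\<in>F. fv q)" using that finite_fv by blast
  ultimately obtain c where "c \<in> {c. odd c}" "c \<notin> (\<Union>q\<in>F. fv q)"
   by (meson finite_subset subsetI)
  hence "odd c & (ALL q:F. c \<notin> fv q)" by auto
  thus ?thesis unfolding fresh_for_def by (rule someI)
 qed
 \<comment> \<open>Only a negated universal formula receives a counterexample. Its constant avoids
   the finitely many formulas added so far and, being odd, all of \<open>T\<close>.\<close>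
 define wit where "wit = (%F p. case p of FImp (FAll q) FFalse => {neg (inst q (fresh_for (insert p F)))} | _ => {})"
 define step where "step = (%F p. if consistent (T \<union> insert p F) then insert p F \<union> wit F p else insert (neg p) F)"
 define F where "F = rec_nat {} (%n F. step F (from_nat n))"
 have F0: "F 0 = {}" and FS: "F (Suc n) = step (F n) (from_nat n)" for n by (auto simp: F_def)
 have finwit: "finite (wit G p)" for G p
  by (auto simp: wit_def split: fm.split)
 have fin: "finite (F n)" for n by (induction n) (auto simp: F0 FS step_def finwit)
 have conneg: "consistent (T \<union> insert (neg p) G)"
  if "consistent (T \<union> G)" "~ consistent (T \<union> insert p G)" for p G
 proof -
  have 1: "T \<union> G \<turnstile> neg p" using that(2) by (auto simp: consistent_def intro: provable.impI)
  show ?thesis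
  proof (rule ccontr)
   assume "~ ?thesis"
   hence "T \<union> G \<turnstile> p" by (auto simp: consistent_def intro: provable.raa)
   with 1 have "T \<union> G \<turnstile> FFalse" by (meson provable.impE)
   with that(1) show False by (simp add: consistent_def)
  qed
 qed
 have conwit: "consistent (T \<union> (insert p G \<union> wit G p))" if "consistent (T \<union> insert p G)" "finite G" for p G
 proof (cases "EX q. p = neg (FAll q)")
  case True
  then obtain q where q: "p = neg (FAll q)" by auto
  let ?c = "fresh_for (insert p G)"
  have "!!r. r \<in> T \<union> insert p G ==> ?c \<notin> fv r" using ff[of "insert p G"] that(2) fresh by auto
  hence "consistent (insert (neg (inst q ?c)) (T \<union> insert p G))"
   using consistent_witness[OF that(1), of q ?c] q by simp
  moreover have "wit G p = {neg (inst q ?c)}" by (simp add: wit_def q)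
  ultimately show ?thesis by simp
 next
  case False
  hence "wit G p = {}" by (auto simp: wit_def split: fm.split)
  thus ?thesis using that by simp
 qed
 have conF: "consistent (T \<union> F n)" for n
 proof (induction n)
  case 0 thus ?case using con by (simp add: F0)
 next
  case (Suc n)
  thus ?case using conneg conwit fin by (auto simp: FS step_def)
 qed
 have mono: "F n <= F (Suc n)" for n by (auto simp: FS step_def)
 have mono': "n \<le> m ==> F n <= F m" for n m using lift_Suc_mono_le[of F n m] mono by blast
 define S where "S = T \<union> (\<Union>n. F n)"
 have conS: "consistent S"
 proof (rule ccontr)
  assume "~ ?thesis"
  then obtain \<Delta> where D: "finite \<Delta>" "\<Delta> <= S" "\<Delta> \<turnstile> FFalse"
   using provable_compact[of S FFalse] by (auto simp: consistent_def)
  have "EX n. \<Delta> <= T \<union> F n" using D(1,2)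
  proof (induction rule: finite_induct)
   case (insert x A)
   then obtain n where n: "A <= T \<union> F n" by auto
   obtain m where m: "x \<in> T \<union> F m" using insert.prems by (auto simp: S_def)
   have "insert x A <= T \<union> F (max n m)"
    using n m mono'[of n "max n m"] mono'[of m "max n m"] by auto
   thus ?case by blast
  qed auto
  thus False using D(3) conF weakening by (metis consistent_def)
 qed
 have step_in: "p \<in> S & wit (F (to_nat p)) p <= S | neg p \<in> S" for p
  using FS[of "to_nat p"] by (auto simp: step_def S_def split: if_splits)
 have "EX c. neg (inst p c) \<in> S" if a: "neg (FAll p) \<in> S" for p
 proof -
  have "neg (neg (FAll p)) \<notin> S" using a conS by (metis consistent_def provable.hyp provable.impE)
  hence "wit (F (to_nat (neg (FAll p)))) (neg (FAll p)) <= S" using step_in by blast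
  thus ?thesis by (auto simp: wit_def)
 qed
 moreover have "p \<in> S | neg p \<in> S" for p using step_in by blast
 moreover have "T <= S" by (auto simp: S_def)
 ultimately show ?thesis using conS by blast
qed

primrec satq :: "('a => 'a => bool) => ('a => 'a => bool) => (nat => 'a) => fm => bool" where
 "satq E q e (FMem i j) = E (e i) (e j)"
| "satq E q e (FEq i j) = q (e i) (e j)"
| "satq E q e FFalse = False"
| "satq E q e (FImp p r) = (satq E q e p --> satq E q e r)"
| "satq E q e (FAll p) = (ALL x. satq E q (case_nat x e) p)"

text \<open>Equality becomes genuine by passing to classes. The injection \<open>s\<close> that
  misses \<open>z\<close> shows that there are infinitely many of them, so they can be renumbered by
  all of \<open>nat\<close>. This serves both the term model and the generic extension.\<close>

lemma satq_quotient:
 fixes E q :: "nat => nat => bool"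
 assumes eq: "equivp q" and cong: "!!x x' y y'. q x x' ==> q y y' ==> E x y ==> E x' y'"
  and s: "!!x y. q (s x) (s y) ==> q x y" and z: "!!x. ~ q z (s x)"
 shows "EX (E' :: nat => nat => bool) v. surj v & (ALL x y. v x = v y <-> q x y) &
   (ALL x y. E' (v x) (v y) <-> E x y) & (ALL e p. sat E' (%i. v (e i)) p <-> satq E q e p)"
proof -
 have qr: "q x x" and qs: "q x y ==> q y x" and qt: "q x y ==> q y w ==> q x w" for x y w
  using eq unfolding equivp_def by metis+
 define rp where "rp = (%x. LEAST y. q x y)"
 have rp: "q x (rp x)" for x unfolding rp_def by (rule LeastI[of "q x"]) (rule qr)
 have rpeq: "rp x = rp y <-> q x y" for x y
 proof
  assume "rp x = rp y" thus "q x y" using rp[of x] rp[of y] qs qt by metis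
 next
  assume "q x y" hence "q x = q y" using qs qt by blast
  thus "rp x = rp y" by (simp add: rp_def)
 qed
 have inj: "q ((s ^^ m) z) ((s ^^ n) z) ==> m = n" for m n
 proof (induction m arbitrary: n)
  case 0 thus ?case using z by (cases n) simp_all
 next
  case (Suc m)
  show ?case
  proof (cases n)
   case 0 thus ?thesis using Suc.prems z qs[of "(s ^^ Suc m) z" z] by simp
  next
   case (Suc n') thus ?thesis using Suc.prems s Suc.IH[of n'] by simp
  qed
 qed
 have "inj (%n. rp ((s ^^ n) z))" by (rule injI) (use inj rpeq in blast)
 hence "infinite (range (%n. rp ((s ^^ n) z)))" by (simp add: range_inj_infinite)
 hence inf: "infinite (range rp)" by (rule contrapos_nn) (auto elim: finite_subset[rotated])
 define v where "v = (%x. to_nat_on (range rp) (rp x))"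
 have bij: "bij_betw (to_nat_on (range rp)) (range rp) UNIV" using inf by (intro to_nat_on_infinite) auto
 have surj: "surj v"
 proof -
  have "range v = to_nat_on (range rp) ` range rp" by (auto simp: v_def)
  thus ?thesis using bij by (simp add: bij_betw_def)
 qed
 have veq: "v x = v y <-> q x y" for x y
  using bij rpeq[of x y] unfolding v_def bij_betw_def by (metis inj_on_eq_iff rangeI)
 define E' where "E' = (%a b. EX x y. v x = a & v y = b & E x y)"
 have E': "E' (v x) (v y) <-> E x y" for x y
  unfolding E'_def using veq cong by metis
 have "sat E' (%i. v (e i)) p <-> satq E q e p" for e p
 proof (induction p arbitrary: e)
  case (FAll p)
  have *: "case_nat (v x) (%i. v (e i)) = (%i. v (case_nat x e i))" for x by (auto split: nat.split)
  have "(ALL a. sat E' (case_nat a (%i. v (e i))) p) <-> (ALL x. sat E' (case_nat (v x) (%i. v (e i))) p)"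
   using surj by (metis surjD)
  thus ?case using FAll by (simp add: *)
 qed (auto simp: E' veq)
 thus ?thesis using surj veq E' by blast
qed

lemma completeness_aux:
 assumes con: "consistent T"
 shows "EX (E :: nat => nat => bool) q e. equivp q & (ALL x x' y y'. q x x' --> q y y' --> E x y --> E x' y') &
   (ALL p:T. satq E q e p)"
proof -
 \<comment> \<open>Doubling the variables frees the odd ones for the Henkin constants. The term
   model then consists of the variables themselves.\<close>
 define T' where "T' = ren (%i. 2 * i) ` T"
 have "consistent T'"
 proof (rule ccontr)
  assume "~ ?thesis"
  hence "ren (%i. i div 2) ` T' \<turnstile> ren (%i. i div 2) FFalse" by (intro provable_ren) (simp add: consistent_def)
  moreover have "ren (%i. i div 2) ` T' = T"
   by (auto simp: T'_def image_image ren_ren comp_def ren_id)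
  ultimately show False using con by (simp add: consistent_def)
 qed
 moreover have "q \<in> T' ==> odd i ==> i \<notin> fv q" for q i by (auto simp: T'_def fv_ren)
 ultimately obtain S where S: "T' <= S" "consistent S" "!!p. p \<in> S | neg p \<in> S"
   "!!p. neg (FAll p) \<in> S ==> EX c. neg (inst p c) \<in> S"
  using henkin_extension[of T'] by blast
 have thS: "p \<in> S" if "S \<turnstile> p" for p
  using that S(2,3) by (metis consistent_def provable.hyp provable.impE)
 have impS: "FImp p r \<in> S <-> (p \<in> S --> r \<in> S)" for p r
 proof
  assume "FImp p r \<in> S" thus "p \<in> S --> r \<in> S" using thS by (meson provable.hyp provable.impE)
 next
  assume a: "p \<in> S --> r \<in> S"
  show "FImp p r \<in> S"
  proof (cases "p \<in> S")
   case True
   hence "insert p S \<turnstile> r" using a by (intro provable.hyp) simp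
   thus ?thesis by (intro thS provable.impI)
  next
   case False
   hence "neg p \<in> S" using S(3) by blast
   hence "insert (neg r) (insert p S) \<turnstile> FFalse"
    by (intro provable.impE[where p = p, OF provable.hyp provable.hyp]) simp_all
   hence "insert p S \<turnstile> r" by (rule provable.raa)
   thus ?thesis by (intro thS provable.impI)
  qed
 qed
 have falseS: "FFalse \<notin> S" using S(2) by (metis consistent_def provable.hyp)
 have allS: "FAll p \<in> S <-> (ALL c. inst p c \<in> S)" for p
 proof
  assume "FAll p \<in> S" thus "ALL c. inst p c \<in> S" using thS by (meson provable.hyp provable.allE)
 next
  assume a: "ALL c. inst p c \<in> S"
  show "FAll p \<in> S"
  proof (rule ccontr)
   assume "FAll p \<notin> S"
   hence "neg (FAll p) \<in> S" using S(3) by blast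
   then obtain c where "neg (inst p c) \<in> S" using S(4) by blast
   thus False using a impS falseS by blast
  qed
 qed
 define E where "E = (%i j. FMem i j \<in> S)"
 define q where "q = (%i j. FEq i j \<in> S)"
 have refl: "q i i" for i unfolding q_def by (intro thS provable.eq_refl)
 have subst: "inst p j \<in> S" if "q i j" "inst p i \<in> S" for p i j
  using that unfolding q_def by (intro thS, rule provable.eq_subst[OF provable.hyp provable.hyp])
 have sym: "q j i" if "q i j" for i j
  using subst[OF that, of "FEq 0 (Suc i)"] refl[of i] by (auto simp: inst_def q_def)
 have trans: "q i l" if "q i j" "q j l" for i j l
  using subst[OF that(2), of "FEq (Suc i) 0"] that(1) by (auto simp: inst_def q_def)
 have eq: "equivp q"
  by (rule equivpI; (intro reflpI sympI transpI)?) (fact refl, erule sym, erule trans)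
 have cong: "E x' y'" if "q x x'" "q y y'" "E x y" for x x' y y'
  using subst[OF that(1), of "FMem 0 (Suc y)"] subst[OF that(2), of "FMem (Suc x') 0"] that(3)
  by (auto simp: inst_def E_def)
 have truth: "satq E q f p <-> ren f p \<in> S" for f p
 proof (induction p arbitrary: f)
  case (FAll p)
  have "inst (ren (case_nat 0 (%i. Suc (f i))) p) c = ren (case_nat c f) p" for c
  proof -
   have "case_nat c (%j. j) \<circ> case_nat 0 (%i. Suc (f i)) = case_nat c f" by (auto split: nat.split)
   thus ?thesis by (simp add: inst_def ren_ren)
  qed
  thus ?case using FAll by (simp add: allS)
 qed (auto simp: E_def q_def impS falseS)
 have "satq E q (%i. 2 * i) p" if "p \<in> T" for p
  using truth S(1) that by (auto simp: T'_def)
 thus ?thesis using eq cong by blast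
qed

text \<open>The introduction rules of \<^const>\<open>provable\<close> shadow these names.\<close>

lemmas allI = HOL.allI
lemmas allE = HOL.allE
lemmas impI = HOL.impI
lemmas impE = HOL.impE

subsection \<open>Definability with parameters\<close>

definition join :: "(nat => 'a) => (nat => 'a) => nat => 'a" where
 "join e a = (%i. if even i then e (i div 2) else a (i div 2))"

text \<open>Parameters occupy the odd variables.\<close>

definition dfn :: "('a => 'a => bool) => ((nat => 'a) => bool) => bool" where
 "dfn E P <-> (EX \<phi> a. ALL e. P e = sat E (join e a) \<phi>)"

text \<open>Definability of the graph, with the value in variable 0 and the arguments shifted. The
  rules collected in \<open>dfn\<close> follow the syntax of a predicate or term, so that formulas
  of the object language need not be written down.\<close>

definition dterm :: "('a => 'a => bool) => ((nat => 'a) => 'a) => bool" where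
 "dterm E t <-> dfn E (%e. e 0 = t (%i. e (Suc i)))"

named_theorems dfn

lemma join_simps [simp]: "join e a (2 * i) = e i" "join e a (Suc (2 * i)) = a i"
 by (simp_all add: join_def)

lemma dfnI: "(!!e. P e = sat E (join e a) \<phi>) ==> dfn E P"
 by (auto simp: dfn_def)

lemma dfn_const [dfn]: "dfn E (%e. b)"
 by (rule dfnI[where \<phi> = "if b then FImp FFalse FFalse else FFalse"]) auto

lemma dfn_imp [dfn]:
 assumes "dfn E P" "dfn E Q" shows "dfn E (%e. P e --> Q e)"
proof -
 obtain \<phi> a \<psi> b where 1: "!!e. P e = sat E (join e a) \<phi>" and 2: "!!e. Q e = sat E (join e b) \<psi>"
  using assms by (auto simp: dfn_def)
 define f where "f = (%i. if even i then i else Suc (2 * (2 * (i div 2))))"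
 define g where "g = (%i. if even i then i else Suc (2 * Suc (2 * (i div 2))))"
 have "(%i. join e (join a b) (f i)) = join e a" "(%i. join e (join a b) (g i)) = join e b" for e
  by (auto simp: f_def g_def fun_eq_iff elim!: evenE oddE simp flip: mult_Suc_right)
 thus ?thesis
  by (intro dfnI[where a = "join a b" and \<phi> = "FImp (ren f \<phi>) (ren g \<psi>)"]) (simp add: sat_ren 1 2)
qed

lemma dfn_not [dfn]: "dfn E P ==> dfn E (%e. ~ P e)"
 using dfn_imp[of E P "%_. False"] dfn_const[of E False] by simp

lemma dfn_conj [dfn]: "dfn E P ==> dfn E Q ==> dfn E (%e. P e & Q e)"
 using dfn_not[OF dfn_imp[of E P "%e. ~ Q e"]] dfn_not[of E Q] by simp

lemma dfn_disj [dfn]: "dfn E P ==> dfn E Q ==> dfn E (%e. P e | Q e)"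
 using dfn_imp[of E "%e. ~ P e" Q] dfn_not[of E P] by (simp add: disj_imp)

lemma dfn_iff [dfn]: "dfn E P ==> dfn E Q ==> dfn E (%e. P e = Q e)"
 using dfn_conj[OF dfn_imp[of E P Q] dfn_imp[of E Q P]] by (simp add: iff_conv_conj_imp)

lemma dfn_all [dfn]:
 assumes "dfn E (%e. P (%i. e (Suc i)) (e 0))" shows "dfn E (%e. ALL x. P e x)"
proof -
 obtain \<phi> a where 1: "!!e. P (%i. e (Suc i)) (e 0) = sat E (join e a) \<phi>"
  using assms unfolding dfn_def by blast
 \<comment> \<open>Binding puts \<open>x\<close> in front of the interleaved environment, although
   only its even half should be shifted; \<open>f\<close> restores the interleaving.\<close>
 define f where "f = (%i. if i = 0 then 0 else if even i then i - 1 else Suc i)"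
 have *: "(%i. case_nat x (join e a) (f i)) = join (case_nat x e) a" for x e
 proof
  fix i show "case_nat x (join e a) (f i) = join (case_nat x e) a i"
  proof (cases "even i")
   case True
   then obtain j where j: "i = 2 * j" by (auto elim: evenE)
   show ?thesis
   proof (cases j)
    case (Suc m)
    hence "f i = Suc (2 * m)" using j by (simp add: f_def)
    thus ?thesis using j Suc by (simp del: mult_Suc_right)
   qed (use j in "simp add: f_def join_def")
  next
   case False
   then obtain j where j: "i = Suc (2 * j)" by (auto elim: oddE)
   thus ?thesis by (simp add: f_def)
  qed
 qed
 have "P e x = sat E (case_nat x (join e a)) (ren f \<phi>)" for e x
  using 1[of "case_nat x e"] by (simp add: sat_ren *)
 thus ?thesis by (intro dfnI[where a = a and \<phi> = "FAll (ren f \<phi>)"]) simp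
qed

lemma dfn_ex [dfn]: "dfn E (%e. P (%i. e (Suc i)) (e 0)) ==> dfn E (%e. EX x. P e x)"
 using dfn_not[OF dfn_all[of E "%e x. ~ P e x"]] dfn_not by fastforce

text \<open>Variables outside \<open>V\<close> are frozen at the values \<open>c\<close>, which join
  the parameters of the formula.\<close>

lemma dfn_psub:
 assumes "dfn E P" shows "dfn E (%e. P (%i. if V i then e (f i) else c i))"
proof -
 obtain \<phi> a where 1: "!!e. P e = sat E (join e a) \<phi>" using assms by (auto simp: dfn_def)
 define g where "g = (%k. if even k then if V (k div 2) then 2 * f (k div 2) else Suc (2 * (2 * (k div 2)))
  else Suc (2 * Suc (2 * (k div 2))))"
 have "(%k. join e (join c a) (g k)) = join (%i. if V i then e (f i) else c i) a" for e
 proof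
  fix k show "join e (join c a) (g k) = join (%i. if V i then e (f i) else c i) a k"
  proof (cases "even k")
   case True
   then obtain i where k: "k = 2 * i" by (auto elim: evenE)
   have "g (2 * i) = (if V i then 2 * f i else Suc (2 * (2 * i)))" by (simp add: g_def)
   thus ?thesis unfolding k by (simp only: join_simps split: if_split) simp
  next
   case False
   then obtain i where k: "k = Suc (2 * i)" by (auto elim: oddE)
   have "g (Suc (2 * i)) = Suc (2 * Suc (2 * i))" by (simp add: g_def)
   thus ?thesis unfolding k by (simp only: join_simps)
  qed
 qed
 thus ?thesis by (intro dfnI[where a = "join c a" and \<phi> = "ren g \<phi>"]) (simp add: sat_ren 1)
qed

lemma dfn_shift: "dfn E P ==> dfn E (%e. P (%i. e (f i)))"
 using dfn_psub[of E P "%_. True"] by simp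

text \<open>All variables but the first are turned into parameters, which is the form in which the
  axiom schemas expect a predicate.\<close>

lemma dfn_par:
 assumes "dfn E (%e. P (%i. e (Suc i)) (e 0))" shows "dfn E (%e'. P e (e' 0))"
 using dfn_psub[OF assms, of "%i. i = 0" "%i. 0" "case_nat undefined e"] by simp

lemma dfn_var_eq: "dfn E (%e. e i = e j)"
 by (rule dfnI[where \<phi> = "FEq (2 * i) (2 * j)"]) simp

lemma dfn_var_mem: "dfn E (%e. E (e i) (e j))"
 by (rule dfnI[where \<phi> = "FMem (2 * i) (2 * j)"]) simp

lemma DT_var [dfn]: "dterm E (%e. e i)"
 unfolding dterm_def by (rule dfn_var_eq)

lemma DT_const [dfn]: "dterm E (%e. c)"
 unfolding dterm_def by (rule dfnI[where a = "%_. c" and \<phi> = "FEq 0 1"]) (simp add: join_def)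

lemma DT_shift: "dterm E t ==> dterm E (%e. t (%i. e (f i)))"
 unfolding dterm_def using dfn_shift[of E "%e. e 0 = t (%i. e (Suc i))" "case_nat 0 (%i. Suc (f i))"] by simp

lemma dfn_sub: "dfn E (%e. P (%i. e (Suc i)) (e 0)) ==> dterm E t ==> dfn E (%e. P e (t e))"
 using dfn_ex[of E "%e x. x = t e & P e x"] dfn_conj[of E "%e. e 0 = t (%i. e (Suc i))" "%e. P (%i. e (Suc i)) (e 0)"]
 by (simp add: dterm_def)

lemma DT_sub:
 assumes "dterm E (%e. f (%i. e (Suc i)) (e 0))" "dterm E t" shows "dterm E (%e. f e (t e))"
proof -
 have "dfn E (%e. e (Suc 0) = f (%i. e (Suc (Suc i))) (e 0))"
  using dfn_shift[OF assms(1)[unfolded dterm_def], of "%i. if i = 0 then 1 else if i = 1 then 0 else i"] by simp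
 thus ?thesis unfolding dterm_def
  by (rule dfn_sub[of E "%e x. e 0 = f (%i. e (Suc i)) x"]) (rule DT_shift[OF assms(2)])
qed

lemma DPD: "dfn E (%e. P (e 0)) ==> dterm E s ==> dfn E (%e. P (s e))"
 by (rule dfn_sub)

lemma DP2D:
 assumes "dfn E (%e. R (e 0) (e (Suc 0)))" "dterm E s" "dterm E t" shows "dfn E (%e. R (s e) (t e))"
proof -
 have "dfn E (%e. R (s (%i. e (Suc i))) (e 0))"
  by (rule dfn_sub[of E "%e x. R x (e 0)"]) (auto intro: assms DT_shift)
 thus ?thesis by (rule dfn_sub) (rule assms)
qed

lemma DP3D:
 assumes "dfn E (%e. R (e 0) (e (Suc 0)) (e (Suc (Suc 0))))" "dterm E s" "dterm E t" "dterm E u"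
 shows "dfn E (%e. R (s e) (t e) (u e))"
proof -
 have "dfn E (%e. R (s (%i. e (Suc (Suc i)))) (e 0) (e (Suc 0)))"
  by (rule dfn_sub[of E "%e x. R x (e 0) (e (Suc 0))"]) (auto intro: assms DT_shift)
 hence "dfn E (%e. R (s (%i. e (Suc i))) (t (%i. e (Suc i))) (e 0))"
  by (rule dfn_sub[of E "%e x. R (s (%i. e (Suc i))) x (e 0)"]) (auto intro: assms DT_shift)
 thus ?thesis by (rule dfn_sub) (rule assms)
qed

lemma DFD: "dterm E (%e. f (e 0)) ==> dterm E s ==> dterm E (%e. f (s e))"
 by (rule DT_sub)

lemma DF2D:
 assumes "dterm E (%e. f (e 0) (e (Suc 0)))" "dterm E s" "dterm E t" shows "dterm E (%e. f (s e) (t e))"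
proof -
 have "dterm E (%e. f (s (%i. e (Suc i))) (e 0))"
  by (rule DT_sub[of E "%e x. f x (e 0)"]) (auto intro: assms DT_shift)
 thus ?thesis by (rule DT_sub) (rule assms)
qed

lemma dfn_eq [dfn]: "dterm E s ==> dterm E t ==> dfn E (%e. s e = t e)"
 by (rule DP2D[where R = "(=)", OF dfn_var_eq])

lemma dfn_mem [dfn]: "dterm E s ==> dterm E t ==> dfn E (%e. E (s e) (t e))"
 by (rule DP2D[where R = E, OF dfn_var_mem[of E 0 "Suc 0"]])

lemma DT_if [dfn]: "dfn E P ==> dterm E s ==> dterm E t ==> dterm E (%e. if P e then s e else t e)"
proof -
 assume a: "dfn E P" "dterm E s" "dterm E t"
 have "dfn E (%e. (P (%i. e (Suc i)) --> e 0 = s (%i. e (Suc i))) & (~ P (%i. e (Suc i)) --> e 0 = t (%i. e (Suc i))))"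
  by (intro dfn dfn_shift[OF a(1)] DT_shift[OF a(2)] DT_shift[OF a(3)])
 thus ?thesis unfolding dterm_def by (rule back_subst[of "dfn E"]) auto
qed

subsection \<open>Basic set theory in a model of ZF\<close>

locale zf =
 fixes E :: "'a => 'a => bool" (infix \<open>\<E>\<close> 50)
 assumes ext: "(!!z. z \<E> x <-> z \<E> y) ==> x = y"
  and fnd: "y \<E> x ==> EX y. y \<E> x & (ALL z. z \<E> x --> ~ z \<E> y)"
  and pairing_ax: "EX p. ALL z. z \<E> p <-> z = x | z = y"
  and union_ax: "EX u. ALL z. z \<E> u <-> (EX y. y \<E> x & z \<E> y)"
  and power_ax: "EX p. ALL z. z \<E> p <-> (ALL w. w \<E> z --> w \<E> x)"
  and inf_ax: "EX x. (EX z. (ALL w. ~ w \<E> z) & z \<E> x) &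
     (ALL y. y \<E> x --> (EX s. (ALL z. z \<E> s <-> z \<E> y | z = y) & s \<E> x))"
  and sep_ax: "dfn E (%e. P (e 0)) ==> EX b. ALL x. x \<E> b <-> x \<E> a & P x"
  and repl_ax: "dfn E (%e. R (e 0) (e (Suc 0))) ==> (!!x y z. R x y ==> R x z ==> y = z) ==>
     EX b. ALL y. y \<E> b <-> (EX x. x \<E> a & R x y)"
begin

abbreviation Dfn where "Dfn \<equiv> dfn E"
abbreviation DT where "DT \<equiv> dterm E"
abbreviation DP where "DP P \<equiv> dfn E (%e. P (e 0))"
abbreviation DP2 where "DP2 P \<equiv> dfn E (%e. P (e 0) (e (Suc 0)))"
abbreviation DF where "DF f \<equiv> dterm E (%e. f (e 0))"
abbreviation DF2 where "DF2 f \<equiv> dterm E (%e. f (e 0) (e (Suc 0)))"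

definition el :: "'a => 'a set" where "el x = {y. y \<E> x}"

lemma el_iff [simp]: "y \<in> el x <-> y \<E> x" by (simp add: el_def)

lemma el_inj: "el x = el y ==> x = y" by (rule ext) (auto simp: el_def)

lemma dfn_el [dfn]: "DT s ==> DT t ==> Dfn (%e. s e \<in> el (t e))"
 by (simp add: dfn)

lemma dfn_ball [dfn]: assumes [THEN DT_shift, dfn]: "DT t" and [dfn]: "Dfn (%e. P (%i. e (Suc i)) (e 0))"
 shows "Dfn (%e. ALL x:el (t e). P e x)"
 unfolding Ball_def by (intro dfn)

lemma sub_iff: "el x <= el y <-> (ALL z. z \<E> x --> z \<E> y)" by auto

lemma dfn_subset [dfn]: assumes [THEN DT_shift, dfn]: "DT s" "DT t" shows "Dfn (%e. el (s e) <= el (t e))"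
 unfolding subset_eq by (intro dfn)

definition setof :: "('a => bool) => 'a" where "setof P = (THE b. ALL x. x \<E> b <-> P x)"

lemma setof: assumes "EX b. ALL x. x \<E> b <-> P x" shows "x \<E> setof P <-> P x"
proof -
 obtain b where b: "ALL x. x \<E> b <-> P x" using assms by blast
 have "ALL x. x \<E> setof P <-> P x" unfolding setof_def
  by (rule theI[of _ b]) (use b in "auto intro: ext")
 thus ?thesis by blast
qed

lemma DT_setof:
 assumes "Dfn (%e. P (%i. e (Suc i)) (e 0))" "!!e. EX b. ALL x. x \<E> b <-> P e x"
 shows "DT (%e. setof (P e))"
proof -
 have "y = setof (P e) <-> (ALL x. x \<E> y <-> P e x)" for y e
  using setof[OF assms(2)[of e]] ext by blast
 moreover have "Dfn (%e. P (%i. e (Suc (Suc i))) (e 0))"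
  using dfn_shift[OF assms(1), of "case_nat 0 (%i. Suc (Suc i))"] by simp
 ultimately show ?thesis unfolding dterm_def by (simp, intro dfn)
qed

section \<open>Elementary set operations and their definability\<close>

definition upair where "upair a b = setof (%z. z = a | z = b)"
definition Union where "Union x = setof (%z. EX y. y \<E> x & z \<E> y)"
definition Pow where "Pow x = setof (%z. ALL w. w \<E> z --> w \<E> x)"
definition Sep where "Sep a P = setof (%x. x \<E> a & P x)"
definition Repl where "Repl a f = setof (%y. EX x. x \<E> a & y = f x)"

lemma mem_upair [simp]: "z \<E> upair a b <-> z = a | z = b"
 unfolding upair_def by (rule setof) (rule pairing_ax)
lemma mem_Union [simp]: "z \<E> Union x <-> (EX y. y \<E> x & z \<E> y)"
 unfolding Union_def by (rule setof) (rule union_ax)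
lemma mem_Pow [simp]: "z \<E> Pow x <-> el z <= el x"
 unfolding Pow_def sub_iff by (rule setof) (rule power_ax)
lemma mem_Sep: "DP P ==> x \<E> Sep a P <-> x \<E> a & P x"
 unfolding Sep_def by (rule setof) (rule sep_ax)
lemma Repl_ex: "DF f ==> EX b. ALL y. y \<E> b <-> (EX x. x \<E> a & y = f x)"
 by (rule repl_ax) (auto intro!: dfn elim: DFD)
lemma mem_Repl: "DF f ==> y \<E> Repl a f <-> (EX x. x \<E> a & y = f x)"
 unfolding Repl_def by (rule setof) (rule Repl_ex)

lemma DT_upair [THEN DF2D, dfn]: "DF2 upair"
 unfolding upair_def by (rule DT_setof) (intro dfn, rule pairing_ax)
lemma DT_Union [THEN DFD, dfn]: "DF Union"
 unfolding Union_def by (rule DT_setof) (intro dfn, rule union_ax)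
lemma DT_Pow [THEN DFD, dfn]: "DF Pow"
 unfolding Pow_def by (rule DT_setof) (intro dfn, rule power_ax)
lemma DT_Sep [dfn]: assumes [THEN DT_shift, dfn]: "DT s" and [dfn]: "Dfn (%e. P (%i. e (Suc i)) (e 0))"
 shows "DT (%e. Sep (s e) (P e))"
 unfolding Sep_def by (rule DT_setof) (intro dfn, rule sep_ax, rule dfn_par[OF assms(2)])

lemma DT_par: "DT (%e. f (%i. e (Suc i)) (e 0)) ==> DT (%e'. f e (e' 0))"
 unfolding dterm_def
 by (drule dfn_psub[where V = "%i. i < 2" and f = "%i. i" and c = "%i. e (i - 2)"]) (simp add: numeral_2_eq_2)

lemma DT_Repl [dfn]: assumes [THEN DT_shift, dfn]: "DT s" and f: "DT (%e. f (%i. e (Suc i)) (e 0))"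
 shows "DT (%e. Repl (s e) (f e))"
 unfolding Repl_def
proof (rule DT_setof)
 have [dfn]: "DT (%e. f (%i. e (Suc (Suc i))) (e 0))"
  using DT_shift[OF f, of "case_nat 0 (%i. Suc (Suc i))"] by simp
 show "Dfn (%e. EX x. x \<E> s (%i. e (Suc i)) & e 0 = f (%i. e (Suc i)) x)" by (intro dfn)
 show "EX b. ALL y. y \<E> b <-> (EX x. x \<E> s e & y = f e x)" for e
  by (rule Repl_ex) (rule DT_par[OF f])
qed

definition emp where "emp = setof (%_. False)"
lemma mem_emp [simp]: "~ x \<E> emp"
proof -
 have "EX b. ALL x. x \<E> b <-> False" using sep_ax[of "%_. False"] dfn_const by fastforce
 thus ?thesis unfolding emp_def using setof[of "%_. False"] by blast
qed

lemma empI: "(!!y. ~ y \<E> x) ==> x = emp" by (rule ext) simp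

definition un where "un a b = Union (upair a b)"
lemma mem_un [simp]: "z \<E> un a b <-> z \<E> a | z \<E> b" by (auto simp: un_def)
lemma DT_un [THEN DF2D, dfn]: "DF2 un" unfolding un_def by (intro dfn)

definition sing where "sing a = upair a a"
lemma mem_sing [simp]: "z \<E> sing a <-> z = a" by (auto simp: sing_def)
lemma DT_sing [THEN DFD, dfn]: "DF sing" unfolding sing_def by (intro dfn)

definition pair where "pair a b = upair (upair a a) (upair a b)"
lemma DT_pair [THEN DF2D, dfn]: "DF2 pair" unfolding pair_def by (intro dfn)

lemma upair_eq: "upair a b = upair c d <-> (a = c & b = d) | (a = d & b = c)"
proof
 assume "upair a b = upair c d"
 hence "z = a | z = b <-> z = c | z = d" for z using mem_upair by metis
 thus "(a = c & b = d) | (a = d & b = c)" by metis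
qed (auto intro: ext)

lemma pair_inj [simp]: "pair a b = pair c d <-> a = c & b = d"
 unfolding pair_def by (auto simp: upair_eq)

lemma mem_Union_pair: "z \<E> Union (pair a b) <-> z = a | z = b" by (auto simp: pair_def)

text \<open>The union over the unique candidate makes the projection a total definable function; a
  set that is no pair is sent to \<open>emp\<close>.\<close>

definition p1 where "p1 p = Union (Sep (Union p) (%a. EX b. p = pair a b))"
definition p2 where "p2 p = Union (Sep (Union p) (%b. EX a. p = pair a b))"
lemma DT_p1 [THEN DFD, dfn]: "DF p1" unfolding p1_def by (intro dfn)
lemma DT_p2 [THEN DFD, dfn]: "DF p2" unfolding p2_def by (intro dfn)

lemma p1_pair [simp]: "p1 (pair a b) = a"
proof (rule ext)
 have d: "DP (%x. EX y. pair a b = pair x y)" by (intro dfn)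
 show "z \<E> p1 (pair a b) <-> z \<E> a" for z
  unfolding p1_def mem_Union[of _ "Sep _ _"] mem_Sep[OF d] mem_Union_pair by auto
qed

lemma p2_pair [simp]: "p2 (pair a b) = b"
proof (rule ext)
 have d: "DP (%x. EX y. pair a b = pair y x)" by (intro dfn)
 show "z \<E> p2 (pair a b) <-> z \<E> b" for z
  unfolding p2_def mem_Union[of _ "Sep _ _"] mem_Sep[OF d] mem_Union_pair by auto
qed

definition prod where "prod a b = Union (Repl a (%x. Repl b (%y. pair x y)))"
lemma DT_prod [THEN DF2D, dfn]: "DF2 prod"
 unfolding prod_def by (intro dfn)
lemma mem_prod: "z \<E> prod a b <-> (EX x y. x \<E> a & y \<E> b & z = pair x y)"
proof -
 have 1: "DF (%x. Repl b (pair x))" and 2: "DF (pair x)" for x by (intro dfn)+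
 show ?thesis unfolding prod_def mem_Union mem_Repl[OF 1] using mem_Repl[OF 2] by (auto; metis)
qed
lemma pair_mem_prod [simp]: "pair x y \<E> prod a b <-> x \<E> a & y \<E> b" by (auto simp: mem_prod)

section \<open>Functions as sets of pairs\<close>

definition lam where "lam a f = Repl a (%x. pair x (f x))"
lemma DT_lam [dfn]: assumes [dfn]: "DT s" "DT (%e. f (%i. e (Suc i)) (e 0))" shows "DT (%e. lam (s e) (f e))"
 unfolding lam_def by (intro dfn)
lemma mem_lam: "DF f ==> z \<E> lam a f <-> (EX x. x \<E> a & z = pair x (f x))"
 unfolding lam_def by (rule mem_Repl) (intro dfn)

text \<open>Total by the same device: where \<open>f\<close> has no value the result is
  \<open>emp\<close>.\<close>

definition app where "app f x = Union (Sep (Union (Union f)) (%y. pair x y \<E> f))"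
lemma DT_app [THEN DF2D, dfn]: "DF2 app"
 unfolding app_def by (intro dfn)

lemma app_eq: assumes "pair x y \<E> f" "!!z. pair x z \<E> f ==> z = y" shows "app f x = y"
proof -
 have d: "DP (%y. pair x y \<E> f)" by (intro dfn)
 have u: "y \<E> upair x y" "upair x y \<E> pair x y" by (simp_all add: pair_def)
 show ?thesis unfolding app_def
 proof (rule ext)
  fix z
  have "(EX w. w \<E> Sep (Union (Union f)) (%y. pair x y \<E> f) & z \<E> w) <-> z \<E> y"
   unfolding mem_Sep[OF d] mem_Union using assms u by metis
  thus "z \<E> Union (Sep (Union (Union f)) (%y. pair x y \<E> f)) <-> z \<E> y"
   unfolding mem_Union .
 qed
qed

lemma app_lam: "DF f ==> x \<E> a ==> app (lam a f) x = f x"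
 by (rule app_eq) (auto simp: mem_lam)

definition fn where "fn f a <-> (ALL p. p \<E> f --> (EX x y. x \<E> a & p = pair x y)) &
  (ALL x. x \<E> a --> (EX y. pair x y \<E> f & (ALL z. pair x z \<E> f --> z = y)))"
lemma dfn_fn [THEN DP2D, dfn]: "DP2 fn"
 unfolding fn_def by (intro dfn)

lemma fn_lam: "DF f ==> fn (lam a f) a" by (auto simp: fn_def mem_lam)
lemma fn_mem: "fn f a ==> p \<E> f <-> (EX x. x \<E> a & p = pair x (app f x))"
proof
 assume a: "fn f a" "p \<E> f"
 then obtain x y where xy: "x \<E> a" "p = pair x y" by (auto simp: fn_def)
 moreover have "app f x = y" by (rule app_eq) (use a xy in "auto simp: fn_def")
 ultimately show "EX x. x \<E> a & p = pair x (app f x)" by auto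
next
 assume a: "fn f a" and "EX x. x \<E> a & p = pair x (app f x)"
 then obtain x where x: "x \<E> a" "p = pair x (app f x)" by blast
 then obtain y where "pair x y \<E> f" "ALL z. pair x z \<E> f --> z = y" using a unfolding fn_def by blast
 thus "p \<E> f" using x app_eq[of x y f] by metis
qed
lemma fn_ext: "fn f a ==> fn g a ==> (!!x. x \<E> a ==> app f x = app g x) ==> f = g"
 by (rule ext) (auto simp: fn_mem)
lemma fn_pair: "fn f a ==> pair x y \<E> f <-> x \<E> a & y = app f x"
 by (auto simp: fn_mem)
lemma lam_cong: "DF f ==> DF g ==> (!!x. x \<E> a ==> f x = g x) ==> lam a f = lam a g"
 by (rule ext) (auto simp: mem_lam)
definition Funs where "Funs a b = Sep (Pow (prod a b)) (%f. fn f a)"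
lemma DT_Funs [THEN DF2D, dfn]: "DF2 Funs"
 unfolding Funs_def by (intro dfn)
lemma mem_Funs: "f \<E> Funs a b <-> fn f a & (ALL x. x \<E> a --> app f x \<E> b)"
proof -
 have d: "DP (%f. fn f a)" by (intro dfn)
 show ?thesis unfolding Funs_def mem_Sep[OF d] mem_Pow sub_iff
  using fn_mem[of f a] by (auto simp: mem_prod; fastforce)
qed

lemma mem_Image: "y \<E> Repl a (app f) <-> (EX x. x \<E> a & y = app f x)"
 by (rule mem_Repl) (intro dfn)

end

subsection \<open>Recursion and ordinals\<close>

context zf begin

lemma mem_UN: "DF f ==> z \<E> Union (Repl a f) <-> (EX x. x \<E> a & z \<E> f x)"
 by (auto simp: mem_Repl)

text \<open>The usual union of attempts. Well-foundedness is demanded for definable classes only,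
  since the relation may well descend forever when seen from outside.\<close>

lemma wf_rec:
 assumes R: "DP2 R" and trans: "!!x y z. R x y ==> R y z ==> R x z"
  and setlike: "!!x. EX b. ALL y. y \<E> b <-> R y x"
  and wf: "!!P x. DP P ==> P x ==> EX x. P x & (ALL y. R y x --> ~ P y)"
  and G: "DF2 G"
 shows "EX F. DF F & (ALL x. F x = G x (lam (setof (%y. R y x)) F))"
proof -
 note [dfn] = DP2D[OF R] DF2D[OF G]
 define pred where "pred = (%x. setof (%y. R y x))"
 have pred: "y \<E> pred x <-> R y x" for x y unfolding pred_def by (rule setof) (rule setlike)
 have "DF pred" unfolding pred_def by (rule DT_setof) (intro dfn, rule setlike)
 note [dfn] = DFD[OF this]
 have ind: "P x" if P: "DP P" and step: "!!x. (!!y. R y x ==> P y) ==> P x" for P x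
 proof (rule ccontr)
  assume "~ P x"
  moreover have "DP (%x. ~ P x)" by (intro dfn P)
  ultimately show False using wf[of "%x. ~ P x" x] step by blast
 qed
 define att where "att = (%x f. fn f (pred x) & (ALL y. R y x --> app f y = G y (lam (pred y) (app f))))"
 have "DP2 att" unfolding att_def fn_def by (intro dfn)
 note [dfn] = DP2D[OF this]
 have dapp: "DF (app f)" for f by (intro dfn)
 have uniq: "R y x --> R y x' --> app f y = app f' y" if a: "att x f" "att x' f'" for x x' f f' y
 proof (rule ind[of "%y. R y x --> R y x' --> app f y = app f' y"], intro dfn, intro impI)
  fix y assume IH: "!!z. R z y ==> R z x --> R z x' --> app f z = app f' z" and y: "R y x" "R y x'"
  have "lam (pred y) (app f) = lam (pred y) (app f')"
   by (rule lam_cong[OF dapp dapp]) (use IH trans y pred in blast)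
  thus "app f y = app f' y" using a y unfolding att_def by simp
 qed
 have attu: "f = f'" if "att x f" "att x f'" for x f f'
  by (rule fn_ext[of _ "pred x"]) (use that uniq[OF that] in "auto simp: att_def pred")
 \<comment> \<open>There is at most one attempt at \<open>x\<close>, and the union extracts
   it.\<close>
 define F0 where "F0 = (%x. Union (setof (att x)))"
 have attex: "EX b. ALL f. f \<E> b <-> att x f" for x
 proof (cases "EX f. att x f")
  case True
  then obtain f where "att x f" by blast
  hence "ALL g. g \<E> sing f <-> att x g" using attu by auto
  thus ?thesis by blast
 next
  case False hence "ALL g. g \<E> emp <-> att x g" by simp
  thus ?thesis by blast
 qed
 have "DF F0" unfolding F0_def by (intro DT_Union DT_setof attex dfn)
 note [dfn] = DFD[OF this]
 have F0: "F0 x = f" if "att x f" for x f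
 proof (rule ext)
  fix z show "z \<E> F0 x <-> z \<E> f"
   unfolding F0_def mem_Union setof[OF attex] using that attu by blast
 qed
 define F where "F = (%x. G x (F0 x))"
 have "DF F" unfolding F_def by (intro dfn)
 note [dfn] = DFD[OF this]
 have "att x (lam (pred x) F)" for x
 proof (rule ind[of "%x. att x (lam (pred x) F)"], intro dfn)
  fix x assume IH: "!!y. R y x ==> att y (lam (pred y) F)"
  have "app (lam (pred x) F) y = G y (lam (pred y) (app (lam (pred x) F)))" if y: "R y x" for y
  proof -
   have "app (lam (pred x) F) y = F y" by (rule app_lam) (auto intro: \<open>DF F\<close> simp: pred y)
   moreover have "app (lam (pred x) F) z = F z" if "R z y" for z
    by (rule app_lam[OF \<open>DF F\<close>]) (use trans[OF that y] pred in blast)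
   hence "lam (pred y) (app (lam (pred x) F)) = lam (pred y) F"
    by (intro lam_cong[OF dapp \<open>DF F\<close>]) (simp add: pred)
   ultimately show ?thesis using F0[OF IH[OF y]] by (simp add: F_def)
  qed
  thus "att x (lam (pred x) F)" unfolding att_def using fn_lam[OF \<open>DF F\<close>] by blast
 qed
 hence "F0 x = lam (pred x) F" for x using F0 by blast
 hence "F x = G x (lam (pred x) F)" for x unfolding F_def by metis
 thus ?thesis using \<open>DF F\<close> unfolding pred_def by blast
qed

section \<open>Ordinals\<close>

definition Ord where "Ord x <-> (ALL y. y \<E> x --> el y <= el x) & (ALL y z. y \<E> x --> z \<E> y --> el z <= el y)"
lemma dfn_Ord [THEN DPD, dfn]: "DP Ord" unfolding Ord_def by (intro dfn)

lemma Ord_trans: "Ord x ==> y \<E> x ==> z \<E> y ==> z \<E> x" unfolding Ord_def sub_iff by blast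
lemma Ord_mem: "Ord x ==> y \<E> x ==> Ord y" unfolding Ord_def sub_iff by blast

lemma not_refl [simp]: "~ x \<E> x" using fnd[of x "sing x"] by auto
lemma not_sym: "x \<E> y ==> ~ y \<E> x" using fnd[of x "upair x y"] by auto

lemma Ord_least: assumes P: "DP P" and "Ord x" "P x"
 shows "EX x. Ord x & P x & (ALL y. y \<E> x --> ~ P y)"
proof (cases "EX y. y \<E> x & P y")
 case True
 then obtain y where "y \<E> Sep x P" by (auto simp: mem_Sep[OF P])
 then obtain z where "z \<E> Sep x P" "ALL w. w \<E> Sep x P --> ~ w \<E> z" using fnd by blast
 thus ?thesis unfolding mem_Sep[OF P] using Ord_mem Ord_trans \<open>Ord x\<close> by blast
next
 case False thus ?thesis using assms by blast
qed

lemma Ord_induct: assumes P: "DP P" and step: "!!x. Ord x ==> (!!y. y \<E> x ==> P y) ==> P x" and "Ord x" shows "P x"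
proof (rule ccontr)
 assume "~ P x"
 moreover have "DP (%x. ~ P x)" by (intro dfn P)
 ultimately show False using Ord_least[of "%x. ~ P x" x] \<open>Ord x\<close> step by blast
qed

lemma Ord_linear: assumes "Ord x" "Ord y" shows "x \<E> y | x = y | y \<E> x"
proof -
 have "ALL y. Ord y --> x \<E> y | x = y | y \<E> x"
 proof (rule Ord_induct[of "%x. ALL y. Ord y --> x \<E> y | x = y | y \<E> x"], intro dfn, intro allI impI)
  fix x y assume x: "Ord x" and IH: "!!z. z \<E> x ==> ALL y. Ord y --> z \<E> y | z = y | y \<E> z" and y: "Ord y"
  show "x \<E> y | x = y | y \<E> x"
  proof (rule Ord_induct[of "%y. x \<E> y | x = y | y \<E> x"], intro dfn)
   fix y assume y: "Ord y" and IH2: "!!z. z \<E> y ==> x \<E> z | x = z | z \<E> x"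
   show "x \<E> y | x = y | y \<E> x"
   proof (rule ccontr)
    assume n: "~ ?thesis"
    have "x = y"
    proof (rule ext)
     fix z
     show "z \<E> x <-> z \<E> y" using n IH[of z] IH2[of z] x y Ord_trans by blast
    qed
    thus False using n by blast
   qed
  qed (rule y)
 qed (rule assms)
 thus ?thesis using assms by blast
qed

lemma OrdI: "(!!y. y \<E> x ==> Ord y) ==> (!!y z. y \<E> x ==> z \<E> y ==> z \<E> x) ==> Ord x"
proof -
 assume a: "!!y. y \<E> x ==> Ord y" "!!y z. y \<E> x ==> z \<E> y ==> z \<E> x"
 hence "y \<E> x ==> z \<E> y ==> w \<E> z ==> w \<E> y" for y z w using Ord_trans by blast
 thus ?thesis using a(2) unfolding Ord_def sub_iff by blast
qed

lemma Ord_emp [simp]: "Ord emp" by (rule OrdI) auto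
lemma Ord_Union: "(!!y. y \<E> x ==> Ord y) ==> Ord (Union x)"
proof (rule OrdI)
 assume x: "!!y. y \<E> x ==> Ord y"
 fix y assume "y \<E> Union x"
 then obtain w where w: "w \<E> x" "y \<E> w" by auto
 show "Ord y" by (rule Ord_mem[OF x[OF w(1)] w(2)])
 fix z assume "z \<E> y"
 thus "z \<E> Union x" using Ord_trans[OF x[OF w(1)] w(2)] w(1) by auto
qed

definition succ where "succ x = un x (sing x)"
lemma mem_succ [simp]: "z \<E> succ x <-> z \<E> x | z = x" by (auto simp: succ_def)
lemma DT_succ [THEN DFD, dfn]: "DF succ" unfolding succ_def by (intro dfn)
lemma Ord_succ: "Ord x ==> Ord (succ x)" by (rule OrdI) (auto intro: Ord_mem Ord_trans)
lemma Ord_subset: "Ord x ==> Ord y ==> el x <= el y <-> x \<E> y | x = y"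
proof
 assume a: "Ord x" "Ord y" "el x <= el y"
 show "x \<E> y | x = y" using Ord_linear[OF a(1,2)] a(3) not_refl by (metis el_iff subset_eq)
qed (auto intro: Ord_trans)
lemma Ord_not_mem: "Ord x ==> Ord y ==> ~ x \<E> y <-> el y <= el x"
 using Ord_linear not_sym Ord_subset not_refl by metis
lemma Union_succ: "Ord x ==> Union (succ x) = x" by (rule ext) (auto intro: Ord_trans)
lemma succ_inj: "succ x = succ y ==> x = y" using mem_succ not_sym by metis
lemma succ_nonemp [simp]: "succ x ~= emp" using mem_succ[of x x] mem_emp by metis
lemma emp_mem: "Ord x ==> x ~= emp ==> emp \<E> x" using Ord_linear[of emp x] by auto
lemma Ord_rec:
 assumes G: "DF2 G"
 shows "EX F. DF F & (ALL x. Ord x --> F x = G x (lam x F))"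
proof -
 \<comment> \<open>Membership is transitive only in ordinals, so all other sets are given no
   predecessors.\<close>
 let ?R = "%y x. y \<E> x & Ord x"
 have set: "EX b. ALL y. y \<E> b <-> ?R y x" for x
 proof (cases "Ord x")
  case True thus ?thesis by blast
 next
  case False hence "ALL y. y \<E> emp <-> ?R y x" by simp
  thus ?thesis by blast
 qed
 have "EX F. DF F & (ALL x. F x = G x (lam (setof (%y. ?R y x)) F))"
 proof (rule wf_rec)
  show "DP2 ?R" by (intro dfn)
  fix P x assume P: "DP P" "P x"
  show "EX x. P x & (ALL y. ?R y x --> ~ P y)"
   using Ord_least[OF P(1) _ P(2)] P(2) by blast
 qed (use set G Ord_trans in blast)+
 then obtain F where F: "DF F" "!!x. F x = G x (lam (setof (%y. ?R y x)) F)" by blast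
 have "setof (%y. ?R y x) = x" if "Ord x" for x
  using setof[OF set[of x]] that by (intro ext) simp
 thus ?thesis using F by metis
qed

section \<open>The natural numbers of the model\<close>

definition indset where "indset x <-> emp \<E> x & (ALL y. y \<E> x --> succ y \<E> x)"
definition omega where "omega = setof (%n. ALL x. indset x --> n \<E> x)"

lemma omega_ex: "EX b. ALL n. n \<E> b <-> (ALL x. indset x --> n \<E> x)"
proof -
 obtain x where x: "EX z. (ALL w. ~ w \<E> z) & z \<E> x" "!!y. y \<E> x ==> EX s. (ALL z. z \<E> s <-> z \<E> y | z = y) & s \<E> x"
  using inf_ax by blast
 have "indset x" unfolding indset_def
 proof (intro conjI allI impI)
  show "emp \<E> x" using x(1) empI by metis
  fix y assume "y \<E> x"
  then obtain s where "ALL z. z \<E> s <-> z \<E> y | z = y" "s \<E> x" using x(2) by blast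
  thus "succ y \<E> x" using ext[of s "succ y"] by simp
 qed
 moreover have d: "DP (%n. ALL x. indset x --> n \<E> x)" unfolding indset_def by (intro dfn)
 ultimately have "ALL n. n \<E> Sep x (%n. ALL x. indset x --> n \<E> x) <-> (ALL x. indset x --> n \<E> x)"
  by (auto simp: mem_Sep[OF d])
 thus ?thesis by blast
qed

lemma mem_omega: "n \<E> omega <-> (ALL x. indset x --> n \<E> x)" unfolding omega_def by (rule setof[OF omega_ex])
lemma emp_omega [simp]: "emp \<E> omega" by (auto simp: mem_omega indset_def)
lemma succ_omega [simp]: "n \<E> omega ==> succ n \<E> omega" by (auto simp: mem_omega indset_def)

lemma nat_induct: assumes P: "DP P" and "P emp" "!!n. n \<E> omega ==> P n ==> P (succ n)" "n \<E> omega" shows "P n"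
proof -
 have "indset (Sep omega P)" unfolding indset_def mem_Sep[OF P] using assms by auto
 hence "n \<E> Sep omega P" using assms(4) by (auto simp: mem_omega)
 thus ?thesis by (simp add: mem_Sep[OF P])
qed

lemma nat_Ord: "n \<E> omega ==> Ord n" by (rule nat_induct[of Ord]) (auto intro: dfn Ord_succ)
lemma nat_trans: "n \<E> omega ==> m \<E> n ==> m \<E> omega"
proof -
 have "n \<E> omega ==> ALL m. m \<E> n --> m \<E> omega" for n
  by (rule nat_induct[of "%n. ALL m. m \<E> n --> m \<E> omega"], intro dfn) auto
 thus "n \<E> omega ==> m \<E> n ==> m \<E> omega" by blast
qed
lemma Ord_omega [simp]: "Ord omega" by (rule OrdI) (auto intro: nat_Ord nat_trans)
lemma nat_cases: "n \<E> omega ==> n = emp | (EX m. m \<E> omega & n = succ m)"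
 by (rule nat_induct[of "%n. n = emp | (EX m. m \<E> omega & n = succ m)"], intro dfn) auto
lemma nat_rec:
 assumes S: "DF2 S"
 shows "EX F. DF F & F emp = z & (ALL n. n \<E> omega --> F (succ n) = S n (F n))"
proof -
 note [dfn] = DF2D[OF S]
 \<comment> \<open>For a successor ordinal \<open>x\<close> the predecessor is
   \<open>Union x\<close>.\<close>
 have G: "DF2 (%x f. if x = emp then z else S (Union x) (app f (Union x)))" by (intro dfn)
 obtain F where F: "DF F" "!!x. Ord x ==> F x = (if x = emp then z else S (Union x) (app (lam x F) (Union x)))"
  using Ord_rec[OF G] by blast
 have "F (succ n) = S n (F n)" if "n \<E> omega" for n
  using F(2)[of "succ n"] that by (simp add: Ord_succ nat_Ord Union_succ app_lam[OF F(1)])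
 thus ?thesis using F(1) F(2)[of emp] by auto
qed

section \<open>Transitive closure, induction and recursion on membership\<close>

lemma trans_superset: "EX t. el x <= el t & (ALL y. y \<E> t --> el y <= el t)"
proof -
 have "DF2 (%n y. Union y)" by (intro dfn)
 then obtain F where F: "DF F" "F emp = x" "!!n. n \<E> omega ==> F (succ n) = Union (F n)"
  using nat_rec[of "%n y. Union y" x] by blast
 let ?t = "Union (Repl omega F)"
 have "el x <= el ?t" using F(2) emp_omega unfolding sub_iff mem_UN[OF F(1)] by blast
 moreover have "el y <= el ?t" if y: "y \<E> ?t" for y
 proof
  fix z assume "z \<in> el y"
  from y obtain n where "n \<E> omega" "y \<E> F n" by (auto simp: mem_Repl[OF F(1)])
  hence "z \<E> F (succ n)" using \<open>z \<in> el y\<close> F(3) by auto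
  thus "z \<in> el ?t" using succ_omega[OF \<open>n \<E> omega\<close>] by (auto simp: mem_Repl[OF F(1)])
 qed
 ultimately show ?thesis by blast
qed

definition tcl where "tcl x = setof (%z. ALL t. el x <= el t & (ALL y. y \<E> t --> el y <= el t) --> z \<E> t)"
lemma tcl_ex: "EX b. ALL z. z \<E> b <-> (ALL t. el x <= el t & (ALL y. y \<E> t --> el y <= el t) --> z \<E> t)"
proof -
 obtain t where t: "el x <= el t & (ALL y. y \<E> t --> el y <= el t)" using trans_superset by blast
 let ?P = "%z. ALL t. el x <= el t & (ALL y. y \<E> t --> el y <= el t) --> z \<E> t"
 have d: "DP ?P" by (intro dfn)
 have "ALL z. z \<E> Sep t ?P <-> ?P z" using t by (auto simp: mem_Sep[OF d])
 thus ?thesis by blast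
qed
lemma DT_tcl [THEN DFD, dfn]: "DF tcl"
 unfolding tcl_def by (rule DT_setof) (intro dfn, rule tcl_ex)
lemma mem_tcl: "z \<E> tcl x <-> (ALL t. el x <= el t & (ALL y. y \<E> t --> el y <= el t) --> z \<E> t)"
 unfolding tcl_def by (rule setof[OF tcl_ex])
lemma tcl_mem: "y \<E> x ==> y \<E> tcl x" by (auto simp: mem_tcl)
lemma tcl_trans: "y \<E> tcl x ==> z \<E> y ==> z \<E> tcl x" by (simp only: mem_tcl sub_iff) blast
lemma tcl_least: "el x <= el t ==> (!!y. y \<E> t ==> el y <= el t) ==> el (tcl x) <= el t" by (simp only: sub_iff mem_tcl) blast
lemma tcl_tcl: "y \<E> tcl x ==> z \<E> tcl y ==> z \<E> tcl x"
 using tcl_least[of y "tcl x"] tcl_trans[of _ x] unfolding sub_iff by blast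
lemma tcl_cases: "z \<E> tcl x ==> z \<E> x | (EX y. y \<E> x & z \<E> tcl y)"
proof -
 have 1: "DF tcl" by (intro dfn)
 let ?U = "un x (Union (Repl x tcl))"
 have "el (tcl x) <= el ?U"
 proof (rule tcl_least)
  fix y assume "y \<E> ?U"
  then consider "y \<E> x" | w where "w \<E> x" "y \<E> tcl w" unfolding mem_un mem_UN[OF 1] by blast
  thus "el y <= el ?U"
   unfolding sub_iff mem_un mem_UN[OF 1] using tcl_mem tcl_trans by cases blast+
 qed auto
 thus "z \<E> tcl x ==> z \<E> x | (EX y. y \<E> x & z \<E> tcl y)"
  unfolding sub_iff mem_un mem_UN[OF 1] by blast
qed

lemma class_fnd: assumes P: "DP P" "P x" shows "EX x. P x & (ALL y. y \<E> tcl x --> ~ P y)"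
proof -
 have minimal: "EX x. P x & (ALL y. y \<E> x --> ~ P y)" if P: "DP P" "P x" for P x
 proof (cases "EX y. y \<E> tcl x & P y")
  case True
  then obtain y where "y \<E> Sep (tcl x) P" by (auto simp: mem_Sep[OF P(1)])
  then obtain z where "z \<E> Sep (tcl x) P" "ALL w. w \<E> Sep (tcl x) P --> ~ w \<E> z" using fnd by blast
  thus ?thesis unfolding mem_Sep[OF P(1)] using tcl_trans by blast
 next
  case False thus ?thesis using P tcl_mem by blast
 qed
 note [dfn] = DPD[OF P(1)]
 \<comment> \<open>Minimality for membership is applied to this larger class. A minimal member of it
   cannot have a \<open>P\<close> in its closure, since an element on the way there would be in the
   class too; so it satisfies \<open>P\<close> itself.\<close>
 have "DP (%x. P x | (EX y. y \<E> tcl x & P y))" by (intro dfn)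
 from minimal[OF this, of x] P(2) obtain x where
  x: "P x | (EX y. y \<E> tcl x & P y)" "!!y. y \<E> x ==> ~ (P y | (EX z. z \<E> tcl y & P z))" by blast
 thus ?thesis using tcl_cases by blast
qed

lemma mem_induct: assumes P: "DP P" and step: "!!x. (!!y. y \<E> tcl x ==> P y) ==> P x" shows "P x"
proof (rule ccontr)
 assume "~ P x"
 moreover have "DP (%x. ~ P x)" by (intro dfn P)
 ultimately show False using class_fnd[of "%x. ~ P x" x] step by blast
qed

lemma mem_rec:
 assumes G: "DF2 G"
 shows "EX F. DF F & (ALL x. F x = G x (lam (tcl x) F))"
proof -
 have "EX F. DF F & (ALL x. F x = G x (lam (setof (%y. y \<E> tcl x)) F))"
 proof (rule wf_rec)
  show "DP2 (%y x. y \<E> tcl x)" by (intro dfn)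
 qed (use tcl_tcl G class_fnd in blast)+
 moreover have "setof (%y. y \<E> tcl x) = tcl x" for x by (rule ext) (rule setof, blast)
 ultimately show ?thesis by simp
qed

text \<open>Scott's trick: for each \<open>x\<close> the least rank of a witness is unique, so
  replacement makes these ranks a set, and a level \<open>V \<delta>\<close> beyond all of them
  contains witnesses.\<close>

lemma collection:
 assumes R: "DP2 R"
 shows "EX b. ALL x. x \<E> a --> (EX y. R x y) --> (EX y. y \<E> b & R x y)"
proof -
 note [dfn] = DP2D[OF R]
 have "DF2 (%x f. Union (Repl x (%y. succ (app f y))))" by (intro dfn)
 from mem_rec[OF this] obtain \<rho> where \<rho>: "DF \<rho>" "!!x. \<rho> x = Union (Repl x (%y. succ (app (lam (tcl x) \<rho>) y)))" by blast
 note [dfn] = DFD[OF \<rho>(1)]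
 have \<rho>': "\<rho> x = Union (Repl x (%y. succ (\<rho> y)))" for x
 proof -
  have d: "DF (%y. succ (app (lam (tcl x) \<rho>) y))" "DF (%y. succ (\<rho> y))" by (intro dfn)+
  have "Repl x (%y. succ (app (lam (tcl x) \<rho>) y)) = Repl x (%y. succ (\<rho> y))"
   by (rule ext) (auto simp: mem_Repl[OF d(1)] mem_Repl[OF d(2)] app_lam[OF \<rho>(1) tcl_mem])
  thus ?thesis using \<rho>(2)[of x] by simp
 qed
 have ds: "DF (%y. succ (\<rho> y))" by (intro dfn)
 have Ord\<rho>: "Ord (\<rho> x)" for x
 proof (rule mem_induct[of "%x. Ord (\<rho> x)"], intro dfn)
  fix x assume "!!y. y \<E> tcl x ==> Ord (\<rho> y)"
  thus "Ord (\<rho> x)" unfolding \<rho>'[of x]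
   by (intro Ord_Union) (auto simp: mem_Repl[OF ds] intro: Ord_succ tcl_mem)
 qed
 have \<rho>mem: "y \<E> x ==> \<rho> y \<E> \<rho> x" for x y unfolding \<rho>'[of x] by (auto simp: mem_Repl[OF ds])
 have "DF2 (%x f. Union (Repl x (%y. Pow (app f y))))" by (intro dfn)
 from Ord_rec[OF this] obtain V where V: "DF V" "!!x. Ord x ==> V x = Union (Repl x (%y. Pow (app (lam x V) y)))" by blast
 note [dfn] = DFD[OF V(1)]
 have V': "z \<E> V x <-> (EX y. y \<E> x & el z <= el (V y))" if "Ord x" for x z
 proof -
  have d: "DF (%y. Pow (app (lam x V) y))" by (intro dfn)
  show ?thesis unfolding V(2)[OF that] mem_Union mem_Repl[OF d] by (auto simp: app_lam[OF V(1)]; metis app_lam[OF V(1)])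
 qed
 have inV: "ALL y. \<rho> y \<E> x --> y \<E> V x" if "Ord x" for x
 proof (rule Ord_induct[of "%x. ALL y. \<rho> y \<E> x --> y \<E> V x"], intro dfn, intro allI impI)
  fix x y assume x: "Ord x" "!!y. y \<E> x ==> ALL z. \<rho> z \<E> y --> z \<E> V y" and y: "\<rho> y \<E> x"
  have "el y <= el (V (\<rho> y))" using x(2)[OF y] \<rho>mem by auto
  thus "y \<E> V x" using V'[OF x(1)] y by blast
 qed (rule that)
 let ?Q = "%x \<alpha>. Ord \<alpha> & (EX y. R x y & \<rho> y = \<alpha>) & (ALL \<beta>. \<beta> \<E> \<alpha> --> ~ (EX y. R x y & \<rho> y = \<beta>))"
 have Q: "DP2 ?Q" by (intro dfn)
 have Qu: "\<alpha> = \<beta>" if "?Q x \<alpha>" "?Q x \<beta>" for x \<alpha> \<beta> using that Ord_linear by blast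
 have "EX b. ALL \<alpha>. \<alpha> \<E> b <-> (EX x. x \<E> a & ?Q x \<alpha>)"
  by (rule repl_ax[OF Q]) (rule Qu)
 then obtain b where b: "!!\<alpha>. \<alpha> \<E> b <-> (EX x. x \<E> a & ?Q x \<alpha>)" by blast
 define \<delta> where "\<delta> = succ (Union b)"
 have bO: "Ord \<alpha>" if "\<alpha> \<E> b" for \<alpha> using that b by blast
 hence \<delta>: "Ord \<delta>" "!!\<alpha>. \<alpha> \<E> b ==> \<alpha> \<E> \<delta>"
 proof -
  show "Ord \<delta>" unfolding \<delta>_def using bO by (intro Ord_succ Ord_Union)
  fix \<alpha> assume a: "\<alpha> \<E> b"
  have "el \<alpha> <= el (Union b)" using a by auto
  thus "\<alpha> \<E> \<delta>" using Ord_subset[OF bO[OF a] Ord_Union[of b]] bO by (auto simp: \<delta>_def)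
 qed
 show ?thesis
 proof (rule exI[of _ "V \<delta>"], intro allI impI)
  fix x assume x: "x \<E> a" "EX y. R x y"
  then obtain y0 where y0: "R x y0" by blast
  have d: "DP (%\<alpha>. EX y. R x y & \<rho> y = \<alpha>)" by (intro dfn)
  obtain \<alpha> where \<alpha>: "?Q x \<alpha>" using Ord_least[OF d Ord\<rho>[of y0]] y0 by blast
  then obtain y where y: "R x y" "\<rho> y = \<alpha>" by blast
  have "\<alpha> \<E> \<delta>" using \<alpha> b x \<delta> by blast
  hence "y \<E> V \<delta>" using inV[OF \<delta>(1)] y by blast
  thus "EX y. y \<E> V \<delta> & R x y" using y by blast
 qed
qed

end

locale zfc = zf +
 assumes choice_ax: "(!!x. x \<E> a ==> EX y. y \<E> x) ==> EX f. ALL x. x \<E> a --> app f x \<E> x"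
begin

text \<open>Collection bounds the possible witnesses by a set \<open>b\<close>, after which a choice
  function for the sets \<open>Sep b (R x)\<close> suffices.\<close>

lemma choice:
 assumes R: "DP2 R" and ex: "!!x. x \<E> a ==> EX y. R x y"
 shows "EX f. DF f & (ALL x. x \<E> a --> R x (f x))"
proof -
 note [dfn] = DP2D[OF R]
 obtain b where b: "!!x. x \<E> a ==> EX y. y \<E> b & R x y" using collection[OF R, of a] ex by blast
 have d1: "DP (R x)" for x by (intro dfn)
 have d2: "DF (%x. Sep b (R x))" by (intro dfn)
 have "EX y. y \<E> z" if "z \<E> Repl a (%x. Sep b (R x))" for z
  using that b unfolding mem_Repl[OF d2] by (metis mem_Sep[OF d1])
 then obtain c where c: "!!z. z \<E> Repl a (%x. Sep b (R x)) ==> app c z \<E> z"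
  using choice_ax[of "Repl a (%x. Sep b (R x))"] by blast
 have "DF (%x. app c (Sep b (R x)))" by (intro dfn)
 moreover have "R x (app c (Sep b (R x)))" if "x \<E> a" for x
  using c[of "Sep b (R x)"] that by (auto simp: mem_Repl[OF d2] mem_Sep[OF d1])
 ultimately show ?thesis by (intro exI[of _ "%x. app c (Sep b (R x))"]) blast
qed

end

subsection \<open>Cardinality\<close>

context zf begin

text \<open>Sizes are compared by injections throughout. As \<open>app\<close> is total,
  \<open>f\<close> may be any set that acts injectively on \<open>a\<close>.\<close>

definition lep where "lep a b <-> (EX f. (ALL x. x \<E> a --> app f x \<E> b) &
  (ALL x y. x \<E> a --> y \<E> a --> app f x = app f y --> x = y))"
lemma dfn_lep [THEN DP2D, dfn]: "DP2 lep"
 unfolding lep_def by (intro dfn)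

lemma lepI: assumes "DF f" "!!x. x \<E> a ==> f x \<E> b" "!!x y. x \<E> a ==> y \<E> a ==> f x = f y ==> x = y" shows "lep a b"
 unfolding lep_def by (rule exI[of _ "lam a f"]) (simp add: app_lam[OF assms(1)] assms(2,3))
lemma lepE: assumes "lep a b" obtains f where "DF f" "!!x. x \<E> a ==> f x \<E> b" "!!x y. x \<E> a ==> y \<E> a ==> f x = f y ==> x = y"
proof -
 obtain f where f: "ALL x. x \<E> a --> app f x \<E> b" "ALL x y. x \<E> a --> y \<E> a --> app f x = app f y --> x = y"
  using assms unfolding lep_def by blast
 have "DF (app f)" by (intro dfn)
 thus thesis using that[of "app f"] f by blast
qed

lemma lep_subset: "el a <= el b ==> lep a b"
 by (rule lepI[of "%x. x"]) (intro dfn, auto)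
lemma lep_refl [simp]: "lep a a" by (simp add: lep_subset)
lemma lep_trans: assumes "lep a b" "lep b c" shows "lep a c"
proof -
 obtain f where f: "DF f" "!!x. x \<E> a ==> f x \<E> b" "!!x y. x \<E> a ==> y \<E> a ==> f x = f y ==> x = y"
  using lepE[OF assms(1)] by blast
 obtain g where g: "DF g" "!!x. x \<E> b ==> g x \<E> c" "!!x y. x \<E> b ==> y \<E> b ==> g x = g y ==> x = y"
  using lepE[OF assms(2)] by blast
 show ?thesis by (rule lepI[of "%x. g (f x)"]) (use f g in "auto intro: DFD")
qed
lemma lep_emp [simp]: "lep emp a" by (rule lep_subset) auto

lemma lep_prod: assumes "lep a c" "lep b d" shows "lep (prod a b) (prod c d)"
proof -
 obtain f where f: "DF f" "!!x. x \<E> a ==> f x \<E> c" "!!x y. x \<E> a ==> y \<E> a ==> f x = f y ==> x = y"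
  using lepE[OF assms(1)] by blast
 obtain g where g: "DF g" "!!x. x \<E> b ==> g x \<E> d" "!!x y. x \<E> b ==> y \<E> b ==> g x = g y ==> x = y"
  using lepE[OF assms(2)] by blast
 note [dfn] = DFD[OF f(1)] DFD[OF g(1)]
 have "DF (%p. pair (f (p1 p)) (g (p2 p)))" by (intro dfn)
 thus ?thesis by (rule lepI) (auto simp: mem_prod f g)
qed

lemma cantor: "~ lep (Pow a) a"
proof
 assume "lep (Pow a) a"
 then obtain f where f: "DF f" "!!x. x \<E> Pow a ==> f x \<E> a" "!!x y. x \<E> Pow a ==> y \<E> Pow a ==> f x = f y ==> x = y"
  using lepE by blast
 note [dfn] = DFD[OF f(1)]
 have d: "DP (%x. EX s. s \<E> Pow a & x = f s & ~ x \<E> s)" by (intro dfn)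
 define D where "D = Sep a (%x. EX s. s \<E> Pow a & x = f s & ~ x \<E> s)"
 have D: "x \<E> D <-> x \<E> a & (EX s. s \<E> Pow a & x = f s & ~ x \<E> s)" for x
  unfolding D_def by (rule mem_Sep[OF d])
 have "D \<E> Pow a" by (auto simp: D)
 thus False using D[of "f D"] f(2,3) by blast
qed

section \<open>Finite sets\<close>

definition diff where "diff a b = Sep a (%x. ~ x \<E> b)"
lemma DT_diff [THEN DF2D, dfn]: "DF2 diff"
 unfolding diff_def by (intro dfn)
lemma mem_diff [simp]: "x \<E> diff a b <-> x \<E> a & ~ x \<E> b"
proof -
 have "DP (%x. ~ x \<E> b)" by (intro dfn)
 thus ?thesis unfolding diff_def by (rule mem_Sep)
qed

text \<open>Finiteness as the model sees it; from outside such a set may be infinite.\<close>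

definition fin where "fin x <-> (EX n. n \<E> omega & lep x n)"
lemma dfn_fin [THEN DPD, dfn]: "DP fin"
 unfolding fin_def by (intro dfn)

lemma lep_insert: assumes "lep x n" shows "lep (un x (sing a)) (succ n)"
proof -
 obtain f where f: "DF f" "!!u. u \<E> x ==> f u \<E> n" "!!u v. u \<E> x ==> v \<E> x ==> f u = f v ==> u = v"
  using lepE[OF assms(1)] by blast
 note [dfn] = DFD[OF f(1)]
 have "DF (%u. if u \<E> x then f u else n)" by (intro dfn)
 thus ?thesis by (rule lepI) (use f not_refl in "auto split: if_splits; metis")+
qed

lemma lep_remove: assumes "lep x (succ n)" "x ~= emp" shows "EX a. a \<E> x & lep (diff x (sing a)) n"
proof -
 obtain f where f: "DF f" "!!u. u \<E> x ==> f u \<E> succ n" "!!u v. u \<E> x ==> v \<E> x ==> f u = f v ==> u = v"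
  using lepE[OF assms(1)] by blast
 obtain a0 where "a0 \<E> x" using assms(2) empI by blast
 \<comment> \<open>The point to be removed is the one with value \<open>n\<close>, or an arbitrary
   one if that value is not taken; the rest then maps into \<open>n\<close>.\<close>
 then obtain a where a: "a \<E> x" "f a = n | (ALL u. u \<E> x --> f u ~= n)" by blast
 have "lep (diff x (sing a)) n" by (rule lepI[OF f(1)]) (use f a in auto)
 thus ?thesis using a by blast
qed

lemma fin_emp [simp]: "fin emp" using emp_omega unfolding fin_def by (intro exI[of _ emp]) simp
lemma fin_insert [simp]: "fin x ==> fin (un x (sing a))"
 unfolding fin_def using lep_insert not_refl succ_omega by blast
lemma fin_lep: "lep x y ==> fin y ==> fin x" unfolding fin_def using lep_trans by blast
lemma fin_subset: "el x <= el y ==> fin y ==> fin x" using fin_lep lep_subset by blast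
lemma fin_nat: "n \<E> omega ==> fin n" unfolding fin_def using lep_refl by blast

lemma fin_induct: assumes P: "DP P" and 0: "P emp" and step: "!!x a. fin x ==> P x ==> ~ a \<E> x ==> P (un x (sing a))" and "fin x"
 shows "P x"
proof -
 note [dfn] = DPD[OF P]
 have "ALL x. lep x n --> P x" if "n \<E> omega" for n
 proof (rule nat_induct[of "%n. ALL x. lep x n --> P x"], intro dfn)
  show "ALL x. lep x emp --> P x"
  proof (intro allI impI)
   fix x assume "lep x emp"
   then obtain f where "!!u. u \<E> x ==> f u \<E> emp" using lepE[of x emp] by metis
   hence "x = emp" using empI mem_emp by blast
   thus "P x" using 0 by simp
  qed
  fix n assume n: "n \<E> omega" and IH: "ALL x. lep x n --> P x"
  show "ALL x. lep x (succ n) --> P x"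
  proof (intro allI impI)
   fix x assume x: "lep x (succ n)"
   show "P x"
   proof (cases "x = emp")
    case False
    then obtain a where a: "a \<E> x" "lep (diff x (sing a)) n" using lep_remove x by blast
    have "x = un (diff x (sing a)) (sing a)" using a(1) by (intro ext) auto
    moreover have "fin (diff x (sing a))" using a n unfolding fin_def by blast
    ultimately show ?thesis using step[of "diff x (sing a)" a] IH a by auto
   qed (use 0 in simp)
  qed
 qed (rule that)
 thus ?thesis using assms(4) unfolding fin_def by blast
qed

lemma fin_un: assumes "fin y" "fin x" shows "fin (un x y)"
proof (rule fin_induct[of "%y. fin (un x y)"], intro dfn)
 show "fin (un x emp)" by (rule fin_subset[OF _ assms(2)]) auto
 fix y a assume "fin (un x y)"
 moreover have "un x (un y (sing a)) = un (un x y) (sing a)" by (rule ext) auto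
 ultimately show "fin (un x (un y (sing a)))" by simp
qed (rule assms)

lemma fin_sing [simp]: "fin (sing a)" using fin_insert[OF fin_emp, of a] by (rule fin_subset[rotated]) auto

lemma fin_UN: assumes F: "DF F" and "fin x" and "!!y. y \<E> x ==> fin (F y)" shows "fin (Union (Repl x F))"
proof -
 note [dfn] = DFD[OF F]
 have "(ALL y. y \<E> x --> fin (F y)) --> fin (Union (Repl x F))"
 proof (rule fin_induct[of "%x. (ALL y. y \<E> x --> fin (F y)) --> fin (Union (Repl x F))"], intro dfn)
  show "(ALL y. y \<E> emp --> fin (F y)) --> fin (Union (Repl emp F))"
  proof -
   have "Union (Repl emp F) = emp" by (rule empI) (auto simp: mem_Repl[OF F])
   thus ?thesis by simp
  qed
  fix x a assume "(ALL y. y \<E> x --> fin (F y)) --> fin (Union (Repl x F))"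
  moreover have "Union (Repl (un x (sing a)) F) = un (Union (Repl x F)) (F a)"
   by (rule ext) (auto simp: mem_Repl[OF F])
  ultimately show "(ALL y. y \<E> un x (sing a) --> fin (F y)) --> fin (Union (Repl (un x (sing a)) F))"
   using fin_un by simp
 qed (rule assms)
 thus ?thesis using assms by blast
qed

lemma fin_Repl: assumes "DF F" "fin x" shows "fin (Repl x F)"
proof -
 note [dfn] = DFD[OF assms(1)]
 have d: "DF (%y. sing (F y))" by (intro dfn)
 have "Repl x F = Union (Repl x (%y. sing (F y)))" by (rule ext) (auto simp: mem_Repl[OF assms(1)] mem_Repl[OF d])
 thus ?thesis using fin_UN[OF d assms(2)] by simp
qed

lemma fin_prod: assumes "fin x" "fin y" shows "fin (prod x y)"
proof -
 have d: "DF (%u. Repl y (pair u))" and d2: "DF (pair u)" for u by (intro dfn)+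
 show ?thesis unfolding prod_def by (intro fin_UN d assms fin_Repl d2)
qed

lemma fin_choice: assumes R: "DP2 R" and "fin x" "!!u. u \<E> x ==> EX v. R u v"
 shows "EX f. ALL u. u \<E> x --> R u (app f u)"
proof -
 note [dfn] = DP2D[OF R]
 have "(ALL u. u \<E> x --> (EX v. R u v)) --> (EX f. ALL u. u \<E> x --> R u (app f u))"
 proof (rule fin_induct[of "%x. (ALL u. u \<E> x --> (EX v. R u v)) --> (EX f. ALL u. u \<E> x --> R u (app f u))"], intro dfn, simp, intro impI)
  fix x a assume IH: "(ALL u. u \<E> x --> (EX v. R u v)) --> (EX f. ALL u. u \<E> x --> R u (app f u))"
   and a: "~ a \<E> x" "ALL u. u \<E> un x (sing a) --> (EX v. R u v)"
  then obtain f v where f: "ALL u. u \<E> x --> R u (app f u)" and v: "R a v" by fastforce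
  have d: "DF (%u. if u = a then v else app f u)" by (intro dfn)
  show "EX f. ALL u. u \<E> un x (sing a) --> R u (app f u)"
   by (rule exI[of _ "lam (un x (sing a)) (%u. if u = a then v else app f u)"]) (use f v in "auto simp: app_lam[OF d]")
 qed (rule assms)
 thus ?thesis using assms by blast
qed

lemma fin_nat_bound: "fin x ==> (!!y. y \<E> x ==> y \<E> omega) ==> EX n. n \<E> omega & el x <= el n"
proof -
 assume "fin x"
 have "el x <= el omega --> (EX n. n \<E> omega & el x <= el n)"
 proof (rule fin_induct[of "%x. el x <= el omega --> (EX n. n \<E> omega & el x <= el n)"], intro dfn)
  show "el emp <= el omega --> (EX n. n \<E> omega & el emp <= el n)" using emp_omega by blast
  fix x a assume IH: "el x <= el omega --> (EX n. n \<E> omega & el x <= el n)"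
  show "el (un x (sing a)) <= el omega --> (EX n. n \<E> omega & el (un x (sing a)) <= el n)"
  proof
   assume a: "el (un x (sing a)) <= el omega"
   then obtain n where n: "n \<E> omega" "el x <= el n" "a \<E> omega" using IH by (auto simp: subset_eq)
   have "el n <= el (succ a) | el (succ a) <= el n"
    using Ord_linear[of n "succ a"] Ord_subset[of n "succ a"] Ord_subset[of "succ a" n] nat_Ord[OF n(1)] nat_Ord[OF succ_omega[OF n(3)]] by blast
   thus "EX n. n \<E> omega & el (un x (sing a)) <= el n"
   proof
    assume "el n <= el (succ a)"
    thus ?thesis using n by (intro exI[of _ "succ a"]) (auto simp: subset_eq)
   next
    assume "el (succ a) <= el n"
    thus ?thesis using n by (intro exI[of _ n]) (auto simp: subset_eq)
   qed
  qed
 qed (rule \<open>fin x\<close>)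
 thus "(!!y. y \<E> x ==> y \<E> omega) ==> EX n. n \<E> omega & el x <= el n" by auto
qed

lemma not_fin_omega: "~ fin omega"
proof
 assume "fin omega"
 then obtain n where "n \<E> omega" "el omega <= el n" using fin_nat_bound[of omega] by blast
 thus False by auto
qed

lemma not_lep_omega_fin: "fin x ==> ~ lep omega x" using fin_lep not_fin_omega by blast

text \<open>Hilbert's hotel: the new point goes to \<open>emp\<close> and the natural numbers move
  up by one.\<close>

lemma lep_succ: assumes "el omega <= el \<kappa>" shows "lep (succ \<kappa>) \<kappa>"
proof -
 have "DF (%x. if x = \<kappa> then emp else if x \<E> omega then succ x else x)" by (intro dfn)
 thus ?thesis
 proof (rule lepI)
  have s: "!!n. n \<E> omega ==> n \<E> \<kappa>" using assms by auto
  fix x assume "x \<E> succ \<kappa>"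
  thus "(if x = \<kappa> then emp else if x \<E> omega then succ x else x) \<E> \<kappa>" using s by auto
 next
  fix x y
  show "(if x = \<kappa> then emp else if x \<E> omega then succ x else x) = (if y = \<kappa> then emp else if y \<E> omega then succ y else y) ==> x = y"
   using succ_inj[of x y] succ_nonemp[of x] succ_nonemp[of y] succ_nonemp[of x, symmetric] succ_nonemp[of y, symmetric] succ_omega[of x] succ_omega[of y] emp_omega by (auto split: if_splits)
 qed
qed

text \<open>Burali-Forti.\<close>

lemma no_ord_set: "EX \<alpha>. Ord \<alpha> & ~ \<alpha> \<E> b"
proof (rule ccontr)
 assume a: "~ ?thesis"
 have d: "DP Ord" by (intro dfn)
 have "y \<E> Sep b Ord <-> Ord y" for y unfolding mem_Sep[OF d] using a by blast
 moreover have "Ord (Sep b Ord)" by (rule OrdI) (use calculation Ord_mem in blast)+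
 ultimately have False by (metis not_refl)
 thus False .
qed

text \<open>\<open>R\<close> well-orders \<open>a\<close>, so its rank function is injective with
  ordinal values. A rank outside \<kappa> would include \<kappa> and thus embed \<kappa> into an
  initial segment of \<open>R\<close>.\<close>

lemma lep_rank:
 assumes R: "DP2 R" and trans: "!!x y z. R x y ==> R y z ==> R x z"
  and setlike: "!!x. EX b. ALL y. y \<E> b <-> R y x"
  and wf: "!!P x. DP P ==> P x ==> EX x. P x & (ALL y. R y x --> ~ P y)"
  and field: "!!x y. R x y ==> x \<E> a"
  and lin: "!!x y. x \<E> a ==> y \<E> a ==> R x y | x = y | R y x"
  and "Ord \<kappa>" and small: "!!x. x \<E> a ==> ~ lep \<kappa> (setof (%y. R y x))"
 shows "lep a \<kappa>"
proof -
 note [dfn] = DP2D[OF R]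
 have "DF2 (%x f. Repl (setof (%y. R y x)) (app f))" by (intro dfn DT_setof setlike)
 note G = this
 have "EX F. DF F & (ALL x. F x = Repl (setof (%y. R y x)) (app (lam (setof (%y. R y x)) F)))"
  by (rule wf_rec[where G = "%x f. Repl (setof (%y. R y x)) (app f)"])
   (fact R, erule (1) trans, rule setlike, erule (1) wf, fact G)
 then obtain \<rho> where \<rho>: "DF \<rho>"
  "!!x. \<rho> x = Repl (setof (%y. R y x)) (app (lam (setof (%y. R y x)) \<rho>))" by blast
 note [dfn] = DFD[OF \<rho>(1)]
 have pred: "y \<E> setof (%y. R y x) <-> R y x" for x y by (rule setof) (rule setlike)
 have mem: "z \<E> \<rho> x <-> (EX y. R y x & z = \<rho> y)" for x z
  unfolding \<rho>(2)[of x] mem_Image using app_lam[OF \<rho>(1)] pred by metis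
 have ind: "P x" if P: "DP P" and step: "!!x. (!!y. R y x ==> P y) ==> P x" for P x
 proof (rule ccontr)
  assume "~ P x"
  moreover have "DP (%x. ~ P x)" by (intro dfn P)
  ultimately show False using wf[of "%x. ~ P x" x] step by blast
 qed
 have Ord: "Ord (\<rho> x)" for x
 proof (rule ind[of "%x. Ord (\<rho> x)"], intro dfn)
  fix x assume IH: "!!y. R y x ==> Ord (\<rho> y)"
  show "Ord (\<rho> x)" by (rule OrdI) (use IH trans mem in metis)+
 qed
 have inj: "x = y" if "x \<E> a" "y \<E> a" "\<rho> x = \<rho> y" for x y
  using lin[OF that(1,2)] mem that(3) not_refl by metis
 have "\<rho> x \<E> \<kappa>" if x: "x \<E> a" for x
 proof (rule ccontr)
  assume "~ \<rho> x \<E> \<kappa>"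
  hence sub: "el \<kappa> <= el (\<rho> x)" using Ord_not_mem Ord \<open>Ord \<kappa>\<close> by blast
  \<comment> \<open>The inverse of the rank function on the predecessors of
    \<open>x\<close>.\<close>
  let ?g = "%z. Union (Sep (setof (%y. R y x)) (%y. z = \<rho> y))"
  have d: "DP (%y. z = \<rho> y)" for z by (intro dfn)
  have g: "?g (\<rho> y) = y" if "R y x" for y
  proof (rule ext)
   have "R w x & \<rho> y = \<rho> w <-> w = y" for w using inj field that by blast
   thus "v \<E> ?g (\<rho> y) <-> v \<E> y" for v unfolding mem_Union mem_Sep[OF d] pred by metis
  qed
  have ex: "EX y. R y x & z = \<rho> y" if "z \<E> \<kappa>" for z using that sub mem by auto
  have "DF ?g" by (intro dfn)
  hence "lep \<kappa> (setof (%y. R y x))" by (rule lepI) (use ex g pred in metis)+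
  thus False using small x by blast
 qed
 thus ?thesis using inj by (intro lepI[OF \<rho>(1)]) auto
qed

end

context zfc begin

lemma lep_surj: assumes F: "DF f" and "!!y. y \<E> b ==> EX x. x \<E> a & f x = y" shows "lep b a"
proof -
 note [dfn] = DFD[OF F]
 have "DP2 (%y x. x \<E> a & f x = y)" by (intro dfn)
 from choice[OF this, of b] assms(2) obtain g where g: "DF g" "!!y. y \<E> b ==> g y \<E> a & f (g y) = y" by blast
 show ?thesis by (rule lepI[OF g(1)]) (use g(2) in metis)+
qed

lemma lep_Repl: "DF f ==> lep (Repl a f) a"
 by (rule lep_surj) (auto simp: mem_Repl)

section \<open>Well-orderings and Hartogs numbers\<close>

lemma well_order: "EX \<alpha> f. Ord \<alpha> & DF f & (ALL \<beta>. \<beta> \<E> \<alpha> --> f \<beta> \<E> a) & (ALL \<beta> \<gamma>. \<beta> \<E> \<alpha> --> \<gamma> \<E> \<alpha> --> f \<beta> = f \<gamma> --> \<beta> = \<gamma>) &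
  (ALL x. x \<E> a --> (EX \<beta>. \<beta> \<E> \<alpha> & f \<beta> = x))"
proof -
 have "EX c. ALL x. x \<E> diff (Pow a) (sing emp) --> app c x \<E> x"
  by (rule choice_ax) (use empI in "auto; metis")
 then obtain c where c: "!!x. el x <= el a ==> x ~= emp ==> app c x \<E> x" by auto
 \<comment> \<open>The value \<open>a\<close>, which is no element of \<open>a\<close>, signals that
   the enumeration is exhausted.\<close>
 have G: "DF2 (%x f. if diff a (Repl x (app f)) = emp then a else app c (diff a (Repl x (app f))))" by (intro dfn)
 obtain F where F: "DF F" "!!x. Ord x ==> F x = (if diff a (Repl x (app (lam x F))) = emp then a else app c (diff a (Repl x (app (lam x F)))))"
  using Ord_rec[OF G] by blast
 note [dfn] = DFD[OF F(1)]
 have im: "Repl x (app (lam x F)) = Repl x F" for x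
  by (rule ext) (auto simp: mem_Repl[OF F(1)] mem_Image app_lam[OF F(1)])
 have F': "F x = (if diff a (Repl x F) = emp then a else app c (diff a (Repl x F)))" if "Ord x" for x
  using F(2)[OF that] unfolding im .
 have Fa: "F x = a & diff a (Repl x F) = emp | F x \<E> diff a (Repl x F)" if "Ord x" for x
  using F'[OF that] c[of "diff a (Repl x F)"] by (auto simp: subset_eq)
 have inj: "x = y" if "Ord x" "Ord y" "F x \<E> a" "F y \<E> a" "F x = F y" for x y
 proof -
  have "~ x \<E> y" "~ y \<E> x" using Fa[OF that(1)] Fa[OF that(2)] that not_refl by (auto simp: mem_Repl[OF F(1)]; metis)+
  thus ?thesis using Ord_linear that by blast
 qed
 have "EX \<alpha>. Ord \<alpha> & ~ F \<alpha> \<E> a"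
 proof (rule ccontr)
  assume n: "~ ?thesis"
  have R: "DP2 (%x \<alpha>. Ord \<alpha> & F \<alpha> = x)" by (intro dfn)
  have "EX b. ALL \<alpha>. \<alpha> \<E> b <-> (EX x. x \<E> a & Ord \<alpha> & F \<alpha> = x)"
   by (rule repl_ax[OF R]) (use n inj in blast)
  thus False using no_ord_set n by metis
 qed
 moreover have "DP (%\<alpha>. ~ F \<alpha> \<E> a)" by (intro dfn)
 ultimately obtain \<alpha> where \<alpha>: "Ord \<alpha>" "~ F \<alpha> \<E> a" "!!\<beta>. \<beta> \<E> \<alpha> ==> F \<beta> \<E> a"
  using Ord_least[of "%\<alpha>. ~ F \<alpha> \<E> a"] by blast
 have "EX \<beta>. \<beta> \<E> \<alpha> & F \<beta> = x" if "x \<E> a" for x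
 proof -
  have "diff a (Repl \<alpha> F) = emp" using Fa[OF \<alpha>(1)] \<alpha>(2) by auto
  hence "~ x \<E> diff a (Repl \<alpha> F)" by simp
  thus ?thesis using that by (auto simp: mem_Repl[OF F(1)])
 qed
 moreover have "\<beta> = \<gamma>" if "\<beta> \<E> \<alpha>" "\<gamma> \<E> \<alpha>" "F \<beta> = F \<gamma>" for \<beta> \<gamma>
  by (rule inj) (use that Ord_mem[OF \<alpha>(1)] \<alpha>(3) in auto)
 ultimately show ?thesis using F(1) \<alpha>(1,3) by (intro exI[of _ \<alpha>], intro exI[of _ F]) blast
qed

lemma ord_card: "EX \<alpha>. Ord \<alpha> & lep \<alpha> a & lep a \<alpha>"
proof -
 obtain \<alpha> f where a: "Ord \<alpha>" "DF f" "!!\<beta>. \<beta> \<E> \<alpha> ==> f \<beta> \<E> a" "!!\<beta> \<gamma>. \<beta> \<E> \<alpha> ==> \<gamma> \<E> \<alpha> ==> f \<beta> = f \<gamma> ==> \<beta> = \<gamma>"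
  "!!x. x \<E> a ==> EX \<beta>. \<beta> \<E> \<alpha> & f \<beta> = x" using well_order[of a] by blast
 have "lep \<alpha> a" by (rule lepI[OF a(2)]) (use a in blast)+
 moreover have "lep a \<alpha>" by (rule lep_surj[OF a(2)]) (use a in blast)
 ultimately show ?thesis using a(1) by blast
qed

text \<open>For an infinite \<open>a\<close> this plays the role of the successor cardinal;
  \<open>omega1\<close> and \<open>omega2\<close> are obtained from it.\<close>

definition hartogs where "hartogs a = setof (%\<alpha>. Ord \<alpha> & lep \<alpha> a)"
lemma hartogs_ex: "EX b. ALL \<alpha>. \<alpha> \<E> b <-> Ord \<alpha> & lep \<alpha> a"
proof -
 \<comment> \<open>By Cantor's theorem no ordinal that injects into \<open>a\<close> can reach an
   ordinal of the size of the power set.\<close>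
 obtain \<nu> where l: "Ord \<nu>" "lep (Pow a) \<nu>" using ord_card by blast
 have d: "DP (%\<alpha>. Ord \<alpha> & lep \<alpha> a)" by (intro dfn)
 have "\<alpha> \<E> \<nu>" if "Ord \<alpha>" "lep \<alpha> a" for \<alpha>
  using Ord_not_mem[OF that(1) l(1)] cantor lep_subset lep_trans that(2) l(2) by metis
 hence "ALL \<alpha>. \<alpha> \<E> Sep \<nu> (%\<alpha>. Ord \<alpha> & lep \<alpha> a) <-> Ord \<alpha> & lep \<alpha> a" unfolding mem_Sep[OF d] by blast
 thus ?thesis by blast
qed
lemma mem_hartogs: "\<alpha> \<E> hartogs a <-> Ord \<alpha> & lep \<alpha> a" unfolding hartogs_def by (rule setof[OF hartogs_ex])
lemma Ord_hartogs [simp]: "Ord (hartogs a)"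
proof (rule OrdI)
 fix y z assume y: "y \<E> hartogs a" "z \<E> y"
 hence "el z <= el y" using Ord_trans by (auto simp: mem_hartogs)
 thus "z \<E> hartogs a" using y Ord_mem lep_trans lep_subset unfolding mem_hartogs by blast
qed (simp add: mem_hartogs)
lemma h_Ord: "x \<E> hartogs a ==> Ord x" by (rule Ord_mem[OF Ord_hartogs])
lemma h_trans: "x \<E> hartogs a ==> y \<E> x ==> y \<E> hartogs a" by (rule Ord_trans[OF Ord_hartogs])
lemma h_linear: "x \<E> hartogs a ==> y \<E> hartogs b ==> x \<E> y | x = y | y \<E> x"
 by (rule Ord_linear[OF h_Ord h_Ord])
lemma not_lep_hartogs: "~ lep (hartogs a) a" using mem_hartogs[of "hartogs a" a] by auto
lemma hartogs_le: "Ord \<beta> ==> ~ lep \<beta> a ==> el (hartogs a) <= el \<beta>"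
 using Ord_not_mem[of \<beta> "hartogs a"] mem_hartogs by auto
lemma not_lepD: "~ lep x a ==> lep (hartogs a) x"
proof -
 assume n: "~ lep x a"
 obtain \<alpha> where a: "Ord \<alpha>" "lep \<alpha> x" "lep x \<alpha>" using ord_card by blast
 hence "~ lep \<alpha> a" using n lep_trans by blast
 thus ?thesis using hartogs_le a lep_subset lep_trans by blast
qed
lemma hartogs_succ: "el omega <= el a ==> \<alpha> \<E> hartogs a ==> succ \<alpha> \<E> hartogs a"
proof -
 assume a: "el omega <= el a" "\<alpha> \<E> hartogs a"
 hence "lep (succ \<alpha>) (succ a)" unfolding succ_def[of \<alpha>] by (intro lep_insert) (simp add: mem_hartogs)
 hence "lep (succ \<alpha>) a" using lep_succ[OF a(1)] lep_trans by blast
 thus ?thesis using a(2) Ord_succ by (simp add: mem_hartogs)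
qed
lemma mem_hartogs_self: "Ord a ==> a \<E> hartogs a" by (simp add: mem_hartogs)
lemma hartogs_infinite: "Ord a ==> el a <= el (hartogs a)" using h_trans[OF mem_hartogs_self] by auto

section \<open>Sizes of unions, squares and sets of finite subsets\<close>

lemma lep_UN: assumes F: "DF F" and I: "lep I \<kappa>" and "!!i. i \<E> I ==> lep (F i) \<kappa>" and sq: "lep (prod \<kappa> \<kappa>) \<kappa>"
 shows "lep (Union (Repl I F)) \<kappa>"
proof -
 note [dfn] = DFD[OF F]
 let ?inj = "%i f. (ALL x. x \<E> F i --> app f x \<E> \<kappa>) & (ALL x y. x \<E> F i --> y \<E> F i --> app f x = app f y --> x = y)"
 have "DP2 ?inj" by (intro dfn)
 from choice[OF this, of I] assms(3) obtain c where c: "DF c" "!!i. i \<E> I ==> ?inj i (c i)" unfolding lep_def by blast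
 note [dfn] = DFD[OF c(1)]
 let ?U = "Union (Repl I F)"
 have "DP2 (%x i. i \<E> I & x \<E> F i)" by (intro dfn)
 from choice[OF this, of ?U] obtain g where g: "DF g" "!!x. x \<E> ?U ==> g x \<E> I & x \<E> F (g x)"
  unfolding mem_UN[OF F] by blast
 note [dfn] = DFD[OF g(1)]
 have "lep ?U (prod I \<kappa>)"
 proof (rule lepI[of "%x. pair (g x) (app (c (g x)) x)"])
  fix x assume "x \<E> ?U" thus "pair (g x) (app (c (g x)) x) \<E> prod I \<kappa>" using g(2) c(2) by simp
 next
  fix x y assume "x \<E> ?U" "y \<E> ?U" "pair (g x) (app (c (g x)) x) = pair (g y) (app (c (g y)) y)"
  thus "x = y" using g(2)[of x] g(2)[of y] c(2)[of "g x"] by auto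
 qed (intro dfn)
 thus ?thesis using lep_prod[OF I lep_refl[of \<kappa>]] sq lep_trans by blast
qed

lemma lep_un: assumes "lep a \<kappa>" "lep b \<kappa>" "lep (prod \<kappa> \<kappa>) \<kappa>" "el omega <= el \<kappa>" shows "lep (un a b) \<kappa>"
proof -
 \<comment> \<open>A binary union as a union indexed by the numeral 2.\<close>
 have d: "DF (%x. if x = emp then a else b)" by (intro dfn)
 have "emp ~= succ emp" using succ_nonemp[of emp] by metis
 hence "un a b = Union (Repl (succ (succ emp)) (%x. if x = emp then a else b))"
  by (intro ext) (simp del: mem_Union add: mem_UN[OF d], metis)
 moreover have "lep (succ (succ emp)) \<kappa>"
  by (rule lep_subset) (use assms(4) emp_omega succ_omega in "auto simp: subset_eq")
 ultimately show ?thesis using lep_UN[OF d _ _ assms(3)] assms(1,2) by auto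
qed

text \<open>Goedel's well-ordering of the square of an ordinal.\<close>

lemma lep_square:
 assumes O: "Ord \<kappa>" and lim: "!!\<gamma>. \<gamma> \<E> \<kappa> ==> succ \<gamma> \<E> \<kappa>" and small: "!!\<gamma>. \<gamma> \<E> \<kappa> ==> ~ lep \<kappa> (prod \<gamma> \<gamma>)"
 shows "lep (prod \<kappa> \<kappa>) \<kappa>"
proof -
 define m where "m = (%p. un (p1 p) (p2 p))"
 define R where "R = (%p q. p \<E> prod \<kappa> \<kappa> & q \<E> prod \<kappa> \<kappa> & (m p \<E> m q | m p = m q & (p1 p \<E> p1 q | p1 p = p1 q & p2 p \<E> p2 q)))"
 have m: "DF m" unfolding m_def by (intro dfn)
 note [dfn] = DFD[OF m]
 have R: "DP2 R" unfolding R_def by (intro dfn)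
 note [dfn] = DP2D[OF R]
 have un: "un x y = x | un x y = y" if "Ord x" "Ord y" for x y
 proof -
  have "el x <= el y | el y <= el x" using Ord_linear[OF that] Ord_subset[OF that] Ord_subset[OF that(2,1)] by blast
  thus ?thesis by (auto intro!: ext)
 qed
 have mem: "p1 p \<E> \<kappa>" "p2 p \<E> \<kappa>" "p = pair (p1 p) (p2 p)" "m p \<E> \<kappa>" if "p \<E> prod \<kappa> \<kappa>" for p
 proof -
  show 1: "p1 p \<E> \<kappa>" "p2 p \<E> \<kappa>" "p = pair (p1 p) (p2 p)" using that by (auto simp: mem_prod)
  show "m p \<E> \<kappa>" using un[of "p1 p" "p2 p"] 1 Ord_mem[OF O] unfolding m_def by metis
 qed
 have OO: "x \<E> \<kappa> ==> Ord x" for x using O Ord_mem by blast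
 have sub: "p1 p \<E> succ (m p)" "p2 p \<E> succ (m p)" if "p \<E> prod \<kappa> \<kappa>" for p
 proof -
  have "el (p1 p) <= el (m p)" "el (p2 p) <= el (m p)" by (auto simp: m_def)
  thus "p1 p \<E> succ (m p)" "p2 p \<E> succ (m p)" using Ord_subset OO mem[OF that] by simp_all
 qed
 have pred: "p \<E> prod (succ (m q)) (succ (m q))" if "R p q" for p q
 proof -
  have pq: "p \<E> prod \<kappa> \<kappa>" "q \<E> prod \<kappa> \<kappa>" "m p \<E> succ (m q)" using that by (auto simp: R_def)
  have "Ord (succ (m q))" using OO mem(4) pq Ord_succ by blast
  note T = Ord_trans[OF this pq(3)]
  have "p1 p \<E> succ (m q)" "p2 p \<E> succ (m q)"
   using sub[OF pq(1)] pq(3) T[of "p1 p"] T[of "p2 p"] by (simp_all only: mem_succ[of _ "m p"]) metis+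
  thus ?thesis using mem(3)[OF pq(1)] by (metis pair_mem_prod)
 qed
 have RP: "R p q ==> p \<E> prod \<kappa> \<kappa>" for p q by (simp add: R_def)
 have setl: "EX b. ALL p. p \<E> b <-> R p q" for q
 proof -
  have d: "DP (%p. R p q)" by (intro dfn)
  have "ALL p. p \<E> Sep (prod \<kappa> \<kappa>) (%p. R p q) <-> R p q" unfolding mem_Sep[OF d] using RP by blast
  thus ?thesis by blast
 qed
 show ?thesis
 proof (rule lep_rank[OF R _ setl])
  fix x y z assume "R x y" "R y z"
  hence xyz: "x \<E> prod \<kappa> \<kappa>" "y \<E> prod \<kappa> \<kappa>" "z \<E> prod \<kappa> \<kappa>"
   "m x \<E> m y | m x = m y & (p1 x \<E> p1 y | p1 x = p1 y & p2 x \<E> p2 y)"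
   "m y \<E> m z | m y = m z & (p1 y \<E> p1 z | p1 y = p1 z & p2 y \<E> p2 z)" unfolding R_def by blast+
  have "Ord (m z)" "Ord (p1 z)" "Ord (p2 z)" using mem[OF xyz(3)] OO by blast+
  thus "R x z" using xyz Ord_trans unfolding R_def by metis
 next
  fix P p assume P: "DP P" "P p"
  show "EX p. P p & (ALL q. R q p --> ~ P q)"
  proof (cases "p \<E> prod \<kappa> \<kappa>")
   case True
   note [dfn] = DPD[OF P(1)]
   let ?P = "%p. p \<E> prod \<kappa> \<kappa> & P p"
   have d1: "DP (%x. EX p. ?P p & m p = x)" by (intro dfn)
   have "Ord (m p)" using mem(4)[OF True] OO by blast
   then obtain x where x: "EX p. ?P p & m p = x" "!!y. y \<E> x ==> ~ (EX p. ?P p & m p = y)"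
    using Ord_least[OF d1, of "m p"] True P(2) by blast
   then obtain q where q: "?P q" "m q = x" by blast
   have d2: "DP (%y. EX p. ?P p & m p = x & p1 p = y)" by (intro dfn)
   have "Ord (p1 q)" using mem q OO by blast
   then obtain y where y: "EX p. ?P p & m p = x & p1 p = y" "!!z. z \<E> y ==> ~ (EX p. ?P p & m p = x & p1 p = z)"
    using Ord_least[OF d2, of "p1 q"] q by blast
   then obtain r where r: "?P r" "m r = x" "p1 r = y" by blast
   have d3: "DP (%z. EX p. ?P p & m p = x & p1 p = y & p2 p = z)" by (intro dfn)
   have "Ord (p2 r)" using mem r OO by blast
   then obtain z where z: "EX p. ?P p & m p = x & p1 p = y & p2 p = z" "!!w. w \<E> z ==> ~ (EX p. ?P p & m p = x & p1 p = y & p2 p = w)"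
    using Ord_least[OF d3, of "p2 r"] r by blast
   then obtain s where s: "?P s" "m s = x" "p1 s = y" "p2 s = z" by blast
   have "~ P q" if "R q s" for q using that s x(2) y(2) z(2) unfolding R_def by metis
   thus ?thesis using s by blast
  next
   case False thus ?thesis using P(2) unfolding R_def by blast
  qed
 next
  fix p assume p: "p \<E> prod \<kappa> \<kappa>"
  let ?s = "setof (%q. R q p)"
  have "lep ?s (prod (succ (m p)) (succ (m p)))"
   by (rule lep_subset) (use pred in "simp add: subset_eq setof[OF setl]")
  thus "~ lep \<kappa> ?s" using small[OF lim[OF mem(4)[OF p]]] lep_trans by blast
 next
  fix x y assume xy: "x \<E> prod \<kappa> \<kappa>" "y \<E> prod \<kappa> \<kappa>"
  note 1 = Ord_linear[OF OO OO, OF mem(4) mem(4), OF xy] and 2 = Ord_linear[OF OO OO, OF mem(1) mem(1), OF xy]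
   and 3 = Ord_linear[OF OO OO, OF mem(2) mem(2), OF xy]
  have 4: "x = y" if "p1 x = p1 y" "p2 x = p2 y" using mem(3)[OF xy(1)] mem(3)[OF xy(2)] that by metis
  show "R x y | x = y | R y x" unfolding R_def using xy 1 2 3 4 by metis
 qed (use O R_def in blast)+
qed

lemma omega_square: "lep (prod omega omega) omega"
 by (rule lep_square) (auto simp: fin_nat fin_prod not_lep_omega_fin)

lemma hartogs_square: assumes "Ord a" "el omega <= el a" "lep (prod a a) a"
 shows "lep (prod (hartogs a) (hartogs a)) (hartogs a)"
proof (rule lep_square)
 fix \<gamma> assume g: "\<gamma> \<E> hartogs a"
 hence "lep (prod \<gamma> \<gamma>) a" using lep_prod lep_trans assms(3) unfolding mem_hartogs by blast
 thus "~ lep (hartogs a) (prod \<gamma> \<gamma>)" using not_lep_hartogs lep_trans by blast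
 show "succ \<gamma> \<E> hartogs a" by (rule hartogs_succ[OF assms(2) g])
qed simp

text \<open>A union of at most \<open>a\<close> many ordinals, each of size at most
  \<open>a\<close>, again has size at most \<open>a\<close>, so the supremum stays below the next
  cardinal.\<close>

lemma hartogs_regular: assumes "lep X a" "el X <= el (hartogs a)" "lep (prod a a) a" "el omega <= el a"
 shows "EX \<beta>. \<beta> \<E> hartogs a & el X <= el \<beta>"
proof -
 have d: "DF (%x. x)" by (intro dfn)
 have X: "x \<E> X ==> Ord x & lep x a" for x using assms(2) mem_hartogs by auto
 have "Repl X (%x. x) = X" by (rule ext) (auto simp: mem_Repl[OF d])
 hence "lep (Union X) a" using lep_UN[OF d assms(1) _ assms(3)] X by simp
 moreover have O: "Ord (Union X)" using X by (intro Ord_Union) blast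
 ultimately have "succ (Union X) \<E> hartogs a" by (intro hartogs_succ assms) (simp add: mem_hartogs)
 moreover have "x \<E> succ (Union X)" if "x \<E> X" for x
  using Ord_subset[OF _ O, of x] X[OF that] that by (auto simp: subset_eq)
 ultimately show ?thesis by auto
qed

lemma pigeonhole: assumes F: "DF f" and "lep b \<kappa>" "!!x. x \<E> X ==> f x \<E> b" "~ lep X \<kappa>" "lep (prod \<kappa> \<kappa>) \<kappa>"
 shows "EX y. y \<E> b & ~ lep (Sep X (%x. f x = y)) \<kappa>"
proof (rule ccontr)
 assume n: "~ ?thesis"
 note [dfn] = DFD[OF F]
 have d: "DF (%y. Sep X (%x. f x = y))" and d2: "DP (%x. f x = y)" for y by (intro dfn)+
 have "lep (Union (Repl b (%y. Sep X (%x. f x = y)))) \<kappa>" using n by (intro lep_UN d assms) blast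
 moreover have "el X <= el (Union (Repl b (%y. Sep X (%x. f x = y))))"
  unfolding sub_iff mem_UN[OF d] mem_Sep[OF d2] using assms(3) by blast
 ultimately show False using assms(4) lep_subset lep_trans by blast
qed

definition Fin where "Fin a = Sep (Pow a) fin"
lemma DT_Fin [THEN DFD, dfn]: "DF Fin" unfolding Fin_def by (intro dfn)
lemma mem_Fin: "x \<E> Fin a <-> el x <= el a & fin x"
proof -
 have d: "DP fin" by (intro dfn)
 show ?thesis unfolding Fin_def mem_Sep[OF d] by simp
qed

lemma lep_Fin: assumes "lep a \<kappa>" "lep (prod \<kappa> \<kappa>) \<kappa>" "el omega <= el \<kappa>" shows "lep (Fin a) \<kappa>"
proof -
 define S where "S = (%n. Sep (Pow a) (%s. lep s n))"
 have dS: "DP (%s. lep s n)" for n by (intro dfn)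
 have S: "s \<E> S n <-> el s <= el a & lep s n" for s n unfolding S_def mem_Sep[OF dS] by simp
 have "DF S" unfolding S_def by (intro dfn)
 note [dfn] = DFD[OF this]
 have "lep (S n) \<kappa>" if "n \<E> omega" for n
 proof (rule nat_induct[of "%n. lep (S n) \<kappa>"], intro dfn)
  have "s = emp" if "lep s emp" for s using that lepE[of s emp] empI mem_emp by metis
  hence "el (S emp) <= el omega" using emp_omega unfolding sub_iff S by blast
  thus "lep (S emp) \<kappa>" using assms(3) lep_subset lep_trans by blast
  fix n assume n: "lep (S n) \<kappa>"
  \<comment> \<open>A nonempty set with at most \<open>n + 1\<close> points arises from one with at
    most \<open>n\<close> points and one more element.\<close>
  have "DF (%p. un (p1 p) (sing (p2 p)))" by (intro dfn)
  hence "lep (diff (S (succ n)) (sing emp)) (prod (S n) a)"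
  proof (rule lep_surj)
   fix s assume "s \<E> diff (S (succ n)) (sing emp)"
   hence s: "el s <= el a" "lep s (succ n)" "s ~= emp" by (auto simp: S)
   then obtain u where u: "u \<E> s" "lep (diff s (sing u)) n" using lep_remove by blast
   have "s = un (diff s (sing u)) (sing u)" using u(1) by (intro ext) auto
   moreover have "pair (diff s (sing u)) u \<E> prod (S n) a" using s u by (auto simp: S)
   ultimately show "EX p. p \<E> prod (S n) a & un (p1 p) (sing (p2 p)) = s" by (metis p1_pair p2_pair)
  qed
  hence 1: "lep (diff (S (succ n)) (sing emp)) \<kappa>" using lep_prod[OF n assms(1)] assms(2) lep_trans by blast
  have 2: "lep (sing emp) \<kappa>" using assms(3) emp_omega by (intro lep_subset) auto
  have "el (S (succ n)) <= el (un (diff (S (succ n)) (sing emp)) (sing emp))" by auto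
  thus "lep (S (succ n)) \<kappa>" using lep_un[OF 1 2 assms(2,3)] lep_subset lep_trans by blast
 qed (rule that)
 hence "lep (Union (Repl omega S)) \<kappa>" by (rule lep_UN[OF \<open>DF S\<close> lep_subset[OF assms(3)]]) (assumption, rule assms)
 moreover have "el (Fin a) <= el (Union (Repl omega S))"
  unfolding sub_iff mem_UN[OF \<open>DF S\<close>] S mem_Fin fin_def by blast
 ultimately show ?thesis using lep_subset lep_trans by blast
qed

abbreviation omega1 where "omega1 \<equiv> hartogs omega"
abbreviation omega2 where "omega2 \<equiv> hartogs omega1"

lemma omega_sub_omega1: "el omega <= el omega1" by (rule hartogs_infinite) simp
lemma omega1_square: "lep (prod omega1 omega1) omega1"
 by (rule hartogs_square) (simp_all add: omega_square)
lemma omega2_square: "lep (prod omega2 omega2) omega2"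
 by (rule hartogs_square[OF _ omega_sub_omega1 omega1_square]) simp

end

subsection \<open>Forcing\<close>

text \<open>The model now lives on \<open>nat\<close>: every natural number is a set of the model,
  and in particular its dense sets are enumerated.\<close>

locale poset = zfc E for E :: "nat => nat => bool" (infix \<open>\<E>\<close> 50) +
 fixes P r :: nat
 assumes P_nonempty: "EX p. p \<E> P"
  and r_refl: "p \<E> P ==> pair p p \<E> r"
  and r_trans: "p \<E> P ==> q \<E> P ==> s \<E> P ==> pair p q \<E> r ==> pair q s \<E> r ==> pair p s \<E> r"
begin

definition le where "le p q <-> p \<E> P & q \<E> P & pair p q \<E> r"
lemma dfn_le [THEN DP2D, dfn]: "DP2 le" unfolding le_def by (intro dfn)
lemma le_refl [simp]: "le p p <-> p \<E> P" by (auto simp: le_def r_refl)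
lemma le_trans: "le p q ==> le q s ==> le p s" unfolding le_def using r_trans by blast
lemma leD: "le p q ==> p \<E> P" "le p q ==> q \<E> P" by (auto simp: le_def)

text \<open>
 Equality of names is forced if it belongs to a bisimulation that is a set of the model. This replaces the
 usual recursion on names.
\<close>

definition half where "half R p x y <-> (ALL u s q. pair u s \<E> x --> le q p --> le q s -->
  (EX r v t. le r q & pair v t \<E> y & le r t & pair (pair u v) r \<E> R))"
definition bis where "bis R <-> (ALL x y p. pair (pair x y) p \<E> R -->
  p \<E> P & pair (pair y x) p \<E> R & half R p x y)"
definition feq where "feq p x y <-> (EX R. bis R & pair (pair x y) p \<E> R)"
definition fsub where "fsub p x y <-> (ALL u s q. pair u s \<E> x --> le q p --> le q s -->
  (EX r v t. le r q & pair v t \<E> y & le r t & feq r u v))"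
definition fmem where "fmem p u y <-> p \<E> P & (ALL q. le q p --> (EX r v t. le r q & pair v t \<E> y & le r t & feq r u v))"

lemma dfn_feq [dfn]: assumes [THEN DT_shift, dfn]: "DT s" "DT t" "DT u" shows "Dfn (%e. feq (s e) (t e) (u e))"
 unfolding feq_def bis_def half_def by (intro dfn)
lemma dfn_fmem [dfn]: assumes [THEN DT_shift, dfn]: "DT s" "DT t" "DT u" shows "Dfn (%e. fmem (s e) (t e) (u e))"
 unfolding fmem_def by (intro dfn)

lemma name_tcl: "pair u s \<E> x ==> u \<E> tcl x"
proof -
 assume a: "pair u s \<E> x"
 have "upair u u \<E> pair u s" "u \<E> upair u u" by (simp_all add: pair_def)
 thus ?thesis using tcl_mem[OF a] tcl_trans by blast
qed

lemma feq_P: "feq p x y ==> p \<E> P" by (auto simp: feq_def bis_def)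
lemma feq_sym: "feq p x y ==> feq p y x" unfolding feq_def bis_def by blast
lemma feq_fsub: "feq p x y ==> fsub p x y" unfolding feq_def bis_def half_def fsub_def by blast
lemma fsub_mono: "fsub p x y ==> le q p ==> fsub q x y" unfolding fsub_def using le_trans by blast

text \<open>The recursive clause for equality of names is recovered from the bisimulations. Within
  the names in a common transitive closure, the equalities forced so far together with those between
  \<open>x\<close> and \<open>y\<close> below \<open>p\<close> form a bisimulation.\<close>

lemma feqI:
 assumes p: "p \<E> P" and xy: "fsub p x y" and yx: "fsub p y x"
 shows "feq p x y"
proof -
 define T where "T = tcl (upair x y)"
 have T: "x \<E> T" "y \<E> T" "!!u v s. u \<E> T ==> pair v s \<E> u ==> v \<E> T"
  unfolding T_def using tcl_mem[of _ "upair x y"] tcl_tcl name_tcl by auto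
 let ?Q = "%z. EX u v q. z = pair (pair u v) q & (feq q u v | le q p & (u = x & v = y | u = y & v = x))"
 have d: "DP ?Q" by (intro dfn)
 define R where "R = Sep (prod (prod T T) P) ?Q"
 have R: "pair (pair u v) q \<E> R <-> u \<E> T & v \<E> T & q \<E> P & (feq q u v | le q p & (u = x & v = y | u = y & v = x))" for u v q
  unfolding R_def mem_Sep[OF d] by auto
 have "half R q u v" if q: "pair (pair u v) q \<E> R" for u v q
 proof -
  have "fsub q u v" using q xy yx feq_fsub fsub_mono unfolding R by blast
  thus ?thesis unfolding half_def fsub_def
   using q T(3) feq_P leD unfolding R by metis
 qed
 moreover have "pair (pair u v) q \<E> R <-> pair (pair v u) q \<E> R" for u v q unfolding R using feq_sym by blast
 ultimately have "bis R" unfolding bis_def using R by blast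
 moreover have "pair (pair x y) p \<E> R" unfolding R using T p by simp
 ultimately show ?thesis unfolding feq_def by blast
qed

lemma feq_iff: "feq p x y <-> p \<E> P & fsub p x y & fsub p y x"
 using feqI feq_fsub feq_P feq_sym by blast
lemma feq_mono: "feq p x y ==> le q p ==> feq q x y" unfolding feq_iff using fsub_mono leD by blast

lemma feq_refl: "p \<E> P ==> feq p x x"
proof -
 assume p: "p \<E> P"
 have "ALL p. p \<E> P --> feq p x x"
 proof (rule mem_induct[of "%x. ALL p. p \<E> P --> feq p x x"], intro dfn, intro allI impI)
  fix x p assume IH: "!!y. y \<E> tcl x ==> ALL p. p \<E> P --> feq p y y" and p: "p \<E> P"
  have "fsub p x x" unfolding fsub_def using IH name_tcl le_refl leD by blast
  thus "feq p x x" using p feq_iff by blast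
 qed
 thus ?thesis using p by blast
qed

lemma feq_trans: "feq p x y ==> feq p y z ==> feq p x z"
proof -
 have "ALL p y z. feq p x y --> feq p y z --> feq p x z"
 proof (rule mem_induct[of "%x. ALL p y z. feq p x y --> feq p y z --> feq p x z"], intro dfn, intro allI impI)
  fix x p y z assume IH: "!!u. u \<E> tcl x ==> ALL p y z. feq p u y --> feq p y z --> feq p u z"
   and xy: "feq p x y" and yz: "feq p y z"
  have "fsub p x z" unfolding fsub_def
  proof (intro allI impI)
   fix u s q assume u: "pair u s \<E> x" "le q p" "le q s"
   obtain r v t where 1: "le r q" "pair v t \<E> y" "le r t" "feq r u v"
    using feq_fsub[OF xy] u unfolding fsub_def by blast
   have "le r p" using 1 u le_trans by blast
   then obtain r' w t' where 2: "le r' r" "pair w t' \<E> z" "le r' t'" "feq r' v w"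
    using feq_fsub[OF yz] 1 unfolding fsub_def by blast
   have "feq r' u w" using IH[OF name_tcl[OF u(1)]] 2 feq_mono[OF 1(4) 2(1)] by blast
   thus "EX r v t. le r q & pair v t \<E> z & le r t & feq r u v" using 2 1 le_trans by blast
  qed
  moreover have "fsub p z x" unfolding fsub_def
  proof (intro allI impI)
   fix w s q assume w: "pair w s \<E> z" "le q p" "le q s"
   obtain r v t where 1: "le r q" "pair v t \<E> y" "le r t" "feq r w v"
    using feq_fsub[OF feq_sym[OF yz]] w unfolding fsub_def by blast
   have "le r p" using 1 w le_trans by blast
   then obtain r' u t' where 2: "le r' r" "pair u t' \<E> x" "le r' t'" "feq r' v u"
    using feq_fsub[OF feq_sym[OF xy]] 1 unfolding fsub_def by blast
   have "feq r' u w" using IH[OF name_tcl[OF 2(2)]] feq_sym[OF 2(4)] feq_sym[OF feq_mono[OF 1(4) 2(1)]] by blast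
   thus "EX r v t. le r q & pair v t \<E> x & le r t & feq r w v" using 2 1 le_trans feq_sym by blast
  qed
  ultimately show "feq p x z" using feqI feq_P[OF xy] by blast
 qed
 thus "feq p x y ==> feq p y z ==> feq p x z" by blast
qed

lemma fmem_P: "fmem p x y ==> p \<E> P" by (simp add: fmem_def)
lemma fmem_mono: "fmem p x y ==> le q p ==> fmem q x y" unfolding fmem_def using le_trans leD by blast
lemma fmem_local: "p \<E> P ==> (!!q. le q p ==> EX r. le r q & fmem r x y) ==> fmem p x y"
proof -
 assume p: "p \<E> P" and a: "!!q. le q p ==> EX r. le r q & fmem r x y"
 have "EX r v t. le r q & pair v t \<E> y & le r t & feq r x v" if q: "le q p" for q
 proof -
  obtain q' where q': "le q' q" "fmem q' x y" using a q by blast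
  then obtain r v t where "le r q'" "pair v t \<E> y" "le r t" "feq r x v"
   using leD(1) le_refl[of q'] unfolding fmem_def by blast
  thus ?thesis using q' le_trans by blast
 qed
 thus ?thesis using p unfolding fmem_def by blast
qed
lemma feq_local: assumes "p \<E> P" "!!q. le q p ==> EX r. le r q & feq r x y" shows "feq p x y"
proof -
 have "fsub p x y" if a: "!!q. le q p ==> EX r. le r q & feq r x y" for x y unfolding fsub_def
 proof (intro allI impI)
  fix u s q assume u: "pair u s \<E> x" "le q p" "le q s"
  then obtain q' where q': "le q' q" "feq q' x y" using a by blast
  have "le q' q'" "le q' s" using le_trans[OF q'(1) u(3)] leD(1)[OF q'(1)] by simp_all
  then obtain r v t where "le r q'" "pair v t \<E> y" "le r t" "feq r u v"
   using feq_fsub[OF q'(2)] u(1) unfolding fsub_def by blast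
  thus "EX r v t. le r q & pair v t \<E> y & le r t & feq r u v" using q'(1) le_trans by blast
 qed
 thus ?thesis using assms feqI feq_sym by metis
qed
lemma fmem_cong1: "fmem p x y ==> feq p x x' ==> fmem p x' y"
proof -
 assume a: "fmem p x y" "feq p x x'"
 show ?thesis unfolding fmem_def
 proof (intro conjI allI impI)
  fix q assume q: "le q p"
  then obtain r v t where 1: "le r q" "pair v t \<E> y" "le r t" "feq r x v" using a(1) unfolding fmem_def by blast
  hence "feq r x' v" using feq_trans feq_sym feq_mono[OF a(2) le_trans[OF 1(1) q]] by blast
  thus "EX r v t. le r q & pair v t \<E> y & le r t & feq r x' v" using 1 by blast
 qed (use a fmem_P in blast)
qed
lemma fmem_cong2: "fmem p x y ==> feq p y y' ==> fmem p x y'"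
proof -
 assume a: "fmem p x y" "feq p y y'"
 show ?thesis unfolding fmem_def
 proof (intro conjI allI impI)
  fix q assume q: "le q p"
  then obtain r v t where 1: "le r q" "pair v t \<E> y" "le r t" "feq r x v" using a(1) unfolding fmem_def by blast
  have "le r p" using 1 q le_trans by blast
  then obtain r' w t' where 2: "le r' r" "pair w t' \<E> y'" "le r' t'" "feq r' v w"
   using feq_fsub[OF a(2)] 1 unfolding fsub_def by blast
  thus "EX r v t. le r q & pair v t \<E> y' & le r t & feq r x v"
   using feq_trans[OF feq_mono[OF 1(4) 2(1)] 2(4)] le_trans 1(1) by blast
 qed (use a fmem_P in blast)
qed
lemma fmem_name: "pair u s \<E> x ==> s \<E> P ==> fmem s u x"
 unfolding fmem_def using feq_refl le_refl leD by metis

section \<open>The forcing relation and generic filters\<close>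

primrec forces :: "fm => nat => (nat => nat) => bool" where
 "forces (FMem i j) = (%p e. fmem p (e i) (e j))"
| "forces (FEq i j) = (%p e. feq p (e i) (e j))"
| "forces FFalse = (%p e. False)"
| "forces (FImp \<phi> \<psi>) = (%p e. ALL q. le q p --> forces \<phi> q e --> forces \<psi> q e)"
| "forces (FAll \<phi>) = (%p e. ALL x. forces \<phi> p (case_nat x e))"

lemma forces_mono: "forces \<phi> p e ==> le q p ==> forces \<phi> q e"
 by (induction \<phi> arbitrary: p q e) (auto simp: feq_mono fmem_mono dest: le_trans)

text \<open>This makes the clauses classical: a condition that does not force \<phi> has an
  extension below which no condition forces it.\<close>

lemma forces_local: "p \<E> P ==> (!!q. le q p ==> EX s. le s q & forces \<phi> s e) ==> forces \<phi> p e"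
proof (induction \<phi> arbitrary: p e)
 case (FMem i j) thus ?case by (simp add: fmem_local)
next
 case (FEq i j) thus ?case by (simp add: feq_local)
next
 case FFalse thus ?case using FFalse.prems(2)[of p] by simp
next
 case (FImp \<phi> \<psi>)
 show ?case unfolding forces.simps
 proof (intro allI impI)
  fix q assume q: "le q p" "forces \<phi> q e"
  show "forces \<psi> q e"
  proof (rule FImp.IH(2))
   show "q \<E> P" using q leD by blast
   fix q' assume q': "le q' q"
   then obtain s where s: "le s q'" "forces (FImp \<phi> \<psi>) s e" using FImp.prems(2) le_trans q(1) by blast
   have "forces \<phi> s e" using q(2) q' s(1) forces_mono le_trans by blast
   thus "EX s. le s q' & forces \<psi> s e" using s leD by auto
  qed
 qed
next
 case (FAll \<phi>)
 show ?case unfolding forces.simps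
 proof (intro allI FAll.IH)
  fix x q assume "le q p"
  thus "EX s. le s q & forces \<phi> s (case_nat x e)" using FAll.prems(2) by fastforce
 qed (rule FAll.prems)
qed

lemma dfn_forces_var: "Dfn (%e. forces \<phi> (e i) (%j. e (f j)))"
proof (induction \<phi> arbitrary: i f)
 case (FMem k l) show ?case unfolding forces.simps by (intro dfn)
next
 case (FEq k l) show ?case unfolding forces.simps by (intro dfn)
next
 case FFalse show ?case unfolding forces.simps by (intro dfn)
next
 case (FImp \<phi> \<psi>)
 have "Dfn (%e. forces \<phi> (e 0) (%j. e (Suc (f j))))" "Dfn (%e. forces \<psi> (e 0) (%j. e (Suc (f j))))"
  using FImp.IH[of 0 "%j. Suc (f j)"] by simp_all
 thus ?case unfolding forces.simps by (intro dfn)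
next
 case (FAll \<phi>)
 have *: "(%j. e (case_nat 0 (%j. Suc (f j)) j)) = case_nat (e 0) (%j. e (Suc (f j)))" for e :: "nat => nat"
  by (auto split: nat.split)
 have "Dfn (%e. forces \<phi> (e (Suc i)) (case_nat (e 0) (%j. e (Suc (f j)))))"
  using FAll.IH[of "Suc i" "case_nat 0 (%j. Suc (f j))"] unfolding * .
 thus ?case unfolding forces.simps by (intro dfn)
qed

lemma dfn_forces_par: "Dfn (%e. forces \<phi> (e i) (%j. if V j then e (f j) else c j))"
 using dfn_psub[OF dfn_forces_var[of \<phi> 0 Suc], of "%i. i = 0 | V (i - 1)" "case_nat i f" "%i. c (i - 1)"]
 by (simp cong: if_cong)

definition generic :: "nat set => bool" where
 "generic G <-> G <= el P & G ~= {} & (ALL p q. p \<in> G --> le p q --> q \<in> G) &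
   (ALL p:G. ALL q:G. EX s:G. le s p & le s q) &
   (ALL D. (ALL p. p \<E> P --> (EX q. le q p & q \<E> D)) --> (EX p:G. p \<E> D))"

lemma generic_ex: assumes "p \<E> P" shows "EX G. generic G & p \<in> G"
proof -
 \<comment> \<open>The dense sets of the model are natural numbers, so the step with number
   \<open>D\<close> can enter the set \<open>D\<close>.\<close>
 define step where "step = (%D p. if EX q. le q p & q \<E> D then SOME q. le q p & q \<E> D else p)"
 define s where "s = rec_nat p (%n q. step n q)"
 have s0: "s 0 = p" and sS: "s (Suc n) = step n (s n)" for n by (simp_all add: s_def)
 have step: "le (step D p) p" "(EX q. le q p & q \<E> D) ==> step D p \<E> D" if "p \<E> P" for D p
 proof -
  have "(EX q. le q p & q \<E> D) ==> le (step D p) p & step D p \<E> D"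
   unfolding step_def using someI_ex[of "%q. le q p & q \<E> D"] by simp
  moreover have "~ (EX q. le q p & q \<E> D) ==> le (step D p) p" using that unfolding step_def by (simp only: if_False le_refl)
  ultimately show "le (step D p) p" "(EX q. le q p & q \<E> D) ==> step D p \<E> D" by blast+
 qed
 have sP: "s n \<E> P" for n by (induction n) (simp_all add: s0 sS assms step(1)[THEN leD(1)])
 have mono: "m \<le> n ==> le (s n) (s m)" for m n
 proof (induction n)
  case (Suc n)
  thus ?case using step(1)[OF sP[of n], of n] sP[of "Suc n"] le_trans by (cases "m = Suc n") (auto simp: sS)
 qed (use sP in simp)
 define G where "G = {q. EX n. le (s n) q}"
 have "generic G" unfolding generic_def
 proof (intro conjI allI impI ballI)
  show "G <= el P" using leD by (auto simp: G_def)
  show "G ~= {}" using sP by (auto simp: G_def intro: le_refl[THEN iffD2])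
  show "q' \<in> G" if "q \<in> G" "le q q'" for q q' using that le_trans by (auto simp: G_def)
  show "EX u:G. le u q & le u q'" if "q \<in> G" "q' \<in> G" for q q'
  proof -
   obtain m n where mn: "le (s m) q" "le (s n) q'" using \<open>q \<in> G\<close> \<open>q' \<in> G\<close> by (auto simp: G_def)
   have "le (s (max m n)) q" "le (s (max m n)) q'" using mono[of m "max m n"] mono[of n "max m n"] mn le_trans by (meson max.cobounded1 max.cobounded2)+
   moreover have "s (max m n) \<in> G" using sP by (auto simp: G_def intro: le_refl[THEN iffD2])
   ultimately show ?thesis by blast
  qed
  fix D assume "ALL p. p \<E> P --> (EX q. le q p & q \<E> D)"
  hence "s (Suc D) \<E> D" using step(2)[OF sP] sP by (simp add: sS)
  moreover have "s (Suc D) \<in> G" using sP by (auto simp: G_def intro: le_refl[THEN iffD2])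
  ultimately show "EX p:G. p \<E> D" by blast
 qed
 moreover have "p \<in> G" using assms s0 unfolding G_def by (metis (mono_tags) le_refl mem_Collect_eq)
 ultimately show ?thesis by blast
qed

lemma generic_dense: assumes G: "generic G" "p \<in> G" and D: "DP D" and dense: "!!q. le q p ==> EX s. le s q & D s"
 shows "EX s:G. le s p & D s"
proof -
 note [dfn] = DPD[OF D]
 \<comment> \<open>The conditions incompatible with \<open>p\<close> make the set dense in all of
   \<open>P\<close>, and a filter containing \<open>p\<close> contains none of them.\<close>
 let ?D = "%s. (D s & le s p) | ~ (EX t. le t s & le t p)"
 have d: "DP ?D" by (intro dfn)
 have "EX s. le s q & s \<E> Sep P ?D" if q: "q \<E> P" for q
 proof (cases "EX t. le t q & le t p")
  case True
  then obtain t where t: "le t q" "le t p" by blast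
  then obtain s where "le s t" "D s" using dense by blast
  thus ?thesis unfolding mem_Sep[OF d] using t le_trans leD by blast
 next
  case False thus ?thesis unfolding mem_Sep[OF d] using q le_refl by blast
 qed
 then obtain s where s: "s \<in> G" "s \<E> Sep P ?D" using G(1) unfolding generic_def by blast
 obtain t where "t \<in> G" "le t s" "le t p" using G s(1) unfolding generic_def by blast
 hence "D s & le s p" using s(2) unfolding mem_Sep[OF d] by blast
 thus ?thesis using s(1) by blast
qed

end

text \<open>The generic extension \<open>N\<close> is presented on \<open>nat\<close>, with \<open>val\<close> the evaluation of names.\<close>

locale generic_ext = poset E P r for E (infix \<open>\<E>\<close> 50) and P r +
 fixes G :: "nat set" and N :: "nat => nat => bool" and val :: "nat => nat"
 assumes generic: "generic G"
  and val_surj: "surj val"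
  and val_eq: "val x = val y <-> (EX p:G. feq p x y)"
  and N_mem: "N (val x) (val y) <-> (EX p:G. fmem p x y)"
  and truth: "sat N (%i. val (e i)) \<phi> <-> (EX p:G. forces \<phi> p e)"

context poset begin

lemma generic_ext_ex: assumes G: "generic G" shows "EX N val. generic_ext E P r G N val"
proof -
 have GP: "p \<in> G ==> p \<E> P" for p using G by (auto simp: generic_def)
 have Gup: "p \<in> G ==> le p q ==> q \<in> G" for p q using G unfolding generic_def by blast
 have Gdir: "p \<in> G ==> q \<in> G ==> EX s:G. le s p & le s q" for p q using G unfolding generic_def by blast
 have Gne: "EX p. p \<in> G" using G unfolding generic_def by blast
 define q where "q = (%x y. EX p:G. feq p x y)"
 define A where "A = (%x y. EX p:G. fmem p x y)"
 have eq: "equivp q"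
 proof (rule equivpI)
  obtain p where "p \<in> G" using Gne by blast
  thus "reflp q" unfolding q_def using feq_refl GP by (intro reflpI) blast
  show "symp q" unfolding q_def using feq_sym by (intro sympI) blast
  show "transp q"
  proof (rule transpI)
   fix x y z assume "q x y" "q y z"
   then obtain p p' where "p \<in> G" "p' \<in> G" "feq p x y" "feq p' y z" unfolding q_def by blast
   moreover then obtain s where "s \<in> G" "le s p" "le s p'" using Gdir by blast
   ultimately show "q x z" unfolding q_def using feq_trans[OF feq_mono feq_mono] by blast
  qed
 qed
 have cong: "A x' y'" if qA: "q x x'" "q y y'" "A x y" for x x' y y'
 proof -
  obtain a b c where abc: "a \<in> G" "b \<in> G" "c \<in> G" "feq a x x'" "feq b y y'" "fmem c x y"
   using qA unfolding q_def A_def by blast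
  obtain s where s: "s \<in> G" "le s a" "le s b" using Gdir abc by blast
  obtain t where t: "t \<in> G" "le t s" "le t c" using Gdir abc s by blast
  have "feq t x x'" "feq t y y'" "fmem t x y" using s t abc feq_mono fmem_mono le_trans by blast+
  thus ?thesis unfolding A_def using t fmem_cong1 fmem_cong2 by blast
 qed
 \<comment> \<open>A name for the singleton of \<open>x\<close>; it shows that the quotient is
   infinite.\<close>
 define s where "s = (%x. prod (sing x) P)"
 have sm: "pair u t \<E> s x <-> u = x & t \<E> P" for u t x by (auto simp: s_def)
 have sq: "q x y" if qs: "q (s x) (s y)" for x y
 proof -
  obtain p where p: "p \<in> G" "feq p (s x) (s y)" using qs unfolding q_def by blast
  have "EX r. le r t & feq r x y" if "le t p" for t
   using feq_fsub[OF p(2)] that GP[OF p(1)] leD le_refl unfolding fsub_def sm by metis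
  hence "feq p x y" using feq_local GP[OF p(1)] by blast
  thus ?thesis unfolding q_def using p by blast
 qed
 have qz: "~ q emp (s x)" for x
 proof
  assume "q emp (s x)"
  then obtain p where p: "p \<in> G" "feq p (s x) emp" unfolding q_def using feq_sym by blast
  thus False using feq_fsub[OF p(2)] GP[OF p(1)] le_refl[of p] unfolding fsub_def sm by (metis mem_emp)
 qed
 have satq: "satq A q e \<phi> <-> (EX p:G. forces \<phi> p e)" for e \<phi>
 proof (induction \<phi> arbitrary: e)
  case (FImp \<phi> \<psi>)
  show ?case
  proof
   assume a: "EX p:G. forces (FImp \<phi> \<psi>) p e"
   then obtain p where p: "p \<in> G" "forces (FImp \<phi> \<psi>) p e" by blast
   { assume "EX p:G. forces \<phi> p e"
    then obtain p' where "p' \<in> G" "forces \<phi> p' e" by blast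
    then obtain s where "s \<in> G" "le s p" "forces \<phi> s e" using Gdir[OF p(1)] forces_mono by blast
    hence "EX p:G. forces \<psi> p e" using p(2) by auto }
   thus "satq A q e (FImp \<phi> \<psi>)" by (simp add: FImp.IH)
  next
   assume a: "satq A q e (FImp \<phi> \<psi>)"
   \<comment> \<open>A condition that does not force the implication has an extension that forces
     the premise, and a further one below which the conclusion is never forced.\<close>
   let ?D = "%p. forces (FImp \<phi> \<psi>) p e | (forces \<phi> p e & (ALL q. le q p --> ~ forces \<psi> q e))"
   have [dfn]: "DT s ==> Dfn (%e'. forces \<chi> (s e') e)" for \<chi> s
    using DPD[OF dfn_forces_par[of \<chi> 0 "%_. False" "%_. 0" e]] by simp
   have d: "DP ?D" by (intro dfn)
   obtain p where p: "p \<in> G" using Gne by blast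
   have "EX t. le t s & ?D t" if "le s p" for s
   proof (cases "forces (FImp \<phi> \<psi>) s e")
    case True thus ?thesis using that leD le_refl by blast
   next
    case False
    then obtain t where t: "le t s" "forces \<phi> t e" "~ forces \<psi> t e" by auto
    then obtain t' where "le t' t" "ALL q. le q t' --> ~ forces \<psi> q e" using forces_local[of t \<psi> e] leD by blast
    thus ?thesis using t forces_mono le_trans by blast
   qed
   then obtain t where t: "t \<in> G" "?D t" using generic_dense[OF G p d] by blast
   { assume "forces \<phi> t e" and n: "ALL q. le q t --> ~ forces \<psi> q e"
    then obtain p' where "p' \<in> G" "forces \<psi> p' e" using a FImp.IH t by auto
    hence False using Gdir[OF t(1)] forces_mono n by blast }
   thus "EX p:G. forces (FImp \<phi> \<psi>) p e" using t by blast
  qed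
 next
  case (FAll \<phi>)
  show ?case
  proof
   assume "EX p:G. forces (FAll \<phi>) p e" thus "satq A q e (FAll \<phi>)" using FAll.IH by auto
  next
   assume a: "satq A q e (FAll \<phi>)"
   let ?D = "%p. forces (FAll \<phi>) p e | (EX x. ALL q. le q p --> ~ forces \<phi> q (case_nat x e))"
   have 1: "Dfn (%e'. forces \<phi> (e' 0) (%j. if j = 0 then e' (Suc 0) else case_nat undefined e j))"
    using dfn_forces_par[of \<phi> 0 "%j. j = 0" "%_. Suc 0"] .
   have "(%j. if j = 0 then x else case_nat undefined e j) = case_nat x e" for x by (auto split: nat.split)
   with 1 have 2: "DP2 (%p x. forces \<phi> p (case_nat x e))" by simp
   have d: "DP ?D" unfolding forces.simps by (intro dfn DP2D[OF 2])
   obtain p where p: "p \<in> G" using Gne by blast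
   have "EX t. le t s & ?D t" if sp: "le s p" for s
   proof (cases "forces (FAll \<phi>) s e")
    case True thus ?thesis using sp leD le_refl by blast
   next
    case False
    then obtain x where "~ forces \<phi> s (case_nat x e)" by auto
    then obtain t' where "le t' s" "ALL q. le q t' --> ~ forces \<phi> q (case_nat x e)" using forces_local[of s \<phi>] leD(1)[OF sp] by blast
    thus ?thesis by blast
   qed
   then obtain t where t: "t \<in> G" "?D t" using generic_dense[OF G p d] by blast
   { fix x assume n: "ALL q. le q t --> ~ forces \<phi> q (case_nat x e)"
    have "satq A q (case_nat x e) \<phi>" using a by simp
    then obtain p' where "p' \<in> G" "forces \<phi> p' (case_nat x e)" using FAll.IH by blast
    hence False using Gdir[OF t(1)] forces_mono n by blast }
   thus "EX p:G. forces (FAll \<phi>) p e" using t by blast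
  qed
 qed (auto simp: A_def q_def)
 have "EX (E' :: nat => nat => bool) v. surj v & (ALL x y. v x = v y <-> q x y) &
   (ALL x y. E' (v x) (v y) <-> A x y) & (ALL e p. sat E' (%i. v (e i)) p <-> satq A q e p)"
  by (rule satq_quotient[where s = s and z = emp]) (fact eq, erule (2) cong, erule sq, rule qz)
 thus ?thesis
 proof (elim exE conjE)
  fix N :: "nat => nat => bool" and v assume Nv: "surj v" "ALL x y. v x = v y <-> q x y" "ALL x y. N (v x) (v y) <-> A x y"
   "ALL e p. sat N (%i. v (e i)) p <-> satq A q e p"
  have "generic_ext E P r G N v"
   by unfold_locales (use Nv G satq in "simp_all add: q_def A_def")
  thus ?thesis by blast
 qed
qed

end

subsection \<open>The generic extension satisfies ZFC\<close>

context poset begin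

section \<open>Canonical names\<close>

definition chk where "chk = (SOME F. DF F & (ALL x. F x = prod (Repl x F) P))"

lemma chk_ex: "DF chk & (ALL x. chk x = prod (Repl x chk) P)"
 unfolding chk_def
proof (rule someI_ex[of "%F. DF F & (ALL x. F x = prod (Repl x F) P)"])
 have "DF2 (%x f. prod (Repl x (app f)) P)" by (intro dfn)
 from mem_rec[OF this] obtain F where F: "DF F" "!!x. F x = prod (Repl x (app (lam (tcl x) F))) P" by blast
 have "Repl x (app (lam (tcl x) F)) = Repl x F" for x
  by (rule ext) (use app_lam[OF F(1)] tcl_mem in "auto simp: mem_Repl[OF F(1)] mem_Image")
 hence "ALL x. F x = prod (Repl x F) P" using F(2) by metis
 thus "EX F. DF F & (ALL x. F x = prod (Repl x F) P)" using F(1) by blast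
qed

lemma DT_chk [dfn]: "DT s ==> DT (%e. chk (s e))" using DFD chk_ex by blast
lemma mem_chk: "pair u s \<E> chk x <-> s \<E> P & (EX y. y \<E> x & u = chk y)"
 using chk_ex mem_Repl[of chk] pair_mem_prod by metis

lemma feq_chk: "feq p (chk x) (chk y) ==> x = y"
proof -
 have "ALL p y. feq p (chk x) (chk y) --> x = y"
 proof (rule mem_induct[of "%x. ALL p y. feq p (chk x) (chk y) --> x = y"], intro dfn, intro allI impI)
  fix x p y assume IH: "!!u. u \<E> tcl x ==> ALL p y. feq p (chk u) (chk y) --> u = y" and xy: "feq p (chk x) (chk y)"
  have p: "le p p" using feq_P[OF xy] by simp
  show "x = y"
  proof (rule ext)
   fix z
   have "z \<E> y" if "z \<E> x"
   proof -
    have "pair (chk z) p \<E> chk x" using that p mem_chk leD by blast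
    then obtain r v t where "pair v t \<E> chk y" "feq r (chk z) v" using feq_fsub[OF xy] p unfolding fsub_def by blast
    thus ?thesis using IH[OF tcl_mem[OF that]] unfolding mem_chk by blast
   qed
   moreover have "z \<E> x" if "z \<E> y"
   proof -
    have "pair (chk z) p \<E> chk y" using that p mem_chk leD by blast
    then obtain r v t where v: "pair v t \<E> chk x" "feq r (chk z) v" using feq_fsub[OF feq_sym[OF xy]] p unfolding fsub_def by blast
    then obtain u where u: "u \<E> x" "v = chk u" unfolding mem_chk by blast
    hence "u = z" using IH[OF tcl_mem[OF u(1)]] feq_sym v(2) by blast
    thus ?thesis using u by simp
   qed
   ultimately show "z \<E> x <-> z \<E> y" by blast
  qed
 qed
 thus "feq p (chk x) (chk y) ==> x = y" by blast
qed

definition op where "op x y = prod (upair (prod (upair x x) P) (prod (upair x y) P)) P"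
lemma DT_op [THEN DF2D, dfn]: "DF2 op" unfolding op_def by (intro dfn)

end

context generic_ext begin

lemma GP: "p \<in> G ==> p \<E> P" using generic by (auto simp: generic_def)
lemma Gup: "p \<in> G ==> le p q ==> q \<in> G" using generic unfolding generic_def by blast
lemma Gdir: "p \<in> G ==> q \<in> G ==> EX s:G. le s p & le s q" using generic unfolding generic_def by blast
lemma Gne: "EX p. p \<in> G" using generic unfolding generic_def by blast
lemmas Gdense = generic_dense[OF generic]

lemma val_ex: "EX x. X = val x" using val_surj by (metis surjD)

lemma val_mem: "N z (val x) <-> (EX u s. pair u s \<E> x & s \<in> G & z = val u)"
proof
 assume a: "N z (val x)"
 obtain w where w: "z = val w" using val_ex by blast
 then obtain p where p: "p \<in> G" "fmem p w x" using a N_mem by blast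
 have d: "DP (%r. EX v t. pair v t \<E> x & le r t & feq r w v)" by (intro dfn)
 have "EX s:G. le s p & (EX v t. pair v t \<E> x & le s t & feq s w v)"
  by (rule Gdense[OF p(1) d]) (use p(2) in "unfold fmem_def, blast")
 thus "EX u s. pair u s \<E> x & s \<in> G & z = val u" using w val_eq Gup by metis
next
 assume "EX u s. pair u s \<E> x & s \<in> G & z = val u"
 thus "N z (val x)" using N_mem GP fmem_name by metis
qed

lemma val_fam: "DF F ==> N z (val (prod (Repl a F) P)) <-> (EX x. x \<E> a & z = val (F x))"
 unfolding val_mem using Gne GP by (auto simp: mem_Repl)
lemma val_prod: "N z (val (prod a P)) <-> (EX x. x \<E> a & z = val x)"
 unfolding val_mem using Gne GP by auto

text \<open>Densely, either the names are forced equal or a member of one is forced to be in it and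
  out of the other. The second alternative cannot occur in the filter when the values have the same
  members.\<close>

lemma N_ext: assumes "!!z. N z X <-> N z Y" shows "X = Y"
proof -
 obtain x y where xy: "X = val x" "Y = val y" using val_ex by metis
 define D where "D = (%p u x y. fmem p u x & (ALL q. le q p --> ~ fmem q u y))"
 have d: "DP (%p. feq p x y | (EX u. D p u x y | D p u y x))" unfolding D_def by (intro dfn)
 obtain p where p: "p \<in> G" using Gne by blast
 have D: "EX s. le s q & (EX u. D s u x y)" if "~ fsub q x y" for q x y
 proof -
  obtain u s q' where u: "pair u s \<E> x" "le q' q" "le q' s" "~ (EX r v t. le r q' & pair v t \<E> y & le r t & feq r u v)"
   using \<open>~ fsub q x y\<close> unfolding fsub_def by blast
  have "fmem q' u x" using fmem_mono[OF fmem_name[OF u(1)] u(3)] leD u(3) by blast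
  moreover have "~ fmem t u y" if "le t q'" for t
  proof
   assume m: "fmem t u y"
   hence "le t t" using fmem_P by simp
   thus False using m u(4) le_trans that unfolding fmem_def by blast
  qed
  ultimately show ?thesis using u(2) unfolding D_def by blast
 qed
 have "EX s:G. le s p & (feq s x y | (EX u. D s u x y | D s u y x))"
 proof (rule Gdense[OF p d])
  fix q assume q: "le q p"
  show "EX s. le s q & (feq s x y | (EX u. D s u x y | D s u y x))"
   using D[of q x y] D[of q y x] feqI[of q x y] leD(1)[OF q] le_refl[of q] by blast
 qed
 then obtain s where s: "s \<in> G" "feq s x y | (EX u. D s u x y | D s u y x)" by blast
 have nD: "~ D s u x y" if "!!z. N z (val x) <-> N z (val y)" for u x y
 proof
  assume a: "D s u x y"
  hence "N (val u) (val y)" using that N_mem s(1) unfolding D_def by blast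
  then obtain t where t: "t \<in> G" "fmem t u y" using N_mem by blast
  then obtain s' where "le s' s" "le s' t" using Gdir s(1) by blast
  thus False using a t(2) fmem_mono unfolding D_def by blast
 qed
 hence "feq s x y" using s(2) assms xy by blast
 thus ?thesis using xy val_eq s(1) by blast
qed

text \<open>The minimal member is found through its name: the ground model picks a \<open>u\<close>
  forced into \<open>x\<close> such that no name in the closure of \<open>u\<close> can be forced
  into \<open>x\<close> by a stronger condition.\<close>

lemma N_fnd: assumes "N Y X" shows "EX Y. N Y X & (ALL Z. N Z X --> ~ N Z Y)"
proof -
 obtain x y where xy: "X = val x" "Y = val y" using val_ex by metis
 then obtain p where p: "p \<in> G" "fmem p y x" using assms N_mem by blast
 let ?D = "%q. EX u. fmem q u x & (ALL w. w \<E> tcl u --> (ALL q'. le q' q --> ~ fmem q' w x))"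
 have d: "DP ?D" by (intro dfn)
 have "EX s:G. le s p & ?D s"
 proof (rule Gdense[OF p(1) d])
  fix q assume q: "le q p"
  have d: "DP (%u. EX q'. le q' q & fmem q' u x)" by (intro dfn)
  have "le q q & fmem q y x" using q p fmem_mono leD by auto
  hence "EX u. (EX q'. le q' q & fmem q' u x) & (ALL w. w \<E> tcl u --> ~ (EX q'. le q' q & fmem q' w x))"
   by (intro class_fnd[OF d, of y]) blast
  thus "EX s. le s q & ?D s" using le_trans by blast
 qed
 then obtain q u where q: "q \<in> G" "fmem q u x" "!!w q'. w \<E> tcl u ==> le q' q ==> ~ fmem q' w x" by blast
 have "~ N Z (val u)" if ZX: "N Z X" for Z
 proof
  assume "N Z (val u)"
  then obtain w s where w: "pair w s \<E> u" "Z = val w" using val_mem by blast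
  then obtain t where t: "t \<in> G" "fmem t w x" using ZX xy N_mem by blast
  then obtain s' where "le s' q" "le s' t" using Gdir q(1) by blast
  thus False using q(3)[OF name_tcl[OF w(1)]] t fmem_mono by blast
 qed
 moreover have "N (val u) X" using xy N_mem q by blast
 ultimately show ?thesis by blast
qed

text \<open>Truth and definability of forcing, packaged for predicates with parameters: what is
  definable in \<open>N\<close> becomes a relation \<open>S\<close> between conditions and names
  that is definable in the ground model.\<close>

lemma dfn_name:
 assumes "dfn N Q"
 shows "EX S. (ALL e. Q (%i. val (e i)) <-> (EX p:G. S p e)) & (ALL p q e. S p e --> le q p --> S q e) &
   (ALL f c V i. Dfn (%e. S (e i) (%j. if V j then e (f j) else c j)))"
proof -
 obtain \<phi> a where Q: "!!e. Q e = sat N (join e a) \<phi>" using assms by (auto simp: dfn_def)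
 define a' where "a' = (%i. SOME x. a i = val x)"
 have a': "a i = val (a' i)" for i unfolding a'_def using someI_ex[OF val_ex] .
 have "join (%i. val (e i)) a = (%i. val (join e a' i))" for e by (auto simp: join_def a')
 hence "Q (%i. val (e i)) <-> (EX p:G. forces \<phi> p (join e a'))" for e unfolding Q by (simp add: truth)
 moreover have "Dfn (%e. forces \<phi> (e i) (join (%j. if V j then e (f j) else c j) a'))" for f c V i
 proof -
  have "join (%j. if V j then e (f j) else c j) a' = (%k. if even k & V (k div 2) then e (f (k div 2)) else join c a' k)" for e
   by (auto simp: join_def)
  thus ?thesis using dfn_forces_par[of \<phi> i "%k. even k & V (k div 2)" "%k. f (k div 2)" "join c a'"] by simp
 qed
 ultimately show ?thesis using forces_mono by (intro exI[of _ "%p e. forces \<phi> p (join e a')"]) simp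
qed

lemma N_sep: assumes "dfn N (%e. Q (e 0))" shows "EX B. ALL X. N X B <-> N X A & Q X"
proof -
 from dfn_name[OF assms] show ?thesis
 proof (elim exE conjE)
 fix S assume S': "ALL e. Q (val (e 0)) <-> (EX p:G. S p e)" "ALL p q e. S p e --> le q p --> S q e"
  "ALL f c V i. Dfn (%e. S (e i) (%j. if V j then e (f j) else c j))"
 note S = S'[rule_format]
 obtain a where a: "A = val a" using val_ex by blast
 have [dfn]: "DP2 (%p u. S p (%_. u))" using S(3)[of 0 "%_. True" "%_. Suc 0"] by simp
 have d: "DP (%z. EX u p. z = pair u p & fmem p u a & S p (%_. u))" by (intro dfn DP2D[of _ "%p u. S p (%_. u)"])
 define b where "b = Sep (prod (tcl a) P) (%z. EX u p. z = pair u p & fmem p u a & S p (%_. u))"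
 have b: "pair u p \<E> b <-> u \<E> tcl a & fmem p u a & S p (%_. u)" for u p
  unfolding b_def mem_Sep[OF d] using fmem_P by auto
 have "N X (val b) <-> N X A & Q X" for X
 proof
  assume "N X (val b)"
  then obtain u p where u: "pair u p \<E> b" "p \<in> G" "X = val u" unfolding val_mem by blast
  hence "fmem p u a" "S p (%_. u)" unfolding b by auto
  thus "N X A & Q X" using u a N_mem S(1)[of "%_. u"] by blast
 next
  assume x: "N X A & Q X"
  then obtain u s where u: "pair u s \<E> a" "s \<in> G" "X = val u" unfolding a val_mem by blast
  then obtain p where p: "p \<in> G" "S p (%_. u)" using S(1)[of "%_. u"] x by blast
  obtain t where t: "t \<in> G" "le t s" "le t p" using Gdir u p by blast
  have "pair u t \<E> b" unfolding b using name_tcl[OF u(1)] S(2)[OF p(2) t(3)] fmem_mono[OF fmem_name[OF u(1)] t(2)] leD t(2) by blast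
  thus "N X (val b)" unfolding val_mem using t u by blast
 qed
 thus ?thesis by blast
 qed
qed

text \<open>Collection in the ground model bounds the names of witnesses for all pairs of a name and
  a condition at once.\<close>

lemma N_collection: assumes "dfn N (%e. R (e 0) (e (Suc 0)))"
 shows "EX B. ALL X. N X A --> (EX Y. R X Y) --> (EX Y. N Y B & R X Y)"
proof -
 from dfn_name[OF assms] show ?thesis
 proof (elim exE conjE)
 fix S assume S': "ALL e. R (val (e 0)) (val (e (Suc 0))) <-> (EX p:G. S p e)" "ALL p q e. S p e --> le q p --> S q e"
  "ALL f c V i. Dfn (%e. S (e i) (%j. if V j then e (f j) else c j))"
 note S = S'[rule_format]
 obtain a where a: "A = val a" using val_ex by blast
 let ?S = "%p u y. S p (%j. if j = 0 then u else y)"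
 have d3: "Dfn (%e. ?S (e 0) (e (Suc 0)) (e (Suc (Suc 0))))"
 proof -
  have *: "(%j. e (if j = 0 then Suc 0 else Suc (Suc 0))) = (%j::nat. if j = 0 then e (Suc 0) else e (Suc (Suc 0)))" for e :: "nat => nat"
   by auto
  show ?thesis using S(3)[of 0 "%_. True" "%j. if j = 0 then Suc 0 else Suc (Suc 0)"] by (simp only: if_True *)
 qed
 have "DP2 (%z y. EX u p. z = pair u p & ?S p u y)" by (intro dfn DP3D[OF d3])
 from collection[OF this] obtain b where b: "!!u p y. pair u p \<E> prod (tcl a) P ==> ?S p u y ==> EX y. y \<E> b & ?S p u y" by (metis pair_inj)
 have "EX Y. N Y (val (prod b P)) & R X Y" if X: "N X A" "R X Y" for X Y
 proof -
  obtain u s where u: "pair u s \<E> a" "X = val u" using X(1) unfolding a val_mem by blast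
  obtain y where y: "Y = val y" using val_ex by blast
  obtain p where p: "p \<in> G" "?S p u y" using S(1)[of "%j. if j = 0 then u else y"] X(2) u y by auto
  have "pair u p \<E> prod (tcl a) P" using name_tcl[OF u(1)] GP[OF p(1)] by simp
  then obtain y' where y': "y' \<E> b" "?S p u y'" using b p(2) by blast
  hence "R X (val y')" using S(1)[of "%j. if j = 0 then u else y'"] u p(1) by auto
  thus ?thesis unfolding val_prod using y' by blast
 qed
 thus ?thesis by blast
 qed
qed

lemma N_repl: assumes R: "dfn N (%e. R (e 0) (e (Suc 0)))" and functional: "!!x y z. R x y ==> R x z ==> y = z"
 shows "EX b. ALL y. N y b <-> (EX x. N x a & R x y)"
proof -
 obtain B where B: "ALL X. N X a --> (EX Y. R X Y) --> (EX Y. N Y B & R X Y)" using N_collection[OF R] by blast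
 have d: "dfn N (%e. EX x. N x a & R x (e 0))" by (intro dfn DP2D[OF R])
 obtain b where "ALL y. N y b <-> N y B & (EX x. N x a & R x y)" using N_sep[of "%y. EX x. N x a & R x y", OF d] by blast
 thus ?thesis using B functional by metis
qed

definition j where "j x = val (chk x)"
lemma j_mem: "N z (j x) <-> (EX y. y \<E> x & z = j y)"
 unfolding j_def val_mem mem_chk using Gne GP by blast
lemma j_inj [simp]: "j x = j y <-> x = y" unfolding j_def val_eq using feq_chk Gne feq_refl GP by blast
lemma j_mem_iff [simp]: "N (j y) (j x) <-> y \<E> x" unfolding j_mem by auto

sublocale N: zf N
proof
 show "(!!z. N z x <-> N z y) ==> x = y" for x y by (rule N_ext)
 show "N y x ==> EX y. N y x & (ALL z. N z x --> ~ N z y)" for x y by (rule N_fnd)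
 show "EX p. ALL z. N z p <-> z = x | z = y" for x y
 proof -
  obtain u v where "x = val u" "y = val v" using val_ex by metis
  hence "ALL z. N z (val (prod (upair u v) P)) <-> z = x | z = y" unfolding val_prod by auto
  thus ?thesis by blast
 qed
 show "EX u. ALL z. N z u <-> (EX y. N y x & N z y)" for x
 proof -
  obtain a where a: "x = val a" using val_ex by blast
  have d: "dfn N (%e. EX y. N y x & N (e 0) y)" by (intro dfn)
  obtain u where u: "ALL z. N z u <-> N z (val (prod (tcl a) P)) & (EX y. N y x & N z y)"
   using N_sep[of "%z. EX y. N y x & N z y", OF d] by blast
  have "N z (val (prod (tcl a) P))" if yz: "N y x" "N z y" for y z
  proof -
   obtain b s where b: "pair b s \<E> a" "y = val b" using yz(1) a val_mem by blast
   then obtain c t where c: "pair c t \<E> b" "z = val c" using yz(2) val_mem by blast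
   thus ?thesis unfolding val_prod using tcl_tcl[OF name_tcl[OF b(1)] name_tcl[OF c(1)]] by blast
  qed
  thus ?thesis using u by blast
 qed
 show "EX p. ALL z. N z p <-> (ALL w. N w z --> N w x)" for x
 proof -
  obtain a where a: "x = val a" using val_ex by blast
  have d: "dfn N (%e. ALL w. N w (e 0) --> N w x)" by (intro dfn)
  \<comment> \<open>Each subset of \<open>x\<close> has a name among the subsets of
    \<open>prod (tcl a) P\<close>: it collects the pairs \<open>(u, q)\<close> with \<open>q\<close>
    forcing \<open>u\<close> into the subset.\<close>
  let ?p = "val (prod (Pow (prod (tcl a) P)) P)"
  obtain p where p: "ALL z. N z p <-> N z ?p & (ALL w. N w z --> N w x)"
   using N_sep[of "%z. ALL w. N w z --> N w x", OF d] by blast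
  have "N z ?p" if z: "ALL w. N w z --> N w x" for z
  proof -
   obtain b where b: "z = val b" using val_ex by blast
   have d: "DP (%z. EX u q. z = pair u q & fmem q u b)" by (intro dfn)
   define c where "c = Sep (prod (tcl a) P) (%z. EX u q. z = pair u q & fmem q u b)"
   have c: "pair u q \<E> c <-> u \<E> tcl a & fmem q u b" for u q unfolding c_def mem_Sep[OF d] using fmem_P by auto
   have "val c = z"
   proof (rule N_ext)
    fix w
    show "N w (val c) <-> N w z"
    proof
     assume "N w (val c)" thus "N w z" unfolding val_mem[of _ c] c b using N_mem by blast
    next
     assume w: "N w z"
     then obtain u s where u: "pair u s \<E> a" "w = val u" using z a val_mem by blast
     then obtain q where "q \<in> G" "fmem q u b" using w b N_mem by blast
     thus "N w (val c)" unfolding val_mem c using name_tcl[OF u(1)] u(2) by blast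
    qed
   qed
   moreover have "c \<E> Pow (prod (tcl a) P)" unfolding c_def by (auto simp: mem_Sep[OF d])
   ultimately show ?thesis unfolding val_prod by blast
  qed
  thus ?thesis using p by blast
 qed
 show "EX x. (EX z. (ALL w. ~ N w z) & N z x) & (ALL y. N y x --> (EX s. (ALL z. N z s <-> N z y | z = y) & N s x))"
 proof (rule exI[of _ "j omega"], rule conjI, rule exI[of _ "j emp"], intro conjI allI; (intro allI impI)?)
  show "~ N w (j emp)" for w unfolding j_mem by simp
  show "N (j emp) (j omega)" by simp
  fix y assume "N y (j omega)"
  then obtain n where n: "n \<E> omega" "y = j n" unfolding j_mem by blast
  have "N z (j (succ n)) <-> N z y | z = y" for z unfolding n j_mem by auto
  moreover have "N (j (succ n)) (j omega)" using n by simp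
  ultimately show "EX s. (ALL z. N z s <-> N z y | z = y) & N s (j omega)" by blast
 qed
 show "dfn N (%e. Q (e 0)) ==> EX b. ALL x. N x b <-> N x a & Q x" for Q a by (rule N_sep)
 show "dfn N (%e. R (e 0) (e (Suc 0))) ==> (!!x y z. R x y ==> R x z ==> y = z) ==>
   EX b. ALL y. N y b <-> (EX x. N x a & R x y)" for R a by (rule N_repl)
qed

lemma j_upair: "j (upair a b) = N.upair (j a) (j b)" by (rule N.ext) (auto simp: j_mem)
lemma j_pair: "j (pair a b) = N.pair (j a) (j b)" by (simp add: pair_def N.pair_def j_upair)
lemma j_emp: "j emp = N.emp" by (rule N.ext) (auto simp: j_mem)
lemma j_succ: "j (succ a) = N.succ (j a)" by (rule N.ext) (auto simp: j_mem)
lemma j_subset: "N.el (j a) <= N.el (j b) <-> el a <= el b"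
 by (simp only: N.sub_iff sub_iff j_mem) (metis j_inj)

lemma val_op: "val (op x y) = N.pair (val x) (val y)"
proof -
 have "val (prod (upair x y) P) = N.upair (val x) (val y)" for x y by (rule N.ext) (auto simp: val_prod)
 thus ?thesis by (simp add: op_def N.pair_def)
qed

lemma j_fn: assumes "fn f a" shows "N.fn (j f) (j a)" and "x \<E> a ==> N.app (j f) (j x) = j (app f x)"
proof -
 have f: "N p (j f) <-> (EX x. x \<E> a & p = N.pair (j x) (j (app f x)))" for p
  unfolding j_mem fn_mem[OF assms] using j_pair by metis
 show "N.fn (j f) (j a)" unfolding N.fn_def f j_mem[of _ a] by auto
 show "x \<E> a ==> N.app (j f) (j x) = j (app f x)" by (rule N.app_eq) (auto simp: f)
qed

lemma N_Ord: "Ord a ==> N.Ord (j a)"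
 unfolding N.Ord_def
proof (intro conjI allI impI)
 assume a: "Ord a"
 fix y assume "N y (j a)"
 then obtain b where b: "b \<E> a" "y = j b" unfolding j_mem by blast
 thus "N.el y <= N.el (j a)" using a unfolding b j_subset Ord_def by blast
 fix z assume "N z y"
 then obtain c where "c \<E> b" "z = j c" unfolding b j_mem by blast
 moreover hence "el c <= el b" using a b(1) unfolding Ord_def by blast
 ultimately show "N.el z <= N.el y" unfolding b by (simp add: j_subset)
qed

text \<open>Both models have the same, possibly nonstandard, natural numbers: a least element of
  \<open>j omega\<close> outside \<open>N.omega\<close> would be zero or a successor.\<close>

lemma j_omega: "j omega = N.omega"
proof (rule N.ext)
 fix z
 show "N z (j omega) <-> N z N.omega"
 proof
  assume "N z (j omega)"
  then obtain n where n: "n \<E> omega" "z = j n" unfolding j_mem by blast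
  show "N z N.omega"
  proof (rule ccontr)
   assume nz: "~ N z N.omega"
   have d: "dfn N (%e. N (e 0) (j omega) & ~ N (e 0) N.omega)" by (intro dfn)
   have "N.Ord z" using n N_Ord nat_Ord by blast
   then obtain y where y: "N y (j omega)" "~ N y N.omega" "!!w. N w y ==> ~ (N w (j omega) & ~ N w N.omega)"
    using N.Ord_least[of "%z. N z (j omega) & ~ N z N.omega", OF d] nz \<open>N z (j omega)\<close> by blast
   then obtain m where m: "m \<E> omega" "y = j m" unfolding j_mem by blast
   from nat_cases[OF m(1)] show False
   proof
    assume "m = emp" thus False using y(2) m j_emp N.emp_omega by simp
   next
    assume "EX k. k \<E> omega & m = succ k"
    then obtain k where k: "k \<E> omega" "m = succ k" by blast
    hence "N (j k) y" using m by simp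
    hence "N (j k) N.omega" using y(3) k(1) by auto
    thus False using y(2) m k N.succ_omega j_succ by simp
   qed
  qed
 next
  have "N.indset (j omega)" unfolding N.indset_def j_emp[symmetric] j_mem[of _ omega]
   using emp_omega succ_omega j_succ by metis
  thus "N z N.omega ==> N z (j omega)" unfolding N.mem_omega by blast
 qed
qed

lemma j_lep: assumes "lep a b" shows "N.lep (j a) (j b)"
proof -
 obtain f where f: "DF f" "!!x. x \<E> a ==> f x \<E> b" "!!x y. x \<E> a ==> y \<E> a ==> f x = f y ==> x = y"
  using lepE[OF assms] by blast
 have 1: "N.app (j (lam a f)) (j x) = j (f x)" if "x \<E> a" for x
  using j_fn(2)[OF fn_lam[OF f(1)] that] app_lam[OF f(1) that] by simp
 have d: "dterm N (%e. N.app (j (lam a f)) (e 0))" by (intro dfn)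
 show ?thesis by (rule N.lepI[OF d]) (use 1 f in "auto simp: j_mem")
qed

text \<open>Turns a family of names given in the ground model into a function of the
  extension.\<close>

definition fname where "fname a F = prod (Repl a (%x. op (chk x) (F x))) P"
lemma fname: assumes [dfn]: "DF F" and x: "x \<E> a" shows "N.app (val (fname a F)) (j x) = val (F x)"
proof -
 have d: "DF (%x. op (chk x) (F x))" by (intro dfn)
 show ?thesis by (rule N.app_eq) (use x in "auto simp: fname_def val_fam[OF d] val_op j_def[symmetric]")
qed

sublocale N: zfc N
proof
 fix A assume ne: "!!X. N X A ==> EX Y. N Y X"
 obtain a where a: "A = val a" using val_ex by blast
 \<comment> \<open>A well-ordering of the names in the ground model induces the choice: from each
   set take the member whose name comes first.\<close>
 obtain \<alpha> f where f: "Ord \<alpha>" "DF f" "!!x. x \<E> tcl a ==> EX \<beta>. \<beta> \<E> \<alpha> & f \<beta> = x" using well_order[of "tcl a"] by blast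
 define h where "h = val (fname \<alpha> f)"
 have h: "EX \<beta>. N \<beta> (j \<alpha>) & N (N.app h \<beta>) X" if X: "N X A" for X
 proof -
  obtain Y where Y: "N Y X" using ne[OF X] by blast
  obtain b s where b: "pair b s \<E> a" "X = val b" using X a val_mem by blast
  then obtain c t where c: "pair c t \<E> b" "Y = val c" using Y val_mem by blast
  have "c \<E> tcl a" using tcl_tcl[OF name_tcl[OF b(1)] name_tcl[OF c(1)]] .
  then obtain \<beta> where "\<beta> \<E> \<alpha>" "f \<beta> = c" using f(3) by blast
  thus ?thesis using fname[OF f(2)] Y c(2) unfolding h_def by (intro exI[of _ "j \<beta>"]) simp
 qed
 let ?Q = "%X \<beta>. N \<beta> (j \<alpha>) & N (N.app h \<beta>) X & (ALL \<gamma>. N \<gamma> \<beta> --> ~ (N \<gamma> (j \<alpha>) & N (N.app h \<gamma>) X))"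
 define F where "F = (%X. N.Union (N.Sep (N.Union A) (%Y. EX \<beta>. ?Q X \<beta> & Y = N.app h \<beta>)))"
 have dF: "N.DF F" unfolding F_def by (intro dfn)
 have "N (F X) X" if X: "N X A" for X
 proof -
  have d: "N.DP (%\<beta>. N \<beta> (j \<alpha>) & N (N.app h \<beta>) X)" by (intro dfn)
  have O: "N \<beta> (j \<alpha>) ==> N.Ord \<beta>" for \<beta> using N.Ord_mem[OF N_Ord[OF f(1)]] .
  obtain \<beta> where b: "?Q X \<beta>" using N.Ord_least[of "%\<beta>. N \<beta> (j \<alpha>) & N (N.app h \<beta>) X", OF d] h[OF X] O by blast
  have u: "\<gamma> = \<beta>" if "?Q X \<gamma>" for \<gamma> using N.Ord_linear[of \<gamma> \<beta>] O b that by blast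
  have d: "N.DP (%Y. EX \<beta>. ?Q X \<beta> & Y = N.app h \<beta>)" by (intro dfn)
  have "N Y (N.Sep (N.Union A) (%Y. EX \<beta>. ?Q X \<beta> & Y = N.app h \<beta>)) <-> Y = N.app h \<beta>" for Y
   unfolding N.mem_Sep[OF d] N.mem_Union using b u X by metis
  hence "F X = N.app h \<beta>" unfolding F_def by (intro N.ext) simp
  thus ?thesis using b by simp
 qed
 thus "EX f. ALL X. N X A --> N (N.app f X) X"
  by (intro exI[of _ "N.lam A F"]) (simp add: N.app_lam[OF dF])
qed

end

subsection \<open>Closed forcing and the collapse\<close>

context generic_ext begin

text \<open>The form in which truth is turned into forcing later on: a property that holds of no
  condition in the filter is excluded below one of them.\<close>

lemma G_meets: assumes d: "DP D" and "!!s. s \<in> G ==> ~ D s"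
 obtains p where "p \<in> G" "!!q. le q p ==> ~ D q"
proof -
 note [dfn] = DPD[OF d]
 have d': "DP (%p. D p | (ALL q. le q p --> ~ D q))" by (intro dfn)
 obtain p where p: "p \<in> G" using Gne by blast
 have "EX s:G. le s p & (D s | (ALL q. le q s --> ~ D q))"
 proof (rule Gdense[OF p d'])
  fix q assume "le q p"
  thus "EX s. le s q & (D s | (ALL q. le q s --> ~ D q))" using leD(1) le_refl by meson
 qed
 thus thesis using that assms(2) by blast
qed

text \<open>\<open>p\<close> decides the value at \<open>i\<close> of the function named \<open>\<tau>\<close> to be \<open>y\<close>, among the elements of \<open>b\<close>.\<close>

definition dec where "dec \<tau> b p i y <-> y \<E> b & fmem p (op (chk i) (chk y)) \<tau> &
  (ALL z q. z \<E> b --> z ~= y --> le q p --> ~ fmem q (op (chk i) (chk z)) \<tau>)"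

lemma dfn_dec [dfn]: assumes [THEN DT_shift, dfn]: "DT s" "DT t" "DT u" "DT v" "DT w"
 shows "Dfn (%e. dec (s e) (t e) (u e) (v e) (w e))" unfolding dec_def by (intro dfn)

lemma fmem_op: "(EX p:G. fmem p (op (chk i) (chk y)) \<tau>) <-> N (N.pair (j i) (j y)) (val \<tau>)"
 unfolding j_def val_op[symmetric] N_mem ..

lemma dec_mono: "dec \<tau> b p i y ==> le q p ==> dec \<tau> b q i y"
 unfolding dec_def using fmem_mono le_trans by blast
lemma dec_G: "p \<in> G ==> dec \<tau> b p i y ==> N (N.pair (j i) (j y)) (val \<tau>)"
 using fmem_op unfolding dec_def by blast

lemma dec_ex: assumes y: "y \<E> b" "N (N.pair (j i) (j y)) (val \<tau>)"
 and uniq: "!!z. N (N.pair (j i) z) (val \<tau>) ==> z = j y"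
 shows "EX p:G. dec \<tau> b p i y"
proof (rule ccontr)
 assume a: "~ ?thesis"
 obtain p where p: "p \<in> G" "fmem p (op (chk i) (chk y)) \<tau>" using y(2) fmem_op by blast
 have d: "DP (%q. dec \<tau> b q i y)" by (intro dfn)
 have d2: "DP (%q. EX z. z \<E> b & z ~= y & fmem q (op (chk i) (chk z)) \<tau>)" by (intro dfn)
 obtain p1 where p1: "p1 \<in> G" "!!q. le q p1 ==> ~ dec \<tau> b q i y" using G_meets[OF d] a by blast
 obtain p2 where p2: "p2 \<in> G" "!!q. le q p2 ==> ~ (EX z. z \<E> b & z ~= y & fmem q (op (chk i) (chk z)) \<tau>)"
 proof (rule G_meets[OF d2])
  fix s assume s: "s \<in> G"
  show "~ (EX z. z \<E> b & z ~= y & fmem s (op (chk i) (chk z)) \<tau>)"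
   using uniq fmem_op s by (metis j_inj)
 qed blast
 obtain q where q: "q \<in> G" "le q p" "le q p1" using Gdir p p1 by blast
 obtain s where s: "s \<in> G" "le s q" "le s p2" using Gdir q p2 by blast
 have "~ fmem t (op (chk i) (chk z)) \<tau>" if "z \<E> b" "z ~= y" "le t s" for z t
  using p2(2)[OF le_trans[OF that(3) s(3)]] that(1,2) by blast
 hence "dec \<tau> b s i y" unfolding dec_def
  using y(1) fmem_mono[OF p(2) le_trans[OF s(2) q(2)]] by blast
 thus False using p1(2)[OF le_trans[OF s(2) q(3)]] by blast
qed

lemma dec_fn: assumes f: "N.fn (val \<tau>) (j a)" "!!z. N z (j a) ==> N (N.app (val \<tau>) z) (j b)" and i: "i \<E> a"
 shows "EX y p. p \<in> G & dec \<tau> b p i y & N.app (val \<tau>) (j i) = j y"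
proof -
 obtain y where y: "y \<E> b" "N.app (val \<tau>) (j i) = j y" using f(2)[of "j i"] i unfolding j_mem by blast
 have "EX p:G. dec \<tau> b p i y" by (rule dec_ex) (use y i N.fn_pair[OF f(1)] in auto)
 thus ?thesis using y by blast
qed

lemma dec_app: "N.fn (val \<tau>) (j a) ==> p \<in> G ==> dec \<tau> b p i y ==> N.app (val \<tau>) (j i) = j y"
 using dec_G[of p \<tau> b i y] N.fn_pair[of "val \<tau>" "j a" "j i" "j y"] by auto

text \<open>A descending sequence of length \<nu> decides the values one by one, and a lower bound
  of it decides the whole function. Closure is assumed for all lengths up to \<nu> inclusive, as
  lower bounds are taken on the way and at the end.\<close>

lemma closed_no_new:
 assumes \<nu>: "Ord \<nu>"
  and closed: "!!p F \<alpha>. p \<E> P ==> DF F ==> \<alpha> \<E> succ \<nu> ==> (!!i. i \<E> \<alpha> ==> le (F i) p) ==>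
    (!!i k. i \<E> \<alpha> ==> k \<E> i ==> le (F i) (F k)) ==> EX q. le q p & (ALL i. i \<E> \<alpha> --> le q (F i))"
  and f: "N.fn f (j \<nu>)" "!!z. N z (j \<nu>) ==> N (N.app f z) (j b)"
 shows "EX g. fn g \<nu> & f = j g & (ALL i. i \<E> \<nu> --> app g i \<E> b)"
proof -
 obtain \<tau> where \<tau>: "f = val \<tau>" using val_ex by blast
 let ?D = "%q i. EX y. dec \<tau> b q i y"
 have d1: "DP (%q. EX i. i \<E> \<nu> & (ALL s. le s q --> ~ ?D s i))" by (intro dfn)
 obtain p where p: "p \<in> G" "!!q. le q p ==> ~ (EX i. i \<E> \<nu> & (ALL s. le s q --> ~ ?D s i))"
 proof (rule G_meets[OF d1])
  fix q assume q: "q \<in> G"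
  show "~ (EX i. i \<E> \<nu> & (ALL s. le s q --> ~ ?D s i))"
  proof
   assume "EX i. i \<E> \<nu> & (ALL s. le s q --> ~ ?D s i)"
   then obtain i where i: "i \<E> \<nu>" "!!s. le s q ==> ~ ?D s i" by blast
   obtain y p where y: "p \<in> G" "dec \<tau> b p i y" using dec_fn[of \<tau> \<nu> b i] f i(1) unfolding \<tau> by blast
   obtain s where "le s p" "le s q" using Gdir q y by blast
   thus False using i(2) dec_mono y(2) by blast
  qed
 qed blast
 have d2: "DP (%q. ALL i. i \<E> \<nu> --> ?D q i)" by (intro dfn)
 have "EX s:G. le s p & (ALL i. i \<E> \<nu> --> ?D s i)"
 proof (rule Gdense[OF p(1) d2])
  fix p0 assume p0: "le p0 p"
  have dd: "!!f i. DP (%q. le q p0 & (ALL k. k \<E> i --> le q (app f k)) & ?D q i)" by (intro dfn)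
  have "EX c. ALL x. x \<E> diff (Pow P) (sing emp) --> app c x \<E> x"
   by (rule choice_ax) (use empI in "auto; metis")
  then obtain c where c: "!!x. el x <= el P ==> x ~= emp ==> app c x \<E> x" by auto
  \<comment> \<open>The candidates at step \<open>i\<close>: below \<open>p0\<close>, below the
    conditions chosen before, and deciding the value at \<open>i\<close>.\<close>
  let ?S = "%i f. Sep P (%q. le q p0 & (ALL k. k \<E> i --> le q (app f k)) & ?D q i)"
  have "DF2 (%i f. app c (?S i f))" by (intro dfn)
  from Ord_rec[OF this] obtain F where F: "DF F" "!!i. Ord i ==> F i = app c (?S i (lam i F))" by blast
  note [dfn] = DFD[OF F(1)]
  have "i \<E> \<nu> --> le (F i) p0 & (ALL k. k \<E> i --> le (F i) (F k)) & ?D (F i) i" if "Ord i" for i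
  proof (rule Ord_induct[of "%i. i \<E> \<nu> --> le (F i) p0 & (ALL k. k \<E> i --> le (F i) (F k)) & ?D (F i) i"], intro dfn, intro impI)
   fix i assume i: "Ord i" "i \<E> \<nu>" and IH: "!!k. k \<E> i ==> k \<E> \<nu> --> le (F k) p0 & (ALL l. l \<E> k --> le (F k) (F l)) & ?D (F k) k"
   have k: "k \<E> i ==> k \<E> \<nu>" for k using Ord_trans[OF \<nu> i(2)] .
   have "EX q. le q p0 & (ALL k. k \<E> i --> le q (F k))"
    by (rule closed) (use leD(1)[OF p0] F(1) i IH k in auto)
   then obtain q where q: "le q p0" "!!k. k \<E> i ==> le q (F k)" by blast
   then obtain s where s: "le s q" "?D s i" using p(2)[of q] i le_trans p0 by blast
   have sS: "s \<E> ?S i (lam i F)" unfolding mem_Sep[OF dd] using s q le_trans leD(1) app_lam[OF F(1)] by metis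
   hence "?S i (lam i F) ~= emp" by (metis mem_emp)
   hence "F i \<E> ?S i (lam i F)" unfolding F(2)[OF i(1)]
    by (intro c) (auto simp: mem_Sep[OF dd])
   thus "le (F i) p0 & (ALL k. k \<E> i --> le (F i) (F k)) & ?D (F i) i" unfolding mem_Sep[OF dd] using app_lam[OF F(1)] by metis
  qed (rule that)
  hence F': "le (F i) p0" "!!k. k \<E> i ==> le (F i) (F k)" "?D (F i) i" if "i \<E> \<nu>" for i
   using that Ord_mem[OF \<nu>] by blast+
  have "EX q. le q p0 & (ALL k. k \<E> \<nu> --> le q (F k))" by (rule closed) (use leD(1)[OF p0] F(1) F' in auto)
  thus "EX q. le q p0 & (ALL i. i \<E> \<nu> --> ?D q i)" using F'(3) dec_mono by blast
 qed
 then obtain s where s: "s \<in> G" "!!i. i \<E> \<nu> ==> ?D s i" by blast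
 have "DP2 (%i y. dec \<tau> b s i y)" by (intro dfn)
 from choice[OF this, of \<nu>] s(2) obtain g where g: "DF g" "!!i. i \<E> \<nu> ==> dec \<tau> b s i (g i)" by blast
 have "f = j (lam \<nu> g)"
 proof (rule N.fn_ext[OF f(1) j_fn(1)[OF fn_lam[OF g(1)]]])
  fix x assume "N x (j \<nu>)"
  then obtain i where i: "i \<E> \<nu>" "x = j i" unfolding j_mem by blast
  show "N.app f x = N.app (j (lam \<nu> g)) x"
   using dec_app[OF f(1)[unfolded \<tau>] s(1) g(2)[OF i(1)]] j_fn(2)[OF fn_lam[OF g(1)] i(1)] app_lam[OF g(1) i(1)] i(2) \<tau> by simp
 qed
 moreover have "app (lam \<nu> g) i \<E> b" if "i \<E> \<nu>" for i using g(2)[OF that] app_lam[OF g(1) that] unfolding dec_def by simp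
 ultimately show ?thesis using fn_lam[OF g(1)] by blast
qed

lemma closed_no_new_subsets:
 assumes \<nu>: "Ord \<nu>"
  and closed: "!!p F \<alpha>. p \<E> P ==> DF F ==> \<alpha> \<E> succ \<nu> ==> (!!i. i \<E> \<alpha> ==> le (F i) p) ==>
    (!!i k. i \<E> \<alpha> ==> k \<E> i ==> le (F i) (F k)) ==> EX q. le q p & (ALL i. i \<E> \<alpha> --> le q (F i))"
 shows "N.Pow (j \<nu>) = j (Pow \<nu>)"
proof (rule N.ext)
 fix X
 show "N X (N.Pow (j \<nu>)) <-> N X (j (Pow \<nu>))"
 proof
  assume "N X (N.Pow (j \<nu>))"
  hence X: "N z X ==> N z (j \<nu>)" for z by auto
  \<comment> \<open>A subset is coded by its characteristic function, where the value
    \<open>emp\<close> stands for membership.\<close>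
  let ?b = "upair emp (sing emp)"
  have ne: "emp ~= sing emp" by (metis mem_sing mem_emp)
  have d: "N.DF (%z. if N z X then j emp else j (sing emp))" by (intro dfn)
  define f where "f = N.lam (j \<nu>) (%z. if N z X then j emp else j (sing emp))"
  have "EX g. fn g \<nu> & f = j g & (ALL i. i \<E> \<nu> --> app g i \<E> ?b)"
   by (rule closed_no_new[OF \<nu> closed]) (use N.fn_lam[OF d] in "auto simp: f_def N.app_lam[OF d]")
  then obtain g where g: "fn g \<nu>" "f = j g" by blast
  have dg: "DP (%i. app g i = emp)" by (intro dfn)
  have "X = j (Sep \<nu> (%i. app g i = emp))"
  proof (rule N.ext)
   fix z
   have "N (j i) X <-> app g i = emp" if "i \<E> \<nu>" for i
    using j_fn(2)[OF g(1) that] N.app_lam[OF d, of "j i" "j \<nu>"] that ne unfolding g(2)[symmetric] f_def by (auto split: if_splits)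
   thus "N z X <-> N z (j (Sep \<nu> (%i. app g i = emp)))" using X unfolding j_mem mem_Sep[OF dg] by metis
  qed
  moreover have "Sep \<nu> (%i. app g i = emp) \<E> Pow \<nu>" by (auto simp: mem_Sep[OF dg])
  ultimately show "N X (j (Pow \<nu>))" by simp
 next
  assume "N X (j (Pow \<nu>))"
  thus "N X (N.Pow (j \<nu>))" unfolding j_mem by (auto simp: j_mem subset_eq)
 qed
qed

end

text \<open>Adds a surjection of the successor cardinal of \<mu> onto the power set of \<mu> by
  conditions of size at most \<mu>. With \<mu> = \<omega> it forces CH, and with \<mu> = \<omega>1
  it bounds the power set of \<omega>1 by \<omega>2.\<close>

locale collapse = zfc E for E :: "nat => nat => bool" (infix \<open>\<E>\<close> 50) +
 fixes \<mu> :: nat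
 assumes Ord_mu: "Ord \<mu>" and mu_infinite: "el omega <= el \<mu>" and mu_square: "lep (prod \<mu> \<mu>) \<mu>"
begin

definition "\<kappa> = hartogs \<mu>"
definition "Cond = Union (Repl \<kappa> (%\<beta>. Funs \<beta> (Pow \<mu>)))"
definition "Cond_le = Sep (prod Cond Cond) (%z. el (p2 z) <= el (p1 z))"

lemma mem_Cond: "p \<E> Cond <-> (EX \<beta>. \<beta> \<E> \<kappa> & fn p \<beta> & (ALL i. i \<E> \<beta> --> app p i \<E> Pow \<mu>))"
proof -
 have d: "DF (%\<beta>. Funs \<beta> (Pow \<mu>))" by (intro dfn)
 show ?thesis unfolding Cond_def mem_UN[OF d] mem_Funs ..
qed

lemma mem_Cond_le: "pair p q \<E> Cond_le <-> p \<E> Cond & q \<E> Cond & el q <= el p"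
proof -
 have d: "DP (%z. el (p2 z) <= el (p1 z))" by (intro dfn)
 show ?thesis unfolding Cond_le_def mem_Sep[OF d] by simp
qed

lemma Ord_kappa: "Ord \<kappa>" unfolding \<kappa>_def by simp
lemma emp_kappa: "emp \<E> \<kappa>" unfolding \<kappa>_def mem_hartogs by simp

sublocale poset E Cond Cond_le
proof
 have "fn emp emp" by (simp add: fn_def)
 thus "EX p. p \<E> Cond" unfolding mem_Cond using emp_kappa by (intro exI[of _ emp]) simp
qed (auto simp: mem_Cond_le)

lemma le_Cond: "le p q <-> p \<E> Cond & q \<E> Cond & el q <= el p" unfolding le_def mem_Cond_le by blast

lemma Union_Cond:
 assumes C: "!!p. p \<E> C ==> p \<E> Cond" and lin: "!!p q. p \<E> C ==> q \<E> C ==> el p <= el q | el q <= el p" and small: "lep C \<mu>"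
 shows "Union C \<E> Cond"
proof -
 have "DP2 (%p \<beta>. \<beta> \<E> \<kappa> & fn p \<beta> & (ALL i. i \<E> \<beta> --> app p i \<E> Pow \<mu>))" by (intro dfn)
 from choice[OF this, of C] C obtain B where B: "DF B" "!!p. p \<E> C ==> B p \<E> \<kappa> & fn p (B p) & (ALL i. i \<E> B p --> app p i \<E> Pow \<mu>)"
  unfolding mem_Cond by blast
 let ?\<beta> = "Union (Repl C B)"
 have "Ord ?\<beta>" by (rule Ord_Union) (use B Ord_mem[OF Ord_kappa] in "auto simp: mem_Repl[OF B(1)]")
 moreover have "lep ?\<beta> \<mu>" by (rule lep_UN[OF B(1) small _ mu_square]) (use B(2) in \<open>auto simp: \<kappa>_def mem_hartogs\<close>)
 ultimately have bk: "?\<beta> \<E> \<kappa>" by (simp add: \<kappa>_def mem_hartogs)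
 have mem: "pair i y \<E> Union C <-> (EX p. p \<E> C & i \<E> B p & y = app p i)" for i y
  unfolding mem_Union using fn_pair B(2) by metis
 have uniq: "app p i = app q i" if pq: "p \<E> C" "q \<E> C" "i \<E> B p" "i \<E> B q" for p q i
 proof -
  have "pair i (app p i) \<E> p" "pair i (app q i) \<E> q" using fn_pair B(2) pq by metis+
  hence "pair i (app p i) \<E> q | pair i (app q i) \<E> p" using lin[OF pq(1,2)] by auto
  thus ?thesis using fn_pair B(2) pq by metis
 qed
 have "fn (Union C) ?\<beta>" unfolding fn_def
 proof (intro conjI allI impI)
  fix z assume "z \<E> Union C"
  then obtain p where p: "p \<E> C" "z \<E> p" by auto
  then obtain i where "i \<E> B p" "z = pair i (app p i)" using fn_mem[of p "B p"] B(2) by blast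
  thus "EX x y. x \<E> ?\<beta> & z = pair x y" using p unfolding mem_UN[OF B(1)] by blast
 next
  fix x assume "x \<E> ?\<beta>"
  then obtain p where p: "p \<E> C" "x \<E> B p" unfolding mem_UN[OF B(1)] by blast
  thus "EX y. pair x y \<E> Union C & (ALL z. pair x z \<E> Union C --> z = y)"
   unfolding mem using uniq by blast
 qed
 moreover have "app (Union C) i \<E> Pow \<mu>" if i: "i \<E> ?\<beta>" for i
 proof -
  have "pair i (app (Union C) i) \<E> Union C" using fn_pair[OF \<open>fn (Union C) ?\<beta>\<close>] i by blast
  thus ?thesis unfolding mem using B(2) by metis
 qed
 ultimately show ?thesis using bk unfolding mem_Cond by blast
qed

lemma Cond_closed:
 assumes p: "p \<E> Cond" and F: "DF F" and \<alpha>: "\<alpha> \<E> succ \<mu>" and Fp: "!!i. i \<E> \<alpha> ==> le (F i) p"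
  and mono: "!!i k. i \<E> \<alpha> ==> k \<E> i ==> le (F i) (F k)"
 shows "EX q. le q p & (ALL i. i \<E> \<alpha> --> le q (F i))"
proof -
 \<comment> \<open>The condition \<open>p\<close> is added for the sake of the empty
   sequence.\<close>
 let ?C = "un (sing p) (Repl \<alpha> F)"
 have O: "Ord \<alpha>" using \<alpha> Ord_mu Ord_mem by auto
 have "lep \<alpha> \<mu>" using \<alpha> Ord_trans[OF Ord_mu] by (intro lep_subset) auto
 hence "lep (Repl \<alpha> F) \<mu>" using lep_Repl[OF F] lep_trans by blast
 moreover have "lep (sing p) \<mu>"
 proof -
  have "DF (%x. emp)" by (rule DT_const)
  thus ?thesis by (rule lepI) (use emp_omega mu_infinite in "auto simp: subset_eq")
 qed
 ultimately have "lep ?C \<mu>" using lep_un mu_square mu_infinite by blast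
 moreover have CC: "q \<E> Cond" if "q \<E> ?C" for q using that p Fp leD by (auto simp: mem_Repl[OF F])
 moreover have "el q <= el q' | el q' <= el q" if q: "q \<E> ?C" "q' \<E> ?C" for q q'
 proof -
  have 1: "el p <= el (F i)" if "i \<E> \<alpha>" for i using Fp[OF that] le_Cond by blast
  have 2: "el (F i) <= el (F k) | el (F k) <= el (F i)" if "i \<E> \<alpha>" "k \<E> \<alpha>" for i k
   using Ord_linear[of i k] Ord_mem[OF O] that mono le_Cond by blast
  show ?thesis using q 1 2 by (simp add: mem_Repl[OF F]) blast
 qed
 ultimately have "Union ?C \<E> Cond" by (intro Union_Cond) blast+
 moreover have "el q <= el (Union ?C)" if "q \<E> ?C" for q using that by auto
 ultimately have "le (Union ?C) q" if "q \<E> ?C" for q using that CC unfolding le_Cond by blast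
 thus ?thesis by (intro exI[of _ "Union ?C"]) (simp add: mem_Repl[OF F], blast)
qed

end

locale collapse_ext = collapse E \<mu> + generic_ext E Cond Cond_le G N val
 for E (infix \<open>\<E>\<close> 50) and \<mu> G N val
begin

lemma no_new_functions:
 assumes "\<nu> \<E> succ \<mu>" "N.fn f (j \<nu>)" "!!z. N z (j \<nu>) ==> N (N.app f z) (j b)"
 shows "EX g. fn g \<nu> & f = j g & (ALL i. i \<E> \<nu> --> app g i \<E> b)"
proof (rule closed_no_new)
 show "Ord \<nu>" using assms(1) Ord_mu Ord_mem by auto
 fix p F \<alpha> assume a: "p \<E> Cond" "DF F" "\<alpha> \<E> succ \<nu>"
 have "\<alpha> \<E> succ \<mu>" using assms(1) a(3) Ord_trans[OF Ord_mu] by auto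
 thus "(!!i. i \<E> \<alpha> ==> le (F i) p) ==>
    (!!i k. i \<E> \<alpha> ==> k \<E> i ==> le (F i) (F k)) ==> EX q. le q p & (ALL i. i \<E> \<alpha> --> le q (F i))"
  by (rule Cond_closed[OF a(1,2)])
qed (use assms in auto)

lemma no_new_subsets:
 assumes "\<nu> \<E> succ \<mu>" shows "N.Pow (j \<nu>) = j (Pow \<nu>)"
proof (rule closed_no_new_subsets)
 show "Ord \<nu>" using assms(1) Ord_mu Ord_mem by auto
 fix p F \<alpha> assume a: "p \<E> Cond" "DF F" "\<alpha> \<E> succ \<nu>"
 have "\<alpha> \<E> succ \<mu>" using assms(1) a(3) Ord_trans[OF Ord_mu] by auto
 thus "(!!i. i \<E> \<alpha> ==> le (F i) p) ==>
    (!!i k. i \<E> \<alpha> ==> k \<E> i ==> le (F i) (F k)) ==> EX q. le q p & (ALL i. i \<E> \<alpha> --> le q (F i))"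
  by (rule Cond_closed[OF a(1,2)])
qed

text \<open>The union of the filter maps \<kappa> onto the old power set of \<mu>, which is also the
  new one because closure adds no subsets of \<mu>.\<close>

lemma collapses: "N.lep (N.Pow (j \<mu>)) (N.hartogs (j \<mu>))"
proof -
 \<comment> \<open>The canonical name of the filter: \<open>chk p\<close> is put in by
   \<open>p\<close>.\<close>
 define \<Gamma> where "\<Gamma> = val (Sep (prod (Repl Cond chk) Cond) (%z. p1 z = chk (p2 z)))"
 have d: "DP (%z. p1 z = chk (p2 z))" and d': "DF chk" by (intro dfn)+
 have \<Gamma>: "N z \<Gamma> <-> (EX p. p \<in> G & z = j p)" for z
  unfolding \<Gamma>_def val_mem mem_Sep[OF d] j_def using GP by (auto simp: mem_Repl[OF d'])
 define g where "g = N.Union \<Gamma>"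
 have dg: "N.DF (N.app g)" by (intro dfn)
 have g: "N (N.pair (j i) z) g <-> (EX p. p \<in> G & (EX y. pair i y \<E> p & z = j y))" for i z
 proof -
  have "N (N.pair (j i) z) (j p) <-> (EX y. pair i y \<E> p & z = j y)" if pC: "p \<E> Cond" for p
  proof
   assume "N (N.pair (j i) z) (j p)"
   then obtain w where w: "w \<E> p" "N.pair (j i) z = j w" unfolding j_mem by blast
   obtain \<beta> where "fn p \<beta>" using pC mem_Cond by blast
   then obtain x y where "w = pair x y" using w(1) unfolding fn_def by blast
   thus "EX y. pair i y \<E> p & z = j y" using w j_pair by auto
  next
   assume "EX y. pair i y \<E> p & z = j y"
   thus "N (N.pair (j i) z) (j p)" using j_pair j_mem_iff by metis
  qed
  thus ?thesis unfolding g_def N.mem_Union \<Gamma> using GP by blast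
 qed
 have app: "N.app g (j i) = j y" if p: "p \<in> G" "pair i y \<E> p" for p i y
 proof (rule N.app_eq)
  show "N (N.pair (j i) (j y)) g" using p g by blast
  fix z assume "N (N.pair (j i) z) g"
  then obtain q y' where q: "q \<in> G" "pair i y' \<E> q" "z = j y'" unfolding g by blast
  obtain s where s: "s \<in> G" "le s p" "le s q" using Gdir p q by blast
  hence "pair i y \<E> s" "pair i y' \<E> s" using p q unfolding le_Cond by auto
  moreover obtain \<beta> where "fn s \<beta>" using GP[OF s(1)] mem_Cond by blast
  ultimately show "z = j y" using fn_pair q(3) by metis
 qed
 have "N.lep (j (Pow \<mu>)) (j \<kappa>)"
 proof (rule N.lep_surj[OF dg])
  fix x assume "N x (j (Pow \<mu>))"
  then obtain y where y: "y \<E> Pow \<mu>" "x = j y" unfolding j_mem by blast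
  have d: "DP (%p. EX i. i \<E> \<kappa> & pair i y \<E> p)" by (intro dfn)
  obtain p where p: "p \<in> G" using Gne by blast
  have "EX s:G. le s p & (EX i. i \<E> \<kappa> & pair i y \<E> s)"
  proof (rule Gdense[OF p d])
   fix q assume q: "le q p"
   hence qC: "q \<E> Cond" using leD by blast
   then obtain \<beta> where b: "\<beta> \<E> \<kappa>" "fn q \<beta>" "!!i. i \<E> \<beta> ==> app q i \<E> Pow \<mu>" unfolding mem_Cond by blast
   \<comment> \<open>The domain of a condition is an ordinal \<beta>, so a missing value
     \<open>y\<close> can be appended at \<beta>.\<close>
   define s where "s = un q (sing (pair \<beta> y))"
   have s: "fn s (succ \<beta>)" unfolding fn_def s_def
    using fn_mem[OF b(2)] by auto
   have "app s i \<E> Pow \<mu>" if i: "i \<E> succ \<beta>" for i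
   proof -
    have "pair i (app s i) \<E> s" using fn_pair[OF s] i by blast
    hence "pair i (app s i) \<E> q | app s i = y" unfolding s_def by auto
    thus ?thesis using y(1) b(3) fn_pair[OF b(2)] by metis
   qed
   moreover have "succ \<beta> \<E> \<kappa>" using hartogs_succ[OF mu_infinite] b(1) unfolding \<kappa>_def by blast
   ultimately have "s \<E> Cond" using s unfolding mem_Cond by blast
   hence "le s q" using qC unfolding le_Cond by (auto simp: s_def)
   moreover have "pair \<beta> y \<E> s" by (simp add: s_def)
   ultimately show "EX s. le s q & (EX i. i \<E> \<kappa> & pair i y \<E> s)" using b(1) by blast
  qed
  then obtain s i where "s \<in> G" "i \<E> \<kappa>" "pair i y \<E> s" by blast
  thus "EX z. N z (j \<kappa>) & N.app g z = x" using app y(2) by (intro exI[of _ "j i"]) auto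
 qed
 moreover have "N.lep (j \<kappa>) (N.hartogs (j \<mu>))"
 proof (rule N.lep_subset)
  have "N z (N.hartogs (j \<mu>))" if "N z (j \<kappa>)" for z
  proof -
   obtain \<beta> where "\<beta> \<E> \<kappa>" "z = j \<beta>" using \<open>N z (j \<kappa>)\<close> unfolding j_mem by blast
   thus ?thesis unfolding N.mem_hartogs using N_Ord j_lep by (auto simp: \<kappa>_def mem_hartogs)
  qed
  thus "N.el (j \<kappa>) <= N.el (N.hartogs (j \<mu>))" by auto
 qed
 ultimately show ?thesis using no_new_subsets[of \<mu>] N.lep_trans by simp
qed

end

lemma force_CH: assumes "zfc (E :: nat => nat => bool)"
 shows "EX N :: nat => nat => bool. zfc N & zf.lep N (zf.Pow N (zf.omega N)) (zfc.hartogs N (zf.omega N))"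
proof -
 interpret zfc E by fact
 interpret collapse E omega by unfold_locales (simp_all add: omega_square)
 obtain p where "E (p) Cond" using P_nonempty by blast
 then obtain G where "generic G" using generic_ex by blast
 then obtain N val where "generic_ext E Cond Cond_le G N val" using generic_ext_ex by blast
 then interpret generic_ext E Cond Cond_le G N val .
 interpret collapse_ext E omega G N val ..
 have "zfc N" ..
 thus ?thesis using collapses unfolding j_omega by blast
qed

text \<open>The second collapse is closed under sequences of length \<omega>1. So it adds no subsets
  of \<omega>, which keeps CH, and it preserves \<omega>1.\<close>

lemma force_CH_GCH: assumes "zfc (E :: nat => nat => bool)" and CH: "zf.lep E (zf.Pow E (zf.omega E)) (zfc.hartogs E (zf.omega E))"
 shows "EX N :: nat => nat => bool. zfc N & zf.lep N (zf.Pow N (zf.omega N)) (zfc.hartogs N (zf.omega N)) &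
   zf.lep N (zf.Pow N (zfc.hartogs N (zf.omega N))) (zfc.hartogs N (zfc.hartogs N (zf.omega N)))"
proof -
 interpret zfc E by fact
 interpret collapse E omega1 by unfold_locales (simp_all add: omega1_square omega_sub_omega1)
 obtain p where "E (p) Cond" using P_nonempty by blast
 then obtain G where "generic G" using generic_ex by blast
 then obtain N val where "generic_ext E Cond Cond_le G N val" using generic_ext_ex by blast
 then interpret generic_ext E Cond Cond_le G N val .
 interpret collapse_ext E omega1 G N val ..
 have N: "zfc N" ..
 have om: "E omega (succ omega1)" using mem_hartogs_self by simp
 have "j omega1 = N.omega1"
 proof (rule N.el_inj, rule antisym)
  have "N z N.omega1" if z: "N z (j omega1)" for z
  proof -
   obtain \<beta> where "E (\<beta>) omega1" "z = j \<beta>" using z unfolding j_mem by blast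
   thus ?thesis unfolding N.mem_hartogs using N_Ord j_lep[of \<beta> omega] by (auto simp: mem_hartogs j_omega)
  qed
  thus "N.el (j omega1) <= N.el N.omega1" by auto
  have "~ N.lep (j omega1) N.omega"
  proof
   assume "N.lep (j omega1) N.omega"
   then obtain f where f: "N.DF f" "!!x. N x (j omega1) ==> N (f x) N.omega"
    "!!x y. N x (j omega1) ==> N y (j omega1) ==> f x = f y ==> x = y" using N.lepE by blast
   note [dfn] = DFD[OF f(1)]
   have eo: "E (emp) omega1" using omega_sub_omega1 emp_omega by (auto simp: subset_eq)
   \<comment> \<open>The injection of \<omega>1 into \<omega> is turned round into a map on
     \<omega>, which already belongs to the ground model and would be onto \<omega>1 there.\<close>
   have "N.DP2 (%n x. N x (j omega1) & ((EX y. N y (j omega1) & f y = n) --> f x = n))" by (intro dfn)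
   moreover have "EX x. N x (j omega1) & ((EX y. N y (j omega1) & f y = n) --> f x = n)" for n
    using eo j_mem_iff[of emp omega1] by blast
   ultimately have "EX h. N.DF h & (ALL n. N n (j omega) --> N (h n) (j omega1) & ((EX y. N y (j omega1) & f y = n) --> f (h n) = n))"
    by (intro N.choice)
   then obtain h where h: "N.DF h"
    "!!n. N n (j omega) ==> N (h n) (j omega1) & ((EX y. N y (j omega1) & f y = n) --> f (h n) = n)"
    by blast
   have "EX g. fn g omega & N.lam (j omega) h = j g & (ALL i. E (i) omega --> E (app g i) omega1)"
    by (rule no_new_functions[OF om]) (use h N.fn_lam[OF h(1)] in "simp_all add: N.app_lam[OF h(1)]")
   then obtain g where g: "fn g omega" "N.lam (j omega) h = j g" by blast
   have "DF (app g)" by (intro dfn)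
   hence "lep omega1 omega"
   proof (rule lep_surj)
    fix \<beta> assume "E (\<beta>) omega1"
    hence b: "N (j \<beta>) (j omega1)" by simp
    hence "N (f (j \<beta>)) (j omega)" using f(2) j_omega by simp
    then obtain n where n: "E (n) omega" "f (j \<beta>) = j n" unfolding j_mem by blast
    have "h (j n) = j \<beta>" using h(2)[of "j n"] n f(3) b by (metis j_mem_iff)
    hence "j (app g n) = j \<beta>" using j_fn(2)[OF g(1) n(1)] g(2) N.app_lam[OF h(1), of "j n" "j omega"] n(1) by simp
    thus "EX n. E (n) omega & app g n = \<beta>" using n(1) by auto
   qed
   thus False using not_lep_hartogs by blast
  qed
  thus "N.el N.omega1 <= N.el (j omega1)" by (intro N.hartogs_le N_Ord) simp_all
 qed
 note om1 = this
 have "N.lep (N.Pow N.omega) N.omega1"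
  using j_lep[OF CH] no_new_subsets[OF om] om1 j_omega by simp
 thus ?thesis using collapses N unfolding om1 by blast
qed

subsection \<open>Systems of distinct representatives\<close>

context zfc begin

definition two where "two = upair emp (sing emp)"
lemma two_cases: "i \<E> two <-> i = emp | i = sing emp" by (simp add: two_def)
lemma emp_sing [simp]: "emp ~= sing a" "sing a ~= emp" by (metis mem_sing mem_emp)+

text \<open>
 Bernstein's division by two. To represent \<open>a\<close> by the point \<open>q\<close> of its claim \<open>(a, 0)\<close>, the owner \<open>p\<close>
 of the other copy of \<open>q\<close> inherits the claim \<open>(a, 1)\<close>; should \<open>p\<close> end up using it, \<open>a\<close> and \<open>p\<close> swap.
\<close>

lemma division_by_two:
 assumes "fin A"
 shows "ALL f. (ALL p i p' i'. p \<E> A --> i \<E> two --> p' \<E> A --> i' \<E> two -->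
    app f (pair p i) = app f (pair p' i') --> p = p' & i = i') -->
   (ALL p i. p \<E> A --> i \<E> two --> (EX q u. u \<E> two & app f (pair p i) = pair q u)) -->
   (EX g. (ALL p. p \<E> A --> (EX i. i \<E> two & app g p = p1 (app f (pair p i)))) &
    (ALL p p'. p \<E> A --> p' \<E> A --> app g p = app g p' --> p = p'))"
  (is "ALL f. ?inj A f --> ?rng A f --> ?ex A f")
proof (rule fin_induct[of "%A. ALL f. ?inj A f --> ?rng A f --> ?ex A f"], intro dfn)
 show "ALL f. ?inj emp f --> ?rng emp f --> ?ex emp f" by simp
 fix A a assume IH: "ALL f. ?inj A f --> ?rng A f --> ?ex A f" and a: "~ a \<E> A"
 show "ALL f. ?inj (un A (sing a)) f --> ?rng (un A (sing a)) f --> ?ex (un A (sing a)) f"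
 proof (intro allI impI)
  fix f assume inj: "?inj (un A (sing a)) f" and rng: "?rng (un A (sing a)) f"
  have inj': "app f (pair p i) = app f (pair p' i') ==> p = p' & i = i'"
   if "p \<E> A | p = a" "i \<E> two" "p' \<E> A | p' = a" "i' \<E> two" for p i p' i'
   using inj[rule_format, of p i p' i'] that by simp
  have t0: "emp \<E> two" and t1: "sing emp \<E> two" by (auto simp: two_cases)
  obtain q \<E>' where q: "\<E>' \<E> two" "app f (pair a emp) = pair q \<E>'" using rng[rule_format, of a emp] t0 by auto
  show "?ex (un A (sing a)) f"
  proof (cases "EX p \<delta>. p \<E> A & \<delta> \<E> two & p1 (app f (pair p \<delta>)) = q")
   case False
   have "?inj A f" "?rng A f" using inj rng unfolding mem_un by blast+
   then obtain g where g: "!!p. p \<E> A ==> EX i. i \<E> two & app g p = p1 (app f (pair p i))"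
    "!!p p'. p \<E> A ==> p' \<E> A ==> app g p = app g p' ==> p = p'" using IH by blast
   have d: "DF (%p. if p = a then q else app g p)" by (intro dfn)
   let ?g = "lam (un A (sing a)) (%p. if p = a then q else app g p)"
   have 1: "app ?g p = (if p = a then q else app g p)" if "p \<E> un A (sing a)" for p using app_lam[OF d that] .
   have 2: "app g p ~= q" if "p \<E> A" for p using g(1)[OF that] False that by metis
   show ?thesis
   proof (rule exI[of _ ?g], intro conjI allI impI)
    fix p assume p: "p \<E> un A (sing a)"
    show "EX i. i \<E> two & app ?g p = p1 (app f (pair p i))"
     unfolding 1[OF p] using p g(1) q t0 by (cases "p = a") auto
    fix p' assume p': "p' \<E> un A (sing a)" and e: "app ?g p = app ?g p'"
    show "p = p'" using e p p' 2 g(2) unfolding 1[OF p] 1[OF p'] by (auto split: if_splits)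
   qed
  next
   case True
   then obtain p \<delta> where p: "p \<E> A" "\<delta> \<E> two" "p1 (app f (pair p \<delta>)) = q" by blast
   have d: "DF (%z. if z = pair p \<delta> then app f (pair a (sing emp)) else app f z)" by (intro dfn)
   define f' where "f' = lam (prod A two) (%z. if z = pair p \<delta> then app f (pair a (sing emp)) else app f z)"
   have f': "app f' (pair p' i) = (if p' = p & i = \<delta> then app f (pair a (sing emp)) else app f (pair p' i))" if "p' \<E> A" "i \<E> two" for p' i
    unfolding f'_def using that by (subst app_lam[OF d]) auto
   \<comment> \<open>Both copies of \<open>q\<close> are taken, by the claims of \<open>a\<close>
     and of \<open>p\<close>, so no third claim has the point \<open>q\<close>.\<close>
   have unit: "v = app f (pair a emp) | v = app f (pair p \<delta>)" if vq: "p1 v = q" "EX q u. u \<E> two & v = pair q u" for v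
   proof -
    obtain u where u: "u \<E> two" "v = pair q u" using vq by auto
    obtain u' where u': "u' \<E> two" "app f (pair p \<delta>) = pair q u'" using rng p by (auto; metis p1_pair)
    have "u' ~= \<E>'" using inj'[of p \<delta> a emp] p(1,2) t0 a q(2) u'(2) by auto
    thus ?thesis using u u' q unfolding two_cases by auto
   qed
   have "?inj A f'"
   proof (intro allI impI)
    fix s i s' i' assume s: "s \<E> A" "i \<E> two" "s' \<E> A" "i' \<E> two" "app f' (pair s i) = app f' (pair s' i')"
    have sa: "s ~= a" "s' ~= a" using s a by auto
    show "s = s' & i = i'"
     using s(5) inj'[of s i s' i'] inj'[of a "sing emp" s' i'] inj'[of s i a "sing emp"] s(1-4) sa t1
     unfolding f'[OF s(1,2)] f'[OF s(3,4)] by (auto split: if_splits)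
   qed
   moreover have "?rng A f'"
   proof (intro allI impI)
    fix s i assume s: "s \<E> A" "i \<E> two"
    thus "EX q u. u \<E> two & app f' (pair s i) = pair q u" unfolding f'[OF s] using rng t1 by auto
   qed
   ultimately obtain g where g: "!!p. p \<E> A ==> EX i. i \<E> two & app g p = p1 (app f' (pair p i))"
    "!!p p'. p \<E> A ==> p' \<E> A ==> app g p = app g p' ==> p = p'" using IH by blast
   have gq: "app g s ~= q" if s: "s \<E> A" for s
   proof
    assume e: "app g s = q"
    obtain i where i: "i \<E> two" "p1 (app f' (pair s i)) = q" using g(1)[OF s] e by auto
    have "EX q u. u \<E> two & app f' (pair s i) = pair q u" using \<open>?rng A f'\<close> s i by blast
    hence "app f' (pair s i) = app f (pair a emp) | app f' (pair s i) = app f (pair p \<delta>)" using unit i by blast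
    moreover have sa: "s ~= a" "p ~= a" using s a p by auto
    ultimately show False
     using inj'[of a "sing emp" a emp] inj'[of a "sing emp" p \<delta>] inj'[of s i a emp] inj'[of s i p \<delta>] t0 t1 p(1,2) s i(1)
     unfolding f'[OF s i(1)] by (auto split: if_splits)
   qed
   define q2 where "q2 = p1 (app f (pair a (sing emp)))"
   define B where "B <-> (EX i. i \<E> two & i ~= \<delta> & app g p = p1 (app f (pair p i)))"
   have nB: "app g p = q2" if "~ B" using g(1)[OF p(1)] that f'[OF p(1)] p(2) unfolding B_def q2_def by (auto split: if_splits)
   let ?h = "%s. if s = a then (if B then q else q2) else if s = p & ~ B then q else app g s"
   have d: "DF ?h" by (intro dfn)
   let ?g = "lam (un A (sing a)) ?h"
   have 1: "app ?g s = ?h s" if "s \<E> un A (sing a)" for s using app_lam[OF d that] .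
   show ?thesis
   proof (rule exI[of _ ?g], intro conjI allI impI)
    fix s assume s: "s \<E> un A (sing a)"
    show "EX i. i \<E> two & app ?g s = p1 (app f (pair s i))"
    proof (cases "s = a")
     case True
     thus ?thesis unfolding 1[OF s] using q t0 t1 q2_def by auto
    next
     case False
     hence sA: "s \<E> A" using s by simp
     show ?thesis
     proof (cases "s = p")
      case True thus ?thesis unfolding 1[OF s] using False B_def p by auto
     next
      case sp: False
      obtain i where "i \<E> two" "app g s = p1 (app f' (pair s i))" using g(1)[OF sA] by blast
      thus ?thesis unfolding 1[OF s] using False sp f'[OF sA] by auto
     qed
    qed
    fix s' assume s': "s' \<E> un A (sing a)" and e: "app ?g s = app ?g s'"
    show "s = s'"
    proof (cases B)
     case True
     hence h: "app ?g s = (if s = a then q else app g s)" if "s \<E> un A (sing a)" for s unfolding 1[OF that] by simp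
     show ?thesis using e s s' gq g(2) unfolding h[OF s] h[OF s'] by (metis mem_sing mem_un)
    next
     case False
     hence h: "app ?g s = (if s = a then app g p else if s = p then q else app g s)" if "s \<E> un A (sing a)" for s
      unfolding 1[OF that] using nB by simp
     show ?thesis using e s s' gq g(2) p(1) unfolding h[OF s] h[OF s'] by (metis mem_sing mem_un)
    qed
   qed
  qed
 qed
qed (rule assms)

text \<open>Strings are nested pairs that end in a bit. Splitting off the last bit gives each
  shorter string two claims, which is the shape that \<open>division_by_two\<close>
  consumes.\<close>

definition Str where "Str = (SOME F. DF F & F emp = sing emp & (ALL n. n \<E> omega --> F (succ n) = prod (F n) two))"
lemma Str_ex: "DF Str & Str emp = sing emp & (ALL n. n \<E> omega --> Str (succ n) = prod (Str n) two)"
 unfolding Str_def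
proof (rule someI_ex[of "%F. DF F & F emp = sing emp & (ALL n. n \<E> omega --> F (succ n) = prod (F n) two)"])
 have "DF2 (%n y. prod y two)" by (intro dfn)
 from nat_rec[OF this] show "EX F. DF F & F emp = sing emp & (ALL n. n \<E> omega --> F (succ n) = prod (F n) two)" .
qed
lemma DT_Str [dfn]: "DT s ==> DT (%e. Str (s e))" using DFD Str_ex by blast
lemma Str_emp: "Str emp = sing emp" and Str_succ: "n \<E> omega ==> Str (succ n) = prod (Str n) two" using Str_ex by auto
lemma fin_two: "fin two" using fin_un[OF fin_sing fin_sing, of emp "sing emp"] by (rule fin_subset[rotated]) (auto simp: two_def)
lemma fin_Str: "n \<E> omega ==> fin (Str n)"
 by (rule nat_induct[of "%n. fin (Str n)"], intro dfn) (simp_all add: Str_emp Str_succ fin_prod fin_two)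

text \<open>Downward induction on the level \<open>m\<close>. At level \<open>m\<close> every demand
  with index at least \<open>m\<close> holds one point for each string of length \<open>m\<close>,
  all of these distinct. Passing from \<open>m + 1\<close> to \<open>m\<close>, the demands of index
  \<open>m\<close> enter with their own points, each point is then claimed at most twice, and
  dividing by two leaves half the strings. At level 0 only the empty string is left.\<close>

lemma fin_sdr:
 assumes D: "fin D" and sys: "DF sys" "!!d. d \<E> D ==> sys d \<E> omega" and pt: "DF2 pt"
  and inj: "!!d s d' s'. d \<E> D ==> d' \<E> D ==> sys d = sys d' ==> s \<E> Str (succ (sys d)) ==> s' \<E> Str (succ (sys d)) ==>
    pt d s = pt d' s' ==> d = d' & s = s'"
 shows "EX x. (ALL d. d \<E> D --> (EX s. s \<E> Str (succ (sys d)) & app x d = pt d s)) & (ALL d d'. d \<E> D --> d' \<E> D --> app x d = app x d' --> d = d')"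
proof -
 note [dfn] = DFD[OF sys(1)] DF2D[OF pt]
 let ?\<Phi> = "%m. EX \<phi>. (ALL d s. d \<E> D --> ~ sys d \<E> m --> s \<E> Str m --> (EX t. t \<E> Str (succ (sys d)) & app \<phi> (pair d s) = pt d t)) &
   (ALL d s d' s'. d \<E> D --> ~ sys d \<E> m --> s \<E> Str m --> d' \<E> D --> ~ sys d' \<E> m --> s' \<E> Str m -->
    app \<phi> (pair d s) = app \<phi> (pair d' s') --> d = d' & s = s')"
 have step: "?\<Phi> m" if m: "m \<E> omega" "?\<Phi> (succ m)" for m
 proof -
  obtain \<phi> where \<phi>: "!!d s. d \<E> D ==> ~ sys d \<E> succ m ==> s \<E> Str (succ m) ==> EX t. t \<E> Str (succ (sys d)) & app \<phi> (pair d s) = pt d t"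
   "!!d s d' s'. d \<E> D ==> ~ sys d \<E> succ m ==> s \<E> Str (succ m) ==> d' \<E> D ==> ~ sys d' \<E> succ m ==> s' \<E> Str (succ m) ==>
    app \<phi> (pair d s) = app \<phi> (pair d' s') ==> d = d' & s = s'" using m(2) by blast
  have d: "DP (%p. ~ sys (p1 p) \<E> m)" by (intro dfn)
  define A where "A = Sep (prod D (Str m)) (%p. ~ sys (p1 p) \<E> m)"
  have A: "pair d s \<E> A <-> d \<E> D & s \<E> Str m & ~ sys d \<E> m" for d s unfolding A_def mem_Sep[OF d] by auto
  have A': "p \<E> A ==> EX d s. p = pair d s" for p unfolding A_def mem_Sep[OF d] by (auto simp: mem_prod)
  have "fin A" using fin_prod[OF D fin_Str[OF m(1)]] by (rule fin_subset[rotated]) (auto simp: A_def mem_Sep[OF d])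
  \<comment> \<open>The second component tells the claims of the newcomers (\<open>emp\<close>) from
    those of the older demands (\<open>sing emp\<close>). Within either group the points are
    distinct, so no copy of a point is claimed twice.\<close>
  let ?f = "%z. if sys (p1 (p1 z)) = m then pair (pt (p1 (p1 z)) (pair (p2 (p1 z)) (p2 z))) emp
    else pair (app \<phi> (pair (p1 (p1 z)) (pair (p2 (p1 z)) (p2 z)))) (sing emp)"
  have df: "DF ?f" by (intro dfn)
  define f where "f = lam (prod A two) ?f"
  have f: "app f (pair (pair d s) i) = (if sys d = m then pair (pt d (pair s i)) emp else pair (app \<phi> (pair d (pair s i))) (sing emp))"
   if "pair d s \<E> A" "i \<E> two" for d s i unfolding f_def using that by (subst app_lam[OF df]) auto
  have SS: "pair s i \<E> Str (succ m) <-> s \<E> Str m & i \<E> two" for s i using Str_succ[OF m(1)] by simp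
  have finj: "pair d s = pair d' s' & i = i'"
   if a: "pair d s \<E> A" "i \<E> two" "pair d' s' \<E> A" "i' \<E> two" "app f (pair (pair d s) i) = app f (pair (pair d' s') i')" for d s i d' s' i'
  proof (cases "sys d = m")
   case True
   hence "sys d' = m" "pt d (pair s i) = pt d' (pair s' i')" using a(5) unfolding f[OF a(1,2)] f[OF a(3,4)] by (auto split: if_splits)
   hence "d = d' & pair s i = pair s' i'" using inj[of d d' "pair s i" "pair s' i'"] True a SS unfolding A by auto
   thus ?thesis by simp
  next
   case False
   hence 1: "sys d' ~= m" "app \<phi> (pair d (pair s i)) = app \<phi> (pair d' (pair s' i'))" using a(5) unfolding f[OF a(1,2)] f[OF a(3,4)] by (auto split: if_splits)
   have "d = d' & pair s i = pair s' i'" by (rule \<phi>(2)) (use 1 False a SS A in auto)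
   thus ?thesis by simp
  qed
  have "EX g. (ALL p. p \<E> A --> (EX i. i \<E> two & app g p = p1 (app f (pair p i)))) & (ALL p p'. p \<E> A --> p' \<E> A --> app g p = app g p' --> p = p')"
  proof (rule division_by_two[OF \<open>fin A\<close>, rule_format])
   fix p i p' i' assume "p \<E> A" "i \<E> two" "p' \<E> A" "i' \<E> two" "app f (pair p i) = app f (pair p' i')"
   thus "p = p' & i = i'" using A' finj by metis
  next
   fix p i assume "p \<E> A" "i \<E> two"
   thus "EX q u. u \<E> two & app f (pair p i) = pair q u" using A' f two_cases by metis
  qed
  then obtain g where g: "!!p. p \<E> A ==> EX i. i \<E> two & app g p = p1 (app f (pair p i))" "!!p p'. p \<E> A ==> p' \<E> A ==> app g p = app g p' ==> p = p'" by blast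
  show ?thesis
  proof (rule exI[of _ g], intro conjI allI impI)
   fix d s assume ds: "d \<E> D" "~ sys d \<E> m" "s \<E> Str m"
   hence a: "pair d s \<E> A" unfolding A by blast
   obtain i where i: "i \<E> two" "app g (pair d s) = p1 (app f (pair (pair d s) i))" using g(1)[OF a] by blast
   show "EX t. t \<E> Str (succ (sys d)) & app g (pair d s) = pt d t"
   proof (cases "sys d = m")
    case True thus ?thesis using i f[OF a i(1)] SS ds by (intro exI[of _ "pair s i"]) simp
   next
    case False thus ?thesis using i f[OF a i(1)] SS ds \<phi>(1)[of d "pair s i"] by simp
   qed
   fix d' s' assume "d' \<E> D" "~ sys d' \<E> m" "s' \<E> Str m" "app g (pair d s) = app g (pair d' s')"
   hence "pair d s = pair d' s'" using g(2)[OF a] A by blast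
   thus "d = d'" "s = s'" by simp_all
  qed
 qed
 have "fin (Repl D sys)" by (rule fin_Repl[OF sys(1) D])
 then obtain L where L: "L \<E> omega" "el (Repl D sys) <= el L" using fin_nat_bound[of "Repl D sys"] sys(2) by (auto simp: mem_Repl[OF sys(1)])
 hence "d \<E> D ==> sys d \<E> L" for d unfolding sub_iff mem_Repl[OF sys(1)] by blast
 \<comment> \<open>No demand has an index as large as \<open>L\<close>, so the induction starts
   vacuously.\<close>
 hence top: "?\<Phi> L" by blast
 have "?\<Phi> emp"
 proof (rule ccontr)
  assume n: "~ ?\<Phi> emp"
  have "~ ?\<Phi> n" if "n \<E> omega" for n
   by (rule nat_induct[of "%n. ~ ?\<Phi> n"], intro dfn) (use n step that in blast)+
  thus False using L(1) top by blast
 qed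
 then obtain \<phi> where \<phi>: "!!d. d \<E> D ==> EX t. t \<E> Str (succ (sys d)) & app \<phi> (pair d emp) = pt d t"
   "!!d d'. d \<E> D ==> d' \<E> D ==> app \<phi> (pair d emp) = app \<phi> (pair d' emp) ==> d = d'"
  unfolding Str_emp mem_sing by (auto; metis)
 have d: "DF (%d. app \<phi> (pair d emp))" by (intro dfn)
 show ?thesis by (rule exI[of _ "lam D (%d. app \<phi> (pair d emp))"]) (use \<phi> in "auto simp: app_lam[OF d]")
qed

text \<open>Compactness: an assignment is safe if it extends to representatives of any finitely many demands.\<close>

lemma sdr:
 assumes D: "lep D omega" and sys: "DF sys" "!!d. d \<E> D ==> sys d \<E> omega" and pt: "DF2 pt"
  and inj: "!!d s d' s'. d \<E> D ==> d' \<E> D ==> sys d = sys d' ==> s \<E> Str (succ (sys d)) ==> s' \<E> Str (succ (sys d)) ==>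
    pt d s = pt d' s' ==> d = d' & s = s'"
 shows "EX x. (ALL d. d \<E> D --> (EX s. s \<E> Str (succ (sys d)) & app x d = pt d s)) & (ALL d d'. d \<E> D --> d' \<E> D --> app x d = app x d' --> d = d')"
proof -
 note [dfn] = DFD[OF sys(1)] DF2D[OF pt]
 let ?rep = "%D0 x. (ALL d. d \<E> D0 --> (EX s. s \<E> Str (succ (sys d)) & app x d = pt d s)) & (ALL d d'. d \<E> D0 --> d' \<E> D0 --> app x d = app x d' --> d = d')"
 let ?safe = "%\<sigma>. ALL D0. fin D0 --> el D0 <= el D --> (EX x. ?rep D0 x & (ALL d v. pair d v \<E> \<sigma> --> d \<E> D0 --> app x d = v))"
 have safe0: "?safe emp"
 proof (intro allI impI)
  fix D0 assume D0: "fin D0" "el D0 <= el D"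
  have DD: "d \<E> D0 ==> d \<E> D" for d using D0(2) by auto
  have "EX x. ?rep D0 x" by (rule fin_sdr[OF D0(1) sys(1) _ pt]) (rule sys(2), erule DD, rule inj, (erule DD | assumption)+)
  thus "EX x. ?rep D0 x & (ALL d v. pair d v \<E> emp --> d \<E> D0 --> app x d = v)" by simp
 qed
 have safeS: "EX v. ?safe (un \<sigma> (sing (pair d v)))" if \<sigma>: "?safe \<sigma>" and d: "d \<E> D" for \<sigma> d
 proof (rule ccontr)
  assume n: "~ ?thesis"
  let ?W = "%s D0. fin D0 & el D0 <= el D & ~ (EX x. ?rep D0 x & (ALL d' v. pair d' v \<E> un \<sigma> (sing (pair d (pt d s))) --> d' \<E> D0 --> app x d' = v))"
  have "DP2 ?W" by (intro dfn)
  hence "EX W. ALL s. s \<E> Str (succ (sys d)) --> ?W s (app W s)"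
  proof (rule fin_choice)
   show "fin (Str (succ (sys d)))" by (intro fin_Str succ_omega sys(2) d)
   fix s
   have "~ ?safe (un \<sigma> (sing (pair d (pt d s))))" using n by blast
   thus "EX D0. ?W s D0" by blast
  qed
  then obtain W where W: "!!s. s \<E> Str (succ (sys d)) ==> ?W s (app W s)" by blast
  have dW: "DF (app W)" by (intro dfn)
  \<comment> \<open>If each candidate for \<open>d\<close> is unsafe because of some finite set, the
    union of these finitely many sets together with \<open>d\<close> is finite too. Representatives
    for it that extend \<sigma> use one of the candidates, a contradiction.\<close>
  define D0 where "D0 = un (Union (Repl (Str (succ (sys d))) (app W))) (sing d)"
  have D0: "v \<E> D0 <-> v = d | (EX s. s \<E> Str (succ (sys d)) & v \<E> app W s)" for v unfolding D0_def mem_un mem_UN[OF dW] by auto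
  have "fin D0" unfolding D0_def using W sys(2)[OF d] fin_Str succ_omega by (intro fin_un fin_UN dW fin_sing) blast+
  moreover have "el D0 <= el D" using W d D0 by (auto simp: subset_eq)
  ultimately obtain x where x: "?rep D0 x" "ALL d' v. pair d' v \<E> \<sigma> --> d' \<E> D0 --> app x d' = v" using \<sigma> by blast
  then obtain s where s: "s \<E> Str (succ (sys d))" "app x d = pt d s" using D0 by blast
  have "?rep (app W s) x" using x(1) D0 s(1) by blast
  moreover have "ALL d' v. pair d' v \<E> un \<sigma> (sing (pair d (pt d s))) --> d' \<E> app W s --> app x d' = v"
   using x(2) D0 s by auto
  ultimately show False using W[OF s(1)] by blast
 qed
 obtain e where e: "DF e" "!!d. d \<E> D ==> e d \<E> omega" "!!d d'. d \<E> D ==> d' \<E> D ==> e d = e d' ==> d = d'"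
  using lepE[OF D] by blast
 note [dfn] = DFD[OF e(1)]
 have dU: "DF (%d. Repl (Str (succ (sys d))) (pt d))" and dpt: "DF (pt d)" for d by (intro dfn)+
 \<comment> \<open>One step of the enumeration \<open>e\<close>: the safe assignment is enlarged so
   as to cover the demand with number \<open>p2 z\<close>, if there is one.\<close>
 let ?R = "%z \<sigma>. el (p1 z) <= el \<sigma> & ?safe \<sigma> & (ALL d. d \<E> D --> e d = p2 z --> (EX v. pair d v \<E> \<sigma>))"
 let ?X = "Pow (prod D (Union (Repl D (%d. Repl (Str (succ (sys d))) (pt d)))))"
 have safe_pt: "v \<E> Union (Repl D (%d. Repl (Str (succ (sys d))) (pt d)))" if sp: "?safe \<sigma>" "d \<E> D" "pair d v \<E> \<sigma>" for \<sigma> d v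
 proof -
  have "fin (sing d)" "el (sing d) <= el D" using sp(2) by auto
  then obtain x where x: "?rep (sing d) x" "ALL d' v. pair d' v \<E> \<sigma> --> d' \<E> sing d --> app x d' = v" using sp(1) by blast
  have "d \<E> sing d" by simp
  hence "app x d = v" "EX s. s \<E> Str (succ (sys d)) & app x d = pt d s" using x sp(3) by blast+
  thus ?thesis unfolding mem_UN[OF dU] mem_Repl[OF dpt] using sp(2) by blast
 qed
 have "EX c. DF c & (ALL z. z \<E> prod (Sep ?X ?safe) omega --> c z \<E> ?X & ?R z (c z))"
 proof (rule choice)
  show "DP2 (%z \<sigma>. \<sigma> \<E> ?X & ?R z \<sigma>)" by (intro dfn)
  fix z assume "z \<E> prod (Sep ?X ?safe) omega"
  have ds: "DP ?safe" by (intro dfn)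
  obtain \<sigma> n where z: "z = pair \<sigma> n" "\<sigma> \<E> ?X" "?safe \<sigma>" "n \<E> omega"
   using \<open>z \<E> prod (Sep ?X ?safe) omega\<close> unfolding mem_prod mem_Sep[OF ds] by blast
  show "EX \<sigma>'. \<sigma>' \<E> ?X & ?R z \<sigma>'"
  proof (cases "EX d. d \<E> D & e d = n")
   case True
   then obtain d where d: "d \<E> D" "e d = n" by blast
   obtain v where v: "?safe (un \<sigma> (sing (pair d v)))" using safeS[OF z(3) d(1)] by blast
   have "v \<E> Union (Repl D (%d. Repl (Str (succ (sys d))) (pt d)))" by (rule safe_pt[OF v d(1)]) simp
   hence "un \<sigma> (sing (pair d v)) \<E> ?X" using z(2) d(1) unfolding mem_Pow sub_iff mem_un mem_sing
    by (metis pair_mem_prod)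
   moreover have "el \<sigma> <= el (un \<sigma> (sing (pair d v)))" by auto
   moreover have "EX v'. pair d' v' \<E> un \<sigma> (sing (pair d v))" if "d' \<E> D" "e d' = n" for d'
    using e(3)[OF that(1) d(1)] that(2) d(2) by auto
   ultimately show ?thesis using v unfolding z(1) p1_pair p2_pair by blast
  next
   case False thus ?thesis using z by (intro exI[of _ \<sigma>]) auto
  qed
 qed
 then obtain c where c: "DF c" "!!z. z \<E> prod (Sep ?X ?safe) omega ==> c z \<E> ?X & ?R z (c z)" by blast
 note [dfn] = DFD[OF c(1)]
 have "DF2 (%n \<sigma>. c (pair \<sigma> n))" by (intro dfn)
 from nat_rec[OF this, of emp] obtain F where F: "DF F" "F emp = emp" "!!n. n \<E> omega ==> F (succ n) = c (pair (F n) n)" by blast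
 note [dfn] = DFD[OF F(1)]
 have ds: "DP ?safe" by (intro dfn)
 have FX: "F n \<E> Sep ?X ?safe" if "n \<E> omega" for n
 proof (rule nat_induct[of "%n. F n \<E> Sep ?X ?safe"], intro dfn)
  show "F emp \<E> Sep ?X ?safe" unfolding mem_Sep[OF ds] F(2) using safe0 by auto
  fix n assume n: "n \<E> omega" "F n \<E> Sep ?X ?safe"
  hence "pair (F n) n \<E> prod (Sep ?X ?safe) omega" by simp
  from c(2)[OF this] show "F (succ n) \<E> Sep ?X ?safe" unfolding mem_Sep[OF ds] F(3)[OF n(1)] by blast
 qed (rule that)
 have Fs: "el (F n) <= el (F (succ n))" "!!d. d \<E> D ==> e d = n ==> EX v. pair d v \<E> F (succ n)" if n: "n \<E> omega" for n
 proof -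
  have "pair (F n) n \<E> prod (Sep ?X ?safe) omega" using FX n by simp
  from c(2)[OF this] show "el (F n) <= el (F (succ n))" "!!d. d \<E> D ==> e d = n ==> EX v. pair d v \<E> F (succ n)"
   unfolding F(3)[OF n] p1_pair p2_pair by blast+
 qed
 have mono: "ALL m. m \<E> n --> el (F m) <= el (F n)" if "n \<E> omega" for n
 proof (rule nat_induct[of "%n. ALL m. m \<E> n --> el (F m) <= el (F n)"], intro dfn)
  fix n assume "n \<E> omega" "ALL m. m \<E> n --> el (F m) <= el (F n)"
  thus "ALL m. m \<E> succ n --> el (F m) <= el (F (succ n))" using Fs(1) by (simp del: el_iff) blast
 qed (use that in auto)
 define \<Sigma> where "\<Sigma> = Union (Repl omega F)"
 have \<Sigma>: "z \<E> \<Sigma> <-> (EX n. n \<E> omega & z \<E> F n)" for z unfolding \<Sigma>_def by (rule mem_UN[OF F(1)])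
 have key: "EX x. ?rep (upair d d') x & app x d = v & app x d' = v'" if a: "d \<E> D" "d' \<E> D" "pair d v \<E> \<Sigma>" "pair d' v' \<E> \<Sigma>" for d d' v v'
 proof -
  obtain m n where mn: "m \<E> omega" "n \<E> omega" "pair d v \<E> F m" "pair d' v' \<E> F n" using a \<Sigma> by blast
  obtain l where l: "l \<E> omega" "pair d v \<E> F l" "pair d' v' \<E> F l"
  proof -
   consider "m \<E> n" | "m = n" | "n \<E> m" using Ord_linear[OF nat_Ord nat_Ord, OF mn(1,2)] by blast
   thus thesis
   proof cases
    case 1
    hence "pair d v \<E> F n" using mono[OF mn(2)] mn(3) by (auto simp: subset_eq)
    thus ?thesis using that mn by blast
   next
    case 2 thus ?thesis using that mn by blast
   next
    case 3
    hence "pair d' v' \<E> F m" using mono[OF mn(1)] mn(4) by (auto simp: subset_eq)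
    thus ?thesis using that mn by blast
   qed
  qed
  have "fin (upair d d')" using fin_un[OF fin_sing fin_sing, of d d'] by (rule fin_subset[rotated]) auto
  moreover have "el (upair d d') <= el D" using a by auto
  moreover have "?safe (F l)" using FX[OF l(1)] unfolding mem_Sep[OF ds] by blast
  ultimately obtain x where x: "?rep (upair d d') x" "ALL d'' v. pair d'' v \<E> F l --> d'' \<E> upair d d' --> app x d'' = v" by blast
  have "d \<E> upair d d'" "d' \<E> upair d d'" by simp_all
  thus ?thesis using x l by blast
 qed
 have ex: "EX v. pair d v \<E> \<Sigma>" if "d \<E> D" for d using Fs(2)[OF e(2)[OF that] that] succ_omega[OF e(2)[OF that]] \<Sigma> by blast
 have app: "app \<Sigma> d = v" if "d \<E> D" "pair d v \<E> \<Sigma>" for d v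
  by (rule app_eq) (use that key[of d d] in blast)+
 have pr: "pair d (app \<Sigma> d) \<E> \<Sigma>" if "d \<E> D" for d using app ex that by metis
 show ?thesis
 proof (rule exI[of _ \<Sigma>], intro conjI allI impI)
  fix d assume d: "d \<E> D"
  obtain x where x: "?rep (upair d d) x" "app x d = app \<Sigma> d" using key[OF d d pr[OF d] pr[OF d]] by blast
  have "d \<E> upair d d" by simp
  thus "EX s. s \<E> Str (succ (sys d)) & app \<Sigma> d = pt d s" using x by metis
  fix d' assume d': "d' \<E> D" and e: "app \<Sigma> d = app \<Sigma> d'"
  obtain x where x: "?rep (upair d d') x" "app x d = app \<Sigma> d" "app x d' = app \<Sigma> d'" using key[OF d d' pr[OF d] pr[OF d']] by blast
  have "d \<E> upair d d'" "d' \<E> upair d d'" by simp_all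
  thus "d = d'" using x e by metis
 qed
qed

end

subsection \<open>The colouring\<close>

context zfc begin

primrec num :: "nat => 'a" where
 "num 0 = emp"
| "num (Suc k) = succ (num k)"

lemma num_omega [simp]: "num k \<E> omega" by (induction k) auto

lemma fin_lep_omega: "fin x ==> lep x omega"
 unfolding fin_def using lep_trans lep_subset Ord_trans[OF Ord_omega] by (meson el_iff subsetI)

lemma lep_Pow: assumes "lep a b" shows "lep (Pow a) (Pow b)"
proof -
 obtain f where f: "DF f" "!!x. x \<E> a ==> f x \<E> b" "!!x y. x \<E> a ==> y \<E> a ==> f x = f y ==> x = y"
  using lepE[OF assms] by blast
 note [dfn] = DFD[OF f(1)]
 have "DF (%s. Repl s f)" by (intro dfn)
 thus ?thesis
 proof (rule lepI)
  fix s assume "s \<E> Pow a"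
  thus "Repl s f \<E> Pow b" using f(2) by (auto simp: mem_Repl[OF f(1)] subset_eq)
 next
  fix s t assume s: "s \<E> Pow a" and t: "t \<E> Pow a" and e: "Repl s f = Repl t f"
  show "s = t"
  proof (rule ext)
   fix x
   have "x \<E> t" if "x \<E> s" "el s <= el a" "el t <= el a" "Repl s f = Repl t f" for s t x
   proof -
    have "f x \<E> Repl t f" using that(1,4) mem_Repl[OF f(1)] by metis
    then obtain y where "y \<E> t" "f x = f y" unfolding mem_Repl[OF f(1)] by blast
    thus ?thesis using that(1-3) f(3)[of x y] by (auto simp: subset_eq)
   qed
   thus "x \<E> s <-> x \<E> t" using s t e by (metis mem_Pow)
  qed
 qed
qed

definition Ctbl where "Ctbl Z = Sep (Pow Z) (%s. lep s omega)"
lemma mem_Ctbl: "s \<E> Ctbl Z <-> el s <= el Z & lep s omega"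
proof -
 have d: "DP (%s. lep s omega)" by (intro dfn)
 show ?thesis unfolding Ctbl_def mem_Sep[OF d] by simp
qed

text \<open>Countable subsets of \<omega>1 are bounded, and by CH each of the \<omega>1 many bounds
  has at most \<omega>1 subsets.\<close>

lemma Ctbl_omega1: assumes CH: "lep (Pow omega) omega1" and Z: "lep Z omega1" shows "lep (Ctbl Z) omega1"
proof -
 have d: "DF Pow" by (intro dfn)
 have "lep (Union (Repl omega1 Pow)) omega1"
 proof (rule lep_UN[OF d lep_refl _ omega1_square])
  fix \<gamma> assume "\<gamma> \<E> omega1"
  thus "lep (Pow \<gamma>) omega1" using lep_Pow CH lep_trans unfolding mem_hartogs by blast
 qed
 moreover have "el (Ctbl omega1) <= el (Union (Repl omega1 Pow))"
 proof
  fix s assume "s \<in> el (Ctbl omega1)"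
  hence "el s <= el omega1" "lep s omega" by (simp_all add: mem_Ctbl)
  from hartogs_regular[OF this(2,1) omega_square] show "s \<in> el (Union (Repl omega1 Pow))"
   unfolding el_iff mem_UN[OF d] mem_Pow by blast
 qed
 ultimately have 1: "lep (Ctbl omega1) omega1" using lep_subset lep_trans by blast
 obtain f where f: "DF f" "!!x. x \<E> Z ==> f x \<E> omega1" "!!x y. x \<E> Z ==> y \<E> Z ==> f x = f y ==> x = y"
  using lepE[OF Z] by blast
 note [dfn] = DFD[OF f(1)]
 have "DF (%s. Repl s f)" by (intro dfn)
 hence "lep (Ctbl Z) (Ctbl omega1)"
 proof (rule lepI)
  fix s assume "s \<E> Ctbl Z"
  thus "Repl s f \<E> Ctbl omega1" using f(2) lep_trans[OF lep_Repl[OF f(1)]] by (auto simp: mem_Ctbl mem_Repl[OF f(1)] subset_eq)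
 next
  fix s t assume s: "s \<E> Ctbl Z" and t: "t \<E> Ctbl Z" and e: "Repl s f = Repl t f"
  have "x \<E> t" if "x \<E> s" "el s <= el Z" "el t <= el Z" "Repl s f = Repl t f" for s t x
  proof -
   have "f x \<E> Repl t f" using that(1,4) mem_Repl[OF f(1)] by metis
   then obtain y where "y \<E> t" "f x = f y" unfolding mem_Repl[OF f(1)] by blast
   thus ?thesis using that(1-3) f(3)[of x y] by (auto simp: subset_eq)
  qed
  thus "s = t" using s t e unfolding mem_Ctbl by (intro ext) metis
 qed
 thus ?thesis using 1 lep_trans by blast
qed

definition Strs where "Strs = Union (Repl omega Str)"
lemma mem_Strs: "s \<E> Strs <-> (EX m. m \<E> omega & s \<E> Str m)"
proof -
 have d: "DF Str" by (intro dfn)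
 show ?thesis unfolding Strs_def by (rule mem_UN[OF d])
qed
lemma Strs_countable: "lep Strs omega"
proof -
 have d: "DF Str" by (intro dfn)
 show ?thesis unfolding Strs_def by (rule lep_UN[OF d lep_refl _ omega_square]) (rule fin_lep_omega[OF fin_Str])
qed
lemma lep_prod_omega: "lep a omega ==> lep b omega ==> lep (prod a b) omega"
 using lep_prod omega_square lep_trans by blast
lemma lep_prod_omega1: "lep a omega1 ==> lep b omega1 ==> lep (prod a b) omega1"
 using lep_prod omega1_square lep_trans by blast
lemma lep_omega_omega1: "lep a omega ==> lep a omega1"
 using lep_trans lep_subset omega_sub_omega1 by blast

text \<open>A system assigns points \<open>a\<close> to pairs \<open>(\<xi>, (l, s))\<close>; it is coded by the set of the triples.\<close>

definition tr where "tr \<xi> l s a = pair \<xi> (pair (pair l s) a)"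
lemma DT_tr [dfn]: assumes [dfn]: "DT s" "DT t" "DT u" "DT v" shows "DT (%e. tr (s e) (t e) (u e) (v e))"
 unfolding tr_def by (intro dfn)
lemma tr_inj [simp]: "tr \<xi> l s a = tr \<xi>' l' s' a' <-> \<xi> = \<xi>' & l = l' & s = s' & a = a'" by (auto simp: tr_def)

definition good where "good S <-> (ALL \<xi> l s a a'. tr \<xi> l s a \<E> S --> tr \<xi> l s a' \<E> S --> a = a') &
  (ALL \<xi> l s \<xi>' l' s' a. tr \<xi> l s a \<E> S --> tr \<xi>' l' s' a \<E> S --> \<xi> = \<xi>' & l = l' & s = s')"
lemma dfn_good [THEN DPD, dfn]: "DP good" unfolding good_def by (intro dfn)

definition full where "full K S b \<xi> <-> (ALL l s. l \<E> K --> s \<E> Strs --> (EX a. a \<E> b & tr \<xi> l s a \<E> S))"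
lemma dfn_full [dfn]: assumes [THEN DT_shift, dfn]: "DT s" "DT t" "DT u" "DT v" shows "Dfn (%e. full (s e) (t e) (u e) (v e))"
 unfolding full_def by (intro dfn)

definition "Trip K = prod omega1 (prod (prod K Strs) omega1)"
lemma mem_Trip [simp]: "tr \<xi> l s a \<E> Trip K <-> \<xi> \<E> omega1 & l \<E> K & s \<E> Strs & a \<E> omega1"
 unfolding Trip_def tr_def by auto

text \<open>
 \<open>cf a b\<close> is the colour of \<open>{a, b}\<close> for \<open>a < b\<close>; every system listed before \<open>b\<close> (by \<open>en\<close>) obtains, in
 each of its rows \<open>\<xi>\<close>, a colour class of \<open>K\<close> points, and these points are found among the strings
 of a length depending only on the index (by \<open>\<iota> b\<close>) of the system.
\<close>

definition colouring where "colouring K cf en \<iota> <->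
  (ALL S. S \<E> Ctbl (Trip K) --> en S \<E> omega1) & (ALL b \<alpha>. b \<E> omega1 --> \<alpha> \<E> b --> \<iota> b \<alpha> \<E> omega) &
  (ALL b v. b \<E> omega1 --> lep (Sep b (%a. cf a b = v)) K) &
  (ALL a b a' b'. cf a b = cf a' b' --> b = b') &
  (ALL S b \<xi>. S \<E> Ctbl (Trip K) --> b \<E> omega1 --> en S \<E> b --> \<xi> \<E> b --> good S --> full K S b \<xi> -->
   (EX x v. (ALL l. l \<E> K --> app x l \<E> b & cf (app x l) b = v &
        (EX s. s \<E> Str (succ (\<iota> b (en S))) & tr \<xi> l s (app x l) \<E> S)) &
       (ALL l l'. l \<E> K --> l' \<E> K --> app x l = app x l' --> l = l')))"

lemma colouring_ex:
 assumes CH: "lep (Pow omega) omega1" and K: "K \<E> omega" "emp \<E> K"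
 shows "EX cf en \<iota>. DF2 cf & DF en & DF2 \<iota> & colouring K cf en \<iota>"
proof -
 have Kc: "lep K omega" using fin_lep_omega fin_nat K(1) by blast
 have "lep (Trip K) omega1" unfolding Trip_def
  by (intro lep_prod_omega1 lep_refl lep_omega_omega1 lep_prod_omega Kc Strs_countable)
 from lepE[OF Ctbl_omega1[OF CH this]] obtain en where en: "DF en" "!!S. S \<E> Ctbl (Trip K) ==> en S \<E> omega1"
  "!!S T. S \<E> Ctbl (Trip K) ==> T \<E> Ctbl (Trip K) ==> en S = en T ==> S = T" by blast
 note [dfn] = DFD[OF en(1)]
 have "DP2 (%b f. (ALL x. x \<E> b --> app f x \<E> omega) & (ALL x y. x \<E> b --> y \<E> b --> app f x = app f y --> x = y))" by (intro dfn)
 from choice[OF this, of omega1] obtain h where h: "DF h"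
  "!!b. b \<E> omega1 ==> (ALL x. x \<E> b --> app (h b) x \<E> omega) & (ALL x y. x \<E> b --> y \<E> b --> app (h b) x = app (h b) y --> x = y)"
  unfolding mem_hartogs lep_def by blast
 note [dfn] = DFD[OF h(1)]
 define \<iota> where "\<iota> = (%b. app (h b))"
 have "DF2 \<iota>" unfolding \<iota>_def by (intro dfn)
 note [dfn] = DF2D[OF this]
 have \<iota>: "!!b x. b \<E> omega1 ==> x \<E> b ==> \<iota> b x \<E> omega" "!!b x y. b \<E> omega1 ==> x \<E> b ==> y \<E> b ==> \<iota> b x = \<iota> b y ==> x = y"
  using h(2) unfolding \<iota>_def by blast+
 \<comment> \<open>A demand at \<open>b\<close> is a triple of a system listed before
   \<open>b\<close>, a complete row \<xi> below \<open>b\<close>, and an \<open>l\<close> in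
   \<open>K\<close>. There are countably many, because listed systems are counted by their places
   below \<open>b\<close>.\<close>
 let ?D = "%b d. en (p1 d) \<E> b & p1 (p2 d) \<E> b & good (p1 d) & full K (p1 d) b (p1 (p2 d))"
 define D where "D = (%b. Sep (prod (Ctbl (Trip K)) (prod omega1 K)) (?D b))"
 have dD: "DP (?D b)" for b by (intro dfn)
 have D: "pair S (pair \<xi> l) \<E> D b <-> S \<E> Ctbl (Trip K) & \<xi> \<E> omega1 & l \<E> K & en S \<E> b & \<xi> \<E> b & good S & full K S b \<xi>" for S \<xi> l b
  unfolding D_def mem_Sep[OF dD] by auto
 have D': "EX S \<xi> l. d = pair S (pair \<xi> l)" if "d \<E> D b" for d b
  using that unfolding D_def mem_Sep[OF dD] by (auto simp: mem_prod)
 have "DF D" unfolding D_def by (intro dfn)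
 note [dfn] = DFD[OF this]
 define pt where "pt = (%d s. Union (Sep omega1 (%a. tr (p1 (p2 d)) (p2 (p2 d)) s a \<E> p1 d)))"
 have "DF2 pt" unfolding pt_def by (intro dfn)
 note [dfn] = DF2D[OF this]
 have pt: "pt (pair S (pair \<xi> l)) s = a" if "S \<E> Ctbl (Trip K)" "good S" "tr \<xi> l s a \<E> S" for S \<xi> l s a
 proof (rule ext)
  have d: "DP (%a. tr \<xi> l s a \<E> S)" by (intro dfn)
  have "a' \<E> Sep omega1 (%a. tr \<xi> l s a \<E> S) <-> a' = a" for a'
  proof -
   have "tr \<xi> l s a \<E> Trip K" using that(1,3) unfolding mem_Ctbl by auto
   thus ?thesis unfolding mem_Sep[OF d] using that(2,3) unfolding good_def mem_Trip by blast
  qed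
  thus "z \<E> pt (pair S (pair \<xi> l)) s <-> z \<E> a" for z unfolding pt_def by simp
 qed
 have Strs_Str: "s \<E> Str (succ m) ==> m \<E> omega ==> s \<E> Strs" for s m using mem_Strs succ_omega by blast
 let ?X = "%b x. (ALL d. d \<E> D b --> (EX s. s \<E> Str (succ (\<iota> b (en (p1 d)))) & app x d = pt d s)) & (ALL d d'. d \<E> D b --> d' \<E> D b --> app x d = app x d' --> d = d')"
 have exX: "EX x. ?X b x" if b: "b \<E> omega1" for b
 proof (rule sdr)
  have bc: "lep b omega" using b by (simp add: mem_hartogs)
  have "DF (%d. pair (en (p1 d)) (p2 d))" by (intro dfn)
  hence "lep (D b) (prod b (prod b K))"
  proof (rule lepI)
   fix d assume d: "d \<E> D b"
   then obtain S \<xi> l where "d = pair S (pair \<xi> l)" using D' by blast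
   thus "pair (en (p1 d)) (p2 d) \<E> prod b (prod b K)" using d D by auto
   fix d' assume d': "d' \<E> D b" "pair (en (p1 d)) (p2 d) = pair (en (p1 d')) (p2 d')"
   obtain S' \<xi>' l' where "d' = pair S' (pair \<xi>' l')" using D' d' by blast
   thus "d = d'" using d d' \<open>d = pair S (pair \<xi> l)\<close> D en(3) by auto
  qed
  thus "lep (D b) omega" using lep_prod_omega bc Kc lep_trans by blast
  show "DF (%d. \<iota> b (en (p1 d)))" "DF2 pt" by (intro dfn)+
  fix d assume d: "d \<E> D b"
  then obtain S \<xi> l where dd: "d = pair S (pair \<xi> l)" using D' by blast
  thus io: "\<iota> b (en (p1 d)) \<E> omega" using d D \<iota>(1)[OF b] by auto
  fix s d' s' assume d': "d' \<E> D b" and e: "\<iota> b (en (p1 d)) = \<iota> b (en (p1 d'))"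
   and s: "s \<E> Str (succ (\<iota> b (en (p1 d))))" "s' \<E> Str (succ (\<iota> b (en (p1 d))))" and ee: "pt d s = pt d' s'"
  obtain S' \<xi>' l' where dd': "d' = pair S' (pair \<xi>' l')" using D' d' by blast
  have S: "S \<E> Ctbl (Trip K)" "en S \<E> b" "good S" "full K S b \<xi>" "l \<E> K" using d dd D by blast+
  have S': "S' \<E> Ctbl (Trip K)" "en S' \<E> b" "good S'" "full K S' b \<xi>'" "l' \<E> K" using d' dd' D by blast+
  have "en S = en S'" using e \<iota>(2)[OF b S(2) S'(2)] dd dd' by simp
  hence SS: "S = S'" using en(3)[OF S(1) S'(1)] by blast
  have "s \<E> Strs" "s' \<E> Strs" using s Strs_Str[OF _ io] by blast+
  then obtain a a' where "tr \<xi> l s a \<E> S" "tr \<xi>' l' s' a' \<E> S'" using S(4,5) S'(4,5) unfolding full_def by blast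
  thus "d = d' & s = s'" using ee pt[OF S(1,3)] pt[OF S'(1,3)] S(3) SS dd dd' unfolding good_def by auto
 qed
 have "DP2 ?X" by (intro dfn)
 from choice[OF this, of omega1] exX obtain X where X: "DF X" "!!b. b \<E> omega1 ==> ?X b (X b)" by blast
 note [dfn] = DFD[OF X(1)]
 \<comment> \<open>The labels \<open>(S, \<xi>)\<close> of the demands represented by
   \<open>a\<close>. As representatives are distinct, there is at most one.\<close>
 define cl where "cl = (%a b. Repl (Sep (D b) (%d. app (X b) d = a)) (%d. pair (p1 d) (p1 (p2 d))))"
 have dcl: "DP (%d. app (X b) d = a)" "DF (%d. pair (p1 d) (p1 (p2 d)))" for a b by (intro dfn)+
 have cl: "z \<E> cl a b <-> (EX d. d \<E> D b & app (X b) d = a & z = pair (p1 d) (p1 (p2 d)))" for z a b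
  unfolding cl_def mem_Repl[OF dcl(2)] mem_Sep[OF dcl(1)] by blast
 have "DF2 cl" unfolding cl_def by (intro dfn)
 note [dfn] = DF2D[OF this]
 \<comment> \<open>A point that represents nothing has a colour of its own, tagged
   \<open>sing emp\<close>; the others share the colour of their label. The component
   \<open>b\<close> keeps the colours at different \<open>b\<close> apart.\<close>
 define cf where "cf = (%a b. if cl a b = emp then pair b (pair (sing emp) a) else pair b (pair emp (cl a b)))"
 have dcf: "DF2 cf" unfolding cf_def by (intro dfn)
 note [dfn] = DF2D[OF this]
 have cl_x: "cl (app (X b) (pair S (pair \<xi> l))) b = sing (pair S \<xi>)" if "b \<E> omega1" "pair S (pair \<xi> l) \<E> D b" for b S \<xi> l
 proof (rule ext)
  show "z \<E> cl (app (X b) (pair S (pair \<xi> l))) b <-> z \<E> sing (pair S \<xi>)" for z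
   unfolding cl mem_sing using X(2)[OF that(1)] that(2) p1_pair p2_pair by metis
 qed
 have "colouring K cf en \<iota>" unfolding colouring_def
 proof (intro conjI allI impI)
  show "S \<E> Ctbl (Trip K) ==> en S \<E> omega1" for S by (rule en(2))
  show "b \<E> omega1 ==> \<alpha> \<E> b ==> \<iota> b \<alpha> \<E> omega" for b \<alpha> by (rule \<iota>(1))
  show "cf a b = cf a' b' ==> b = b'" for a b a' b' unfolding cf_def by (auto split: if_splits)
 next
  fix b v assume b: "b \<E> omega1"
  have d: "DP (%a. cf a b = v)" by (intro dfn)
  show "lep (Sep b (%a. cf a b = v)) K"
  proof (cases "EX a. cf a b = v & cl a b ~= emp")
   case False
   have "a = a'" if "cf a b = v" "cf a' b = v" for a a'
   proof -
    have "cl a b = emp" "cl a' b = emp" using False that by blast+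
    thus ?thesis using that unfolding cf_def by auto
   qed
   moreover have "DF (%x. emp)" by (rule DT_const)
   ultimately show ?thesis using K(2) by (intro lepI[of "%x. emp"]) (auto simp: mem_Sep[OF d])
  next
   case True
   then obtain a where a: "cf a b = v" "cl a b ~= emp" by blast
   then obtain z where z: "z \<E> cl a b" using empI by blast
   then obtain d where d0: "d \<E> D b" "app (X b) d = a" unfolding cl by blast
   then obtain S \<xi> l where dd: "d = pair S (pair \<xi> l)" using D' by blast
   have v: "v = pair b (pair emp (sing (pair S \<xi>)))" using a d0 cl_x[OF b] dd unfolding cf_def by auto
   \<comment> \<open>The class of a label consists of its representatives, one for each
     \<open>l\<close> in \<open>K\<close>.\<close>
   have "DF (%l. app (X b) (pair S (pair \<xi> l)))" by (intro dfn)
   thus ?thesis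
   proof (rule lep_surj)
    fix a' assume "a' \<E> Sep b (%a. cf a b = v)"
    hence "cf a' b = v" unfolding mem_Sep[OF d] by blast
    hence "cl a' b = sing (pair S \<xi>)" unfolding v cf_def by (auto split: if_splits)
    hence "pair S \<xi> \<E> cl a' b" by simp
    then obtain d' where d': "d' \<E> D b" "app (X b) d' = a'" "pair S \<xi> = pair (p1 d') (p1 (p2 d'))" unfolding cl by blast
    obtain S' \<xi>' l' where "d' = pair S' (pair \<xi>' l')" using D' d' by blast
    thus "EX l. l \<E> K & app (X b) (pair S (pair \<xi> l)) = a'" using d' D by auto
   qed
  qed
 next
  fix S b \<xi> assume S: "S \<E> Ctbl (Trip K)" and b: "b \<E> omega1" and h: "en S \<E> b" "\<xi> \<E> b" "good S" "full K S b \<xi>"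
  have \<xi>: "\<xi> \<E> omega1" using h_trans[OF b h(2)] .
  have d: "pair S (pair \<xi> l) \<E> D b" if "l \<E> K" for l unfolding D using S \<xi> h that by blast
  have dx: "DF (%l. app (X b) (pair S (pair \<xi> l)))" by (intro dfn)
  let ?x = "lam K (%l. app (X b) (pair S (pair \<xi> l)))"
  have x: "app ?x l = app (X b) (pair S (pair \<xi> l))" if "l \<E> K" for l using app_lam[OF dx that] .
  have io: "\<iota> b (en S) \<E> omega" using \<iota>(1)[OF b h(1)] .
  have tr: "EX s. s \<E> Str (succ (\<iota> b (en S))) & tr \<xi> l s (app ?x l) \<E> S & app ?x l \<E> b" if l: "l \<E> K" for l
  proof -
   obtain s where s: "s \<E> Str (succ (\<iota> b (en S)))" "app (X b) (pair S (pair \<xi> l)) = pt (pair S (pair \<xi> l)) s"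
    using X(2)[OF b] d[OF l] p1_pair by metis
   obtain a where "a \<E> b" "tr \<xi> l s a \<E> S" using h(4) l Strs_Str[OF s(1) io] unfolding full_def by blast
   thus ?thesis using s pt[OF S h(3)] x[OF l] by auto
  qed
  show "EX x v. (ALL l. l \<E> K --> app x l \<E> b & cf (app x l) b = v &
        (EX s. s \<E> Str (succ (\<iota> b (en S))) & tr \<xi> l s (app x l) \<E> S)) &
       (ALL l l'. l \<E> K --> l' \<E> K --> app x l = app x l' --> l = l')"
  proof (rule exI[of _ ?x], rule exI[of _ "pair b (pair emp (sing (pair S \<xi>)))"], intro conjI allI impI)
   fix l assume l: "l \<E> K"
   show "app ?x l \<E> b" "EX s. s \<E> Str (succ (\<iota> b (en S))) & tr \<xi> l s (app ?x l) \<E> S" using tr[OF l] by blast+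
   show "cf (app ?x l) b = pair b (pair emp (sing (pair S \<xi>)))" unfolding x[OF l] cf_def using cl_x[OF b d[OF l]] by simp
   fix l' assume l': "l' \<E> K" "app ?x l = app ?x l'"
   hence "pair S (pair \<xi> l) = pair S (pair \<xi> l')" using X(2)[OF b] d[OF l] d[OF l'(1)] unfolding x[OF l] x[OF l'(1)] by blast
   thus "l = l'" by simp
  qed
 qed
 thus ?thesis using dcf en(1) \<open>DF2 \<iota>\<close> by blast
qed

end

subsection \<open>The colouring survives ccc forcing\<close>

context zfc begin

lemma un_mem: assumes "Ord \<kappa>" "x \<E> \<kappa>" "y \<E> \<kappa>" shows "un x y \<E> \<kappa>"
proof -
 have "un x y = y | un x y = x"
  using Ord_linear[OF Ord_mem[OF assms(1,2)] Ord_mem[OF assms(1,3)]]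
 proof (elim disjE)
  assume "x \<E> y"
  hence "un x y = y" by (intro ext) (auto intro: Ord_trans[OF Ord_mem[OF assms(1,3)]])
  thus ?thesis ..
 next
  assume "x = y" hence "un x y = y" by (intro ext) auto
  thus ?thesis ..
 next
  assume "y \<E> x"
  hence "un x y = x" by (intro ext) (auto intro: Ord_trans[OF Ord_mem[OF assms(1,2)]])
  thus ?thesis ..
 qed
 thus ?thesis using assms by auto
qed

lemma omega1_sup: assumes "lep X omega" "el X <= el omega1" shows "Union X \<E> omega1"
proof -
 obtain \<beta> where \<beta>: "\<beta> \<E> omega1" "el X <= el \<beta>" using hartogs_regular[OF assms omega_square] by blast
 have O: "Ord \<beta>" using h_Ord[OF \<beta>(1)] .
 have "el (Union X) <= el \<beta>" 
  unfolding sub_iff mem_Union using \<beta>(2) Ord_trans[OF O] by (metis el_iff subsetD)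
 moreover have "Ord (Union X)" by (rule Ord_Union, rule h_Ord[of _ omega]) (use assms(2) in "auto simp: subset_eq")
 ultimately show ?thesis using Ord_subset[OF _ O] \<beta>(1) h_trans[OF \<beta>(1)] by blast
qed

lemma Ord_le_succ: "Ord x ==> Ord y ==> el x <= el y ==> x \<E> succ y"
 using Ord_subset by auto

end

context poset begin

text \<open>The chain condition for indexed families: equal conditions at different indices count as
  compatible, so families need not be injective.\<close>

definition ccc where "ccc <-> (ALL f X. ~ lep X omega --> (ALL i. i \<E> X --> app f i \<E> P) -->
  (EX i k t. i \<E> X & k \<E> X & i ~= k & le t (app f i) & le t (app f k)))"
lemma cccD: assumes "ccc" "DF f" "~ lep X omega" "!!i. i \<E> X ==> f i \<E> P"
 obtains i k t where "i \<E> X" "k \<E> X" "i ~= k" "le t (f i)" "le t (f k)"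
 using assms(1,3,4) app_lam[OF assms(2), of _ X] unfolding ccc_def by metis

text \<open>
 \<open>F n\<close> is a pair of a condition and a point: the point of \<open>F 0\<close> is in \<open>B\<close>, those of
 \<open>F 1, F 2, \<dots>\<close> are in \<open>A\<close>.
\<close>

lemma tower:
 assumes FA: "DP2 FA" and FB: "DP2 FB" and \<gamma>: "\<gamma> \<E> omega1" and p: "p \<E> P"
  and extA: "!!q \<gamma>. le q p ==> \<gamma> \<E> omega1 ==> EX r a. le r q & a \<E> omega1 & \<gamma> \<E> a & FA r a"
  and extB: "!!q \<gamma>. le q p ==> \<gamma> \<E> omega1 ==> EX r a. le r q & a \<E> omega1 & \<gamma> \<E> a & FB r a"
 shows "EX F. \<gamma> \<E> p2 (app F emp) & FB (p1 (app F emp)) (p2 (app F emp)) &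
  (ALL n. n \<E> omega --> p2 (app F n) \<E> omega1 & le (p1 (app F n)) p & le (p1 (app F (succ n))) (p1 (app F n)) &
    p2 (app F n) \<E> p2 (app F (succ n)) & FA (p1 (app F (succ n))) (p2 (app F (succ n))))"
proof -
 note [dfn] = DP2D[OF FA] DP2D[OF FB]
 let ?R = "%y y'. le (p1 y') (p1 y) & p2 y \<E> p2 y' & p2 y' \<E> omega1 & FA (p1 y') (p2 y')"
 let ?d = "Sep (prod P omega1) (%y. le (p1 y) p)"
 have dd: "DP (%y. le (p1 y) p)" by (intro dfn)
 have "DP2 ?R" by (intro dfn)
 moreover have "EX y'. ?R y y'" if y: "y \<E> ?d" for y
 proof -
  have "le (p1 y) p" "p2 y \<E> omega1" using y unfolding mem_Sep[OF dd] by (auto simp: mem_prod)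
  then obtain r a where "le r (p1 y)" "a \<E> omega1" "p2 y \<E> a" "FA r a" using extA by blast
  thus ?thesis by (intro exI[of _ "pair r a"]) simp
 qed
 ultimately obtain f where f: "DF f" "!!y. y \<E> ?d ==> ?R y (f y)" using choice[of ?R ?d] by blast
 note [dfn] = DFD[OF f(1)]
 obtain r0 b where b: "le r0 p" "b \<E> omega1" "\<gamma> \<E> b" "FB r0 b" using extB[of p \<gamma>] p \<gamma> by auto
 have "DF2 (%n y. f y)" by (intro dfn)
 from nat_rec[OF this, of "pair r0 b"] obtain F where F: "DF F" "F emp = pair r0 b" "!!n. n \<E> omega ==> F (succ n) = f (F n)" by blast
 note [dfn] = DFD[OF F(1)]
 have Fd: "F n \<E> ?d" if "n \<E> omega" for n
 proof (rule nat_induct[of "%n. F n \<E> ?d"], intro dfn)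
  show "F emp \<E> ?d" unfolding F(2) mem_Sep[OF dd] using b leD by auto
  fix n assume n: "n \<E> omega" "F n \<E> ?d"
  have R: "?R (F n) (F (succ n))" using f(2)[OF n(2)] F(3)[OF n(1)] by simp
  obtain q a where qa: "F n = pair q a" "le q p" using n(2) unfolding mem_Sep[OF dd] by (auto simp: mem_prod)
  have lp: "le (p1 (F (succ n))) p" using R qa le_trans by auto
  have fp: "EX x y. F (succ n) = pair x y"
  proof (rule ccontr)
   assume "~ ?thesis"
   hence e: "!!x y. F (succ n) ~= pair x y" by blast
   \<comment> \<open>The second projection of a set that is no pair is \<open>emp\<close>, but this
     one has an element.\<close>
   have "p2 (F (succ n)) = emp" unfolding p2_def
   proof (rule empI)
    have d: "DP (%b. EX a. F (succ n) = pair a b)" by (intro dfn)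
    fix y show "~ y \<E> Union (Sep (Union (F (succ n))) (%b. EX a. F (succ n) = pair a b))"
     unfolding mem_Union mem_Sep[OF d] using e by blast
   qed
   thus False using R by simp
  qed
  thus "F (succ n) \<E> ?d" unfolding mem_Sep[OF dd] using R lp leD(1)[OF lp] by auto
 qed (rule that)
 have R: "?R (F n) (F (succ n))" if "n \<E> omega" for n using f(2)[OF Fd[OF that]] F(3)[OF that] by simp
 have app: "app (lam omega F) n = F n" if "n \<E> omega" for n using app_lam[OF F(1) that] .
 show ?thesis
 proof (rule exI[of _ "lam omega F"], intro conjI allI impI)
  show "\<gamma> \<E> p2 (app (lam omega F) emp)" "FB (p1 (app (lam omega F) emp)) (p2 (app (lam omega F) emp))"
   using b by (simp_all add: app F(2))
  fix n assume n: "n \<E> omega"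
  have "le (p1 (F n)) p" "p2 (F n) \<E> omega1" using Fd[OF n] unfolding mem_Sep[OF dd] by (auto simp: mem_prod)
  thus "p2 (app (lam omega F) n) \<E> omega1" "le (p1 (app (lam omega F) n)) p" using app[OF n] by auto
  show "le (p1 (app (lam omega F) (succ n))) (p1 (app (lam omega F) n))" 
    "p2 (app (lam omega F) n) \<E> p2 (app (lam omega F) (succ n))" "FA (p1 (app (lam omega F) (succ n))) (p2 (app (lam omega F) (succ n)))"
   using R[OF n] app n succ_omega[OF n] by auto
 qed
qed

text \<open>The combinatorial core, carried out entirely in the ground model: \<open>FA r a\<close>
  and \<open>FB r a\<close> stand for \<open>r\<close> forcing \<open>a\<close> into the two
  uncountable sets. The lack of a hit below \<open>p\<close> yields an uncountable family of
  pairwise incompatible conditions.\<close>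

lemma ccc_hit:
 assumes ccc: ccc and K: "K \<E> omega" and cfd: "DF2 cf" "DF en" "DF2 \<iota>" and col: "colouring K cf en \<iota>"
  and FA: "DP2 FA" and FB: "DP2 FB" and p: "p \<E> P"
  and extA: "!!q \<gamma>. le q p ==> \<gamma> \<E> omega1 ==> EX r a. le r q & a \<E> omega1 & \<gamma> \<E> a & FA r a"
  and extB: "!!q \<gamma>. le q p ==> \<gamma> \<E> omega1 ==> EX r a. le r q & a \<E> omega1 & \<gamma> \<E> a & FB r a"
  and FA_mono: "!!q r a. FA q a ==> le r q ==> FA r a" and FB_mono: "!!q r a. FB q a ==> le r q ==> FB r a"
 shows "EX r b x v. le r p & b \<E> omega1 & FB r b & (ALL l. l \<E> K --> app x l \<E> b & FA r (app x l) & cf (app x l) b = v) &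
  (ALL l l'. l \<E> K --> l' \<E> K --> app x l = app x l' --> l = l')"
proof (rule ccontr)
 assume no: "~ ?thesis"
 note [dfn] = DP2D[OF FA] DP2D[OF FB] DF2D[OF cfd(1)] DFD[OF cfd(2)] DF2D[OF cfd(3)]
 let ?T = "%\<gamma> F. \<gamma> \<E> p2 (app F emp) & FB (p1 (app F emp)) (p2 (app F emp)) &
  (ALL n. n \<E> omega --> p2 (app F n) \<E> omega1 & le (p1 (app F n)) p & le (p1 (app F (succ n))) (p1 (app F n)) &
    p2 (app F n) \<E> p2 (app F (succ n)) & FA (p1 (app F (succ n))) (p2 (app F (succ n))))"
 have "DP2 ?T" by (intro dfn)
 moreover have "EX F. ?T \<gamma> F" if "\<gamma> \<E> omega1" for \<gamma> by (rule tower[OF FA FB that p]) (fact extA extB)+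
 ultimately obtain z where z: "DF z" "!!\<gamma>. \<gamma> \<E> omega1 ==> ?T \<gamma> (z \<gamma>)" using choice[of ?T omega1] by blast
 note [dfn] = DFD[OF z(1)]
 \<comment> \<open>The tower over \<gamma>: the point \<open>b \<gamma>\<close> lies above \<gamma>
   and is in the second set, the conditions \<open>rr \<gamma> n\<close> descend, and the points
   \<open>aa \<gamma> n\<close> increase above \<open>b \<gamma>\<close>, the \<open>n\<close>-th
   being put into the first set by \<open>rr \<gamma> (succ n)\<close>.\<close>
 define b where "b = (%\<gamma>. p2 (app (z \<gamma>) emp))"
 define rr where "rr = (%\<gamma> n. p1 (app (z \<gamma>) n))"
 define aa where "aa = (%\<gamma> n. p2 (app (z \<gamma>) (succ n)))"
 have "DF b" "DF2 rr" "DF2 aa" unfolding b_def rr_def aa_def by (intro dfn)+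
 note [dfn] = DFD[OF this(1)] DF2D[OF this(2)] DF2D[OF this(3)]
 have b: "b \<gamma> \<E> omega1" "\<gamma> \<E> b \<gamma>" if "\<gamma> \<E> omega1" for \<gamma> using z(2)[OF that] emp_omega unfolding b_def by blast+
 have rp: "le (rr \<gamma> n) p" if "\<gamma> \<E> omega1" "n \<E> omega" for \<gamma> n using z(2)[OF that(1)] that(2) unfolding rr_def by blast
 have rS: "le (rr \<gamma> (succ n)) (rr \<gamma> n)" if "\<gamma> \<E> omega1" "n \<E> omega" for \<gamma> n using z(2)[OF that(1)] that(2) unfolding rr_def by blast
 have aw: "aa \<gamma> n \<E> omega1" if "\<gamma> \<E> omega1" "n \<E> omega" for \<gamma> n using z(2)[OF that(1)] succ_omega[OF that(2)] unfolding aa_def by blast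
 have aS: "aa \<gamma> n \<E> aa \<gamma> (succ n)" if "\<gamma> \<E> omega1" "n \<E> omega" for \<gamma> n using z(2)[OF that(1)] succ_omega[OF that(2)] unfolding aa_def by blast
 have a0: "b \<gamma> \<E> aa \<gamma> emp" if "\<gamma> \<E> omega1" for \<gamma> using z(2)[OF that(1)] emp_omega unfolding aa_def b_def by blast
 have FAr: "FA (rr \<gamma> (succ n)) (aa \<gamma> n)" if "\<gamma> \<E> omega1" "n \<E> omega" for \<gamma> n using z(2)[OF that(1)] that(2) unfolding aa_def rr_def by blast
 have rm: "ALL n. n \<E> m --> le (rr \<gamma> m) (rr \<gamma> (succ n)) & aa \<gamma> n \<E> aa \<gamma> m" if g: "\<gamma> \<E> omega1" and m: "m \<E> omega" for \<gamma> m
 proof (rule nat_induct[of "%m. ALL n. n \<E> m --> le (rr \<gamma> m) (rr \<gamma> (succ n)) & aa \<gamma> n \<E> aa \<gamma> m", OF _ _ _ m], intro dfn)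
  fix m assume m: "m \<E> omega" "ALL n. n \<E> m --> le (rr \<gamma> m) (rr \<gamma> (succ n)) & aa \<gamma> n \<E> aa \<gamma> m"
  show "ALL n. n \<E> succ m --> le (rr \<gamma> (succ m)) (rr \<gamma> (succ n)) & aa \<gamma> n \<E> aa \<gamma> (succ m)"
  proof (intro allI impI)
   fix n assume "n \<E> succ m"
   then consider "n \<E> m" | "n = m" by auto
   thus "le (rr \<gamma> (succ m)) (rr \<gamma> (succ n)) & aa \<gamma> n \<E> aa \<gamma> (succ m)"
   proof cases
    case 1
    thus ?thesis using m le_trans[OF rS[OF g m(1)]] aS[OF g m(1)] Ord_trans[OF h_Ord[OF aw[OF g succ_omega[OF m(1)]]]] by blast
   next
    case 2
    thus ?thesis using aS[OF g m(1)] leD(1)[OF rS[OF g m(1)]] by simp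
   qed
  qed
 qed simp
 have r_mono: "le (rr \<gamma> m) (rr \<gamma> (succ n))" and a_mono: "aa \<gamma> n \<E> aa \<gamma> m" if "\<gamma> \<E> omega1" "m \<E> omega" "n \<E> m" for \<gamma> m n
  using rm that by blast+
 have a_inj: "n = m" if "\<gamma> \<E> omega1" "m \<E> omega" "n \<E> omega" "aa \<gamma> n = aa \<gamma> m" for \<gamma> m n
  using Ord_linear[OF nat_Ord[OF that(2)] nat_Ord[OF that(3)]] a_mono[OF that(1,2)] a_mono[OF that(1,3)] that(4) not_refl by metis
 have ba: "b \<gamma> \<E> aa \<gamma> n" if g: "\<gamma> \<E> omega1" "n \<E> omega" for \<gamma> n
 proof (cases "n = emp")
  case False
  hence "aa \<gamma> emp \<E> aa \<gamma> n" using a_mono[OF g emp_mem[OF nat_Ord[OF g(2)]]] by blast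
  thus ?thesis using a0[OF g(1)] Ord_trans[OF h_Ord[OF aw[OF g]]] by blast
 qed (use a0[OF g(1)] in simp)
 have FBr: "FB (rr \<gamma> n) (b \<gamma>)" if g: "\<gamma> \<E> omega1" and n: "n \<E> omega" for \<gamma> n
 proof (rule nat_induct[of "%n. FB (rr \<gamma> n) (b \<gamma>)", OF _ _ _ n], intro dfn)
  show "FB (rr \<gamma> emp) (b \<gamma>)" using z(2)[OF g] unfolding rr_def b_def by blast
 qed (use rS[OF g] FB_mono in blast)
 have Kc: "lep K omega" using fin_lep_omega fin_nat K by blast
 \<comment> \<open>Numbering the pairs \<open>(l, s)\<close> lays the points of one tower out as a
   row.\<close>
 obtain e where e: "DF e" "!!d. d \<E> prod K Strs ==> e d \<E> omega" "!!d d'. d \<E> prod K Strs ==> d' \<E> prod K Strs ==> e d = e d' ==> d = d'"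
  using lepE[OF lep_prod_omega[OF Kc Strs_countable]] by blast
 note [dfn] = DFD[OF e(1)]
 define S where "S = (%\<eta> f. Sep (Trip K) (%t. EX \<xi> l s. \<xi> \<E> \<eta> & t = tr \<xi> l s (aa (app f \<xi>) (e (pair l s)))))"
 have dS: "DP (%t. EX \<xi> l s. \<xi> \<E> \<eta> & t = tr \<xi> l s (aa (app f \<xi>) (e (pair l s))))" for \<eta> f by (intro dfn)
 have "DF2 S" unfolding S_def by (intro dfn)
 note [dfn] = DF2D[OF this]
 \<comment> \<open>The next tower starts beyond \<eta>, beyond the place of the system built so far
   in the list, and beyond all its points. So at its \<open>b\<close> this system is listed already
   and its rows are complete.\<close>
 define nx where "nx = (%\<eta> s. succ (un (un \<eta> (en s)) (Union (Repl s (%t. p2 (p2 t))))))"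
 have dR: "DF (%t. p2 (p2 t))" by (intro dfn)
 have "DF2 nx" unfolding nx_def by (intro dfn)
 note [dfn] = DF2D[OF this]
 have "DF2 (%\<eta> f. nx \<eta> (S \<eta> f))" by (intro dfn)
 from Ord_rec[OF this] obtain \<Gamma> where \<Gamma>: "DF \<Gamma>" "!!\<eta>. Ord \<eta> ==> \<Gamma> \<eta> = nx \<eta> (S \<eta> (lam \<eta> \<Gamma>))" by blast
 note [dfn] = DFD[OF \<Gamma>(1)]
 define \<Sigma> where "\<Sigma> = (%\<eta>. S \<eta> (lam \<eta> \<Gamma>))"
 have "DF \<Sigma>" unfolding \<Sigma>_def by (intro dfn)
 note [dfn] = DFD[OF this]
 have \<Sigma>_iff: "tr \<xi> l s a \<E> \<Sigma> \<eta> <-> tr \<xi> l s a \<E> Trip K & \<xi> \<E> \<eta> & a = aa (\<Gamma> \<xi>) (e (pair l s))" for \<xi> l s a \<eta>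
  unfolding \<Sigma>_def S_def mem_Sep[OF dS] using app_lam[OF \<Gamma>(1)] by auto
 have \<Sigma>_tr: "EX \<xi> l s a. t = tr \<xi> l s a" if "t \<E> \<Sigma> \<eta>" for t \<eta>
  using that unfolding \<Sigma>_def S_def mem_Sep[OF dS] by blast
 have \<Sigma>_T: "el (\<Sigma> \<eta>) <= el (Trip K)" for \<eta> unfolding \<Sigma>_def S_def sub_iff mem_Sep[OF dS] by blast
 have \<Sigma>C: "\<Sigma> \<eta> \<E> Ctbl (Trip K)" if "\<eta> \<E> omega1" for \<eta>
 proof -
  have "DF (%t. pair (p1 t) (p1 (p2 t)))" by (intro dfn)
  hence "lep (\<Sigma> \<eta>) (prod \<eta> (prod K Strs))"
  proof (rule lepI)
   fix t assume t: "t \<E> \<Sigma> \<eta>"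
   then obtain \<xi> l s a where tt: "t = tr \<xi> l s a" using \<Sigma>_tr by blast
   hence T: "tr \<xi> l s a \<E> Trip K" "\<xi> \<E> \<eta>" "a = aa (\<Gamma> \<xi>) (e (pair l s))" using t \<Sigma>_iff by blast+
   thus "pair (p1 t) (p1 (p2 t)) \<E> prod \<eta> (prod K Strs)" unfolding mem_Trip tt by (simp add: tr_def)
   fix t' assume t': "t' \<E> \<Sigma> \<eta>" "pair (p1 t) (p1 (p2 t)) = pair (p1 t') (p1 (p2 t'))"
   obtain \<xi>' l' s' a' where tt': "t' = tr \<xi>' l' s' a'" using \<Sigma>_tr t' by blast
   hence "a' = aa (\<Gamma> \<xi>') (e (pair l' s'))" using t' \<Sigma>_iff by blast
   thus "t = t'" using tt tt' t'(2) T(3) by (simp add: tr_def)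
  qed
  hence "lep (\<Sigma> \<eta>) omega" using lep_trans lep_prod_omega Kc Strs_countable that unfolding mem_hartogs by blast
  thus ?thesis unfolding mem_Ctbl using \<Sigma>_T by blast
 qed
 have en: "en (\<Sigma> \<eta>) \<E> omega1" if "\<eta> \<E> omega1" for \<eta> using \<Sigma>C[OF that] col unfolding colouring_def by blast
 let ?U = "%\<eta>. Union (Repl (\<Sigma> \<eta>) (%t. p2 (p2 t)))"
 have U: "?U \<eta> \<E> omega1" if "\<eta> \<E> omega1" for \<eta>
 proof (rule omega1_sup)
  show "lep (Repl (\<Sigma> \<eta>) (%t. p2 (p2 t))) omega" using lep_trans[OF lep_Repl[OF dR]] \<Sigma>C[OF that] unfolding mem_Ctbl by blast
  show "el (Repl (\<Sigma> \<eta>) (%t. p2 (p2 t))) <= el omega1"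
  proof
   fix a assume "a \<in> el (Repl (\<Sigma> \<eta>) (%t. p2 (p2 t)))"
   then obtain t where t: "t \<E> \<Sigma> \<eta>" "a = p2 (p2 t)" unfolding el_iff mem_Repl[OF dR] by blast
   obtain \<xi> l s a' where tt: "t = tr \<xi> l s a'" using \<Sigma>_tr t by blast
   hence "tr \<xi> l s a' \<E> Trip K" using t \<Sigma>_iff by blast
   thus "a \<in> el omega1" unfolding mem_Trip using t tt by (simp add: tr_def)
  qed
 qed
 have \<Gamma>': "\<Gamma> \<eta> = succ (un (un \<eta> (en (\<Sigma> \<eta>))) (?U \<eta>))" if "\<eta> \<E> omega1" for \<eta>
  using \<Gamma>(2)[OF h_Ord[OF that]] unfolding nx_def \<Sigma>_def .
 have unw: "un (un \<eta> (en (\<Sigma> \<eta>))) (?U \<eta>) \<E> omega1" if "\<eta> \<E> omega1" for \<eta>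
  using un_mem[OF Ord_hartogs un_mem[OF Ord_hartogs that en[OF that]] U[OF that]] .
 have \<Gamma>w: "\<Gamma> \<eta> \<E> omega1" if "\<eta> \<E> omega1" for \<eta> unfolding \<Gamma>'[OF that] by (rule hartogs_succ[OF _ unw[OF that]]) simp
 have below: "x \<E> \<Gamma> \<eta>" if "\<eta> \<E> omega1" "x \<E> omega1" "el x <= el (un (un \<eta> (en (\<Sigma> \<eta>))) (?U \<eta>))" for x \<eta>
  unfolding \<Gamma>'[OF that(1)] by (rule Ord_le_succ[OF h_Ord[OF that(2)] h_Ord[OF unw[OF that(1)]] that(3)])
 have bb: "x \<E> b (\<Gamma> \<eta>)" if "\<eta> \<E> omega1" "x \<E> \<Gamma> \<eta>" for x \<eta>
  using Ord_trans[OF h_Ord[OF b(1)[OF \<Gamma>w[OF that(1)]]] b(2)[OF \<Gamma>w[OF that(1)]] that(2)] .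
 have en\<Gamma>: "en (\<Sigma> \<eta>) \<E> b (\<Gamma> \<eta>)" and \<xi>b: "\<xi> \<E> \<eta> ==> \<xi> \<E> b (\<Gamma> \<eta>)" if "\<eta> \<E> omega1" for \<eta> \<xi>
 proof -
  show "en (\<Sigma> \<eta>) \<E> b (\<Gamma> \<eta>)" by (rule bb[OF that below[OF that en[OF that]]]) auto
  have "\<eta> \<E> b (\<Gamma> \<eta>)" by (rule bb[OF that below[OF that that]]) auto
  thus "\<xi> \<E> \<eta> ==> \<xi> \<E> b (\<Gamma> \<eta>)" using Ord_trans[OF h_Ord[OF b(1)[OF \<Gamma>w[OF that]]]] by blast
 qed
 have a\<Gamma>: "a \<E> b (\<Gamma> \<eta>)" if h: "\<eta> \<E> omega1" and t: "tr \<xi> l s a \<E> \<Sigma> \<eta>" for \<eta> \<xi> l s a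
 proof (rule bb[OF h below[OF h]])
  show "a \<E> omega1" using t \<Sigma>_iff unfolding mem_Trip by blast
  have "a \<E> Repl (\<Sigma> \<eta>) (%t. p2 (p2 t))" unfolding mem_Repl[OF dR] using t by (intro exI[of _ "tr \<xi> l s a"]) (simp add: tr_def)
  thus "el a <= el (un (un \<eta> (en (\<Sigma> \<eta>))) (?U \<eta>))" unfolding sub_iff mem_un mem_Union by blast
 qed
 have trin: "tr \<xi> l s (aa (\<Gamma> \<xi>) (e (pair l s))) \<E> \<Sigma> \<eta>" if "\<eta> \<E> omega1" "\<xi> \<E> \<eta>" "l \<E> K" "s \<E> Strs" for \<xi> \<eta> l s
 proof -
  have "\<xi> \<E> omega1" using h_trans[OF that(1,2)] .
  thus ?thesis unfolding \<Sigma>_iff mem_Trip using that aw[OF \<Gamma>w e(2)] by simp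
 qed
 have lt: "aa (\<Gamma> \<xi>) (e (pair l s)) ~= aa (\<Gamma> \<xi>') (e (pair l' s'))"
  if h: "\<xi>' \<E> omega1" "\<xi> \<E> \<xi>'" "l \<E> K" "s \<E> Strs" "l' \<E> K" "s' \<E> Strs" for \<xi> \<xi>' l s l' s'
 proof -
  have "e (pair l' s') \<E> omega" using e(2) h(5,6) by simp
  hence 1: "b (\<Gamma> \<xi>') \<E> aa (\<Gamma> \<xi>') (e (pair l' s'))" using ba[OF \<Gamma>w[OF h(1)]] by blast
  have "aa (\<Gamma> \<xi>) (e (pair l s)) \<E> b (\<Gamma> \<xi>')" by (rule a\<Gamma>[OF h(1) trin[OF h(1-4)]])
  thus ?thesis using 1 not_sym by metis
 qed
 have good: "good (\<Sigma> \<eta>)" if h: "\<eta> \<E> omega1" for \<eta>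
  unfolding good_def
 proof (rule conjI)
  show "ALL \<xi> l s a a'. tr \<xi> l s a \<E> \<Sigma> \<eta> --> tr \<xi> l s a' \<E> \<Sigma> \<eta> --> a = a'" by (simp add: \<Sigma>_iff)
  show "ALL \<xi> l s \<xi>' l' s' a. tr \<xi> l s a \<E> \<Sigma> \<eta> --> tr \<xi>' l' s' a \<E> \<Sigma> \<eta> --> \<xi> = \<xi>' & l = l' & s = s'"
  proof (intro allI impI)
   fix \<xi> l s \<xi>' l' s' a assume 1: "tr \<xi> l s a \<E> \<Sigma> \<eta>" and 2: "tr \<xi>' l' s' a \<E> \<Sigma> \<eta>"
   have 3: "\<xi> \<E> omega1" "l \<E> K" "s \<E> Strs" "a = aa (\<Gamma> \<xi>) (e (pair l s))" using 1 unfolding \<Sigma>_iff mem_Trip by blast+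
   have 4: "\<xi>' \<E> omega1" "l' \<E> K" "s' \<E> Strs" "a = aa (\<Gamma> \<xi>') (e (pair l' s'))" using 2 unfolding \<Sigma>_iff mem_Trip by blast+
   have "\<xi> = \<xi>'" using h_linear[OF 3(1) 4(1)]
    lt[OF 4(1) _ 3(2,3) 4(2,3)] lt[OF 3(1) _ 4(2,3) 3(2,3)] 3(4) 4(4) by metis
   moreover have "e (pair l s) = e (pair l' s')"
    by (rule a_inj[OF \<Gamma>w[OF 3(1)]]) (use 3 4 e(2) \<open>\<xi> = \<xi>'\<close> in auto)
   hence "pair l s = pair l' s'" by (rule e(3)[rotated 2]) (use 3 4 in auto)
   ultimately show "\<xi> = \<xi>' & l = l' & s = s'" by simp
  qed
 qed
 have full: "full K (\<Sigma> \<eta>) (b (\<Gamma> \<eta>)) \<xi>" if h: "\<eta> \<E> omega1" "\<xi> \<E> \<eta>" for \<eta> \<xi>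
  unfolding full_def using trin[OF h] a\<Gamma>[OF h(1)] by blast
 \<comment> \<open>The place that \<open>b (\<Gamma> \<eta>)\<close> assigns to the part of the
   system before \<eta>. It alone determines the length of the strings used by the colouring
   there.\<close>
 define m where "m = (%\<eta>. \<iota> (b (\<Gamma> \<eta>)) (en (\<Sigma> \<eta>)))"
 have dm: "DF m" unfolding m_def by (intro dfn)
 note [dfn] = DFD[OF dm]
 have "m \<eta> \<E> omega" if "\<eta> \<E> omega1" for \<eta> using col b(1)[OF \<Gamma>w[OF that]] en\<Gamma>[OF that] unfolding colouring_def m_def by blast
 from pigeonhole[OF dm lep_refl this not_lep_hartogs omega_square]
 obtain M where M: "M \<E> omega" "~ lep (Sep omega1 (%x. m x = M)) omega" by blast
 define Y where "Y = Sep omega1 (%x. m x = M)"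
 have dY: "DP (%x. m x = M)" by (intro dfn)
 have Y: "\<eta> \<E> Y <-> \<eta> \<E> omega1 & m \<eta> = M" for \<eta> unfolding Y_def mem_Sep[OF dY] ..
 \<comment> \<open>Once the place \<open>M\<close> is fixed, finitely many points of each row can be
   used, so one \<open>n\<close> works for all towers: the condition \<open>rr _ n\<close> forces
   all these points of its row into the first set.\<close>
 have "fin (Repl (prod K (Str (succ M))) e)" by (intro fin_Repl e(1) fin_prod fin_nat K fin_Str succ_omega M(1))
 moreover have Sub: "s \<E> Str (succ M) ==> s \<E> Strs" for s using mem_Strs succ_omega[OF M(1)] by blast
 hence "y \<E> omega" if "y \<E> Repl (prod K (Str (succ M))) e" for y
  using that e(2) unfolding mem_Repl[OF e(1)] by (auto simp: mem_prod)
 ultimately obtain n where n: "n \<E> omega" "el (Repl (prod K (Str (succ M))) e) <= el n" using fin_nat_bound by blast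
 have en': "e (pair l s) \<E> n" if "l \<E> K" "s \<E> Str (succ M)" for l s
 proof -
  have "e (pair l s) \<E> Repl (prod K (Str (succ M))) e" unfolding mem_Repl[OF e(1)] by (intro exI[of _ "pair l s"]) (use that in simp)
  thus ?thesis using n(2) by auto
 qed
 define q where "q = (%\<eta>. rr (\<Gamma> \<eta>) n)"
 have dq: "DF q" unfolding q_def by (intro dfn)
 \<comment> \<open>The \<open>k\<close> points come from row \<xi>, hence from the tower that gives
   \<open>q \<xi>\<close>, while the point of the second set comes from the tower that gives
   \<open>q \<eta>\<close>. A common extension would force both and be a hit.\<close>
 have inc: "~ (le t (q \<xi>) & le t (q \<eta>))" if h: "\<eta> \<E> Y" "\<xi> \<E> \<eta>" for \<eta> \<xi> t
 proof (rule notI)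
  assume t: "le t (q \<xi>) & le t (q \<eta>)"
  have \<eta>: "\<eta> \<E> omega1" "m \<eta> = M" using h(1) Y by blast+
  have \<xi>: "\<xi> \<E> omega1" using h_trans[OF \<eta>(1) h(2)] .
  have "EX x v. (ALL l. l \<E> K --> app x l \<E> b (\<Gamma> \<eta>) & cf (app x l) (b (\<Gamma> \<eta>)) = v &
        (EX s. s \<E> Str (succ (m \<eta>)) & tr \<xi> l s (app x l) \<E> \<Sigma> \<eta>)) &
       (ALL l l'. l \<E> K --> l' \<E> K --> app x l = app x l' --> l = l')"
   using col \<Sigma>C[OF \<eta>(1)] b(1)[OF \<Gamma>w[OF \<eta>(1)]] en\<Gamma>[OF \<eta>(1)] \<xi>b[OF \<eta>(1) h(2)] good[OF \<eta>(1)] full[OF \<eta>(1) h(2)]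
   unfolding colouring_def m_def by blast
  then obtain x v where x: "!!l. l \<E> K ==> app x l \<E> b (\<Gamma> \<eta>) & cf (app x l) (b (\<Gamma> \<eta>)) = v &
        (EX s. s \<E> Str (succ M) & tr \<xi> l s (app x l) \<E> \<Sigma> \<eta>)"
   "ALL l l'. l \<E> K --> l' \<E> K --> app x l = app x l' --> l = l'" unfolding \<eta>(2) by blast
  have FAx: "FA t (app x l)" if l: "l \<E> K" for l
  proof -
   obtain s where s: "s \<E> Str (succ M)" "tr \<xi> l s (app x l) \<E> \<Sigma> \<eta>" using x(1)[OF l] by blast
   hence eq: "app x l = aa (\<Gamma> \<xi>) (e (pair l s))" using \<Sigma>_iff by blast
   have ew: "e (pair l s) \<E> omega" by (rule e(2)) (use l Sub[OF s(1)] in simp)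
   have "FA (rr (\<Gamma> \<xi>) (succ (e (pair l s)))) (app x l)" unfolding eq by (rule FAr[OF \<Gamma>w[OF \<xi>] ew])
   moreover have "le t (rr (\<Gamma> \<xi>) (succ (e (pair l s))))"
    using le_trans[OF _ r_mono[OF \<Gamma>w[OF \<xi>] n(1) en'[OF l s(1)]]] t unfolding q_def by blast
   ultimately show ?thesis by (rule FA_mono)
  qed
  have "le t p" using le_trans[OF _ rp[OF \<Gamma>w[OF \<eta>(1)] n(1)]] t unfolding q_def by blast
  moreover have "FB t (b (\<Gamma> \<eta>))" using FB_mono[OF FBr[OF \<Gamma>w[OF \<eta>(1)] n(1)]] t unfolding q_def by blast
  ultimately show False using no b(1)[OF \<Gamma>w[OF \<eta>(1)]] FAx x by blast
 qed
 have qP: "q \<eta> \<E> P" if "\<eta> \<E> Y" for \<eta> using leD(1)[OF rp[OF \<Gamma>w n(1)]] that Y unfolding q_def by blast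
 obtain \<xi> \<eta> t where h: "\<xi> \<E> Y" "\<eta> \<E> Y" "\<xi> ~= \<eta>" "le t (q \<xi>)" "le t (q \<eta>)" using cccD[OF ccc dq M(2)[folded Y_def] qP] by blast
 thus False using h_linear[of \<xi> omega \<eta> omega] Y inc by blast
qed

end

context generic_ext begin

text \<open>A failure in the extension is reflected by one condition of the filter: below it both
  sets are forced to be unbounded and no condition forces a hit, which \<open>ccc_hit\<close>
  refutes.\<close>

lemma indestructible:
 assumes ccc: ccc and K: "K \<E> omega" and cfd: "DF2 cf" "DF en" "DF2 \<iota>" and col: "colouring K cf en \<iota>"
  and A: "!!\<gamma>. \<gamma> \<E> omega1 ==> EX a. a \<E> omega1 & \<gamma> \<E> a & N (j a) A"
  and B: "!!\<gamma>. \<gamma> \<E> omega1 ==> EX a. a \<E> omega1 & \<gamma> \<E> a & N (j a) B"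
 shows "EX b x v. b \<E> omega1 & N (j b) B & (ALL l. l \<E> K --> app x l \<E> b & N (j (app x l)) A & cf (app x l) b = v) &
  (ALL l l'. l \<E> K --> l' \<E> K --> app x l = app x l' --> l = l')"
proof (rule ccontr)
 assume no: "~ ?thesis"
 note [dfn] = DF2D[OF cfd(1)] DFD[OF cfd(2)] DF2D[OF cfd(3)]
 obtain \<tau>A \<tau>B where \<tau>: "A = val \<tau>A" "B = val \<tau>B" using val_ex by metis
 have forced: "EX p:G. ALL q \<gamma>. le q p --> \<gamma> \<E> omega1 --> (EX r a. le r q & a \<E> omega1 & \<gamma> \<E> a & fmem r (chk a) \<tau>)"
  if h: "!!\<gamma>. \<gamma> \<E> omega1 ==> EX a. a \<E> omega1 & \<gamma> \<E> a & N (j a) (val \<tau>)" for \<tau>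
 proof -
  have d: "DP (%q. EX \<gamma>. \<gamma> \<E> omega1 & (ALL r a. le r q --> a \<E> omega1 --> \<gamma> \<E> a --> ~ fmem r (chk a) \<tau>))" by (intro dfn)
  obtain p where "p \<in> G" "!!q. le q p ==> ~ (EX \<gamma>. \<gamma> \<E> omega1 & (ALL r a. le r q --> a \<E> omega1 --> \<gamma> \<E> a --> ~ fmem r (chk a) \<tau>))"
  proof (rule G_meets[OF d])
   fix s assume s: "s \<in> G"
   show "~ (EX \<gamma>. \<gamma> \<E> omega1 & (ALL r a. le r s --> a \<E> omega1 --> \<gamma> \<E> a --> ~ fmem r (chk a) \<tau>))"
   proof (intro notI, elim exE conjE)
    fix \<gamma> assume g: "\<gamma> \<E> omega1" "ALL r a. le r s --> a \<E> omega1 --> \<gamma> \<E> a --> ~ fmem r (chk a) \<tau>"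
    obtain a where a: "a \<E> omega1" "\<gamma> \<E> a" "N (j a) (val \<tau>)" using h[OF g(1)] by blast
    then obtain p where p: "p \<in> G" "fmem p (chk a) \<tau>" unfolding j_def N_mem by blast
    obtain r where "le r s" "le r p" using Gdir s p(1) by blast
    thus False using g(2) a fmem_mono[OF p(2)] by blast
   qed
  qed blast
  thus ?thesis by blast
 qed
 obtain pA where pA: "pA \<in> G" "!!q \<gamma>. le q pA ==> \<gamma> \<E> omega1 ==> EX r a. le r q & a \<E> omega1 & \<gamma> \<E> a & fmem r (chk a) \<tau>A"
  using forced[of \<tau>A] A unfolding \<tau> by blast
 obtain pB where pB: "pB \<in> G" "!!q \<gamma>. le q pB ==> \<gamma> \<E> omega1 ==> EX r a. le r q & a \<E> omega1 & \<gamma> \<E> a & fmem r (chk a) \<tau>B"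
  using forced[of \<tau>B] B unfolding \<tau> by blast
 let ?H = "%r. EX b x v. b \<E> omega1 & fmem r (chk b) \<tau>B & (ALL l. l \<E> K --> app x l \<E> b & fmem r (chk (app x l)) \<tau>A & cf (app x l) b = v) &
  (ALL l l'. l \<E> K --> l' \<E> K --> app x l = app x l' --> l = l')"
 have d: "DP ?H" by (intro dfn)
 obtain pH where pH: "pH \<in> G" "!!q. le q pH ==> ~ ?H q"
 proof (rule G_meets[OF d])
  fix s assume s: "s \<in> G"
  show "~ ?H s"
  proof (intro notI, elim exE conjE)
   fix b x v assume h: "b \<E> omega1" "fmem s (chk b) \<tau>B" "ALL l. l \<E> K --> app x l \<E> b & fmem s (chk (app x l)) \<tau>A & cf (app x l) b = v"
    "ALL l l'. l \<E> K --> l' \<E> K --> app x l = app x l' --> l = l'"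
   have jm: "fmem s (chk a) t ==> N (j a) (val t)" for a t unfolding j_def N_mem using s by blast
   have 1: "N (j b) B" unfolding \<tau> by (rule jm[OF h(2)])
   have 2: "N (j (app x l)) A" if "l \<E> K" for l unfolding \<tau> using jm h(3) that by blast
   show False by (rule no[THEN notE], rule exI[of _ b], rule exI[of _ x], rule exI[of _ v]) (simp add: h(1) 1 2 h(3)[rule_format] h(4))
  qed
 qed blast
 obtain s where s: "s \<in> G" "le s pA" "le s pB" using Gdir pA(1) pB(1) by blast
 obtain p where p: "p \<in> G" "le p s" "le p pH" using Gdir s(1) pH(1) by blast
 have "DP2 (%r a. fmem r (chk a) \<tau>A)" "DP2 (%r a. fmem r (chk a) \<tau>B)" by (intro dfn)+
 note d2 = this
 have pAB: "le q p ==> le q pA" "le q p ==> le q pB" for q using le_trans p(2) s(2,3) by blast+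
 have "EX r b x v. le r p & b \<E> omega1 & fmem r (chk b) \<tau>B & (ALL l. l \<E> K --> app x l \<E> b & fmem r (chk (app x l)) \<tau>A & cf (app x l) b = v) &
  (ALL l l'. l \<E> K --> l' \<E> K --> app x l = app x l' --> l = l')"
  by (rule ccc_hit[OF ccc K cfd col d2 GP[OF p(1)]]) ((rule pA(2) pB(2), erule pAB, assumption) | erule (1) fmem_mono)+
 thus False using pH(2) le_trans[OF _ p(3)] by blast
qed

end

subsection \<open>Two-step iterations with a forced ccc preorder on \<open>\<omega>\<^sub>1\<close>\<close>

context zf begin

text \<open>A preorder is coded by its relation \<open>r\<close>; its conditions are the \<open>p\<close> with \<open>pair p p \<E> r\<close>.\<close>

definition compat where "compat r p q <-> (EX s. pair s p \<E> r & pair s q \<E> r)"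
lemma dfn_compat [dfn]: assumes [THEN DT_shift, dfn]: "DT s" "DT t" "DT u" shows "Dfn (%e. compat (s e) (t e) (u e))"
 unfolding compat_def by (intro dfn)

definition preord where "preord r <-> (ALL p q s. pair p q \<E> r --> pair q s \<E> r --> pair p s \<E> r) &
  (ALL p q. pair p q \<E> r --> pair p p \<E> r & pair q q \<E> r)"

text \<open>\<open>R\<close> is a name for a relation: \<open>pair s (pair x y) \<E> R\<close> means that \<open>s\<close> puts \<open>(x, y)\<close> into it.\<close>

definition FR where "FR r R p x y <-> (ALL q. pair q p \<E> r --> (EX t s. pair t q \<E> r & pair t s \<E> r & pair s (pair x y) \<E> R))"
lemma dfn_FR [dfn]: assumes [THEN DT_shift, dfn]: "DT a" "DT b" "DT c" "DT d" "DT f" shows "Dfn (%e. FR (a e) (b e) (c e) (d e) (f e))"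
 unfolding FR_def by (intro dfn)

text \<open>Inclusion of the sets of predecessors is always a preorder, and is the given relation if that is a preorder.\<close>

definition FQ where "FQ r R p x y <-> (ALL q z. pair q p \<E> r --> FR r R q z x --> FR r R q z y)"
lemma dfn_FQ [dfn]: assumes [THEN DT_shift, dfn]: "DT a" "DT b" "DT c" "DT d" "DT f" shows "Dfn (%e. FQ (a e) (b e) (c e) (d e) (f e))"
 unfolding FQ_def by (intro dfn)

end

context zfc begin

text \<open>The members \<open>i\<close> and \<open>k\<close> of a family of conditions of the
  two-step order have a common extension \<open>(s, z)\<close>.\<close>

definition two_compat where "two_compat r R f i k <-> (EX s z. z \<E> omega1 & pair s (p1 (app f i)) \<E> r & pair s (p1 (app f k)) \<E> r &
  FQ r R s z (p2 (app f i)) & FQ r R s z (p2 (app f k)))"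
lemma dfn_two_compat [dfn]: assumes [THEN DT_shift, dfn]: "DT a" "DT b" "DT c" "DT d" "DT f" shows "Dfn (%e. two_compat (a e) (b e) (c e) (d e) (f e))"
 unfolding two_compat_def by (intro dfn)

text \<open>The condition \<open>g\<close> forces the named preorder to be ccc, expressed without
  names for antichains: families in the two-step order below \<open>g\<close> have two compatible
  members.\<close>

definition GC where "GC r R g <-> (ALL f. (ALL i. i \<E> omega1 --> pair (p1 (app f i)) g \<E> r & p2 (app f i) \<E> omega1) -->
  (EX i k. i \<E> omega1 & k \<E> omega1 & i ~= k & two_compat r R f i k))"
lemma dfn_GC [dfn]: assumes [THEN DT_shift, dfn]: "DT a" "DT b" "DT c" shows "Dfn (%e. GC (a e) (b e) (c e))"
 unfolding GC_def by (intro dfn)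

text \<open>
 The iterand at a stage is the preorder named by \<open>R\<close> below the conditions that force it to be ccc; below
 the others any two points are equivalent. So every iterand is ccc, whatever \<open>R\<close> is.
\<close>

definition SR where "SR r R p x y <-> (ALL q. pair q p \<E> r --> GC r R q --> FQ r R q x y)"
lemma dfn_SR [dfn]: assumes [THEN DT_shift, dfn]: "DT a" "DT b" "DT c" "DT d" "DT f" shows "Dfn (%e. SR (a e) (b e) (c e) (d e) (f e))"
 unfolding SR_def by (intro dfn)

definition cc where "cc r <-> (ALL f. (ALL i. i \<E> omega1 --> pair (app f i) (app f i) \<E> r) -->
  (EX i k. i \<E> omega1 & k \<E> omega1 & i ~= k & compat r (app f i) (app f k)))"
lemma dfn_cc [THEN DPD, dfn]: "DP cc"
 unfolding cc_def by (intro dfn)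

section \<open>Chain conditions and thinning out\<close>

lemma uncountable_enum: assumes "~ lep X omega"
 obtains h where "DF h" "!!i. i \<E> omega1 ==> h i \<E> X" "!!i k. i \<E> omega1 ==> k \<E> omega1 ==> h i = h k ==> i = k"
 using lepE[OF not_lepD[OF assms]] by blast

lemma ccD: assumes cc: "cc r" and f: "DF f" and X: "~ lep X omega" "!!i. i \<E> X ==> pair (f i) (f i) \<E> r"
 shows "EX i k. i \<E> X & k \<E> X & i ~= k & compat r (f i) (f k)"
proof -
 obtain h where h: "DF h" "!!i. i \<E> omega1 ==> h i \<E> X" "!!i k. i \<E> omega1 ==> k \<E> omega1 ==> h i = h k ==> i = k"
  using uncountable_enum[OF X(1)] by blast
 note [dfn] = DFD[OF f] DFD[OF h(1)]
 have d: "DF (%i. f (h i))" by (intro dfn)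
 have "EX i k. i \<E> omega1 & k \<E> omega1 & i ~= k & compat r (app (lam omega1 (%i. f (h i))) i) (app (lam omega1 (%i. f (h i))) k)"
  using cc X(2)[OF h(2)] app_lam[OF d] unfolding cc_def by simp
 then obtain i k where "i \<E> omega1" "k \<E> omega1" "i ~= k" "compat r (f (h i)) (f (h k))" using app_lam[OF d] by auto
 thus ?thesis using h by blast
qed

lemma uncountable_split: assumes "DP Q" "~ lep X omega" shows "~ lep (Sep X Q) omega | ~ lep (Sep X (%x. ~ Q x)) omega"
proof (rule ccontr)
 note [dfn] = DPD[OF assms(1)]
 have d: "DP (%x. ~ Q x)" by (intro dfn)
 assume "~ ?thesis"
 hence "lep (un (Sep X Q) (Sep X (%x. ~ Q x))) omega" using lep_un omega_square by blast
 moreover have "el X <= el (un (Sep X Q) (Sep X (%x. ~ Q x)))" by (auto simp: mem_Sep[OF assms(1)] mem_Sep[OF d])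
 ultimately show False using assms(2) lep_subset lep_trans by blast
qed

text \<open>An \<omega>1-sequence in \<kappa> whose terms outrun the \<open>f\<close>-values of the
  earlier ones. It is applied to \<omega>1 and to \<omega>2, where members of a family must escape
  the bounds set by their predecessors.\<close>

lemma thin:
 assumes O: "Ord \<kappa>" and reg: "!!X. lep X omega ==> el X <= el \<kappa> ==> EX \<beta>. \<beta> \<E> \<kappa> & el X <= el \<beta>"
  and lim: "!!x. x \<E> \<kappa> ==> succ x \<E> \<kappa>" and f: "DF f" "!!x. x \<E> \<kappa> ==> f x \<E> \<kappa>"
 shows "EX g. DF g & (ALL \<eta>. \<eta> \<E> omega1 --> g \<eta> \<E> \<kappa>) & (ALL \<eta> \<zeta>. \<eta> \<E> omega1 --> \<zeta> \<E> \<eta> --> f (g \<zeta>) \<E> g \<eta> & g \<zeta> \<E> g \<eta>)"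
proof -
 note [dfn] = DFD[OF f(1)]
 have "DF2 (%\<eta> h. succ (Union (Repl \<eta> (%\<zeta>. un (f (app h \<zeta>)) (app h \<zeta>)))))" by (intro dfn)
 from Ord_rec[OF this] obtain g where g: "DF g"
  "!!\<eta>. Ord \<eta> ==> g \<eta> = succ (Union (Repl \<eta> (%\<zeta>. un (f (app (lam \<eta> g) \<zeta>)) (app (lam \<eta> g) \<zeta>))))" by blast
 note [dfn] = DFD[OF g(1)]
 have d1: "DF (%\<zeta>. un (f (app h \<zeta>)) (app h \<zeta>))" and d2: "DF (%\<zeta>. un (f (g \<zeta>)) (g \<zeta>))" for h by (intro dfn)+
 let ?X = "%\<eta>. Repl \<eta> (%\<zeta>. un (f (g \<zeta>)) (g \<zeta>))"
 have g2: "g \<eta> = succ (Union (?X \<eta>))" if "Ord \<eta>" for \<eta>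
 proof -
  have "Repl \<eta> (%\<zeta>. un (f (app (lam \<eta> g) \<zeta>)) (app (lam \<eta> g) \<zeta>)) = ?X \<eta>"
   by (rule ext) (unfold mem_Repl[OF d1] mem_Repl[OF d2], metis app_lam[OF g(1)])
  thus ?thesis using g(2)[OF that] by simp
 qed
 have U: "Union (?X \<eta>) \<E> \<kappa>" if \<eta>: "\<eta> \<E> omega1" and IH: "!!\<zeta>. \<zeta> \<E> \<eta> ==> g \<zeta> \<E> \<kappa>" for \<eta>
 proof -
  have X: "el (?X \<eta>) <= el \<kappa>" using un_mem[OF O f(2)[OF IH] IH] by (auto simp: mem_Repl[OF d2])
  moreover have "lep (?X \<eta>) omega" using lep_trans[OF lep_Repl[OF d2]] \<eta> unfolding mem_hartogs by blast
  ultimately obtain \<beta> where \<beta>: "\<beta> \<E> \<kappa>" "el (?X \<eta>) <= el \<beta>" using reg by blast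
  have O\<beta>: "Ord \<beta>" using Ord_mem[OF O \<beta>(1)] .
  have "el (Union (?X \<eta>)) <= el \<beta>"
   unfolding sub_iff mem_Union using \<beta>(2) Ord_trans[OF O\<beta>] by (metis el_iff subsetD)
  moreover have "Ord (Union (?X \<eta>))" by (rule Ord_Union, rule Ord_mem[OF O]) (use X in "auto simp: subset_eq")
  ultimately show ?thesis using Ord_subset[OF _ O\<beta>] \<beta>(1) Ord_trans[OF O \<beta>(1)] by blast
 qed
 have g\<kappa>: "\<eta> \<E> omega1 --> g \<eta> \<E> \<kappa>" if "Ord \<eta>" for \<eta>
 proof (rule Ord_induct[of "%\<eta>. \<eta> \<E> omega1 --> g \<eta> \<E> \<kappa>", OF _ _ that], intro dfn, intro impI)
  fix \<eta> assume \<eta>: "Ord \<eta>" "\<eta> \<E> omega1" and IH: "!!\<zeta>. \<zeta> \<E> \<eta> ==> \<zeta> \<E> omega1 --> g \<zeta> \<E> \<kappa>"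
  show "g \<eta> \<E> \<kappa>" unfolding g2[OF \<eta>(1)] using lim U[OF \<eta>(2)] IH h_trans[OF \<eta>(2)] by blast
 qed
 show ?thesis
 proof (intro exI[of _ g] conjI allI impI g(1))
  show "\<eta> \<E> omega1 ==> g \<eta> \<E> \<kappa>" for \<eta> using g\<kappa> h_Ord by blast
  fix \<eta> \<zeta> assume \<eta>: "\<eta> \<E> omega1" "\<zeta> \<E> \<eta>"
  have O\<eta>: "Ord \<eta>" using h_Ord[OF \<eta>(1)] .
  have gk: "\<zeta> \<E> \<eta> ==> g \<zeta> \<E> \<kappa>" for \<zeta> using g\<kappa> h_Ord h_trans[OF \<eta>(1)] by blast
  have OU: "Ord (Union (?X \<eta>))" using Ord_mem[OF O U[OF \<eta>(1) gk]] .
  have "el (un (f (g \<zeta>)) (g \<zeta>)) <= el (Union (?X \<eta>))" using \<eta>(2) unfolding sub_iff mem_UN[OF d2] by blast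
  hence "el (f (g \<zeta>)) <= el (Union (?X \<eta>))" "el (g \<zeta>) <= el (Union (?X \<eta>))" unfolding sub_iff mem_un by blast+
  thus "f (g \<zeta>) \<E> g \<eta>" "g \<zeta> \<E> g \<eta>" unfolding g2[OF O\<eta>]
   using Ord_le_succ[OF _ OU] Ord_mem[OF O f(2)[OF gk[OF \<eta>(2)]]] Ord_mem[OF O gk[OF \<eta>(2)]] by blast+
 qed
qed

lemma thin_omega1: assumes "DF f" "!!x. x \<E> omega1 ==> f x \<E> omega1"
 obtains g where "DF g" "!!\<eta>. \<eta> \<E> omega1 ==> g \<eta> \<E> omega1" "!!\<eta> \<zeta>. \<eta> \<E> omega1 ==> \<zeta> \<E> \<eta> ==> f (g \<zeta>) \<E> g \<eta> & g \<zeta> \<E> g \<eta>"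
proof -
 have "succ x \<E> omega1" if "x \<E> omega1" for x by (rule hartogs_succ[OF _ that]) simp
 thus thesis using thin[OF Ord_hartogs hartogs_regular[OF _ _ omega_square] _ assms] that by blast
qed

lemma omega1_bound: assumes "!!X. X \<E> omega1 ==> EX x. x \<E> b & x \<E> omega1 & X \<E> x" shows "~ lep b omega"
proof
 assume "lep b omega"
 have d: "DP (%x. x \<E> omega1)" by (intro dfn)
 have "lep (Sep b (%x. x \<E> omega1)) omega" by (rule lep_trans[OF lep_subset \<open>lep b omega\<close>]) (auto simp: mem_Sep[OF d])
 moreover have "el (Sep b (%x. x \<E> omega1)) <= el omega1" by (auto simp: mem_Sep[OF d])
 ultimately obtain \<beta> where \<beta>: "\<beta> \<E> omega1" "el (Sep b (%x. x \<E> omega1)) <= el \<beta>"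
  using hartogs_regular[OF _ _ omega_square] by blast
 obtain x where "x \<E> b" "x \<E> omega1" "\<beta> \<E> x" using assms[OF \<beta>(1)] by blast
 moreover hence "x \<E> \<beta>" using \<beta>(2) by (auto simp: mem_Sep[OF d] subset_eq)
 ultimately show False using not_sym by blast
qed

lemma strict_inj: assumes "!!\<eta> \<zeta>. \<eta> \<E> omega1 ==> \<zeta> \<E> \<eta> ==> g \<zeta> \<E> g \<eta>" "i \<E> omega1" "k \<E> omega1" "g i = g k" shows "i = k"
 using h_linear[OF assms(2) assms(3)] assms not_refl by metis

text \<open>Some member of an \<omega>1-sequence forces that uncountably many members lie in the
  filter. Otherwise each has an extension that excludes all members from some bound on, and thinning
  out by these bounds produces an uncountable antichain.\<close>

lemma unbounded:
 assumes cc: "cc r" and po: "preord r"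
  and f: "DF f" "!!i. i \<E> omega1 ==> pair (f i) (f i) \<E> r"
 shows "EX i. i \<E> omega1 & (ALL q \<gamma>. pair q (f i) \<E> r --> \<gamma> \<E> omega1 --> (EX k. k \<E> omega1 & \<gamma> \<E> k & compat r q (f k)))"
proof (rule ccontr)
 have tr: "!!p q s. pair p q \<E> r ==> pair q s \<E> r ==> pair p s \<E> r" and rf: "!!p q. pair p q \<E> r ==> pair p p \<E> r"
  using po unfolding preord_def by blast+
 assume a: "~ ?thesis"
 note [dfn] = DFD[OF f(1)]
 let ?R = "%i z. pair (p1 z) (f i) \<E> r & p2 z \<E> omega1 & (ALL k. k \<E> omega1 --> p2 z \<E> k --> ~ compat r (p1 z) (f k))"
 have "DP2 ?R" by (intro dfn)
 moreover have "EX z. ?R i z" if i: "i \<E> omega1" for i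
 proof -
  obtain q \<gamma> where "pair q (f i) \<E> r" "\<gamma> \<E> omega1" "ALL k. k \<E> omega1 --> \<gamma> \<E> k --> ~ compat r q (f k)" using a i by blast
  thus ?thesis by (intro exI[of _ "pair q \<gamma>"]) simp
 qed
 ultimately obtain z where z: "DF z" "!!i. i \<E> omega1 ==> ?R i (z i)" using choice[of ?R omega1] by blast
 note [dfn] = DFD[OF z(1)]
 have d: "DF (%i. p2 (z i))" by (intro dfn)
 obtain g where g: "DF g" "!!\<eta>. \<eta> \<E> omega1 ==> g \<eta> \<E> omega1" "!!\<eta> \<zeta>. \<eta> \<E> omega1 ==> \<zeta> \<E> \<eta> ==> p2 (z (g \<zeta>)) \<E> g \<eta> & g \<zeta> \<E> g \<eta>"
  using thin_omega1[OF d] z(2) by blast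
 note [dfn] = DFD[OF g(1)]
 have "DF (%i. p1 (z (g i)))" by (intro dfn)
 from ccD[OF cc this not_lep_hartogs] obtain i k where ik: "i \<E> omega1" "k \<E> omega1" "i ~= k" "compat r (p1 (z (g i))) (p1 (z (g k)))"
  using z(2)[OF g(2)] rf by blast
 have no: False if h: "k \<E> omega1" "i \<E> k" "compat r (p1 (z (g i))) (p1 (z (g k)))" for i k
 proof -
  have i: "i \<E> omega1" using h_trans[OF h(1,2)] .
  obtain s where "pair s (p1 (z (g i))) \<E> r" "pair s (p1 (z (g k))) \<E> r" using h(3) unfolding compat_def by blast
  hence "compat r (p1 (z (g i))) (f (g k))" using tr z(2)[OF g(2)[OF h(1)]] unfolding compat_def by blast
  thus False using z(2)[OF g(2)[OF i]] g(2)[OF h(1)] g(3)[OF h(1,2)] by blast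
 qed
 have "compat r (p1 (z (g k))) (p1 (z (g i)))" using ik(4) unfolding compat_def by blast
 thus False using h_linear[OF ik(1) ik(2)] no ik by blast
qed

lemma preord_trans: "preord r ==> pair p q \<E> r ==> pair q s \<E> r ==> pair p s \<E> r" unfolding preord_def by blast
lemma FR_mono: "[|preord r; FR r R p x y; pair q p \<E> r|] ==> FR r R q x y"
 unfolding FR_def using preord_trans[of r _ q p] by blast
lemma FQ_mono: "[|preord r; FQ r R p x y; pair q p \<E> r|] ==> FQ r R q x y"
 unfolding FQ_def using preord_trans[of r _ q p] by blast
lemma GC_mono: "[|preord r; GC r R p; pair q p \<E> r|] ==> GC r R q"
 unfolding GC_def using preord_trans[of r _ q p] by blast
lemma SR_mono: "[|preord r; SR r R p x y; pair q p \<E> r|] ==> SR r R q x y"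
 unfolding SR_def using preord_trans[of r _ q p] by blast
lemma FQ_refl: "FQ r R p x x" unfolding FQ_def by blast
lemma SR_refl: "SR r R p x x" unfolding SR_def by (simp add: FQ_refl)
lemma SR_trans: "SR r R p x y ==> SR r R p y z ==> SR r R p x z" unfolding SR_def FQ_def by blast
lemma FQ_SR: "[|preord r; FQ r R p x y|] ==> SR r R p x y"
 unfolding SR_def using FQ_mono by blast

text \<open>If uncountably many first coordinates have no extension with \<open>GC\<close>, then
  below these the second coordinates are all equivalent and the chain condition of \<open>r\<close>
  suffices. Otherwise first coordinates with \<open>GC\<close> are used, and one of them, compatible
  with uncountably many others, supplies the family for its own \<open>GC\<close>.\<close>

lemma two_step:
 assumes cc: "cc r" and po: "preord r"
  and f: "DF f" "DF x" and X: "~ lep X omega" "!!i. i \<E> X ==> pair (f i) (f i) \<E> r" "!!i. i \<E> X ==> x i \<E> omega1"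
 shows "EX i k s z. i \<E> X & k \<E> X & i ~= k & pair s (f i) \<E> r & pair s (f k) \<E> r & z \<E> omega1 & SR r R s z (x i) & SR r R s z (x k)"
proof -
 have tr: "!!p q s. pair p q \<E> r ==> pair q s \<E> r ==> pair p s \<E> r" and rf: "!!p q. pair p q \<E> r ==> pair p p \<E> r"
  using po unfolding preord_def by blast+
 note [dfn] = DFD[OF f(1)] DFD[OF f(2)]
 let ?Q = "%i. EX g. pair g (f i) \<E> r & GC r R g"
 have d: "DP ?Q" "DP (%i. ~ ?Q i)" by (intro dfn)+
 show ?thesis
 proof (cases "lep (Sep X ?Q) omega")
  case True
  hence "~ lep (Sep X (%i. ~ ?Q i)) omega" using uncountable_split[OF d(1) X(1)] by blast
  from ccD[OF cc f(1) this] obtain i k where ik: "i \<E> X" "k \<E> X" "i ~= k" "~ ?Q i" "compat r (f i) (f k)"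
   using X(2) unfolding mem_Sep[OF d(2)] by blast
  obtain s where s: "pair s (f i) \<E> r" "pair s (f k) \<E> r" using ik(5) unfolding compat_def by blast
  have "SR r R s z w" for z w unfolding SR_def using ik(4) tr s(1) by blast
  thus ?thesis using ik s X(3) by blast
 next
  case False
  obtain h where h: "DF h" "!!i. i \<E> omega1 ==> h i \<E> Sep X ?Q" "!!i k. i \<E> omega1 ==> k \<E> omega1 ==> h i = h k ==> i = k"
   using uncountable_enum[OF False] by blast
  note [dfn] = DFD[OF h(1)]
  have "DP2 (%i g. pair g (f (h i)) \<E> r & GC r R g)" by (intro dfn)
  from choice[OF this, of omega1] obtain g where g: "DF g" "!!i. i \<E> omega1 ==> pair (g i) (f (h i)) \<E> r & GC r R (g i)"
   using h(2) unfolding mem_Sep[OF d(1)] by blast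
  note [dfn] = DFD[OF g(1)]
  obtain i0 where i0: "i0 \<E> omega1" "!!q \<gamma>. pair q (g i0) \<E> r ==> \<gamma> \<E> omega1 ==> EX k. k \<E> omega1 & \<gamma> \<E> k & compat r q (g k)"
   using unbounded[OF cc po g(1)] g(2) rf by blast
  have dY: "DP (%k. compat r (g i0) (g k))" by (intro dfn)
  have "~ lep (Sep omega1 (%k. compat r (g i0) (g k))) omega"
   by (rule omega1_bound) (unfold mem_Sep[OF dY], use i0(2)[OF rf] g(2)[OF i0(1)] in blast)
  then obtain u where u: "DF u" "!!i. i \<E> omega1 ==> u i \<E> omega1 & compat r (g i0) (g (u i))" "!!i k. i \<E> omega1 ==> k \<E> omega1 ==> u i = u k ==> i = k"
   using uncountable_enum[of "Sep omega1 (%k. compat r (g i0) (g k))"] unfolding mem_Sep[OF dY] by metis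
  note [dfn] = DFD[OF u(1)]
  have "DP2 (%i s. pair s (g i0) \<E> r & pair s (g (u i)) \<E> r)" by (intro dfn)
  from choice[OF this, of omega1] obtain s where s: "DF s" "!!i. i \<E> omega1 ==> pair (s i) (g i0) \<E> r & pair (s i) (g (u i)) \<E> r"
   using u(2) unfolding compat_def by blast
  note [dfn] = DFD[OF s(1)]
  \<comment> \<open>The conditions \<open>s i\<close> lie below the fixed \<open>g i0\<close>, as
    the definition of \<open>GC\<close> demands of a family.\<close>
  have dF: "DF (%i. pair (s i) (x (h (u i))))" by (intro dfn)
  let ?F = "lam omega1 (%i. pair (s i) (x (h (u i))))"
  have "GC r R (g i0)" using g(2)[OF i0(1)] by blast
  hence "EX i k. i \<E> omega1 & k \<E> omega1 & i ~= k & two_compat r R ?F i k"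
   unfolding GC_def
  proof (rule allE[of _ ?F], elim impE)
   show "ALL i. i \<E> omega1 --> pair (p1 (app ?F i)) (g i0) \<E> r & p2 (app ?F i) \<E> omega1"
    using s(2) X(3) h(2) u(2) unfolding mem_Sep[OF d(1)] by (simp add: app_lam[OF dF])
  qed blast
  then obtain i k t z where t: "i \<E> omega1" "k \<E> omega1" "i ~= k" "z \<E> omega1" "pair t (s i) \<E> r" "pair t (s k) \<E> r"
   "FQ r R t z (x (h (u i)))" "FQ r R t z (x (h (u k)))" unfolding two_compat_def by (auto simp: app_lam[OF dF])
  have lf: "pair t (f (h (u i))) \<E> r" if "i \<E> omega1" "pair t (s i) \<E> r" for i t
   using tr that s(2)[OF that(1)] g(2)[OF conjunct1[OF u(2)[OF that(1)]]] by blast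
  have hX: "h (u i) \<E> X" if "i \<E> omega1" for i using h(2) u(2) that unfolding mem_Sep[OF d(1)] by blast
  have ne: "h (u i) ~= h (u k)" using h(3) u(2,3) t(1-3) by blast
  show ?thesis using hX t lf ne FQ_SR[OF po] by metis
 qed
qed

end

subsection \<open>Finite support iteration\<close>

context zfc begin

text \<open>The coordinates are ordinals below \<omega>1 in place of names for them. So a stage
  below \<omega>2 has at most \<omega>1 conditions, and names for relations on \<omega>1 can be
  counted.\<close>

definition C where "C \<alpha> = Sep (Fin (prod \<alpha> omega1)) (%p. ALL \<beta> x y. pair \<beta> x \<E> p --> pair \<beta> y \<E> p --> x = y)"
lemma DT_C [THEN DFD, dfn]: "DF C" unfolding C_def by (intro dfn)
lemma mem_C: "p \<E> C \<alpha> <-> fin p & (ALL t. t \<E> p --> (EX \<beta> x. \<beta> \<E> \<alpha> & x \<E> omega1 & t = pair \<beta> x)) &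
  (ALL \<beta> x y. pair \<beta> x \<E> p --> pair \<beta> y \<E> p --> x = y)"
proof -
 have d: "DP (%p. ALL \<beta> x y. pair \<beta> x \<E> p --> pair \<beta> y \<E> p --> x = y)" by (intro dfn)
 show ?thesis unfolding C_def mem_Sep[OF d] mem_Fin sub_iff mem_prod by blast
qed
lemma C_fin: "p \<E> C \<alpha> ==> fin p" by (simp add: mem_C)
lemma C_pair: "p \<E> C \<alpha> ==> pair \<beta> x \<E> p ==> \<beta> \<E> \<alpha> & x \<E> omega1" unfolding mem_C using pair_inj by metis
lemma C_ex: "p \<E> C \<alpha> ==> t \<E> p ==> EX \<beta> x. t = pair \<beta> x" unfolding mem_C by blast
lemma C_fun: "p \<E> C \<alpha> ==> pair \<beta> x \<E> p ==> pair \<beta> y \<E> p ==> x = y" unfolding mem_C by blast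
lemma C_mono: "el \<alpha> <= el \<alpha>' ==> p \<E> C \<alpha> ==> p \<E> C \<alpha>'" unfolding mem_C sub_iff by blast
lemma C_emp: "emp \<E> C \<alpha>" by (simp add: mem_C)
lemma C_un: assumes "s \<E> C \<alpha>" "t \<E> C \<alpha>" "!!\<gamma> x y. pair \<gamma> x \<E> s ==> ~ pair \<gamma> y \<E> t" shows "un s t \<E> C \<alpha>"
proof -
 have "fin (un s t)" using fin_un C_fin assms(1,2) by blast
 moreover have "EX \<beta> x. \<beta> \<E> \<alpha> & x \<E> omega1 & u = pair \<beta> x" if "u \<E> un s t" for u
  using that assms(1,2) unfolding mem_C mem_un by blast
 moreover have "x = y" if "pair \<beta> x \<E> un s t" "pair \<beta> y \<E> un s t" for \<beta> x y
  using that assms(3) C_fun[OF assms(1)] C_fun[OF assms(2)] unfolding mem_un by blast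
 ultimately show ?thesis unfolding mem_C by blast
qed
lemma C_subset: assumes "t \<E> C \<alpha>" "el s <= el t" shows "s \<E> C \<alpha>"
proof -
 have "fin s" using fin_subset[OF assms(2) C_fin[OF assms(1)]] .
 thus ?thesis using assms unfolding mem_C sub_iff by metis
qed

definition rs where "rs p \<beta> = Sep p (%t. p1 t \<E> \<beta>)"
lemma DT_rs [THEN DF2D, dfn]: "DF2 rs" unfolding rs_def by (intro dfn)
lemma mem_rs: "t \<E> rs p \<beta> <-> t \<E> p & p1 t \<E> \<beta>"
proof -
 have d: "DP (%t. p1 t \<E> \<beta>)" by (intro dfn)
 show ?thesis unfolding rs_def mem_Sep[OF d] ..
qed
lemma pair_rs [simp]: "pair \<gamma> x \<E> rs p \<beta> <-> pair \<gamma> x \<E> p & \<gamma> \<E> \<beta>" by (simp add: mem_rs)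
lemma rs_C: assumes "p \<E> C \<alpha>" shows "rs p \<beta> \<E> C \<beta>"
proof -
 have "rs p \<beta> \<E> C \<alpha>" by (rule C_subset[OF assms]) (auto simp: mem_rs)
 thus ?thesis unfolding mem_C mem_rs by (metis p1_pair)
qed
lemma C_ext: assumes "p \<E> C \<alpha>" "q \<E> C \<alpha>'" "!!\<beta> x. pair \<beta> x \<E> p <-> pair \<beta> x \<E> q" shows "p = q"
 using assms C_ex by (intro ext) metis
lemma rs_rs: "p \<E> C \<alpha> ==> Ord \<beta> ==> \<gamma> \<E> \<beta> ==> rs (rs p \<beta>) \<gamma> = rs p \<gamma>"
 by (rule C_ext[OF rs_C[OF rs_C] rs_C]) (auto intro: Ord_trans)
lemma rs_id: "p \<E> C \<beta> ==> rs p \<beta> = p" by (rule C_ext[OF rs_C]) (auto dest: C_pair)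

text \<open>At each coordinate of \<open>p\<close> the restriction of \<open>p'\<close> has to put
  the pair of coordinates into the relation of that stage. The set \<open>f\<close> gives this
  relation as a set of triples, already closed under what is forced.\<close>

definition ple where "ple f p' p <-> (ALL \<beta> y. pair \<beta> y \<E> p --> (EX x. pair \<beta> x \<E> p' & pair (rs p' \<beta>) (pair x y) \<E> app f \<beta>))"
lemma dfn_ple [dfn]: assumes [THEN DT_shift, dfn]: "DT s" "DT t" "DT u" shows "Dfn (%e. ple (s e) (t e) (u e))" unfolding ple_def by (intro dfn)

definition ord where "ord f \<alpha> = Sep (prod (C \<alpha>) (C \<alpha>)) (%t. ple f (p1 t) (p2 t))"
lemma DT_ord [THEN DF2D, dfn]: "DF2 ord" unfolding ord_def by (intro dfn)
lemma mem_ord: "pair p q \<E> ord f \<alpha> <-> p \<E> C \<alpha> & q \<E> C \<alpha> & ple f p q"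
proof -
 have d: "DP (%t. ple f (p1 t) (p2 t))" by (intro dfn)
 show ?thesis unfolding ord_def mem_Sep[OF d] by simp
qed

definition Sset where "Sset r c R = Sep (prod c (prod omega1 omega1)) (%t. SR r R (p1 t) (p1 (p2 t)) (p2 (p2 t)))"
lemma DT_Sset [dfn]: assumes [THEN DT_shift, dfn]: "DT s" "DT t" "DT u" shows "DT (%e. Sset (s e) (t e) (u e))" unfolding Sset_def by (intro dfn)
lemma mem_Sset: "pair s (pair x y) \<E> Sset r c R <-> s \<E> c & x \<E> omega1 & y \<E> omega1 & SR r R s x y"
proof -
 have d: "DP (%t. SR r R (p1 t) (p1 (p2 t)) (p2 (p2 t)))" by (intro dfn)
 show ?thesis unfolding Sset_def mem_Sep[OF d] by simp
qed

text \<open>The order on \<open>C \<beta>\<close> looks up \<sigma> at stages below \<beta> only, so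
  the recursion is well-posed, and its restriction to \<beta> may be replaced by the whole of
  \<sigma>.\<close>

lemma iteration_ex: assumes e: "DF e"
 shows "EX \<sigma>. ALL \<beta>. \<beta> \<E> omega2 --> app \<sigma> \<beta> = Sset (ord \<sigma> \<beta>) (C \<beta>) (e \<beta>)"
proof -
 note [dfn] = DFD[OF e]
 have "DF2 (%\<beta> f. Sset (ord f \<beta>) (C \<beta>) (e \<beta>))" by (intro dfn)
 from Ord_rec[OF this] obtain F where F: "DF F" "!!\<beta>. Ord \<beta> ==> F \<beta> = Sset (ord (lam \<beta> F) \<beta>) (C \<beta>) (e \<beta>)" by blast
 have "app (lam omega2 F) \<beta> = Sset (ord (lam omega2 F) \<beta>) (C \<beta>) (e \<beta>)" if b: "\<beta> \<E> omega2" for \<beta>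
 proof -
  have app: "app (lam \<beta> F) \<gamma> = app (lam omega2 F) \<gamma>" if "\<gamma> \<E> \<beta>" for \<gamma>
   using app_lam[OF F(1)] that h_trans[OF b] by simp
  have "ple (lam \<beta> F) p q <-> ple (lam omega2 F) p q" if "q \<E> C \<beta>" for p q
   unfolding ple_def using app C_pair[OF that] by metis
  hence "ord (lam \<beta> F) \<beta> = ord (lam omega2 F) \<beta>"
  proof (intro ext)
   fix z
   have d: "DP (%t. ple f (p1 t) (p2 t))" for f by (intro dfn)
   show "z \<E> ord (lam \<beta> F) \<beta> <-> z \<E> ord (lam omega2 F) \<beta>" unfolding ord_def mem_Sep[OF d]
    using \<open>!!q p. q \<E> C \<beta> ==> ple (lam \<beta> F) p q <-> ple (lam omega2 F) p q\<close> by (auto simp: mem_prod)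
  qed
  thus ?thesis using F(2)[OF h_Ord[OF b]] app_lam[OF F(1) b] by simp
 qed
 thus ?thesis by blast
qed

lemma lep_delete: assumes "lep x (succ n)" "c \<E> x" shows "lep (diff x (sing c)) n"
proof -
 obtain f where f: "DF f" "!!u. u \<E> x ==> f u \<E> succ n" "!!u v. u \<E> x ==> v \<E> x ==> f u = f v ==> u = v"
  using lepE[OF assms(1)] by blast
 note [dfn] = DFD[OF f(1)]
 have "DF (%u. if f u = n then f c else f u)" by (intro dfn)
 thus ?thesis
 proof (rule lepI)
  fix u assume u: "u \<E> diff x (sing c)"
  thus "(if f u = n then f c else f u) \<E> n" using f(2)[of u] f(2)[of c] f(3)[of u c] assms(2) by auto
  fix v assume v: "v \<E> diff x (sing c)" "(if f u = n then f c else f u) = (if f v = n then f c else f v)"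
  thus "u = v" using u f(3)[of u c] f(3)[of v c] f(3)[of u v] assms(2) by (auto split: if_splits)
 qed
qed

lemma C_small: assumes "\<beta> \<E> omega2" shows "lep (C \<beta>) omega1"
proof -
 have "lep (prod \<beta> omega1) omega1" using lep_prod_omega1 assms by (simp add: mem_hartogs)
 from lep_Fin[OF this omega1_square omega_sub_omega1] have "lep (Fin (prod \<beta> omega1)) omega1" .
 moreover have "el (C \<beta>) <= el (Fin (prod \<beta> omega1))" unfolding sub_iff mem_Fin mem_C mem_prod by blast
 ultimately show ?thesis using lep_trans lep_subset by blast
qed

section \<open>Counting and listing the names for relations on \<omega>1\<close>

definition "Names = Union (Repl omega2 (%\<beta>. Pow (prod (C \<beta>) (prod omega1 omega1))))"
lemma mem_Names: "R \<E> Names <-> (EX \<beta>. \<beta> \<E> omega2 & el R <= el (prod (C \<beta>) (prod omega1 omega1)))"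
proof -
 have d: "DF (%\<beta>. Pow (prod (C \<beta>) (prod omega1 omega1)))" by (intro dfn)
 show ?thesis unfolding Names_def mem_UN[OF d] mem_Pow ..
qed
lemma lep_Names: assumes "lep (Pow omega1) omega2" shows "lep Names omega2"
proof -
 have d: "DF (%\<beta>. Pow (prod (C \<beta>) (prod omega1 omega1)))" by (intro dfn)
 show ?thesis unfolding Names_def
 proof (rule lep_UN[OF d lep_refl _ omega2_square])
  fix \<beta> assume "\<beta> \<E> omega2"
  hence "lep (prod (C \<beta>) (prod omega1 omega1)) omega1" by (intro lep_prod_omega1 C_small lep_refl)
  thus "lep (Pow (prod (C \<beta>) (prod omega1 omega1))) omega2" using lep_Pow assms lep_trans by blast
 qed
qed

text \<open>Under an injection of \<open>prod omega2 Names\<close> into \<omega>2 each name owns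
  \<omega>2 many places, which cannot all lie below a given \<beta>.\<close>

lemma bookkeeping: assumes "lep (Pow omega1) omega2"
 shows "EX e. DF e & (ALL \<beta> R. \<beta> \<E> omega2 --> R \<E> Names --> (EX \<gamma>. \<gamma> \<E> omega2 & el \<beta> <= el \<gamma> & e \<gamma> = R))"
proof -
 have "lep (prod omega2 Names) omega2" using lep_trans[OF lep_prod[OF lep_refl lep_Names[OF assms]] omega2_square] .
 from lepE[OF this] obtain \<phi> where \<phi>: "DF \<phi>" "!!x. x \<E> prod omega2 Names ==> \<phi> x \<E> omega2"
  "!!x y. x \<E> prod omega2 Names ==> y \<E> prod omega2 Names ==> \<phi> x = \<phi> y ==> x = y" by blast
 note [dfn] = DFD[OF \<phi>(1)]
 \<comment> \<open>The second coordinate of the inverse of \<phi>; it is \<open>emp\<close> at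
   places that are not a value of \<phi>.\<close>
 define e where "e = (%\<beta>. Union (Sep Names (%R. EX \<gamma>. \<gamma> \<E> omega2 & \<phi> (pair \<gamma> R) = \<beta>)))"
 have de: "DF e" unfolding e_def by (intro dfn)
 have e: "e (\<phi> (pair \<gamma> R)) = R" if "\<gamma> \<E> omega2" "R \<E> Names" for \<gamma> R
 proof (rule ext)
  have d: "DP (%R'. EX \<gamma>'. \<gamma>' \<E> omega2 & \<phi> (pair \<gamma>' R') = \<phi> (pair \<gamma> R))" by (intro dfn)
  have "R' \<E> Sep Names (%R'. EX \<gamma>'. \<gamma>' \<E> omega2 & \<phi> (pair \<gamma>' R') = \<phi> (pair \<gamma> R)) <-> R' = R" for R'
   unfolding mem_Sep[OF d] using that \<phi>(3)[of "pair _ R'" "pair \<gamma> R"] by auto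
  thus "z \<E> e (\<phi> (pair \<gamma> R)) <-> z \<E> R" for z unfolding e_def by simp
 qed
 have "EX \<gamma>. \<gamma> \<E> omega2 & el \<beta> <= el \<gamma> & e \<gamma> = R" if b: "\<beta> \<E> omega2" and R: "R \<E> Names" for \<beta> R
 proof -
  have "EX \<gamma>. \<gamma> \<E> omega2 & ~ \<phi> (pair \<gamma> R) \<E> \<beta>"
  proof (rule ccontr)
   assume a: "~ ?thesis"
   have "DF (%\<gamma>. \<phi> (pair \<gamma> R))" by (intro dfn)
   hence "lep omega2 \<beta>" by (rule lepI) (use a R \<phi>(3)[of "pair _ R" "pair _ R"] in auto)
   thus False using b lep_trans not_lep_hartogs unfolding mem_hartogs by blast
  qed
  then obtain \<gamma> where g: "\<gamma> \<E> omega2" "~ \<phi> (pair \<gamma> R) \<E> \<beta>" by blast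
  have "\<phi> (pair \<gamma> R) \<E> omega2" using \<phi>(2)[of "pair \<gamma> R"] g R by simp
  thus ?thesis using e[OF g(1) R] g(2) Ord_not_mem[OF h_Ord h_Ord[OF b]] by blast
 qed
 thus ?thesis using de by blast
qed

end

section \<open>The order of the iteration\<close>

locale iter = zfc E for E :: "'a => 'a => bool" (infix \<open>\<E>\<close> 50) +
 fixes \<sigma> :: 'a and e :: "'a => 'a"
 assumes e: "DF e" and \<sigma>: "\<beta> \<E> omega2 ==> app \<sigma> \<beta> = Sset (ord \<sigma> \<beta>) (C \<beta>) (e \<beta>)"
begin

abbreviation Oo where "Oo \<equiv> ord \<sigma>"
abbreviation CC where "CC \<equiv> C omega2"

lemma mem_\<sigma>: "\<beta> \<E> omega2 ==> pair s (pair x y) \<E> app \<sigma> \<beta> <-> s \<E> C \<beta> & x \<E> omega1 & y \<E> omega1 & SR (Oo \<beta>) (e \<beta>) s x y"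
 unfolding \<sigma> by (rule mem_Sset)

lemma ple_rs: "p \<E> CC ==> q \<E> CC ==> Ord \<beta> ==> ple \<sigma> p q ==> ple \<sigma> (rs p \<beta>) (rs q \<beta>)"
 unfolding ple_def using rs_rs by (metis pair_rs)

lemma \<sigma>_refl: assumes "p \<E> CC" "\<beta> \<E> omega2" "y \<E> omega1" shows "pair (rs p \<beta>) (pair y y) \<E> app \<sigma> \<beta>"
 unfolding mem_\<sigma>[OF assms(2)] using assms rs_C SR_refl by blast

lemma ple_sup: assumes p: "p \<E> CC" and q: "q \<E> CC" and s: "el q <= el p" shows "ple \<sigma> p q"
 unfolding ple_def using \<sigma>_refl[OF p] C_pair[OF q] s unfolding sub_iff by blast

text \<open>From \<delta> on the coordinates agree, where reflexivity of the iterands is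
  enough.\<close>

lemma ple_join:
 assumes t: "t \<E> CC" and p: "p \<E> CC" and \<delta>: "Ord \<delta>" and s: "ple \<sigma> (rs t \<delta>) (rs p \<delta>)"
  and above: "!!\<gamma> y. pair \<gamma> y \<E> p ==> ~ \<gamma> \<E> \<delta> ==> pair \<gamma> y \<E> t"
 shows "ple \<sigma> t p"
 unfolding ple_def
proof (intro allI impI)
 fix \<gamma> y assume y: "pair \<gamma> y \<E> p"
 show "EX x. pair \<gamma> x \<E> t & pair (rs t \<gamma>) (pair x y) \<E> app \<sigma> \<gamma>"
 proof (cases "\<gamma> \<E> \<delta>")
  case True
  then obtain x where x: "pair \<gamma> x \<E> rs t \<delta>" "pair (rs (rs t \<delta>) \<gamma>) (pair x y) \<E> app \<sigma> \<gamma>" using s y unfolding ple_def by auto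
  thus ?thesis using rs_rs[OF t \<delta> True] by auto
 next
  case False
  thus ?thesis using above[OF y] \<sigma>_refl[OF t] C_pair[OF p y] by blast
 qed
qed

lemma C_CC: "\<alpha> \<E> succ omega2 ==> p \<E> C \<alpha> ==> p \<E> CC"
 by (rule C_mono[of \<alpha>]) (auto intro: h_trans)

text \<open>For transitivity at the coordinate \<beta>, what \<open>rs q \<beta>\<close> forces is
  passed down to \<open>rs p \<beta>\<close>; this needs the order below \<beta> to be a preorder
  already, hence the induction.\<close>

lemma o_preord: assumes "\<alpha> \<E> succ omega2" shows "preord (Oo \<alpha>)"
proof -
 have O: "Ord \<alpha>" using Ord_mem[OF Ord_succ[OF Ord_hartogs] assms] .
 have "\<alpha> \<E> succ omega2 --> preord (Oo \<alpha>)"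
  unfolding preord_def
 proof (rule Ord_induct[of "%\<alpha>. \<alpha> \<E> succ omega2 --> (ALL p q s. pair p q \<E> Oo \<alpha> --> pair q s \<E> Oo \<alpha> --> pair p s \<E> Oo \<alpha>) &
   (ALL p q. pair p q \<E> Oo \<alpha> --> pair p p \<E> Oo \<alpha> & pair q q \<E> Oo \<alpha>)", OF _ _ O], intro dfn, fold preord_def, intro impI)
  fix \<alpha> assume \<alpha>: "Ord \<alpha>" "\<alpha> \<E> succ omega2" and IH: "!!\<beta>. \<beta> \<E> \<alpha> ==> \<beta> \<E> succ omega2 --> preord (Oo \<beta>)"
  have b2: "\<beta> \<E> omega2" if "\<beta> \<E> \<alpha>" for \<beta> using that \<alpha>(2) by (auto intro: Ord_trans)
  show "preord (Oo \<alpha>)" unfolding preord_def mem_ord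
  proof (intro conjI allI impI; (elim conjE)?)
   fix p q s assume h: "p \<E> C \<alpha>" "q \<E> C \<alpha>" "s \<E> C \<alpha>" "ple \<sigma> p q" "ple \<sigma> q s"
   show "ple \<sigma> p s" unfolding ple_def
   proof (intro allI impI)
    fix \<beta> y assume y: "pair \<beta> y \<E> s"
    have b: "\<beta> \<E> \<alpha>" using C_pair h(3) y by blast
    obtain x where x: "pair \<beta> x \<E> q" "pair (rs q \<beta>) (pair x y) \<E> app \<sigma> \<beta>" using h(5) y unfolding ple_def by blast
    obtain w where w: "pair \<beta> w \<E> p" "pair (rs p \<beta>) (pair w x) \<E> app \<sigma> \<beta>" using h(4) x(1) unfolding ple_def by blast
    have "pair (rs p \<beta>) (rs q \<beta>) \<E> Oo \<beta>" unfolding mem_ord using rs_C h ple_rs C_CC[OF \<alpha>(2)] Ord_mem[OF \<alpha>(1) b] by blast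
    hence "pair (rs p \<beta>) (pair w y) \<E> app \<sigma> \<beta>"
     using x(2) w(2) SR_mono SR_trans IH[OF b] b2[OF b] unfolding mem_\<sigma>[OF b2[OF b]] by (meson mem_succ)
    thus "EX x. pair \<beta> x \<E> p & pair (rs p \<beta>) (pair x y) \<E> app \<sigma> \<beta>" using w(1) by blast
   qed
  qed (use ple_sup C_CC[OF \<alpha>(2)] in blast)+
 qed
 thus ?thesis using assms by blast
qed

text \<open>Makes \<open>C \<beta>\<close> a complete suborder: an extension of the restriction to
  \<beta> can be joined with the rest of the condition.\<close>

lemma amalg:
 assumes \<beta>: "\<beta> \<E> omega2" and p: "p \<E> CC" and s: "s \<E> C \<beta>" "ple \<sigma> s (rs p \<beta>)"
 shows "EX t. t \<E> CC & ple \<sigma> t p & rs t \<beta> = s & (ALL \<gamma> x. pair \<gamma> x \<E> p --> ~ \<gamma> \<E> \<beta> --> pair \<gamma> x \<E> t)"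
proof -
 let ?t = "un s (diff p (rs p \<beta>))"
 have s2: "s \<E> CC" using C_CC[OF _ s(1)] \<beta> by auto
 have t: "?t \<E> CC"
 proof (rule C_un[OF s2 C_subset[OF p]])
  show "el (diff p (rs p \<beta>)) <= el p" by auto
  show "pair \<gamma> x \<E> s ==> ~ pair \<gamma> y \<E> diff p (rs p \<beta>)" for \<gamma> x y using C_pair[OF s(1)] by auto
 qed
 have r: "rs ?t \<beta> = s" by (rule C_ext[OF rs_C[OF t] s(1)]) (use C_pair[OF s(1)] in auto)
 have "ple \<sigma> ?t p" by (rule ple_join[OF t p h_Ord[OF \<beta>]]) (use s(2) r in auto)
 thus ?thesis using t r by (intro exI[of _ ?t]) auto
qed


definition hi where "hi p \<delta> = diff p (rs p \<delta>)"
lemma DT_hi [THEN DF2D, dfn]: "DF2 hi" unfolding hi_def by (intro dfn)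
lemma pair_hi [simp]: "pair \<gamma> x \<E> hi p \<delta> <-> pair \<gamma> x \<E> p & ~ \<gamma> \<E> \<delta>" by (auto simp: hi_def)
lemma hi_sub: "el (hi p \<delta>) <= el p" by (auto simp: hi_def)

lemma join2:
 assumes \<delta>: "Ord \<delta>" "el \<delta> <= el \<alpha>" and \<alpha>: "\<alpha> \<E> succ omega2" and p: "p \<E> C \<alpha>" and q: "q \<E> C \<alpha>" and s: "s \<E> C \<delta>" "ple \<sigma> s (rs p \<delta>)" "ple \<sigma> s (rs q \<delta>)"
  and disj: "!!\<gamma> x y. pair \<gamma> x \<E> p ==> pair \<gamma> y \<E> q ==> \<gamma> \<E> \<delta>"
 shows "compat (Oo \<alpha>) p q"
proof -
 let ?u = "un (hi p \<delta>) (hi q \<delta>)" and ?t = "un s (un (hi p \<delta>) (hi q \<delta>))"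
 have u: "?u \<E> C \<alpha>"
  by (rule C_un[OF C_subset[OF p hi_sub] C_subset[OF q hi_sub]]) (use disj in auto)
 have t: "?t \<E> C \<alpha>"
  by (rule C_un[OF C_mono[OF \<delta>(2) s(1)] u]) (use C_pair[OF s(1)] in auto)
 have r: "rs ?t \<delta> = s" by (rule C_ext[OF rs_C[OF t] s(1)]) (use C_pair[OF s(1)] in auto)
 have "ple \<sigma> ?t p" "ple \<sigma> ?t q"
  by (rule ple_join[OF C_CC[OF \<alpha> t] C_CC[OF \<alpha> p] \<delta>(1)], use s(2) r in auto)
    (rule ple_join[OF C_CC[OF \<alpha> t] C_CC[OF \<alpha> q] \<delta>(1)], use s(3) r in auto)
 thus ?thesis unfolding compat_def mem_ord using t p q by blast
qed

text \<open>The \<open>\<Delta>\<close>-system: \<open>\<delta>\<close> bounds the root, and is chosen to leave as few points above it as possible.\<close>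

lemma delta_system:
 assumes p: "DF p" "!!i. i \<E> omega1 ==> p i \<E> C \<alpha>" and \<alpha>: "Ord \<alpha>"
 shows "EX u \<delta>. DF u & (ALL i. i \<E> omega1 --> u i \<E> omega1) & (ALL i k. i \<E> omega1 --> k \<E> omega1 --> u i = u k --> i = k) &
  (ALL i k \<gamma> x y. i \<E> omega1 --> k \<E> omega1 --> i ~= k --> pair \<gamma> x \<E> p (u i) --> pair \<gamma> y \<E> p (u k) --> \<gamma> \<E> \<delta>) &
  (\<delta> = emp | (EX \<beta>. \<beta> \<E> \<alpha> & \<delta> = succ \<beta> & (ALL i. i \<E> omega1 --> (EX x. pair \<beta> x \<E> p (u i)))))"
proof -
 note [dfn] = DFD[OF p(1)]
 \<comment> \<open>Here \<open>n\<close> bounds the number of points at or above \<delta> uniformly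
   on an uncountable set of indices, and the least such \<open>n\<close> is taken.\<close>
 let ?\<Phi> = "%n. n \<E> omega & (EX X \<delta>. el X <= el omega1 & ~ lep X omega & (\<delta> = emp | (EX \<beta>. \<beta> \<E> \<alpha> & \<delta> = succ \<beta> & (ALL i. i \<E> X --> (EX x. pair \<beta> x \<E> p i)))) &
  (ALL i. i \<E> X --> lep (hi (p i) \<delta>) n))"
 have d\<Phi>: "DP ?\<Phi>" by (intro dfn)
 have "DP2 (%i n. n \<E> omega & lep (p i) n)" by (intro dfn)
 from choice[OF this, of omega1] obtain n where n: "DF n" "!!i. i \<E> omega1 ==> n i \<E> omega & lep (p i) (n i)"
  using C_fin[OF p(2)] unfolding fin_def by blast
 note [dfn] = DFD[OF n(1)]
 obtain m where m: "m \<E> omega" "~ lep (Sep omega1 (%i. n i = m)) omega"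
  using pigeonhole[OF n(1) lep_refl _ not_lep_hartogs omega_square] n(2) by blast
 have dX: "DP (%i. n i = m)" by (intro dfn)
 have "?\<Phi> m"
 proof (intro conjI m(1), rule exI[of _ "Sep omega1 (%i. n i = m)"], rule exI[of _ emp], intro conjI m(2) disjI1 refl allI impI)
  show "el (Sep omega1 (%i. n i = m)) <= el omega1" by (auto simp: mem_Sep[OF dX])
  fix i assume "i \<E> Sep omega1 (%i. n i = m)"
  thus "lep (hi (p i) emp) m" using n(2) lep_trans[OF lep_subset[OF hi_sub]] unfolding mem_Sep[OF dX] by blast
 qed
 from Ord_least[of ?\<Phi>, OF d\<Phi> nat_Ord[OF m(1)] this]
 obtain n X \<delta> where n: "n \<E> omega" and least: "!!m. m \<E> n ==> ~ ?\<Phi> m" and X: "el X <= el omega1" "~ lep X omega"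
  and \<delta>: "\<delta> = emp | (EX \<beta>. \<beta> \<E> \<alpha> & \<delta> = succ \<beta> & (ALL i. i \<E> X --> (EX x. pair \<beta> x \<E> p i)))"
  and small: "!!i. i \<E> X ==> lep (hi (p i) \<delta>) n" by blast
 have O\<delta>: "Ord \<delta>" using \<delta> Ord_emp Ord_succ Ord_mem[OF \<alpha>] by blast
 have dg: "DP (%i. EX x. pair \<gamma> x \<E> p i)" for \<gamma> by (intro dfn)
 \<comment> \<open>If uncountably many domains had a common \<gamma> outside \<delta>, then moving
   \<delta> up to \<open>succ \<gamma>\<close> would leave fewer points, against the choice of
   \<open>n\<close>.\<close>
 have ctbl: "lep (Sep X (%i. EX x. pair \<gamma> x \<E> p i)) omega" if \<gamma>: "~ \<gamma> \<E> \<delta>" for \<gamma>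
 proof (rule ccontr)
  let ?X = "Sep X (%i. EX x. pair \<gamma> x \<E> p i)"
  assume un: "~ lep ?X omega"
  hence "?X ~= emp" by (metis lep_emp)
  then obtain i where i: "i \<E> ?X" using empI by blast
  then obtain x where "i \<E> X" "pair \<gamma> x \<E> p i" unfolding mem_Sep[OF dg] by blast
  moreover have "i \<E> omega1" using X(1) \<open>i \<E> X\<close> by auto
  ultimately have \<gamma>\<alpha>: "\<gamma> \<E> \<alpha>" using C_pair p(2) by blast
  have sub: "el \<delta> <= el \<gamma>" using Ord_not_mem[OF Ord_mem[OF \<alpha> \<gamma>\<alpha>] O\<delta>] \<gamma> by blast
  have dm: "lep (diff (hi (p i) \<delta>) (sing (pair \<gamma> x))) m" if "n = succ m" "i \<E> X" "pair \<gamma> x \<E> p i" for i x m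
   by (rule lep_delete) (use small that \<gamma> in auto)
  have "n ~= emp" using small[OF \<open>i \<E> X\<close>] \<open>pair \<gamma> x \<E> p i\<close> \<gamma> unfolding lep_def by (metis mem_emp pair_hi)
  then obtain m where m: "m \<E> omega" "n = succ m" using nat_cases[OF n] by blast
  have "?\<Phi> m"
  proof (intro conjI m(1), rule exI[of _ ?X], rule exI[of _ "succ \<gamma>"], intro conjI un disjI2 allI impI)
   show "el ?X <= el omega1" using X(1) by (auto simp: mem_Sep[OF dg] subset_eq)
   show "EX \<beta>. \<beta> \<E> \<alpha> & succ \<gamma> = succ \<beta> & (ALL i. i \<E> ?X --> (EX x. pair \<beta> x \<E> p i))" using \<gamma>\<alpha> unfolding mem_Sep[OF dg] by blast
   fix i assume i: "i \<E> ?X"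
   then obtain x where x: "i \<E> X" "pair \<gamma> x \<E> p i" unfolding mem_Sep[OF dg] by blast
   have "p i \<E> C \<alpha>" using p(2) X(1) x(1) by auto
   hence "el (hi (p i) (succ \<gamma>)) <= el (diff (hi (p i) \<delta>) (sing (pair \<gamma> x)))"
    using sub by (auto simp: hi_def mem_rs subset_eq)
   thus "lep (hi (p i) (succ \<gamma>)) m" using dm[OF m(2) x] lep_subset lep_trans by blast
  qed
  thus False using least[of m] m by simp
 qed
 obtain h where h: "DF h" "!!i. i \<E> omega1 ==> h i \<E> X" "!!i k. i \<E> omega1 ==> k \<E> omega1 ==> h i = h k ==> i = k"
  using uncountable_enum[OF X(2)] by blast
 note [dfn] = DFD[OF h(1)]
 have hw: "h i \<E> omega1" if "i \<E> omega1" for i using h(2)[OF that] X(1) by auto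
 let ?A = "%t. Sep omega1 (%k. EX x. pair (p1 t) x \<E> p (h k))"
 have dA: "DP (%k. EX x. pair (p1 t) x \<E> p (h k))" for t by (intro dfn)
 have dA': "DF ?A" by (intro dfn)
 \<comment> \<open>The indices whose domain meets that of \<open>i\<close> outside \<delta>. They
   are countably many, so an \<omega>1-sequence can be thinned out to avoid them.\<close>
 define B where "B = (%i. Union (Repl (hi (p (h i)) \<delta>) ?A))"
 have mB: "k \<E> B i <-> (EX t. t \<E> hi (p (h i)) \<delta> & k \<E> omega1 & (EX x. pair (p1 t) x \<E> p (h k)))" for k i
  unfolding B_def mem_UN[OF dA'] mem_Sep[OF dA] ..
 have dB: "DF B" unfolding B_def by (intro dfn)
 note [dfn] = DFD[OF this]
 have B: "lep (B i) omega" if i: "i \<E> omega1" for i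
  unfolding B_def
 proof (rule lep_UN[OF dA' _ _ omega_square])
  have "fin (hi (p (h i)) \<delta>)" using C_fin[OF C_subset[OF p(2)[OF hw[OF i]] hi_sub]] .
  thus "lep (hi (p (h i)) \<delta>) omega" by (rule fin_lep_omega)
  fix t assume t: "t \<E> hi (p (h i)) \<delta>"
  have "t \<E> p (h i)" using t by (simp add: hi_def)
  then obtain \<gamma> x where tt: "t = pair \<gamma> x" using C_ex[OF p(2)[OF hw[OF i]]] by blast
  have "lep (?A t) (Sep X (%i. EX x. pair \<gamma> x \<E> p i))"
   by (rule lepI[OF h(1)], unfold mem_Sep[OF dA] mem_Sep[OF dg]) (use h(2,3) tt in auto)
  thus "lep (?A t) omega" using ctbl[of \<gamma>] t tt lep_trans by auto
 qed
 have "DP2 (%i b. b \<E> omega1 & el (B i) <= el b)" by (intro dfn)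
 moreover have "EX b. b \<E> omega1 & el (B i) <= el b" if "i \<E> omega1" for i
  by (rule hartogs_regular[OF B[OF that] _ omega_square]) (auto simp: mB)
 ultimately obtain b where b: "DF b" "!!i. i \<E> omega1 ==> b i \<E> omega1 & el (B i) <= el (b i)"
  using choice[of "%i b. b \<E> omega1 & el (B i) <= el b" omega1] by blast
 obtain g where g: "DF g" "!!\<eta>. \<eta> \<E> omega1 ==> g \<eta> \<E> omega1" "!!\<eta> \<zeta>. \<eta> \<E> omega1 ==> \<zeta> \<E> \<eta> ==> b (g \<zeta>) \<E> g \<eta> & g \<zeta> \<E> g \<eta>"
  using thin_omega1[OF b(1)] b(2) by blast
 note [dfn] = DFD[OF g(1)]
 have disj: "\<gamma> \<E> \<delta>" if k: "k \<E> omega1" "i \<E> k" and xy: "pair \<gamma> x \<E> p (h (g i))" "pair \<gamma> y \<E> p (h (g k))" for i k \<gamma> x y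
 proof (rule ccontr)
  assume "~ \<gamma> \<E> \<delta>"
  hence t: "pair \<gamma> x \<E> hi (p (h (g i))) \<delta>" using xy by simp
  have "g k \<E> B (g i)" unfolding mB by (rule exI[of _ "pair \<gamma> x"]) (use t xy(2) g(2)[OF k(1)] in auto)
  moreover have "g i \<E> omega1" using g(2) h_trans[OF k] by blast
  ultimately have "g k \<E> b (g i)" using b(2) by (meson el_iff subsetD)
  thus False using g(3)[OF k] not_sym by blast
 qed
 have inj: "i = k" if "i \<E> omega1" "k \<E> omega1" "h (g i) = h (g k)" for i k
  by (rule strict_inj[of g]) (use that g(2,3) h(3) in blast)+
 have d: "DF (%i. h (g i))" by (intro dfn)
 show ?thesis
 proof (rule exI[of _ "%i. h (g i)"], rule exI[of _ \<delta>], intro conjI allI impI d)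
  show "h (g i) \<E> omega1" if "i \<E> omega1" for i using hw g(2) that by blast
  show "i = k" if "i \<E> omega1" "k \<E> omega1" "h (g i) = h (g k)" for i k using inj that by blast
  show "\<gamma> \<E> \<delta>" if "i \<E> omega1" "k \<E> omega1" "i ~= k" "pair \<gamma> x \<E> p (h (g i))" "pair \<gamma> y \<E> p (h (g k))" for i k \<gamma> x y
   using h_linear[OF that(1) that(2)] disj that by blast
  show "\<delta> = emp | (EX \<beta>. \<beta> \<E> \<alpha> & \<delta> = succ \<beta> & (ALL i. i \<E> omega1 --> (EX x. pair \<beta> x \<E> p (h (g i)))))"
   using \<delta> h(2) g(2) by blast
 qed
qed

text \<open>Limits and successors are treated alike. Either \<delta> is empty and the thinned-out
  domains are disjoint, or \<delta> is the successor of some \<beta> that belongs to all domains;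
  then \<open>two_step\<close> at stage \<beta> joins two conditions up to and including \<beta>,
  and beyond it the domains are disjoint.\<close>

lemma o_cc: assumes "\<alpha> \<E> succ omega2" shows "cc (Oo \<alpha>)"
proof -
 have O: "Ord \<alpha>" using Ord_mem[OF Ord_succ[OF Ord_hartogs] assms] .
 have "\<alpha> \<E> succ omega2 --> cc (Oo \<alpha>)"
 proof (rule Ord_induct[of "%\<alpha>. \<alpha> \<E> succ omega2 --> cc (Oo \<alpha>)", OF _ _ O], intro dfn, intro impI)
  fix \<alpha> assume \<alpha>: "Ord \<alpha>" "\<alpha> \<E> succ omega2" and IH: "!!\<beta>. \<beta> \<E> \<alpha> ==> \<beta> \<E> succ omega2 --> cc (Oo \<beta>)"
  show "cc (Oo \<alpha>)" unfolding cc_def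
  proof (intro allI impI)
   fix f assume f: "ALL i. i \<E> omega1 --> pair (app f i) (app f i) \<E> Oo \<alpha>"
   have df: "DF (app f)" by (intro dfn)
   have fC: "!!i. i \<E> omega1 ==> app f i \<E> C \<alpha>" using f unfolding mem_ord by blast
   obtain u \<delta> where u: "DF u" "!!i. i \<E> omega1 ==> u i \<E> omega1" "!!i k. i \<E> omega1 ==> k \<E> omega1 ==> u i = u k ==> i = k"
    and disj: "!!i k \<gamma> x y. i \<E> omega1 ==> k \<E> omega1 ==> i ~= k ==> pair \<gamma> x \<E> app f (u i) ==> pair \<gamma> y \<E> app f (u k) ==> \<gamma> \<E> \<delta>"
    and \<delta>: "\<delta> = emp | (EX \<beta>. \<beta> \<E> \<alpha> & \<delta> = succ \<beta> & (ALL i. i \<E> omega1 --> (EX x. pair \<beta> x \<E> app f (u i))))"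
    using delta_system[of "app f" \<alpha>, OF df fC \<alpha>(1)] by blast
   note [dfn] = DFD[OF u(1)]
   have fu: "!!i. i \<E> omega1 ==> app f (u i) \<E> C \<alpha>" using fC u(2) by blast
   have "EX i k. i \<E> omega1 & k \<E> omega1 & i ~= k & compat (Oo \<alpha>) (app f (u i)) (app f (u k))"
    using \<delta>
   proof (elim disjE exE conjE)
    assume \<delta>: "\<delta> = emp"
    have 01: "emp \<E> omega1" "succ emp \<E> omega1" "emp ~= succ emp" using omega_sub_omega1 succ_nonemp[of emp, symmetric] by (auto simp: subset_eq simp del: succ_nonemp)
    have "compat (Oo \<alpha>) (app f (u emp)) (app f (u (succ emp)))"
    proof (rule join2[of \<delta> \<alpha> _ _ emp])
     have "rs q emp = emp" for q by (rule empI) (simp add: mem_rs)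
     thus "ple \<sigma> emp (rs (app f (u emp)) \<delta>)" "ple \<sigma> emp (rs (app f (u (succ emp))) \<delta>)" unfolding \<delta> ple_def by simp_all
    qed (use \<delta> \<alpha>(2) fu 01 C_emp disj in auto)
    thus ?thesis using 01 by blast
   next
    fix \<beta> assume b: "\<beta> \<E> \<alpha>" "\<delta> = succ \<beta>" "ALL i. i \<E> omega1 --> (EX x. pair \<beta> x \<E> app f (u i))"
    have b2: "\<beta> \<E> omega2" using b(1) \<alpha>(2) h_trans by auto
    have bs: "\<beta> \<E> succ omega2" using b2 by simp
    have Ob: "Ord \<beta>" using Ord_mem[OF \<alpha>(1) b(1)] .
    have "DP2 (%i x. pair \<beta> x \<E> app f (u i))" by (intro dfn)
    from choice[OF this, of omega1] obtain x where x: "DF x" "!!i. i \<E> omega1 ==> pair \<beta> (x i) \<E> app f (u i)" using b(3) by blast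
    have dr: "DF (%i. rs (app f (u i)) \<beta>)" by (intro dfn)
    have rf: "pair (rs (app f (u i)) \<beta>) (rs (app f (u i)) \<beta>) \<E> Oo \<beta>" if "i \<E> omega1" for i
     unfolding mem_ord using rs_C[OF fu[OF that]] ple_sup C_CC[OF bs] by blast
    have xw: "x i \<E> omega1" if "i \<E> omega1" for i using C_pair[OF fu x(2)] that by blast
    from two_step[OF IH[OF b(1), rule_format, OF bs] o_preord[OF bs] dr x(1) not_lep_hartogs rf xw, of "e \<beta>"]
    obtain i k s z where s: "i \<E> omega1" "k \<E> omega1" "i ~= k" "pair s (rs (app f (u i)) \<beta>) \<E> Oo \<beta>" "pair s (rs (app f (u k)) \<beta>) \<E> Oo \<beta>"
     "z \<E> omega1" "SR (Oo \<beta>) (e \<beta>) s z (x i)" "SR (Oo \<beta>) (e \<beta>) s z (x k)" by blast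
    have sb: "s \<E> C \<beta>" using s(4) unfolding mem_ord by blast
    \<comment> \<open>The pair found by \<open>two_step\<close>, read as a condition with the
      coordinate \<open>z\<close> at \<beta>.\<close>
    let ?s = "un s (sing (pair \<beta> z))"
    have "el \<beta> <= el (succ \<beta>)" by auto
    have sC: "?s \<E> C \<delta>" unfolding b(2)
    proof (rule C_un[OF C_mono[OF \<open>el \<beta> <= el (succ \<beta>)\<close> sb]])
     show "sing (pair \<beta> z) \<E> C (succ \<beta>)" unfolding mem_C using s(6) by auto
     show "pair \<gamma> y \<E> s ==> ~ pair \<gamma> y' \<E> sing (pair \<beta> z)" for \<gamma> y y' using C_pair[OF sb, of \<beta> y] by auto
    qed
    have rs\<gamma>: "rs ?s \<gamma> = rs s \<gamma>" if "\<gamma> \<E> \<beta>" for \<gamma>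
     by (rule C_ext[OF rs_C[OF sC] rs_C[OF sb]]) (use that not_sym[OF that] in auto)
    have rs\<beta>: "rs ?s \<beta> = s"
     by (rule C_ext[OF rs_C[OF sC] sb]) (use C_pair[OF sb] in auto)
    have low: "ple \<sigma> ?s (rs (app f (u i)) \<delta>)" if i: "i \<E> omega1" "pair s (rs (app f (u i)) \<beta>) \<E> Oo \<beta>" "SR (Oo \<beta>) (e \<beta>) s z (x i)" for i
     unfolding ple_def
    proof (intro allI impI)
     fix \<gamma> y assume y: "pair \<gamma> y \<E> rs (app f (u i)) \<delta>"
     then consider "\<gamma> \<E> \<beta>" | "\<gamma> = \<beta>" using b(2) by auto
     thus "EX x. pair \<gamma> x \<E> ?s & pair (rs ?s \<gamma>) (pair x y) \<E> app \<sigma> \<gamma>"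
     proof cases
      case 1
      hence "pair \<gamma> y \<E> rs (app f (u i)) \<beta>" using y by simp
      then obtain x where "pair \<gamma> x \<E> s" "pair (rs s \<gamma>) (pair x y) \<E> app \<sigma> \<gamma>" using i(2) unfolding mem_ord ple_def by blast
      thus ?thesis using rs\<gamma>[OF 1] by auto
     next
      case 2
      hence "y = x i" using C_fun[OF fu[OF i(1)] _ x(2)[OF i(1)]] y by simp
      thus ?thesis using 2 rs\<beta> sb s(6) i(3) xw[OF i(1)] by (intro exI[of _ z]) (simp add: mem_\<sigma>[OF b2])
     qed
    qed
    have sub: "el \<delta> <= el \<alpha>" unfolding b(2) using b(1) Ord_trans[OF \<alpha>(1) b(1)] by auto
    have "compat (Oo \<alpha>) (app f (u i)) (app f (u k))"
     by (rule join2[OF _ sub \<alpha>(2) fu[OF s(1)] fu[OF s(2)] sC low[OF s(1,4,7)] low[OF s(2,5,8)]])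
       (use Ord_succ[OF Ob] b(2) disj[OF s(1-3)] in blast)+
    thus ?thesis using s by blast
   qed
   thus "EX i k. i \<E> omega1 & k \<E> omega1 & i ~= k & compat (Oo \<alpha>) (app f i) (app f k)" using u by blast
  qed
 qed
 thus ?thesis using assms by blast
qed

end

subsection \<open>The extension by the iteration\<close>

context generic_ext begin

text \<open>If \<omega>1 became countable, uncountably many conditions would decide the same value
  of an injection at different arguments; two of them are compatible, and a common extension
  contradicts injectivity.\<close>

lemma ccc_omega1: assumes ccc: ccc shows "N.hartogs N.omega = j omega1"
proof -
 have no: "~ N.lep (j omega1) N.omega"
 proof
  assume "N.lep (j omega1) N.omega"
  then obtain f where f: "!!x. N x (j omega1) ==> N (N.app f x) N.omega"
   "!!x y. N x (j omega1) ==> N y (j omega1) ==> N.app f x = N.app f y ==> x = y" unfolding N.lep_def by blast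
  have df: "N.DF (N.app f)" by (intro dfn)
  obtain \<tau> where \<tau>: "N.lam (j omega1) (N.app f) = val \<tau>" using val_ex by blast
  have fn: "N.fn (val \<tau>) (j omega1)" unfolding \<tau>[symmetric] by (rule N.fn_lam[OF df])
  have app: "N.app (val \<tau>) x = N.app f x" if "N x (j omega1)" for x unfolding \<tau>[symmetric] using N.app_lam[OF df that] .
  have dec: "EX y p. p \<in> G & dec \<tau> omega p i y & N.app (val \<tau>) (j i) = j y" if "i \<E> omega1" for i
   by (rule dec_fn[OF fn _ that]) (simp add: app f(1) j_omega)
  let ?D = "%q. (EX i. i \<E> omega1 & (ALL s y. le s q --> ~ dec \<tau> omega s i y)) |
   (EX i k y. i \<E> omega1 & k \<E> omega1 & i ~= k & dec \<tau> omega q i y & dec \<tau> omega q k y)"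
  have d: "DP ?D" by (intro dfn)
  obtain p where p: "p \<in> G" "!!q. le q p ==> ~ ?D q"
  proof (rule G_meets[OF d])
   fix s assume s: "s \<in> G"
   show "~ ?D s"
   proof (intro notI, elim disjE exE conjE)
    fix i assume i: "i \<E> omega1" "ALL t y. le t s --> ~ dec \<tau> omega t i y"
    obtain y p where y: "p \<in> G" "dec \<tau> omega p i y" using dec[OF i(1)] by blast
    obtain t where "le t s" "le t p" using Gdir s y(1) by blast
    thus False using i(2) dec_mono[OF y(2)] by blast
   next
    fix i k y assume h: "i \<E> omega1" "k \<E> omega1" "i ~= k" "dec \<tau> omega s i y" "dec \<tau> omega s k y"
    hence "N.app f (j i) = N.app f (j k)" using dec_app[OF fn s h(4)] dec_app[OF fn s h(5)] app[of "j i"] app[of "j k"] by simp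
    thus False using f(2)[of "j i" "j k"] h by simp
   qed
  qed blast
  have "DP2 (%i z. le (p1 z) p & dec \<tau> omega (p1 z) i (p2 z))" by (intro dfn)
  moreover have "EX z. le (p1 z) p & dec \<tau> omega (p1 z) i (p2 z)" if i: "i \<E> omega1" for i
  proof -
   have "le p p" using GP[OF p(1)] by simp
   then obtain s y where "le s p" "dec \<tau> omega s i y" using p(2)[of p] i by blast
   thus ?thesis by (intro exI[of _ "pair s y"]) simp
  qed
  ultimately obtain z where z: "DF z" "!!i. i \<E> omega1 ==> le (p1 (z i)) p & dec \<tau> omega (p1 (z i)) i (p2 (z i))"
   using choice[of "%i z. le (p1 z) p & dec \<tau> omega (p1 z) i (p2 z)" omega1] by blast
  note [dfn] = DFD[OF z(1)]
  have d2: "DF (%i. p2 (z i))" and d1: "DF (%i. p1 (z i))" by (intro dfn)+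
  have "p2 (z i) \<E> omega" if "i \<E> omega1" for i using z(2)[OF that] unfolding dec_def by blast
  from pigeonhole[OF d2 lep_refl this not_lep_hartogs omega_square]
  obtain y where y: "~ lep (Sep omega1 (%i. p2 (z i) = y)) omega" by blast
  let ?X = "Sep omega1 (%i. p2 (z i) = y)"
  have dX: "DP (%i. p2 (z i) = y)" by (intro dfn)
  have "p1 (z i) \<E> P" if "i \<E> ?X" for i using z(2) leD(1) that unfolding mem_Sep[OF dX] by blast
  then obtain i k t where h: "i \<E> ?X" "k \<E> ?X" "i ~= k" "le t (p1 (z i))" "le t (p1 (z k))" using cccD[OF ccc d1 y] by blast
  have ik: "i \<E> omega1" "k \<E> omega1" "p2 (z i) = y" "p2 (z k) = y" using h(1,2) unfolding mem_Sep[OF dX] by blast+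
  have "dec \<tau> omega t i y" "dec \<tau> omega t k y" using z(2) ik dec_mono h(4,5) by metis+
  thus False using p(2)[of t] ik h(3) le_trans[OF h(4)] z(2) by blast
 qed
 show ?thesis
 proof (rule N.ext)
  fix z
  show "N z (N.hartogs N.omega) <-> N z (j omega1)"
  proof
   assume "N z (N.hartogs N.omega)"
   hence z: "N.Ord z" "N.lep z N.omega" by (simp_all add: N.mem_hartogs)
   show "N z (j omega1)"
   proof (rule ccontr)
    assume "~ ?thesis"
    hence "N.el (j omega1) <= N.el z" using N.Ord_not_mem[OF z(1) N_Ord[OF Ord_hartogs]] by blast
    thus False using no z(2) N.lep_trans N.lep_subset by blast
   qed
  next
   assume "N z (j omega1)"
   then obtain \<alpha> where "\<alpha> \<E> omega1" "z = j \<alpha>" unfolding j_mem by blast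
   thus "N z (N.hartogs N.omega)" unfolding N.mem_hartogs using N_Ord j_lep j_omega by (metis mem_hartogs)
  qed
 qed
qed

end

context iter begin

section \<open>Approximation at stages below \<omega>2\<close>

lemma CC_bounded: assumes "p \<E> CC" shows "EX \<gamma>. \<gamma> \<E> omega2 & p \<E> C \<gamma>"
proof -
 have d: "DF p1" by (intro dfn)
 have "lep (Repl p p1) omega1" using lep_omega_omega1 fin_lep_omega fin_Repl[OF d C_fin[OF assms]] by blast
 moreover have "el (Repl p p1) <= el omega2"
 proof
  fix \<beta> assume "\<beta> \<in> el (Repl p p1)"
  then obtain t where "t \<E> p" "\<beta> = p1 t" unfolding el_iff mem_Repl[OF d] by blast
  thus "\<beta> \<in> el omega2" using C_ex[OF assms] C_pair[OF assms] by fastforce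
 qed
 ultimately obtain \<gamma> where g: "\<gamma> \<E> omega2" "el (Repl p p1) <= el \<gamma>" using hartogs_regular[OF _ _ omega1_square omega_sub_omega1] by blast
 have "\<beta> \<E> \<gamma>" if "pair \<beta> x \<E> p" for \<beta> x
 proof -
  have "\<beta> \<E> Repl p p1" unfolding mem_Repl[OF d] by (rule exI[of _ "pair \<beta> x"]) (simp add: that)
  thus ?thesis using g(2) by auto
 qed
 hence "p \<E> C \<gamma>" using assms unfolding mem_C by blast
 thus ?thesis using g(1) by blast
qed

lemma omega2_reg: "lep X omega1 ==> el X <= el omega2 ==> EX \<beta>. \<beta> \<E> omega2 & el X <= el \<beta>"
 using hartogs_regular[OF _ _ omega1_square omega_sub_omega1] .

abbreviation r2 where "r2 \<equiv> Oo omega2"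
lemma r2: "preord r2" "cc r2" using o_preord o_cc by simp_all

text \<open>Otherwise each stage \<beta> is escaped by a condition in \<open>Q\<close>, living at
  some later stage, that is incompatible with all of \<open>Q\<close> in \<open>C \<beta>\<close>.
  An \<omega>1-sequence of stages, each beyond the supports of the conditions chosen earlier, then
  gives an antichain.\<close>

lemma predense1: assumes Q: "DP Q"
 shows "EX \<beta>. \<beta> \<E> omega2 & (ALL p. p \<E> CC --> Q p --> (EX s. s \<E> C \<beta> & Q s & compat r2 p s))"
proof (rule ccontr)
 assume a: "~ ?thesis"
 note [dfn] = DPD[OF Q]
 let ?R = "%\<beta> z. p2 z \<E> omega2 & p1 z \<E> C (p2 z) & Q (p1 z) & (ALL s. s \<E> C \<beta> --> Q s --> ~ compat r2 (p1 z) s)"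
 have "DP2 ?R" by (intro dfn)
 moreover have "EX z. ?R \<beta> z" if b2: "\<beta> \<E> omega2" for \<beta>
 proof -
  obtain p where p: "p \<E> CC" "Q p" "ALL s. s \<E> C \<beta> --> Q s --> ~ compat r2 p s"
   using a b2 by blast
  obtain \<gamma> where "\<gamma> \<E> omega2" "p \<E> C \<gamma>" using CC_bounded[OF p(1)] by blast
  thus ?thesis using p by (intro exI[of _ "pair p \<gamma>"]) simp
 qed
 ultimately obtain z where z: "DF z" "!!\<beta>. \<beta> \<E> omega2 ==> ?R \<beta> (z \<beta>)" using choice[of ?R omega2] by blast
 note [dfn] = DFD[OF z(1)]
 have d: "DF (%\<beta>. p2 (z \<beta>))" by (intro dfn)
 have lim: "succ x \<E> omega2" if "x \<E> omega2" for x by (rule hartogs_succ[OF omega_sub_omega1 that])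
 obtain g where g: "DF g" "!!\<eta>. \<eta> \<E> omega1 ==> g \<eta> \<E> omega2" "!!\<eta> \<zeta>. \<eta> \<E> omega1 ==> \<zeta> \<E> \<eta> ==> p2 (z (g \<zeta>)) \<E> g \<eta>"
  using thin[OF Ord_hartogs omega2_reg[OF lep_omega_omega1] lim d] z(2) by blast
 note [dfn] = DFD[OF g(1)]
 let ?q = "%i. p1 (z (g i))"
 have dq: "DF ?q" by (intro dfn)
 have q: "?q i \<E> CC" if "i \<E> omega1" for i using z(2)[OF g(2)[OF that]] C_CC[of "p2 (z (g i))"] by simp
 have "pair (?q i) (?q i) \<E> r2" if "i \<E> omega1" for i unfolding mem_ord using q[OF that] ple_sup by blast
 from ccD[OF r2(2) dq not_lep_hartogs this] obtain i k where ik: "i \<E> omega1" "k \<E> omega1" "i ~= k" "compat r2 (?q i) (?q k)" by blast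
 have no: False if h: "k \<E> omega1" "i \<E> k" "compat r2 (?q k) (?q i)" for i k
 proof -
  have i: "i \<E> omega1" using h_trans[OF h(1,2)] .
  have "p2 (z (g i)) \<E> g k" using g(3)[OF h(1,2)] .
  hence "el (p2 (z (g i))) <= el (g k)" using Ord_trans[OF h_Ord[OF g(2)[OF h(1)]]] by auto
  hence "?q i \<E> C (g k)" using C_mono z(2)[OF g(2)[OF i]] by blast
  thus False using z(2)[OF g(2)[OF h(1)]] z(2)[OF g(2)[OF i]] h(3) by blast
 qed
 have "compat r2 (?q k) (?q i)" using ik(4) unfolding compat_def by blast
 thus False using h_linear[OF ik(1) ik(2)] no ik by blast
qed

lemma predense: assumes Q: "DP2 Q" and I: "lep I omega1"
 shows "EX \<beta>. \<beta> \<E> omega2 & (ALL i p. i \<E> I --> p \<E> CC --> Q i p --> (EX s. s \<E> C \<beta> & Q i s & compat r2 p s))"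
proof -
 note [dfn] = DP2D[OF Q]
 let ?R = "%i \<beta>. \<beta> \<E> omega2 & (ALL p. p \<E> CC --> Q i p --> (EX s. s \<E> C \<beta> & Q i s & compat r2 p s))"
 have "DP2 ?R" by (intro dfn)
 moreover have "EX \<beta>. ?R i \<beta>" for i by (rule predense1) (intro dfn)
 ultimately obtain b where b: "DF b" "!!i. i \<E> I ==> ?R i (b i)" using choice[of ?R I] by blast
 have "lep (Repl I b) omega1" using lep_trans[OF lep_Repl[OF b(1)] I] .
 moreover have "el (Repl I b) <= el omega2" using b(2) unfolding sub_iff mem_Repl[OF b(1)] by blast
 ultimately obtain \<beta> where \<beta>: "\<beta> \<E> omega2" "el (Repl I b) <= el \<beta>" using omega2_reg by blast
 have "EX s. s \<E> C \<beta> & Q i s & compat r2 p s" if h: "i \<E> I" "p \<E> CC" "Q i p" for i p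
 proof -
  have "b i \<E> \<beta>" using \<beta>(2) h(1) unfolding sub_iff mem_Repl[OF b(1)] by blast
  hence "el (b i) <= el \<beta>" using Ord_trans[OF h_Ord[OF \<beta>(1)]] by auto
  thus ?thesis using b(2)[OF h(1)] h(2,3) C_mono by blast
 qed
 thus ?thesis using \<beta>(1) by blast
qed

end

locale iter_ext = iter E \<sigma> e + generic_ext E P r G N val for E :: "nat => nat => bool" (infix \<open>\<E>\<close> 50) and \<sigma> :: nat and e :: "nat => nat" and P r G N val +
 assumes P_CC: "P = CC" and r_r2: "r = r2"
begin

lemma le_r2: "le p q <-> pair p q \<E> r2" unfolding le_def unfolding P_CC r_r2 mem_ord by blast
lemma le_iff: "le p q <-> p \<E> CC & q \<E> CC & ple \<sigma> p q" unfolding le_r2 mem_ord ..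
lemma G_CC: "p \<in> G ==> p \<E> CC" using GP P_CC by simp

lemma ccc: ccc
 unfolding ccc_def
proof (intro allI impI)
 fix f X assume X: "~ lep X omega" "ALL i. i \<E> X --> app f i \<E> P"
 have d: "DF (app f)" by (intro dfn)
 have "pair (app f i) (app f i) \<E> r2" if "i \<E> X" for i using X(2) that unfolding le_r2[symmetric] by simp
 from ccD[OF r2(2) d X(1) this] show "EX i k t. i \<E> X & k \<E> X & i ~= k & le t (app f i) & le t (app f k)"
  unfolding compat_def le_r2[symmetric] by blast
qed

lemmas N_omega1 = ccc_omega1[OF ccc]

text \<open>Up to \<omega>1 many facts about the extension depend on the filter at one stage below
  \<omega>2 only. This gives small names for reals and for relations on \<omega>1.\<close>

lemma predense_G: assumes Q: "DP2 Q" and I: "lep I omega1" and mono: "!!i p q. Q i p ==> le q p ==> Q i q"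
 shows "EX \<beta>. \<beta> \<E> omega2 & (ALL i p. i \<E> I --> p \<in> G --> Q i p --> (EX s:G. s \<E> C \<beta> & Q i s))"
proof -
 note [dfn] = DP2D[OF Q]
 obtain \<beta> where \<beta>: "\<beta> \<E> omega2" "!!i p. i \<E> I ==> p \<E> CC ==> Q i p ==> EX s. s \<E> C \<beta> & Q i s & compat r2 p s"
  using predense[OF Q I] by blast
 have "EX s:G. s \<E> C \<beta> & Q i s" if h: "i \<E> I" "p \<in> G" "Q i p" for i p
 proof -
  have d: "DP (%t. EX s. s \<E> C \<beta> & Q i s & le t s)" by (intro dfn)
  have "EX t:G. le t p & (EX s. s \<E> C \<beta> & Q i s & le t s)"
  proof (rule Gdense[OF h(2) d])
   fix q assume q: "le q p"
   then obtain s where "s \<E> C \<beta>" "Q i s" "compat r2 q s" using \<beta>(2)[OF h(1)] mono[OF h(3) q] le_iff by blast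
   thus "EX t. le t q & (EX s. s \<E> C \<beta> & Q i s & le t s)" unfolding compat_def le_r2[symmetric] by blast
  qed
  thus ?thesis using Gup by blast
 qed
 thus ?thesis using \<beta>(1) by blast
qed

lemma continuum: assumes GCH: "lep (Pow omega1) omega2" shows "N.lep (N.Pow N.omega) (j omega2)"
proof -
 \<comment> \<open>Reads an element of \<open>Names\<close> as a name of a set of ordinals: the
   first ordinal of the pair is the member, and the second is mere padding.\<close>
 define F where "F = (%R. Repl R (%t. pair (chk (p1 (p2 t))) (p1 t)))"
 have dF: "DF F" unfolding F_def by (intro dfn)
 have dt: "DF (%t. pair (chk (p1 (p2 t))) (p1 t))" by (intro dfn)
 have vF: "N z (val (F R)) <-> (EX t. t \<E> R & p1 t \<in> G & z = j (p1 (p2 t)))" for z R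
  unfolding val_mem F_def mem_Repl[OF dt] by (auto simp: j_def)
 have df: "N.DF (N.app (val (fname Names F)))" by (intro dfn)
 have "N.lep (N.Pow N.omega) (j Names)"
 proof (rule N.lep_surj[OF df])
  fix B assume "N B (N.Pow N.omega)"
  hence B: "N.el B <= N.el (j omega)" by (simp add: j_omega)
  obtain \<tau> where \<tau>: "B = val \<tau>" using val_ex by blast
  have "DP2 (%n p. fmem p (chk n) \<tau>)" by (intro dfn)
  hence "EX \<beta>. \<beta> \<E> omega2 & (ALL n p. n \<E> omega --> p \<in> G --> fmem p (chk n) \<tau> --> (EX s:G. s \<E> C \<beta> & fmem s (chk n) \<tau>))"
   by (rule predense_G[OF _ lep_omega_omega1[OF lep_refl]]) (erule (1) fmem_mono)
  then obtain \<beta> where \<beta>: "\<beta> \<E> omega2" "!!n p. n \<E> omega ==> p \<in> G ==> fmem p (chk n) \<tau> ==> EX s:G. s \<E> C \<beta> & fmem s (chk n) \<tau>" by blast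
  have d: "DP (%t. p1 (p2 t) \<E> omega & fmem (p1 t) (chk (p1 (p2 t))) \<tau>)" by (intro dfn)
  let ?R = "Sep (prod (C \<beta>) (prod omega1 omega1)) (%t. p1 (p2 t) \<E> omega & fmem (p1 t) (chk (p1 (p2 t))) \<tau>)"
  have R: "?R \<E> Names" unfolding mem_Names using \<beta>(1) by (auto simp: mem_Sep[OF d])
  have "val (F ?R) = B"
  proof (rule N.ext)
   fix z
   show "N z (val (F ?R)) <-> N z B"
   proof
    assume "N z (val (F ?R))"
    then obtain t where "t \<E> ?R" "p1 t \<in> G" "z = j (p1 (p2 t))" unfolding vF by blast
    hence "fmem (p1 t) (chk (p1 (p2 t))) \<tau>" unfolding mem_Sep[OF d] by blast
    thus "N z B" using \<open>p1 t \<in> G\<close> unfolding \<open>z = _\<close> \<tau> j_def N_mem by blast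
   next
    assume z: "N z B"
    then obtain n where n: "n \<E> omega" "z = j n" using B unfolding N.sub_iff j_mem by blast
    hence "EX p:G. fmem p (chk n) \<tau>" using z unfolding \<tau> n(2) j_def N_mem by blast
    then obtain s where s: "s \<in> G" "s \<E> C \<beta>" "fmem s (chk n) \<tau>" using \<beta>(2)[OF n(1)] by blast
    have nw: "n \<E> omega1" using n(1) omega_sub_omega1 by auto
    show "N z (val (F ?R))" unfolding vF
     by (rule exI[of _ "pair s (pair n n)"]) (use s n nw in "simp add: mem_Sep[OF d]")
   qed
  qed
  thus "EX x. N x (j Names) & N.app (val (fname Names F)) x = B" using fname[OF dF R] R by (intro exI[of _ "j ?R"]) simp
 qed
 thus ?thesis using j_lep[OF lep_Names[OF GCH]] N.lep_trans by blast
qed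

section \<open>The filter restricted to a stage\<close>

lemma rs_G: "p \<in> G ==> rs p \<beta> \<in> G"
proof -
 assume p: "p \<in> G"
 have "rs p \<beta> \<E> CC" by (rule C_subset[OF G_CC[OF p]]) (auto simp: mem_rs)
 moreover have "ple \<sigma> p (rs p \<beta>)" by (rule ple_sup[OF G_CC[OF p] calculation]) (auto simp: mem_rs)
 ultimately show ?thesis using Gup[OF p] G_CC[OF p] unfolding le_iff by blast
qed

lemma b_le: "\<beta> \<E> omega2 ==> pair p q \<E> Oo \<beta> ==> le p q" unfolding mem_ord le_iff using C_CC[of \<beta>] by simp

lemma b_dir: assumes \<beta>: "\<beta> \<E> omega2" and p: "p \<in> G" "p \<E> C \<beta>" "q \<in> G" "q \<E> C \<beta>"
 shows "EX t:G. pair t p \<E> Oo \<beta> & pair t q \<E> Oo \<beta>"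
proof -
 obtain s where s: "s \<in> G" "le s p" "le s q" using Gdir p by blast
 have "ple \<sigma> (rs s \<beta>) (rs p \<beta>)" "ple \<sigma> (rs s \<beta>) (rs q \<beta>)" using s ple_rs h_Ord[OF \<beta>] unfolding le_iff by blast+
 hence "pair (rs s \<beta>) p \<E> Oo \<beta> & pair (rs s \<beta>) q \<E> Oo \<beta>" unfolding mem_ord using rs_C[OF G_CC[OF s(1)]] p rs_id by simp
 thus ?thesis using rs_G[OF s(1)] by blast
qed

text \<open>The part of the filter at stage \<beta> is generic for that stage, because by
  \<open>amalg\<close> the restrictions to \<beta> of extensions of a condition meet whatever is
  dense there.\<close>

lemma b_dense: assumes \<beta>: "\<beta> \<E> omega2" and q: "q \<in> G" "q \<E> C \<beta>" and D: "DP D"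
  and dense: "!!p. pair p q \<E> Oo \<beta> ==> EX t. pair t p \<E> Oo \<beta> & D t"
 shows "EX s:G. pair s q \<E> Oo \<beta> & D s"
proof -
 note [dfn] = DPD[OF D]
 have d: "DP (%p. D (rs p \<beta>))" by (intro dfn)
 have low: "pair (rs p \<beta>) q \<E> Oo \<beta>" if "le p q" for p
  unfolding mem_ord using that rs_C q(2) ple_rs[OF _ _ h_Ord[OF \<beta>], of p q] rs_id[OF q(2)] unfolding le_iff by metis
 have "EX s:G. le s q & D (rs s \<beta>)"
 proof (rule Gdense[OF q(1) d])
  fix p assume p: "le p q"
  obtain t where t: "pair t (rs p \<beta>) \<E> Oo \<beta>" "D t" using dense[OF low[OF p]] by blast
  obtain p' where "p' \<E> CC" "ple \<sigma> p' p" "rs p' \<beta> = t" using amalg[OF \<beta>, of p t] t(1) p unfolding le_iff mem_ord by blast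
  thus "EX s. le s p & D (rs s \<beta>)" using t(2) p unfolding le_iff by blast
 qed
 thus ?thesis using low rs_G by blast
qed

lemma b_dense': assumes \<beta>: "\<beta> \<E> omega2" and D: "DP D" and dense: "!!p. p \<E> C \<beta> ==> EX t. pair t p \<E> Oo \<beta> & D t"
 shows "EX s:G. s \<E> C \<beta> & D s"
proof -
 obtain p where p: "p \<in> G" using Gne by blast
 show ?thesis using b_dense[OF \<beta> rs_G[OF p] rs_C[OF G_CC[OF p]] D] dense unfolding mem_ord by blast
qed


text \<open>Here \<open>Q\<close> is the relation that \<open>R\<close> names at stage \<beta>, and
  it happens to be a preorder. The lemmas identify it in turn with what \<open>FR\<close>,
  \<open>FQ\<close> and \<open>SR\<close> force, so that the modification of the iterand is harmless
  in this case.\<close>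

context
 fixes \<beta> R Q
 assumes \<beta>: "\<beta> \<E> omega2"
  and RG: "!!x y. Q x y <-> (EX s:G. s \<E> C \<beta> & pair s (pair x y) \<E> R)"
  and Q_refl: "!!x. x \<E> omega1 ==> Q x x"
  and Q_trans: "!!x y z. Q x y ==> Q y z ==> Q x z"
begin

lemma b_preord: "preord (Oo \<beta>)" using o_preord \<beta> by simp
lemma b_trans: "pair p q \<E> Oo \<beta> ==> pair q s \<E> Oo \<beta> ==> pair p s \<E> Oo \<beta>" using preord_trans[OF b_preord] .
lemma b_refl: "p \<E> C \<beta> ==> pair p p \<E> Oo \<beta>" unfolding mem_ord using ple_sup C_CC[of \<beta> p] \<beta> by auto
lemma b_C: "pair p q \<E> Oo \<beta> ==> p \<E> C \<beta>" "pair p q \<E> Oo \<beta> ==> q \<E> C \<beta>" unfolding mem_ord by blast+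

lemma FR_G: "Q x y <-> (EX s:G. s \<E> C \<beta> & FR (Oo \<beta>) R s x y)"
proof
 assume "Q x y"
 then obtain s where "s \<in> G" "s \<E> C \<beta>" "pair s (pair x y) \<E> R" using RG by blast
 moreover have "FR (Oo \<beta>) R s x y" unfolding FR_def using calculation(3) b_refl b_C by blast
 ultimately show "EX s:G. s \<E> C \<beta> & FR (Oo \<beta>) R s x y" by blast
next
 assume "EX s:G. s \<E> C \<beta> & FR (Oo \<beta>) R s x y"
 then obtain s where s: "s \<in> G" "s \<E> C \<beta>" "FR (Oo \<beta>) R s x y" by blast
 have d: "DP (%t. EX u. pair t u \<E> Oo \<beta> & pair u (pair x y) \<E> R)" by (intro dfn)
 have "EX t:G. pair t s \<E> Oo \<beta> & (EX u. pair t u \<E> Oo \<beta> & pair u (pair x y) \<E> R)"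
  by (rule b_dense[OF \<beta> s(1,2) d]) (use s(3) in "unfold FR_def, blast")
 thus "Q x y" using RG Gup b_le[OF \<beta>] b_C by blast
qed

lemma FQ_G: assumes x: "x \<E> omega1" shows "Q x y <-> (EX s:G. s \<E> C \<beta> & FQ (Oo \<beta>) R s x y)"
proof
 assume "EX s:G. s \<E> C \<beta> & FQ (Oo \<beta>) R s x y"
 then obtain s where s: "s \<in> G" "s \<E> C \<beta>" "FQ (Oo \<beta>) R s x y" by blast
 obtain u where u: "u \<in> G" "u \<E> C \<beta>" "FR (Oo \<beta>) R u x x" using Q_refl[OF x] FR_G by blast
 obtain t where t: "t \<in> G" "pair t s \<E> Oo \<beta>" "pair t u \<E> Oo \<beta>" using b_dir[OF \<beta> s(1,2) u(1,2)] by blast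
 hence "FR (Oo \<beta>) R t x y" using s(3) FR_mono[OF b_preord u(3)] unfolding FQ_def by blast
 thus "Q x y" using FR_G t b_C by blast
next
 assume Q: "Q x y"
 let ?B = "%t. EX z. FR (Oo \<beta>) R t z x & (ALL u s. pair u t \<E> Oo \<beta> --> pair u s \<E> Oo \<beta> --> ~ pair s (pair z y) \<E> R)"
 have d: "DP (%t. FQ (Oo \<beta>) R t x y | ?B t)" by (intro dfn)
 have "EX s:G. s \<E> C \<beta> & (FQ (Oo \<beta>) R s x y | ?B s)"
 proof (rule b_dense'[OF \<beta> d])
  fix q assume q: "q \<E> C \<beta>"
  show "EX t. pair t q \<E> Oo \<beta> & (FQ (Oo \<beta>) R t x y | ?B t)"
  proof (cases "FQ (Oo \<beta>) R q x y")
   case False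
   then obtain q1 z where q1: "pair q1 q \<E> Oo \<beta>" "FR (Oo \<beta>) R q1 z x" "~ FR (Oo \<beta>) R q1 z y" unfolding FQ_def by blast
   then obtain q2 where q2: "pair q2 q1 \<E> Oo \<beta>" "ALL u s. pair u q2 \<E> Oo \<beta> --> pair u s \<E> Oo \<beta> --> ~ pair s (pair z y) \<E> R"
    unfolding FR_def by blast
   thus ?thesis using b_trans[OF q2(1) q1(1)] FR_mono[OF b_preord q1(2) q2(1)] by blast
  qed (use b_refl[OF q] in blast)
 qed
 then obtain t where t: "t \<in> G" "t \<E> C \<beta>" "FQ (Oo \<beta>) R t x y | ?B t" by blast
 moreover have "~ ?B t"
 proof (intro notI, elim exE conjE)
  fix z assume z: "FR (Oo \<beta>) R t z x" "ALL u s. pair u t \<E> Oo \<beta> --> pair u s \<E> Oo \<beta> --> ~ pair s (pair z y) \<E> R"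
  have "Q z y" using Q_trans[OF _ Q] FR_G t(1,2) z(1) by blast
  then obtain s where s: "s \<in> G" "s \<E> C \<beta>" "pair s (pair z y) \<E> R" using RG by blast
  obtain u where "pair u t \<E> Oo \<beta>" "pair u s \<E> Oo \<beta>" using b_dir[OF \<beta> t(1,2) s(1,2)] by blast
  thus False using z(2) s(3) by blast
 qed
 ultimately show "EX s:G. s \<E> C \<beta> & FQ (Oo \<beta>) R s x y" by blast
qed

text \<open>If no condition of the filter had \<open>GC\<close>, one of them would carry a family
  without compatible members while forcing uncountably many first coordinates into the filter. The
  second coordinates of these would be an uncountable antichain of \<open>Q\<close>.\<close>

lemma GC_G:
 assumes Nccc: "!!W. N.el W <= N.el (j omega1) ==> (!!u v w. N (j u) W ==> N (j v) W ==> w \<E> omega1 ==> Q w u ==> Q w v ==> u = v) ==> N.lep W N.omega"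
 shows "EX g:G. g \<E> C \<beta> & GC (Oo \<beta>) R g"
proof -
 let ?B = "%q. EX f. (ALL i. i \<E> omega1 --> p1 (app f i) \<E> C \<beta> & p2 (app f i) \<E> omega1) &
   (ALL i k. i \<E> omega1 --> k \<E> omega1 --> i ~= k --> ~ two_compat (Oo \<beta>) R f i k) &
   (ALL p \<gamma>. pair p q \<E> Oo \<beta> --> \<gamma> \<E> omega1 --> (EX k. k \<E> omega1 & \<gamma> \<E> k & compat (Oo \<beta>) p (p1 (app f k))))"
 have d: "DP (%q. GC (Oo \<beta>) R q | ?B q)" by (intro dfn)
 have "EX q:G. q \<E> C \<beta> & (GC (Oo \<beta>) R q | ?B q)"
 proof (rule b_dense'[OF \<beta> d])
  fix q assume q: "q \<E> C \<beta>"
  show "EX t. pair t q \<E> Oo \<beta> & (GC (Oo \<beta>) R t | ?B t)"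
  proof (cases "GC (Oo \<beta>) R q")
   case False
   then obtain f where f: "!!i. i \<E> omega1 ==> pair (p1 (app f i)) q \<E> Oo \<beta> & p2 (app f i) \<E> omega1"
    "ALL i k. i \<E> omega1 --> k \<E> omega1 --> i ~= k --> ~ two_compat (Oo \<beta>) R f i k" unfolding GC_def by blast
   have df: "DF (%i. p1 (app f i))" by (intro dfn)
   have "cc (Oo \<beta>)" using o_cc \<beta> by simp
   from unbounded[OF this b_preord df] obtain i where i: "i \<E> omega1"
    "ALL p \<gamma>. pair p (p1 (app f i)) \<E> Oo \<beta> --> \<gamma> \<E> omega1 --> (EX k. k \<E> omega1 & \<gamma> \<E> k & compat (Oo \<beta>) p (p1 (app f k)))"
    using f(1) b_refl b_C by blast
   have "?B (p1 (app f i))" by (rule exI[of _ f]) (use f i b_C(1) in blast)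
   thus ?thesis using f(1)[OF i(1)] by blast
  qed (use b_refl[OF q] in blast)
 qed
 then obtain q where q: "q \<in> G" "q \<E> C \<beta>" "GC (Oo \<beta>) R q | ?B q" by blast
 moreover have "~ ?B q"
 proof (intro notI, elim exE conjE)
  fix f assume f: "ALL i. i \<E> omega1 --> p1 (app f i) \<E> C \<beta> & p2 (app f i) \<E> omega1"
   "ALL i k. i \<E> omega1 --> k \<E> omega1 --> i ~= k --> ~ two_compat (Oo \<beta>) R f i k"
   "ALL p \<gamma>. pair p q \<E> Oo \<beta> --> \<gamma> \<E> omega1 --> (EX k. k \<E> omega1 & \<gamma> \<E> k & compat (Oo \<beta>) p (p1 (app f k)))"
  have unb: "EX k. k \<E> omega1 & \<gamma> \<E> k & p1 (app f k) \<in> G" if \<gamma>: "\<gamma> \<E> omega1" for \<gamma>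
  proof -
   have d: "DP (%t. EX k. k \<E> omega1 & \<gamma> \<E> k & pair t (p1 (app f k)) \<E> Oo \<beta>)" by (intro dfn)
   have "EX t:G. pair t q \<E> Oo \<beta> & (EX k. k \<E> omega1 & \<gamma> \<E> k & pair t (p1 (app f k)) \<E> Oo \<beta>)"
    by (rule b_dense[OF \<beta> q(1,2) d]) (use f(3) \<gamma> in "unfold compat_def, blast")
   thus ?thesis using Gup b_le[OF \<beta>] by blast
  qed
  have inc: "i = k" if h: "i \<E> omega1" "k \<E> omega1" "p1 (app f i) \<in> G" "p1 (app f k) \<in> G" "w \<E> omega1"
    "Q w (p2 (app f i))" "Q w (p2 (app f k))" for i k w
  proof (rule ccontr)
   assume ne: "i ~= k"
   obtain s1 where s1: "s1 \<in> G" "s1 \<E> C \<beta>" "FQ (Oo \<beta>) R s1 w (p2 (app f i))" using FQ_G[OF h(5)] h(6) by blast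
   obtain s2 where s2: "s2 \<in> G" "s2 \<E> C \<beta>" "FQ (Oo \<beta>) R s2 w (p2 (app f k))" using FQ_G[OF h(5)] h(7) by blast
   obtain t1 where t1: "t1 \<in> G" "pair t1 s1 \<E> Oo \<beta>" "pair t1 s2 \<E> Oo \<beta>" using b_dir[OF \<beta> s1(1,2) s2(1,2)] by blast
   obtain t2 where t2: "t2 \<in> G" "pair t2 (p1 (app f i)) \<E> Oo \<beta>" "pair t2 (p1 (app f k)) \<E> Oo \<beta>" using b_dir[OF \<beta> h(3) _ h(4)] f(1) h(1,2) by blast
   obtain t where t: "pair t t1 \<E> Oo \<beta>" "pair t t2 \<E> Oo \<beta>" using b_dir[OF \<beta> t1(1) b_C(1)[OF t1(2)] t2(1) b_C(1)[OF t2(2)]] by blast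
   have "FQ (Oo \<beta>) R t w (p2 (app f i))" "FQ (Oo \<beta>) R t w (p2 (app f k))"
    using FQ_mono[OF b_preord s1(3)] FQ_mono[OF b_preord s2(3)] b_trans t(1) t1(2,3) by blast+
   hence "two_compat (Oo \<beta>) R f i k" unfolding two_compat_def using b_trans[OF t(2) t2(2)] b_trans[OF t(2) t2(3)] h(5) by blast
   thus False using f(2) h(1,2) ne by blast
  qed
  have dX: "DF (%i. pair (chk (p2 (app f i))) (p1 (app f i)))" and dI: "DF (%i. pair (chk i) (p1 (app f i)))" and dx: "DF (%i. p2 (app f i))"
   by (intro dfn)+
  \<comment> \<open>\<open>I\<close> collects the indices whose first coordinate is in the filter,
    and \<open>X\<close> the second coordinates there; \<open>I\<close> is unbounded in \<omega>1
    and injects into \<open>X\<close>.\<close>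
  define X where "X = val (Repl omega1 (%i. pair (chk (p2 (app f i))) (p1 (app f i))))"
  define I where "I = val (Repl omega1 (%i. pair (chk i) (p1 (app f i))))"
  have X: "N z X <-> (EX i. i \<E> omega1 & p1 (app f i) \<in> G & z = j (p2 (app f i)))" for z
   unfolding X_def val_mem mem_Repl[OF dX] j_def by auto
  have I: "N z I <-> (EX i. i \<E> omega1 & p1 (app f i) \<in> G & z = j i)" for z
   unfolding I_def val_mem mem_Repl[OF dI] j_def by auto
  have "N.lep X N.omega"
  proof (rule Nccc)
   show "N.el X <= N.el (j omega1)" unfolding N.sub_iff X using f(1) by auto
   fix u v w assume "N (j u) X" "N (j v) X" "w \<E> omega1" "Q w u" "Q w v"
   thus "u = v" unfolding X using inc by (metis j_inj)
  qed
  moreover have "N.lep I X"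
  proof (rule N.lepI)
   show "N.DF (N.app (j (lam omega1 (%i. p2 (app f i)))))" by (intro dfn)
   have app: "N.app (j (lam omega1 (%i. p2 (app f i)))) (j i) = j (p2 (app f i))" if "i \<E> omega1" for i
    using j_fn(2)[OF fn_lam[OF dx] that] app_lam[OF dx that] by simp
   show "N x I ==> N (N.app (j (lam omega1 (%i. p2 (app f i)))) x) X" for x unfolding I X using app by blast
   fix x y assume "N x I" "N y I" "N.app (j (lam omega1 (%i. p2 (app f i)))) x = N.app (j (lam omega1 (%i. p2 (app f i)))) y"
   then obtain i k where ik: "i \<E> omega1" "k \<E> omega1" "p1 (app f i) \<in> G" "p1 (app f k) \<in> G" "x = j i" "y = j k" "p2 (app f i) = p2 (app f k)"
    unfolding I using app by auto
   thus "x = y" using inc[OF ik(1-4), of "p2 (app f i)"] f(1) Q_refl by auto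
  qed
  ultimately have "N.lep I N.omega" using N.lep_trans by blast
  moreover have "~ N.lep I N.omega"
  proof (rule N.omega1_bound)
   fix z assume "N z (N.hartogs N.omega)"
   then obtain \<gamma> where "\<gamma> \<E> omega1" "z = j \<gamma>" unfolding N_omega1 j_mem by blast
   thus "EX x. N x I & N x (N.hartogs N.omega) & N z x" using unb[of \<gamma>] unfolding N_omega1 I by (metis j_mem_iff)
  qed
  ultimately show False by blast
 qed
 ultimately show ?thesis by blast
qed

lemma SR_G: assumes g: "g \<in> G" "g \<E> C \<beta>" "GC (Oo \<beta>) R g" and x: "x \<E> omega1"
 shows "Q x y <-> (EX s:G. s \<E> C \<beta> & SR (Oo \<beta>) R s x y)"
proof
 assume "Q x y"
 thus "EX s:G. s \<E> C \<beta> & SR (Oo \<beta>) R s x y" using FQ_G[OF x] FQ_SR[OF b_preord] by blast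
next
 assume "EX s:G. s \<E> C \<beta> & SR (Oo \<beta>) R s x y"
 then obtain s where s: "s \<in> G" "s \<E> C \<beta>" "SR (Oo \<beta>) R s x y" by blast
 obtain t where t: "t \<in> G" "pair t s \<E> Oo \<beta>" "pair t g \<E> Oo \<beta>" using b_dir[OF \<beta> s(1,2) g(1,2)] by blast
 hence "FQ (Oo \<beta>) R t x y" using s(3) GC_mono[OF b_preord g(3)] unfolding SR_def by blast
 thus "Q x y" using FQ_G[OF x] t b_C by blast
qed

end

text \<open>\<open>T\<close> codes \<omega>1 many dense sets by its sections. A stage \<beta> that
  the list assigns to a name of \<open>Q\<close> adds the filter: it consists of the coordinates at
  \<beta> of the conditions in \<open>G\<close>.\<close>

lemma MA_preorder:
 assumes book: "!!\<beta> R. \<beta> \<E> omega2 ==> R \<E> Names ==> EX \<gamma>. \<gamma> \<E> omega2 & el \<beta> <= el \<gamma> & e \<gamma> = R"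
  and Q_refl: "!!x. N x (j omega1) ==> N (N.pair x x) Q"
  and Q_trans: "!!x y z. N x (j omega1) ==> N y (j omega1) ==> N z (j omega1) ==> N (N.pair x y) Q ==> N (N.pair y z) Q ==> N (N.pair x z) Q"
  and Nccc: "!!W. N.el W <= N.el (j omega1) ==> (!!u v w. N u W ==> N v W ==> N w (j omega1) ==> N (N.pair w u) Q ==> N (N.pair w v) Q ==> u = v) ==> N.lep W N.omega"
  and T: "!!i x. N i (j omega1) ==> N x (j omega1) ==> EX y. N y (j omega1) & N (N.pair y x) Q & N (N.pair i y) T"
 shows "EX K. N.el K <= N.el (j omega1) & (EX x. N x K) & (ALL x y. N x K --> N y (j omega1) --> N (N.pair x y) Q --> N y K) &
  (ALL x y. N x K --> N y K --> (EX z. N z K & N (N.pair z x) Q & N (N.pair z y) Q)) & (ALL i. N i (j omega1) --> (EX x. N x K & N (N.pair i x) T))"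
proof -
 obtain \<tau> \<theta> where \<tau>: "Q = val \<tau>" and \<theta>: "T = val \<theta>" using val_ex by metis
 define QQ where "QQ = (%x y. x \<E> omega1 & y \<E> omega1 & N (N.pair (j x) (j y)) Q)"
 have w1: "N z (j omega1) <-> (EX x. x \<E> omega1 & z = j x)" for z by (rule j_mem)
 have ll: "lep (prod omega1 omega1) omega1" by (rule omega1_square)
 have pre: "EX \<beta>. \<beta> \<E> omega2 & (ALL x y p. x \<E> omega1 --> y \<E> omega1 --> p \<in> G --> fmem p (op (chk x) (chk y)) \<tau> --> (EX s:G. s \<E> C \<beta> & fmem s (op (chk x) (chk y)) \<tau>))" for \<tau>
 proof -
  have "DP2 (%i p. fmem p (op (chk (p1 i)) (chk (p2 i))) \<tau>)" by (intro dfn)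
  hence "EX \<beta>. \<beta> \<E> omega2 & (ALL i p. i \<E> prod omega1 omega1 --> p \<in> G --> fmem p (op (chk (p1 i)) (chk (p2 i))) \<tau> -->
    (EX s:G. s \<E> C \<beta> & fmem s (op (chk (p1 i)) (chk (p2 i))) \<tau>))"
   by (rule predense_G[OF _ ll]) (erule (1) fmem_mono)
  thus ?thesis by (metis pair_mem_prod p1_pair p2_pair)
 qed
 obtain \<beta>1 where \<beta>1: "\<beta>1 \<E> omega2" "!!x y p. x \<E> omega1 ==> y \<E> omega1 ==> p \<in> G ==> fmem p (op (chk x) (chk y)) \<tau> ==> EX s:G. s \<E> C \<beta>1 & fmem s (op (chk x) (chk y)) \<tau>"
  using pre[of \<tau>] by blast
 \<comment> \<open>Membership in \<open>T\<close> should be forced by conditions on stages before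
   \<beta>, because the new coordinate at \<beta> is chosen on the strength of such a
   condition.\<close>
 obtain \<beta>2 where \<beta>2: "\<beta>2 \<E> omega2" "!!x y p. x \<E> omega1 ==> y \<E> omega1 ==> p \<in> G ==> fmem p (op (chk x) (chk y)) \<theta> ==> EX s:G. s \<E> C \<beta>2 & fmem s (op (chk x) (chk y)) \<theta>"
  using pre[of \<theta>] by blast
 define R where "R = Sep (prod (C \<beta>1) (prod omega1 omega1)) (%t. fmem (p1 t) (op (chk (p1 (p2 t))) (chk (p2 (p2 t)))) \<tau>)"
 have dR: "DP (%t. fmem (p1 t) (op (chk (p1 (p2 t))) (chk (p2 (p2 t)))) \<tau>)" by (intro dfn)
 have mR: "pair s (pair x y) \<E> R <-> s \<E> C \<beta>1 & x \<E> omega1 & y \<E> omega1 & fmem s (op (chk x) (chk y)) \<tau>" for s x y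
  unfolding R_def mem_Sep[OF dR] by simp
 have "R \<E> Names" unfolding mem_Names R_def using \<beta>1(1) by (auto simp: mem_Sep[OF dR])
 from book[OF un_mem[OF Ord_hartogs \<beta>1(1) \<beta>2(1)] this] obtain \<beta> where \<beta>: "\<beta> \<E> omega2" "el (un \<beta>1 \<beta>2) <= el \<beta>" "e \<beta> = R" by blast
 have sub: "el \<beta>1 <= el \<beta>" "el \<beta>2 <= el \<beta>" using \<beta>(2) by (auto simp: subset_eq)
 have RG: "QQ x y <-> (EX s:G. s \<E> C \<beta> & pair s (pair x y) \<E> R)" for x y
  unfolding mR QQ_def \<tau> fmem_op[symmetric] using \<beta>1(2) C_mono[OF sub(1)] by blast
 have refl: "QQ x x" if "x \<E> omega1" for x unfolding QQ_def using Q_refl that by simp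
 have trans: "QQ x y ==> QQ y z ==> QQ x z" for x y z unfolding QQ_def using Q_trans[of "j x" "j y" "j z"] by auto
 have "EX g:G. g \<E> C \<beta> & GC (Oo \<beta>) R g"
 proof (rule GC_G[of \<beta> QQ, OF \<beta>(1) RG refl trans])
  fix W assume W: "N.el W <= N.el (j omega1)" and inc: "!!u v w. N (j u) W ==> N (j v) W ==> w \<E> omega1 ==> QQ w u ==> QQ w v ==> u = v"
  show "N.lep W N.omega"
  proof (rule Nccc[OF W])
   fix u v w assume h: "N u W" "N v W" "N w (j omega1)" "N (N.pair w u) Q" "N (N.pair w v) Q"
   have "N u (j omega1)" "N v (j omega1)" using h(1,2) W by auto
   thus "u = v" using h inc unfolding w1 QQ_def by blast
  qed
 qed
 then obtain g where g: "g \<in> G" "g \<E> C \<beta>" "GC (Oo \<beta>) R g" by blast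
 have SG: "QQ x y <-> (EX s:G. s \<E> C \<beta> & SR (Oo \<beta>) R s x y)" if "x \<E> omega1" for x y
  using SR_G[of \<beta> QQ, OF \<beta>(1) RG refl trans g that] .
 have \<sigma>\<beta>: "pair s (pair x y) \<E> app \<sigma> \<beta> <-> s \<E> C \<beta> & x \<E> omega1 & y \<E> omega1 & SR (Oo \<beta>) R s x y" for s x y
  using mem_\<sigma>[OF \<beta>(1)] \<beta>(3) by simp
 have po: "preord (Oo \<beta>)" using o_preord \<beta>(1) by simp
 have dk: "DF (%t. pair (chk (p2 t)) (p1 t))" by (intro dfn)
 have dk': "DP (%t. pair \<beta> (p2 t) \<E> p1 t)" by (intro dfn)
 define K where "K = val (Repl (Sep (prod CC omega1) (%t. pair \<beta> (p2 t) \<E> p1 t)) (%t. pair (chk (p2 t)) (p1 t)))"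
 have K: "N z K <-> (EX p y. p \<in> G & pair \<beta> y \<E> p & z = j y)" for z
 proof -
  let ?S = "Sep (prod CC omega1) (%t. pair \<beta> (p2 t) \<E> p1 t)"
  have 1: "N z K <-> (EX t. t \<E> ?S & p1 t \<in> G & z = j (p2 t))"
   unfolding K_def val_mem mem_Repl[OF dk] j_def by auto
  have 2: "t \<E> ?S <-> (EX p y. p \<E> CC & y \<E> omega1 & pair \<beta> y \<E> p & t = pair p y)" for t
   unfolding mem_Sep[OF dk'] mem_prod by auto
  have "N z K <-> (EX p y. p \<E> CC & y \<E> omega1 & pair \<beta> y \<E> p & p \<in> G & z = j y)"
   unfolding 1 2 by (metis p1_pair p2_pair)
  thus ?thesis using G_CC C_pair by blast
 qed
 have Gw: "y \<E> omega1" if "p \<in> G" "pair \<beta> y \<E> p" for p y using C_pair[OF G_CC] that by blast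
 have below: "EX x. pair \<beta> x \<E> s & QQ x y" if h: "s \<in> G" "le s p" "pair \<beta> y \<E> p" for s p y
 proof -
  obtain x where x: "pair \<beta> x \<E> s" "pair (rs s \<beta>) (pair x y) \<E> app \<sigma> \<beta>" using h(2,3) unfolding le_iff ple_def by blast
  thus ?thesis using SG rs_G[OF h(1)] unfolding \<sigma>\<beta> by blast
 qed
 have dense: "EX p:G. EX y. pair \<beta> y \<E> p & N (N.pair (j i) (j y)) T" if i: "i \<E> omega1" for i
 proof (rule ccontr)
  assume no: "~ ?thesis"
  let ?D = "%q. EX y. pair \<beta> y \<E> q & fmem q (op (chk i) (chk y)) \<theta>"
  have dD: "DP ?D" by (intro dfn)
  obtain p where p: "p \<in> G" "!!q. le q p ==> ~ ?D q"
  proof (rule G_meets[OF dD])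
   show "s \<in> G ==> ~ ?D s" for s using no fmem_op unfolding \<theta> by blast
  qed blast
  have dd: "DP (%q. EX y. pair \<beta> y \<E> q)" by (intro dfn)
  have "EX q:G. le q p & (EX y. pair \<beta> y \<E> q)"
  proof (rule Gdense[OF p(1) dd])
   fix q assume q: "le q p"
   show "EX s. le s q & (EX y. pair \<beta> y \<E> s)"
   proof (cases "EX y. pair \<beta> y \<E> q")
    case True
    thus ?thesis using leD(1)[OF q] le_refl by blast
   next
    case False
    have qC: "q \<E> CC" using q unfolding le_iff by blast
    \<comment> \<open>Any value at \<beta> may serve as a start; it is improved below.\<close>
    let ?t = "un q (sing (pair \<beta> emp))"
    have "emp \<E> omega1" using omega_sub_omega1 emp_omega by (auto simp: subset_eq simp del: emp_omega)
    hence "sing (pair \<beta> emp) \<E> CC" using \<beta>(1) unfolding mem_C by auto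
    hence t: "?t \<E> CC" by (rule C_un[OF qC]) (use False in auto)
    have "ple \<sigma> ?t q" by (rule ple_sup[OF t qC]) auto
    hence "le ?t q" unfolding le_iff using t qC by blast
    thus ?thesis by (intro exI[of _ ?t]) auto
   qed
  qed
  then obtain p' x where p': "p' \<in> G" "le p' p" "pair \<beta> x \<E> p'" by blast
  have xw: "x \<E> omega1" using Gw p' by blast
  obtain y where y: "y \<E> omega1" "N (N.pair (j y) (j x)) Q" "N (N.pair (j i) (j y)) T" using T[of "j i" "j x"] i xw unfolding w1 by auto
  have "QQ y x" unfolding QQ_def using y xw by blast
  then obtain s where s: "s \<in> G" "s \<E> C \<beta>" "SR (Oo \<beta>) R s y x" using SG[OF y(1)] by blast
  obtain u where u: "u \<in> G" "u \<E> C \<beta>" "fmem u (op (chk i) (chk y)) \<theta>"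
   using \<beta>2(2)[OF i y(1)] y(3) C_mono[OF sub(2)] unfolding \<theta> fmem_op[symmetric] by blast
  obtain v where v: "v \<in> G" "pair v s \<E> Oo \<beta>" "pair v u \<E> Oo \<beta>" using b_dir[OF \<beta>(1) s(1,2) u(1,2)] by blast
  have vC: "v \<E> C \<beta>" using v(2) unfolding mem_ord by blast
  have pC: "p' \<E> CC" using G_CC p'(1) by blast
  obtain q where q: "q \<in> G" "pair q v \<E> Oo \<beta>" "pair q (rs p' \<beta>) \<E> Oo \<beta>" using b_dir[OF \<beta>(1) v(1) vC rs_G[OF p'(1)] rs_C[OF pC]] by blast
  have qC: "q \<E> C \<beta>" using q(2) unfolding mem_ord by blast
  have SRq: "SR (Oo \<beta>) R q y x" by (rule SR_mono[OF po s(3) preord_trans[OF po q(2) v(2)]])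
  have Ob: "Ord \<beta>" using h_Ord[OF \<beta>(1)] .
  let ?h = "hi p' (succ \<beta>)"
  \<comment> \<open>The condition \<open>q\<close> before \<beta>, the improved value
    \<open>y\<close> at \<beta>, and \<open>p'\<close> after \<beta>.\<close>
  let ?t = "un q (un (sing (pair \<beta> y)) ?h)"
  have qCC: "q \<E> CC" using C_CC qC \<beta>(1) by (meson mem_succ)
  have sC: "sing (pair \<beta> y) \<E> CC" using \<beta>(1) y(1) unfolding mem_C by auto
  have uC: "un (sing (pair \<beta> y)) ?h \<E> CC" by (rule C_un[OF sC C_subset[OF pC hi_sub]]) auto
  have nb: "~ pair \<beta> z \<E> q" for z using C_pair[OF qC, of \<beta> z] by auto
  have tC: "?t \<E> CC" by (rule C_un[OF qCC uC]) (use C_pair[OF qC] nb in auto)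
  have rt: "rs ?t \<beta> = q" by (rule C_ext[OF rs_C[OF tC] qC]) (use C_pair[OF qC] in auto)
  have "ple \<sigma> ?t p'"
  proof (rule ple_join[OF tC pC Ord_succ[OF Ob]])
   show "pair \<gamma> z \<E> p' ==> ~ \<gamma> \<E> succ \<beta> ==> pair \<gamma> z \<E> ?t" for \<gamma> z by simp
   show "ple \<sigma> (rs ?t (succ \<beta>)) (rs p' (succ \<beta>))" unfolding ple_def
   proof (intro allI impI)
    fix \<gamma> z assume z: "pair \<gamma> z \<E> rs p' (succ \<beta>)"
    hence gs: "\<gamma> \<E> succ \<beta>" by simp
    have rr: "rs (rs ?t (succ \<beta>)) \<gamma> = rs ?t \<gamma>" by (rule rs_rs[OF tC Ord_succ[OF Ob] gs])
    consider "\<gamma> \<E> \<beta>" | "\<gamma> = \<beta>" using gs by auto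
    thus "EX w. pair \<gamma> w \<E> rs ?t (succ \<beta>) & pair (rs (rs ?t (succ \<beta>)) \<gamma>) (pair w z) \<E> app \<sigma> \<gamma>"
    proof cases
     case 1
     then obtain w where "pair \<gamma> w \<E> q" "pair (rs q \<gamma>) (pair w z) \<E> app \<sigma> \<gamma>" using q(3) z unfolding mem_ord ple_def by auto
     moreover have "rs ?t \<gamma> = rs q \<gamma>" using rs_rs[OF tC Ob 1] rt by simp
     ultimately show ?thesis unfolding rr using gs by auto
    next
     case 2
     hence "z = x" using C_fun[OF pC _ p'(3)] z by simp
     thus ?thesis unfolding 2 rr[unfolded 2] rt \<sigma>\<beta> using qC y(1) xw SRq by (intro exI[of _ y]) simp
    qed
   qed
  qed
  hence tp: "le ?t p" using le_trans[OF _ p'(2)] tC pC unfolding le_iff by blast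
  have "ple \<sigma> ?t q" by (rule ple_sup[OF tC qCC]) auto
  hence "le ?t q" using tC qCC unfolding le_iff by blast
  hence "le ?t u" using le_trans b_le[OF \<beta>(1) preord_trans[OF po q(2) v(3)]] by blast
  hence "fmem ?t (op (chk i) (chk y)) \<theta>" by (rule fmem_mono[OF u(3)])
  thus False using p(2)[OF tp] by auto
 qed
 show ?thesis
 proof (rule exI[of _ K], intro conjI allI impI)
  show "N.el K <= N.el (j omega1)" unfolding N.sub_iff K using Gw by auto
  have e0: "emp \<E> omega1" using omega_sub_omega1 emp_omega by (auto simp: subset_eq simp del: emp_omega)
  thus "EX x. N x K" using dense unfolding K by blast
  show "EX x. N x K & N (N.pair i x) T" if "N i (j omega1)" for i
   using that dense unfolding w1 K by blast
 next
  fix x y assume "N x K" "N y K"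
  then obtain p q a b where h: "p \<in> G" "pair \<beta> a \<E> p" "x = j a" "q \<in> G" "pair \<beta> b \<E> q" "y = j b" unfolding K by blast
  obtain s where s: "s \<in> G" "le s p" "le s q" using Gdir h(1,4) by blast
  obtain c where c: "pair \<beta> c \<E> s" "QQ c a" using below[OF s(1,2) h(2)] by blast
  obtain d where d: "pair \<beta> d \<E> s" "QQ d b" using below[OF s(1,3) h(5)] by blast
  have "c = d" using C_fun[OF G_CC[OF s(1)]] c d by blast
  thus "EX z. N z K & N (N.pair z x) Q & N (N.pair z y) Q" unfolding K using c d s(1) h unfolding QQ_def by blast
 next
  fix x y assume "N x K" and y: "N y (j omega1)" and xy: "N (N.pair x y) Q"
  then obtain p a where h: "p \<in> G" "pair \<beta> a \<E> p" "x = j a" unfolding K by blast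
  obtain b where b: "b \<E> omega1" "y = j b" using y unfolding w1 by blast
  have aw: "a \<E> omega1" using Gw h by blast
  have "QQ a b" unfolding QQ_def using aw b xy h by blast
  then obtain s where s: "s \<in> G" "s \<E> C \<beta>" "SR (Oo \<beta>) R s a b" using SG[OF aw] by blast
  obtain q where q: "q \<in> G" "le q p" "le q s" using Gdir h(1) s(1) by blast
  obtain c where c: "pair \<beta> c \<E> q" "QQ c a" "pair (rs q \<beta>) (pair c a) \<E> app \<sigma> \<beta>"
   using q(2) h(2) below[OF q(1,2) h(2)] C_fun[OF G_CC[OF q(1)]] unfolding le_iff ple_def by metis
  have qs: "pair (rs q \<beta>) s \<E> Oo \<beta>"
   unfolding mem_ord using rs_C[OF G_CC[OF q(1)]] s(2) q(3) ple_rs[OF _ _ h_Ord[OF \<beta>(1)], of q s] rs_id[OF s(2)] unfolding le_iff by metis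
  have "SR (Oo \<beta>) R (rs q \<beta>) c b" using SR_trans SR_mono[OF po s(3) qs] c(3) unfolding \<sigma>\<beta> by blast
  hence cb: "pair (rs q \<beta>) (pair c b) \<E> app \<sigma> \<beta>" using c(3) b(1) unfolding \<sigma>\<beta> by blast
  \<comment> \<open>Replacing the value at \<beta> by the weaker \<open>b\<close> gives a weaker
    condition than \<open>q\<close>, so it is in the filter, and \<open>b\<close> is one of the
    coordinates at \<beta>.\<close>
  let ?t = "un (rs q \<beta>) (sing (pair \<beta> b))"
  have qC: "q \<E> CC" using G_CC q(1) by blast
  have rC: "rs q \<beta> \<E> CC" by (rule C_subset[OF qC]) (auto simp: mem_rs)
  have sC: "sing (pair \<beta> b) \<E> CC" using \<beta>(1) b(1) unfolding mem_C by auto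
  have tC: "?t \<E> CC" by (rule C_un[OF rC sC]) auto
  have "ple \<sigma> q ?t" unfolding ple_def
  proof (intro allI impI)
   fix \<gamma> z assume "pair \<gamma> z \<E> ?t"
   then consider "pair \<gamma> z \<E> q" | "\<gamma> = \<beta>" "z = b" by auto
   thus "EX x. pair \<gamma> x \<E> q & pair (rs q \<gamma>) (pair x z) \<E> app \<sigma> \<gamma>"
   proof cases
    case 1
    thus ?thesis using \<sigma>_refl[OF qC] C_pair[OF qC] by blast
   next
    case 2
    thus ?thesis using c(1) cb by blast
   qed
  qed
  hence "le q ?t" using qC tC unfolding le_iff by blast
  hence "?t \<in> G" using Gup q(1) by blast
  thus "N y K" unfolding K b(2) by (intro exI[of _ ?t] exI[of _ b]) auto
 qed
qed

end

subsection \<open>Consequences of Martin's Axiom\<close>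

context zfc begin

definition cccr where "cccr P r <-> (ALL A. el A <= el P -->
  (ALL x y. x \<E> A --> y \<E> A --> x ~= y --> ~ (EX z. z \<E> P & pair z x \<E> r & pair z y \<E> r)) --> lep A omega)"

definition densr where "densr P r D <-> el D <= el P & (ALL x. x \<E> P --> (EX y. y \<E> D & pair y x \<E> r))"

definition filtr where "filtr P r G <-> el G <= el P & (EX x. x \<E> G) &
  (ALL x y. x \<E> G --> y \<E> P --> pair x y \<E> r --> y \<E> G) & (ALL x y. x \<E> G --> y \<E> G --> (EX z. z \<E> G & pair z x \<E> r & pair z y \<E> r))"

text \<open>Stated for preorders: there is no antisymmetry hypothesis, so it implies what
  \<open>MA_at\<close> says about partial orders.\<close>

definition MA_for where "MA_for \<kappa> <-> (ALL P r S. (EX p. p \<E> P) --> (ALL x. x \<E> P --> pair x x \<E> r) -->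
  (ALL x y z. x \<E> P --> y \<E> P --> z \<E> P --> pair x y \<E> r --> pair y z \<E> r --> pair x z \<E> r) --> cccr P r -->
  (ALL D. D \<E> S --> densr P r D) --> lep S \<kappa> --> (EX G. filtr P r G & (ALL D. D \<E> S --> (EX x. x \<E> D & x \<E> G))))"

lemma MA_for_mono: "MA_for \<kappa> ==> lep \<mu> \<kappa> ==> MA_for \<mu>" unfolding MA_for_def using lep_trans by blast

text \<open>The Skolem hull of one point under \<omega>1 many unary functions and a binary
  one.\<close>

lemma closure:
 assumes f: "DF2 f" and h: "DF2 h" and p: "p \<E> P" "!!i x. i \<E> omega1 ==> x \<E> P ==> f i x \<E> P" "!!x y. x \<E> P ==> y \<E> P ==> h x y \<E> P"
 shows "EX P0. el P0 <= el P & p \<E> P0 & lep P0 omega1 & (ALL i x. i \<E> omega1 --> x \<E> P0 --> f i x \<E> P0) & (ALL x y. x \<E> P0 --> y \<E> P0 --> h x y \<E> P0)"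
proof -
 note [dfn] = DF2D[OF f] DF2D[OF h]
 have d1: "DF (%t. f (p1 t) (p2 t))" and d2: "DF (%t. h (p1 t) (p2 t))" by (intro dfn)+
 let ?S = "%Y. un Y (un (Repl (prod omega1 Y) (%t. f (p1 t) (p2 t))) (Repl (prod Y Y) (%t. h (p1 t) (p2 t))))"
 have "DF2 (%n Y. ?S Y)" by (intro dfn)
 from nat_rec[OF this, of "sing p"] obtain F where F: "DF F" "F emp = sing p" "!!n. n \<E> omega ==> F (succ n) = ?S (F n)" by blast
 note [dfn] = DFD[OF F(1)]
 have mS: "z \<E> ?S Y <-> z \<E> Y | (EX i x. i \<E> omega1 & x \<E> Y & z = f i x) | (EX x y. x \<E> Y & y \<E> Y & z = h x y)" for z Y
 proof -
  have 1: "z \<E> Repl (prod omega1 Y) (%t. f (p1 t) (p2 t)) <-> (EX i x. i \<E> omega1 & x \<E> Y & z = f i x)"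
   unfolding mem_Repl[OF d1] mem_prod by force
  have 2: "z \<E> Repl (prod Y Y) (%t. h (p1 t) (p2 t)) <-> (EX x y. x \<E> Y & y \<E> Y & z = h x y)"
   unfolding mem_Repl[OF d2] mem_prod by force
  show ?thesis unfolding mem_un 1 2 ..
 qed
 have FP: "lep (F n) omega1 & el (F n) <= el P" if "n \<E> omega" for n
 proof (rule nat_induct[of "%n. lep (F n) omega1 & el (F n) <= el P", OF _ _ _ that], intro dfn)
  show "lep (F emp) omega1 & el (F emp) <= el P" unfolding F(2) using lep_omega_omega1[OF fin_lep_omega[OF fin_sing]] p(1) by auto
  fix n assume n: "n \<E> omega" "lep (F n) omega1 & el (F n) <= el P"
  have "lep (Repl (prod omega1 (F n)) (%t. f (p1 t) (p2 t))) omega1" "lep (Repl (prod (F n) (F n)) (%t. h (p1 t) (p2 t))) omega1"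
   using n(2) lep_trans[OF lep_Repl[OF d1]] lep_trans[OF lep_Repl[OF d2]] lep_prod_omega1 lep_refl by blast+
  hence "lep (?S (F n)) omega1" using n(2) lep_un[OF _ _ omega1_square omega_sub_omega1] by blast
  moreover have "el (?S (F n)) <= el P" using n(2) p(2,3) unfolding sub_iff mS by blast
  ultimately show "lep (F (succ n)) omega1 & el (F (succ n)) <= el P" unfolding F(3)[OF n(1)] by blast
 qed
 have mono: "ALL n. n \<E> m --> el (F n) <= el (F m)" if "m \<E> omega" for m
 proof (rule nat_induct[of "%m. ALL n. n \<E> m --> el (F n) <= el (F m)", OF _ _ _ that], intro dfn)
  fix m assume m: "m \<E> omega" "ALL n. n \<E> m --> el (F n) <= el (F m)"
  have "el (F m) <= el (F (succ m))" unfolding F(3)[OF m(1)] sub_iff mS by blast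
  thus "ALL n. n \<E> succ m --> el (F n) <= el (F (succ m))" using m(2) unfolding mem_succ by blast
 qed simp
 let ?P = "Union (Repl omega F)"
 have mP: "z \<E> ?P <-> (EX n. n \<E> omega & z \<E> F n)" for z by (rule mem_UN[OF F(1)])
 have up: "EX n. n \<E> omega & x \<E> F n & y \<E> F n" if h: "x \<E> ?P" "y \<E> ?P" for x y
 proof -
  obtain m n where mn: "m \<E> omega" "x \<E> F m" "n \<E> omega" "y \<E> F n" using h unfolding mP by blast
  thus ?thesis using Ord_linear[OF nat_Ord[OF mn(1)] nat_Ord[OF mn(3)]] mono unfolding sub_iff by metis
 qed
 show ?thesis
 proof (rule exI[of _ ?P], intro conjI allI impI)
  show "el ?P <= el P" using FP unfolding sub_iff mP by blast
  show "p \<E> ?P" unfolding mP by (rule exI[of _ emp]) (simp add: F(2))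
  show "lep ?P omega1" by (rule lep_UN[OF F(1) lep_omega_omega1[OF lep_refl] _ omega1_square]) (use FP in blast)
  show "f i x \<E> ?P" if hh: "i \<E> omega1" "x \<E> ?P" for i x
  proof -
   obtain n where n: "n \<E> omega" "x \<E> F n" using hh(2) unfolding mP by blast
   hence "f i x \<E> F (succ n)" unfolding F(3)[OF n(1)] mS using hh(1) by blast
   thus ?thesis unfolding mP using succ_omega[OF n(1)] by blast
  qed
  show "h x y \<E> ?P" if hh: "x \<E> ?P" "y \<E> ?P" for x y
  proof -
   obtain n where n: "n \<E> omega" "x \<E> F n" "y \<E> F n" using up[OF hh] by blast
   hence "h x y \<E> F (succ n)" unfolding F(3)[OF n(1)] mS by blast
   thus ?thesis unfolding mP using succ_omega[OF n(1)] by blast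
  qed
 qed
qed

text \<open>The hull is taken under \<open>f\<close>, which enters the dense sets, and
  \<open>h\<close>, which picks common extensions. So density survives in it and incompatible
  conditions of it are incompatible in \<open>P\<close>. The order is then pulled back along a map
  \<open>g\<close> of \<omega>1 onto the hull, which is why preorders are considered.\<close>

lemma MA_for_omega1:
 assumes MA: "!!Q T. (!!x. x \<E> omega1 ==> pair x x \<E> Q) ==>
  (!!x y z. x \<E> omega1 ==> y \<E> omega1 ==> z \<E> omega1 ==> pair x y \<E> Q ==> pair y z \<E> Q ==> pair x z \<E> Q) ==>
  (!!W. el W <= el omega1 ==> (!!u v w. u \<E> W ==> v \<E> W ==> w \<E> omega1 ==> pair w u \<E> Q ==> pair w v \<E> Q ==> u = v) ==> lep W omega) ==>
  (!!i x. i \<E> omega1 ==> x \<E> omega1 ==> EX y. y \<E> omega1 & pair y x \<E> Q & pair i y \<E> T) ==>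
  EX K. el K <= el omega1 & (EX x. x \<E> K) & (ALL x y. x \<E> K --> y \<E> omega1 --> pair x y \<E> Q --> y \<E> K) &
   (ALL x y. x \<E> K --> y \<E> K --> (EX z. z \<E> K & pair z x \<E> Q & pair z y \<E> Q)) & (ALL i. i \<E> omega1 --> (EX x. x \<E> K & pair i x \<E> T))"
 shows "MA_for omega1"
 unfolding MA_for_def
proof (intro allI impI)
 fix P r S assume ne: "EX p. p \<E> P" and rf: "ALL x. x \<E> P --> pair x x \<E> r"
  and tr: "ALL x y z. x \<E> P --> y \<E> P --> z \<E> P --> pair x y \<E> r --> pair y z \<E> r --> pair x z \<E> r"
  and cc: "cccr P r" and dn: "ALL D. D \<E> S --> densr P r D" and S: "lep S omega1"
 obtain \<phi> where \<phi>: "DF \<phi>" "!!x. x \<E> S ==> \<phi> x \<E> omega1" "!!x y. x \<E> S ==> y \<E> S ==> \<phi> x = \<phi> y ==> x = y" using lepE[OF S] by blast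
 note [dfn] = DFD[OF \<phi>(1)]
 obtain p where p: "p \<E> P" using ne by blast
 \<comment> \<open>\<open>x\<close> lies in the dense set with number \<open>i\<close>; a number
   that belongs to no dense set imposes no demand.\<close>
 define hit where "hit = (%i x. x \<E> P & (ALL D. D \<E> S --> \<phi> D = i --> x \<E> D))"
 have "DP2 hit" unfolding hit_def by (intro dfn)
 note [dfn] = DP2D[OF this]
 have "EX y. y \<E> P & pair y x \<E> r & hit i y" if h: "x \<E> P" for i x
 proof (cases "EX D. D \<E> S & \<phi> D = i")
  case True
  then obtain D where D: "D \<E> S" "\<phi> D = i" by blast
  then obtain y where y: "y \<E> D" "pair y x \<E> r" "y \<E> P" using dn h unfolding densr_def sub_iff by blast
  have "hit i y" unfolding hit_def using y D \<phi>(3) by blast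
  thus ?thesis using y by blast
 next
  case False
  thus ?thesis using h rf unfolding hit_def by blast
 qed
 hence ex1: "EX y. y \<E> P & pair y (p2 t) \<E> r & hit (p1 t) y" if "t \<E> prod omega1 P" for t using that by (auto simp: mem_prod)
 have "DP2 (%t y. y \<E> P & pair y (p2 t) \<E> r & hit (p1 t) y)" by (intro dfn)
 from choice[OF this ex1] obtain f where f: "DF f" "!!t. t \<E> prod omega1 P ==> f t \<E> P & pair (f t) (p2 t) \<E> r & hit (p1 t) (f t)" by blast
 let ?R = "%t z. z \<E> P & ((EX z. z \<E> P & pair z (p1 t) \<E> r & pair z (p2 t) \<E> r) --> pair z (p1 t) \<E> r & pair z (p2 t) \<E> r)"
 have "DP2 ?R" by (intro dfn)
 moreover have "EX z. ?R t z" for t using p by blast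
 ultimately obtain h where h: "DF h" "!!t. t \<E> prod P P ==> ?R t (h t)" using choice[of ?R "prod P P"] by blast
 note [dfn] = DFD[OF f(1)] DFD[OF h(1)]
 have d2: "DF2 (%i x. f (pair i x))" "DF2 (%x y. h (pair x y))" by (intro dfn)+
 have "EX P0. el P0 <= el P & p \<E> P0 & lep P0 omega1 & (ALL i x. i \<E> omega1 --> x \<E> P0 --> f (pair i x) \<E> P0) & (ALL x y. x \<E> P0 --> y \<E> P0 --> h (pair x y) \<E> P0)"
  by (rule closure[OF d2 p]) (use f(2) h(2) in auto)
 then obtain P0 where P0: "el P0 <= el P" "p \<E> P0" "lep P0 omega1" "!!i x. i \<E> omega1 ==> x \<E> P0 ==> f (pair i x) \<E> P0"
  "!!x y. x \<E> P0 ==> y \<E> P0 ==> h (pair x y) \<E> P0" by blast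
 have PP: "x \<E> P0 ==> x \<E> P" for x using P0(1) by auto
 obtain \<psi> where \<psi>: "DF \<psi>" "!!x. x \<E> P0 ==> \<psi> x \<E> omega1" "!!x y. x \<E> P0 ==> y \<E> P0 ==> \<psi> x = \<psi> y ==> x = y" using lepE[OF P0(3)] by blast
 note [dfn] = DFD[OF \<psi>(1)]
 have "DP2 (%i x. x \<E> P0 & (ALL y. y \<E> P0 --> \<psi> y = i --> x = y))" by (intro dfn)
 moreover have "EX x. x \<E> P0 & (ALL y. y \<E> P0 --> \<psi> y = i --> x = y)" for i
  using P0(2) \<psi>(3) by (cases "EX y. y \<E> P0 & \<psi> y = i") blast+
 ultimately obtain g where g: "DF g" "!!i. i \<E> omega1 ==> g i \<E> P0 & (ALL y. y \<E> P0 --> \<psi> y = i --> g i = y)"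
  using choice[of "%i x. x \<E> P0 & (ALL y. y \<E> P0 --> \<psi> y = i --> x = y)" omega1] by blast
 note [dfn] = DFD[OF g(1)]
 have gs: "EX i. i \<E> omega1 & g i = x" if "x \<E> P0" for x using g(2)[OF \<psi>(2)[OF that]] that \<psi>(2) by blast
 have gP: "g i \<E> P" if "i \<E> omega1" for i using g(2) PP that by blast
 let ?Q = "Sep (prod omega1 omega1) (%t. pair (g (p1 t)) (g (p2 t)) \<E> r)"
 let ?T = "Sep (prod omega1 omega1) (%t. hit (p1 t) (g (p2 t)))"
 have dQ: "DP (%t. pair (g (p1 t)) (g (p2 t)) \<E> r)" and dT: "DP (%t. hit (p1 t) (g (p2 t)))" by (intro dfn)+
 have Q: "pair x y \<E> ?Q <-> x \<E> omega1 & y \<E> omega1 & pair (g x) (g y) \<E> r" for x y by (auto simp: mem_Sep[OF dQ])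
 have T: "pair x y \<E> ?T <-> x \<E> omega1 & y \<E> omega1 & hit x (g y)" for x y by (auto simp: mem_Sep[OF dT])
 have "EX K. el K <= el omega1 & (EX x. x \<E> K) & (ALL x y. x \<E> K --> y \<E> omega1 --> pair x y \<E> ?Q --> y \<E> K) &
   (ALL x y. x \<E> K --> y \<E> K --> (EX z. z \<E> K & pair z x \<E> ?Q & pair z y \<E> ?Q)) & (ALL i. i \<E> omega1 --> (EX x. x \<E> K & pair i x \<E> ?T))"
 proof (rule MA)
  show "pair x x \<E> ?Q" if "x \<E> omega1" for x unfolding Q using gP rf that by blast
  show "pair x z \<E> ?Q" if "pair x y \<E> ?Q" "pair y z \<E> ?Q" for x y z
   using that gP tr unfolding Q by blast
  show "EX y. y \<E> omega1 & pair y x \<E> ?Q & pair i y \<E> ?T" if ix: "i \<E> omega1" "x \<E> omega1" for i x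
  proof -
   have "f (pair i (g x)) \<E> P0" using P0(4) ix g(2) by blast
   then obtain y where y: "y \<E> omega1" "g y = f (pair i (g x))" using gs by blast
   have "pair (g y) (g x) \<E> r & hit i (g y)" using f(2)[of "pair i (g x)"] y ix gP by simp
   thus ?thesis unfolding Q T using y(1) ix by blast
  qed
  fix W assume W: "el W <= el omega1" and inc: "!!u v w. u \<E> W ==> v \<E> W ==> w \<E> omega1 ==> pair w u \<E> ?Q ==> pair w v \<E> ?Q ==> u = v"
  have Ww: "u \<E> omega1" if "u \<E> W" for u using W that by auto
  have "lep (Repl W g) omega"
  proof (rule cc[unfolded cccr_def, rule_format])
   show "el (Repl W g) <= el P" unfolding sub_iff mem_Repl[OF g(1)] using gP Ww by blast
   fix x y assume xy: "x \<E> Repl W g" "y \<E> Repl W g" "x ~= y"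
   then obtain u v where u: "u \<E> W" "x = g u" and v: "v \<E> W" "y = g v" unfolding mem_Repl[OF g(1)] by blast
   show "~ (EX z. z \<E> P & pair z x \<E> r & pair z y \<E> r)"
   proof
    assume "EX z. z \<E> P & pair z x \<E> r & pair z y \<E> r"
    hence "pair (h (pair x y)) x \<E> r & pair (h (pair x y)) y \<E> r" using h(2)[of "pair x y"] gP Ww u v by simp
    moreover obtain w where w: "w \<E> omega1" "g w = h (pair x y)" using gs[of "h (pair x y)"] P0(5)[of x y] g(2) Ww u v by blast
    ultimately have "u = v" using inc[OF u(1) v(1) w(1)] unfolding Q using Ww u v w by simp
    thus False using xy(3) u v by simp
   qed
  qed
  moreover have "lep W (Repl W g)"
  proof (rule lepI[OF g(1)])
   show "u \<E> W ==> g u \<E> Repl W g" for u unfolding mem_Repl[OF g(1)] by blast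
   fix u v assume uv: "u \<E> W" "v \<E> W" "g u = g v"
   have "pair (g u) (g u) \<E> r" using rf gP[OF Ww[OF uv(1)]] by blast
   thus "u = v" using inc[OF uv(1,2) Ww[OF uv(1)]] unfolding Q using Ww uv by simp
  qed
  ultimately show "lep W omega" using lep_trans by blast
 qed
 then obtain K where K: "el K <= el omega1" "EX x. x \<E> K"
   "!!x y. x \<E> K ==> y \<E> K ==> EX z. z \<E> K & pair z x \<E> ?Q & pair z y \<E> ?Q" "!!i. i \<E> omega1 ==> EX x. x \<E> K & pair i x \<E> ?T" by blast
 let ?G = "Sep P (%x. EX a. a \<E> K & pair (g a) x \<E> r)"
 have dG: "DP (%x. EX a. a \<E> K & pair (g a) x \<E> r)" by (intro dfn)
 have G: "x \<E> ?G <-> x \<E> P & (EX a. a \<E> K & pair (g a) x \<E> r)" for x by (rule mem_Sep[OF dG])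
 have Kw: "a \<E> K ==> a \<E> omega1" for a using K(1) by auto
 have gG: "g a \<E> ?G" if "a \<E> K" for a unfolding G using gP[OF Kw[OF that]] rf that by blast
 show "EX G. filtr P r G & (ALL D. D \<E> S --> (EX x. x \<E> D & x \<E> G))"
 proof (rule exI[of _ ?G], unfold filtr_def, intro conjI allI impI)
  show "el ?G <= el P" unfolding sub_iff G by blast
  show "EX x. x \<E> ?G" using K(2) gG by blast
  show "y \<E> ?G" if "x \<E> ?G" "y \<E> P" "pair x y \<E> r" for x y using that tr gP Kw unfolding G by blast
  show "EX z. z \<E> ?G & pair z x \<E> r & pair z y \<E> r" if xy: "x \<E> ?G" "y \<E> ?G" for x y
  proof -
   obtain a b where ab: "a \<E> K" "pair (g a) x \<E> r" "b \<E> K" "pair (g b) y \<E> r" "x \<E> P" "y \<E> P" using xy unfolding G by blast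
   obtain c where c: "c \<E> K" "pair (g c) (g a) \<E> r" "pair (g c) (g b) \<E> r" using K(3)[OF ab(1,3)] unfolding Q by blast
   have "pair (g c) x \<E> r" "pair (g c) y \<E> r" using tr gP Kw ab c by blast+
   thus ?thesis using gG[OF c(1)] by blast
  qed
  show "EX x. x \<E> D & x \<E> ?G" if D: "D \<E> S" for D
  proof -
   obtain a where "a \<E> K" "hit (\<phi> D) (g a)" using K(4)[OF \<phi>(2)[OF D]] unfolding T by blast
   thus ?thesis using gG D unfolding hit_def by blast
  qed
 qed
qed

text \<open>Cohen forcing is countable, hence ccc. Were there only \<omega>1 subsets of \<omega>, a
  filter could meet \<open>D Y\<close> for all of them and would define a subset that differs from
  each.\<close>

lemma MA_not_CH: assumes MA: "MA_for omega1" shows "~ lep (Pow omega) omega1"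
proof
 assume CH: "lep (Pow omega) omega1"
 let ?P = "Sep (prod omega (Fin omega)) (%t. el (p2 t) <= el (p1 t))"
 have dP: "DP (%t. el (p2 t) <= el (p1 t))" by (intro dfn)
 have P: "pair n a \<E> ?P <-> n \<E> omega & el a <= el n" for n a
 proof -
  have "a \<E> Fin omega" if "n \<E> omega" "el a <= el n"
   unfolding mem_Fin using fin_subset[OF that(2) fin_nat[OF that(1)]] that nat_trans[OF that(1)] by (auto simp: subset_eq)
  thus ?thesis by (auto simp: mem_Sep[OF dP])
 qed
 have P_ex: "EX n a. t = pair n a" if "t \<E> ?P" for t using that unfolding mem_Sep[OF dP] by (auto simp: mem_prod)
 have Pc: "lep ?P omega"
 proof -
  have "lep (Fin omega) omega" by (rule lep_Fin[OF lep_refl omega_square]) simp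
  hence "lep (prod omega (Fin omega)) omega" by (intro lep_prod_omega lep_refl)
  moreover have "el ?P <= el (prod omega (Fin omega))" by (rule subsetI) (simp add: mem_Sep[OF dP])
  ultimately show ?thesis using lep_trans lep_subset by blast
 qed
 define L where "L = (%s t. el (p1 t) <= el (p1 s) & (ALL k. k \<E> p1 t --> (k \<E> p2 s <-> k \<E> p2 t)))"
 have "DP2 L" unfolding L_def by (intro dfn)
 note [dfn] = DP2D[OF this]
 let ?r = "Sep (prod ?P ?P) (%t. L (p1 t) (p2 t))"
 have dr: "DP (%t. L (p1 t) (p2 t))" by (intro dfn)
 have r: "pair s t \<E> ?r <-> s \<E> ?P & t \<E> ?P & L s t" for s t unfolding mem_Sep[OF dr] by simp
 have L_refl: "L t t" and L_trans: "L s t ==> L t u ==> L s u" for s t u unfolding L_def sub_iff by blast+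
 define D where "D = (%Y. Sep ?P (%t. EX k. k \<E> p1 t & ~ (k \<E> p2 t <-> k \<E> Y)))"
 have dD: "DP (%t. EX k. k \<E> p1 t & ~ (k \<E> p2 t <-> k \<E> Y))" for Y by (intro dfn)
 have D: "t \<E> D Y <-> t \<E> ?P & (EX k. k \<E> p1 t & ~ (k \<E> p2 t <-> k \<E> Y))" for t Y unfolding D_def by (rule mem_Sep[OF dD])
 have DD: "DF D" unfolding D_def by (intro dfn)
 have "EX G. filtr ?P ?r G & (ALL d. d \<E> Repl (Pow omega) D --> (EX x. x \<E> d & x \<E> G))"
 proof (rule MA[unfolded MA_for_def, rule_format])
  show "EX p. p \<E> ?P" using P[of emp emp] by (intro exI[of _ "pair emp emp"]) simp
  show "x \<E> ?P ==> pair x x \<E> ?r" for x unfolding r using L_refl by blast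
  show "pair x y \<E> ?r ==> pair y z \<E> ?r ==> pair x z \<E> ?r" for x y z unfolding r using L_trans by blast
  show "cccr ?P ?r" unfolding cccr_def using Pc lep_subset lep_trans by blast
  show "lep (Repl (Pow omega) D) omega1" using lep_trans[OF lep_Repl[OF DD] CH] .
  fix d assume "d \<E> Repl (Pow omega) D"
  then obtain Y where Y: "d = D Y" unfolding mem_Repl[OF DD] by blast
  show "densr ?P ?r d" unfolding densr_def Y
  proof (intro conjI allI impI)
   show "el (D Y) <= el ?P" unfolding sub_iff D by blast
   fix x assume x: "x \<E> ?P"
   then obtain n a where na: "x = pair n a" using P_ex by blast
   hence n: "n \<E> omega" "el a <= el n" using x P by auto
   let ?b = "if n \<E> Y then a else un a (sing n)"
   have y: "pair (succ n) ?b \<E> ?P" unfolding P using n by auto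
   have nb: "n \<E> ?b <-> ~ n \<E> Y" using n(2) not_refl[of n] unfolding sub_iff by auto
   have "L (pair (succ n) ?b) x" unfolding L_def na using n by auto
   hence "pair (pair (succ n) ?b) x \<E> ?r" unfolding r using x y by blast
   moreover have "pair (succ n) ?b \<E> D Y" unfolding D using y nb by (intro conjI exI[of _ n]) auto
   ultimately show "EX y. y \<E> D Y & pair y x \<E> ?r" by blast
  qed
 qed
 then obtain G where G: "filtr ?P ?r G" "!!d. d \<E> Repl (Pow omega) D ==> EX x. x \<E> d & x \<E> G" by blast
 have dp: "DF p2" by (intro dfn)
 let ?X = "Union (Repl G p2)"
 have X: "k \<E> ?X <-> (EX t. t \<E> G & k \<E> p2 t)" for k by (rule mem_UN[OF dp])
 have GP: "t \<E> G ==> t \<E> ?P" for t using G(1) unfolding filtr_def sub_iff by blast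
 have sub: "k \<E> p1 t & k \<E> omega" if h: "t \<E> G" "k \<E> p2 t" for k t
 proof -
  obtain n a where na: "t = pair n a" using P_ex GP h by blast
  hence "n \<E> omega" "el a <= el n" using GP h(1) P by auto
  thus ?thesis using h(2) na nat_trans by auto
 qed
 have "?X \<E> Pow omega" unfolding mem_Pow sub_iff X using sub by blast
 hence "D ?X \<E> Repl (Pow omega) D" unfolding mem_Repl[OF DD] by blast
 then obtain t k where t: "t \<E> G" "k \<E> p1 t" "~ (k \<E> p2 t <-> k \<E> ?X)" using G(2) D by blast
 then obtain s where s: "s \<E> G" "k \<E> p2 s" "~ k \<E> p2 t" using X by blast
 obtain u where "pair u t \<E> ?r" "pair u s \<E> ?r" using G(1) t(1) s(1) unfolding filtr_def by blast
 hence "L u t" "L u s" unfolding r by blast+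
 thus False using s(2,3) t(2) sub[OF s(1,2)] unfolding L_def by blast
qed

lemma order_type_unbounded: assumes "lep omega1 A" "el A <= el omega1" "\<gamma> \<E> omega1" shows "EX a. a \<E> A & \<gamma> \<E> a"
proof (rule ccontr)
 assume "~ ?thesis"
 hence "x \<E> succ \<gamma>" if "x \<E> A" for x
  using that assms(2) Ord_linear[OF h_Ord[OF assms(3)] h_Ord[of x omega]] unfolding sub_iff mem_succ by blast
 hence "el A <= el (succ \<gamma>)" by auto
 moreover have "succ \<gamma> \<E> omega1" by (rule hartogs_succ[OF _ assms(3)]) simp
 ultimately show False using assms(1) lep_subset lep_trans not_lep_hartogs unfolding mem_hartogs by blast
qed

end

subsection \<open>Satisfaction of the formulas\<close>

text \<open>The value of the variable of level \<open>x\<close> at depth \<open>d\<close>.\<close>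

definition V where "V e d x = e (d - Suc x)"

lemma V_new [simp]: "V (case_nat a e) (Suc d) d = a" by (simp add: V_def)
lemma V_old [simp]: "x < d ==> V (case_nat a e) (Suc d) x = V e d x"
proof -
 assume "x < d"
 hence "d - x = Suc (d - Suc x)" by simp
 thus ?thesis by (simp add: V_def)
qed

lemma sat_f [simp]:
 "sat E e ((x \<^bold>\<in> y) d) <-> E (V e d x) (V e d y)"
 "sat E e ((x \<^bold>= y) d) <-> V e d x = V e d y"
 "sat E e ((F \<^bold>\<longrightarrow> H) d) <-> (sat E e (F d) --> sat E e (H d))"
 "sat E e ((\<^bold>\<not> F) d) <-> ~ sat E e (F d)"
 "sat E e ((F \<^bold>\<or> H) d) <-> sat E e (F d) | sat E e (H d)"
 "sat E e ((F \<^bold>\<and> H) d) <-> sat E e (F d) & sat E e (H d)"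
 "sat E e ((F \<^bold>\<longleftrightarrow> H) d) <-> (sat E e (F d) <-> sat E e (H d))"
 by (auto simp: f_mem_def f_eq_def f_imp_def f_not_def f_or_def f_and_def f_iff_def V_def)
lemma sat_all [simp]: "sat E e ((\<^bold>\<forall>x. F x) d) <-> (ALL a. sat E (case_nat a e) (F d (Suc d)))"
 by (simp add: f_all_def)
lemma sat_ex [simp]: "sat E e ((\<^bold>\<exists>x. F x) d) <-> (EX a. sat E (case_nat a e) (F d (Suc d)))"
 by (simp add: f_ex_def)
lemma sat_plug: "sat E e (f_plug p v d) <-> sat E (%i. V e d (v i)) p"
 by (simp add: f_plug_def sat_ren V_def)

lemma fv_free_below: "free_below n p <-> (ALL i:fv p. i < n)"
proof (induction p arbitrary: n)
 case (FAll p)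
 show ?case
 proof
  assume "free_below n (FAll p)" thus "ALL i:fv (FAll p). i < n" using FAll[of "Suc n"] by auto
 next
  assume a: "ALL i:fv (FAll p). i < n"
  have "i < Suc n" if "i \<in> fv p" for i using a that by (cases i) auto
  thus "free_below n (FAll p)" using FAll[of "Suc n"] by auto
 qed
qed auto

lemma free_below_ex: "EX n. ALL m>=n. free_below m p"
proof -
 obtain n where "ALL i:fv p. i < n" using finite_fv[of p] finite_nat_set_iff_bounded by auto
 thus ?thesis unfolding fv_free_below by (meson less_le_trans)
qed

lemma sat_FAlls: "sat E e ((FAll ^^ n) f) <-> (ALL b. sat E (%i. if i < n then b i else e (i - n)) f)"
proof (induction n arbitrary: e)
 case (Suc n)
 have eq: "(%i. if i < n then b i else case_nat x e (i - n)) = (%i. if i < Suc n then (b(n := x)) i else e (i - Suc n))" for b x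
  by (auto split: nat.split simp: fun_eq_iff) (metis diff_Suc_Suc diff_is_0_eq' le_eq_less_or_eq less_Suc_eq_le Suc_diff_Suc diff_less_Suc nat.inject not_less_eq)+
 have "sat E e ((FAll ^^ Suc n) f) <-> (ALL x b. sat E (%i. if i < Suc n then (b(n := x)) i else e (i - Suc n)) f)"
  using Suc eq by simp
 also have "\<dots> <-> (ALL b. sat E (%i. if i < Suc n then b i else e (i - Suc n)) f)"
 proof (intro iffI allI)
  fix b assume a: "ALL x b. sat E (%i. if i < Suc n then (b(n := x)) i else e (i - Suc n)) f"
  have "sat E (%i. if i < Suc n then (b(n := b n)) i else e (i - Suc n)) f" using a by blast
  thus "sat E (%i. if i < Suc n then b i else e (i - Suc n)) f" by (simp only: fun_upd_triv)
 next
  fix x b assume a: "ALL b. sat E (%i. if i < Suc n then b i else e (i - Suc n)) f"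
  show "sat E (%i. if i < Suc n then (b(n := x)) i else e (i - Suc n)) f" using spec[OF a, of "b(n := x)"] .
 qed
 finally show ?case .
qed simp

lemma sat_plug1: assumes "free_below (n + 1) p" "V e d x = u" "!!i. i < n ==> V e d i = a i"
 shows "sat E e (f_plug p (case_nat x (%i. i)) d) <-> sat E (case_nat u a) p"
 unfolding sat_plug
proof (rule sat_cong)
 fix i assume "i \<in> fv p"
 hence "i < n + 1" using assms(1) fv_free_below by blast
 thus "V e d (case_nat x (%i. i) i) = case_nat u a i" using assms by (cases i) auto
qed

lemma sat_plug2: assumes "free_below (n + 2) p" "V e d x = u" "V e d y = w" "!!i. i < n ==> V e d i = a i"
 shows "sat E e (f_plug p (case_nat x (case_nat y (%i. i))) d) <-> sat E (case_nat u (case_nat w a)) p"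
 unfolding sat_plug
proof (rule sat_cong)
 fix i assume "i \<in> fv p"
 hence "i < n + 2" using assms(1) fv_free_below by blast
 thus "V e d (case_nat x (case_nat y (%i. i)) i) = case_nat u (case_nat w a) i" using assms by (auto split: nat.split)
qed

lemma sat_separation: assumes "free_below (n + 1) p"
 shows "sat E e (separation n p) <-> (ALL \<alpha>. ALL a. EX b. ALL x. E x b <-> E x a & sat E (case_nat x \<alpha>) p)"
proof -
 have 1: "sat E e ((\<^bold>\<forall>a. \<^bold>\<exists>b. \<^bold>\<forall>x. x \<^bold>\<in> b \<^bold>\<longleftrightarrow> x \<^bold>\<in> a \<^bold>\<and> f_plug p (case_nat x (%i. i))) n) <->
   (ALL a. EX b. ALL x. E x b <-> E x a & sat E (case_nat x (V e n)) p)" for e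
 proof -
  have "sat E (case_nat x (case_nat b (case_nat a e))) (f_plug p (case_nat (Suc (Suc n)) (%i. i)) (Suc (Suc (Suc n)))) <-> sat E (case_nat x (V e n)) p" for x a b
   by (rule sat_plug1[OF assms]) simp_all
  thus ?thesis by simp
 qed
 \<comment> \<open>Levels count from the outermost quantifier and de Bruijn indices from the
   innermost, so the parameters are reversed.\<close>
 have 2: "EX b. ALL i<n. V (%i. if i < n then b i else e (i - n)) n i = \<alpha> i" for \<alpha>
  by (rule exI[of _ "%i. \<alpha> (n - Suc i)"]) (auto simp: V_def)
 have c: "(%x. sat E (case_nat x \<alpha>) p) = (%x. sat E (case_nat x \<alpha>') p)" if "ALL i<n. \<alpha> i = \<alpha>' i" for \<alpha> \<alpha>'
  by (intro HOL.ext sat_cong) (use that assms fv_free_below in "auto split: nat.split")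
 show ?thesis unfolding separation_def sat_FAlls 1
 proof (intro iffI allI)
  fix \<alpha> a assume h: "ALL b a. EX ba. ALL x. E x ba <-> E x a & sat E (case_nat x (V (%i. if i < n then b i else e (i - n)) n)) p"
  obtain b where b: "ALL i<n. V (%i. if i < n then b i else e (i - n)) n i = \<alpha> i" using 2 by blast
  show "EX b. ALL x. E x b <-> E x a & sat E (case_nat x \<alpha>) p"
   using h[rule_format, of a b] unfolding fun_cong[OF c[OF b]] .
 qed blast
qed

lemma sat_replacement: assumes "free_below (n + 2) p"
 shows "sat E e (replacement n p) <-> (ALL \<alpha>. let R = (%x y. sat E (case_nat x (case_nat y \<alpha>)) p) in
   (ALL x y z. R x y & R x z --> y = z) --> (ALL a. EX b. ALL y. E y b <-> (EX x. E x a & R x y)))"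
proof -
 let ?P = "%x y. f_plug p (case_nat x (case_nat y (%i. i)))"
 have 1: "sat E e (((\<^bold>\<forall>x y z. ?P x y \<^bold>\<and> ?P x z \<^bold>\<longrightarrow> y \<^bold>= z) \<^bold>\<longrightarrow>
     (\<^bold>\<forall>a. \<^bold>\<exists>b. \<^bold>\<forall>y. y \<^bold>\<in> b \<^bold>\<longleftrightarrow> (\<^bold>\<exists>x. x \<^bold>\<in> a \<^bold>\<and> ?P x y))) n) <->
   (let R = (%x y. sat E (case_nat x (case_nat y (V e n))) p) in
   (ALL x y z. R x y & R x z --> y = z) --> (ALL a. EX b. ALL y. E y b <-> (EX x. E x a & R x y)))" for e
 proof -
  have "sat E (case_nat z (case_nat y (case_nat x e))) (?P n (Suc n) (Suc (Suc (Suc n)))) <-> sat E (case_nat x (case_nat y (V e n))) p" for x y z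
   by (rule sat_plug2[OF assms]) simp_all
  moreover have "sat E (case_nat z (case_nat y (case_nat x e))) (?P n (Suc (Suc n)) (Suc (Suc (Suc n)))) <-> sat E (case_nat x (case_nat z (V e n))) p" for x y z
   by (rule sat_plug2[OF assms]) simp_all
  moreover have "sat E (case_nat x (case_nat y (case_nat b (case_nat a e)))) (?P (Suc (Suc (Suc n))) (Suc (Suc n)) (Suc (Suc (Suc (Suc n))))) <-> sat E (case_nat x (case_nat y (V e n))) p" for x y a b
   by (rule sat_plug2[OF assms]) simp_all
  ultimately show ?thesis by (simp add: Let_def)
 qed
 have 2: "EX b. ALL i<n. V (%i. if i < n then b i else e (i - n)) n i = \<alpha> i" for \<alpha>
  by (rule exI[of _ "%i. \<alpha> (n - Suc i)"]) (auto simp: V_def)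
 have c: "(%x y. sat E (case_nat x (case_nat y \<alpha>)) p) = (%x y. sat E (case_nat x (case_nat y \<alpha>')) p)" if "ALL i<n. \<alpha> i = \<alpha>' i" for \<alpha> \<alpha>'
 proof (intro HOL.ext sat_cong)
  fix x y i assume "i \<in> fv p"
  hence "i < n + 2" using assms fv_free_below by blast
  thus "case_nat x (case_nat y \<alpha>) i = case_nat x (case_nat y \<alpha>') i" using that by (auto split: nat.split)
 qed
 show ?thesis unfolding replacement_def Let_def[of "%x y. f_plug p (case_nat x (case_nat y (%i. i)))"] sat_FAlls 1
 proof
  assume a: "ALL b. let R = (%x y. sat E (case_nat x (case_nat y (V (%i. if i < n then b i else e (i - n)) n))) p) in
    (ALL x y z. R x y & R x z --> y = z) --> (ALL a. EX b. ALL y. E y b <-> (EX x. E x a & R x y))"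
  show "ALL \<alpha>. let R = (%x y. sat E (case_nat x (case_nat y \<alpha>)) p) in
    (ALL x y z. R x y & R x z --> y = z) --> (ALL a. EX b. ALL y. E y b <-> (EX x. E x a & R x y))"
  proof
   fix \<alpha>
   obtain b where b: "ALL i<n. V (%i. if i < n then b i else e (i - n)) n i = \<alpha> i" using 2 by blast
   show "let R = (%x y. sat E (case_nat x (case_nat y \<alpha>)) p) in
    (ALL x y z. R x y & R x z --> y = z) --> (ALL a. EX b. ALL y. E y b <-> (EX x. E x a & R x y))"
    using spec[OF a, of b] unfolding c[OF b] .
  qed
 qed blast
qed

lemma sat_DP: "dfn E (%e. sat E (case_nat (e 0) \<alpha>) p)"
proof (rule dfnI)
 have "(%i. join e \<alpha> (case_nat 0 (%i. Suc (2 * i)) i)) = case_nat (e 0) \<alpha>" for e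
  by (auto simp: join_def split: nat.split)
 thus "sat E (case_nat (e 0) \<alpha>) p = sat E (join e \<alpha>) (ren (case_nat 0 (%i. Suc (2 * i))) p)" for e
  by (simp add: sat_ren)
qed

lemma sat_DP2: "dfn E (%e. sat E (case_nat (e 0) (case_nat (e (Suc 0)) \<alpha>)) p)"
proof (rule dfnI)
 have "(%i. join e \<alpha> (case_nat 0 (case_nat 2 (%i. Suc (2 * i))) i)) = case_nat (e 0) (case_nat (e (Suc 0)) \<alpha>)" for e
  by (auto simp: join_def split: nat.split)
 thus "sat E (case_nat (e 0) (case_nat (e (Suc 0)) \<alpha>)) p = sat E (join e \<alpha>) (ren (case_nat 0 (case_nat 2 (%i. Suc (2 * i)))) p)" for e
  by (simp add: sat_ren)
qed

lemma DP_sat: assumes "dfn E (%e. P (e 0))" shows "EX p \<alpha>. ALL x. P x = sat E (case_nat x \<alpha>) p"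
proof -
 obtain \<phi> a where P: "!!e. P (e 0) = sat E (join e a) \<phi>" using assms unfolding dfn_def by blast
 \<comment> \<open>The predicate depends on variable 0 only, so all even variables may be given the
   value \<open>x\<close>.\<close>
 have "P x = sat E (case_nat x a) (ren (%i. if even i then 0 else Suc (i div 2)) \<phi>)" for x
 proof -
  have "(%i. case_nat x a (if even i then 0 else Suc (i div 2))) = join (%_. x) a" by (auto simp: join_def)
  thus ?thesis using P[of "%_. x"] by (simp add: sat_ren)
 qed
 thus ?thesis by blast
qed

lemma DP2_sat: assumes "dfn E (%e. R (e 0) (e (Suc 0)))" shows "EX p \<alpha>. ALL x y. R x y = sat E (case_nat x (case_nat y \<alpha>)) p"
proof -
 obtain \<phi> a where R: "!!e. R (e 0) (e (Suc 0)) = sat E (join e a) \<phi>" using assms unfolding dfn_def by blast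
 have "R x y = sat E (case_nat x (case_nat y a)) (ren (%i. if even i then if i = 0 then 0 else 1 else Suc (Suc (i div 2))) \<phi>)" for x y
 proof -
  have "(%i. case_nat x (case_nat y a) (if even i then if i = 0 then 0 else 1 else Suc (Suc (i div 2)))) = join (case_nat x (%_. y)) a"
   by (auto simp: join_def fun_eq_iff elim!: evenE split: nat.split)
  thus ?thesis using R[of "case_nat x (%_. y)"] by (simp add: sat_ren)
 qed
 thus ?thesis by blast
qed

context zf begin

lemma sat_subset [simp]: "x < d ==> y < d ==> sat E e ((x \<^bold>\<subseteq> y) d) <-> el (V e d x) <= el (V e d y)"
 by (simp add: is_subset_def subset_eq Ball_def)
lemma sat_empty [simp]: "x < d ==> sat E e (is_empty x d) <-> V e d x = emp"
 by (auto simp: is_empty_def intro: empI)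
lemma sat_upair [simp]: "x < d ==> y < d ==> p < d ==> sat E e (is_upair x y p d) <-> V e d p = upair (V e d x) (V e d y)"
 by (auto simp: is_upair_def intro: ext)
lemma sat_pair [simp]: "x < d ==> y < d ==> p < d ==> sat E e (is_pair x y p d) <-> V e d p = pair (V e d x) (V e d y)"
 by (simp add: is_pair_def pair_def)
lemma sat_pair_in [simp]: "x < d ==> y < d ==> r < d ==> sat E e (pair_in x y r d) <-> pair (V e d x) (V e d y) \<E> V e d r"
 by (simp add: pair_in_def)
lemma sat_power [simp]: "x < d ==> p < d ==> sat E e (is_power x p d) <-> V e d p = Pow (V e d x)"
 by (auto simp: is_power_def subset_eq intro: ext)
lemma sat_succ [simp]: "x < d ==> s < d ==> sat E e (is_succ x s d) <-> V e d s = succ (V e d x)"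
 by (auto simp: is_succ_def intro: ext)

definition isfun where "isfun f A B <-> fn f A & (ALL x. x \<E> A --> app f x \<E> B)"
lemma isfun_lam: "DF f ==> (!!x. x \<E> A ==> f x \<E> B) ==> isfun (lam A f) A B"
 unfolding isfun_def using fn_lam app_lam by metis

lemma isfun_iff: "isfun f A B <-> (ALL p. p \<E> f --> (EX x y. x \<E> A & y \<E> B & p = pair x y)) &
 (ALL x. x \<E> A --> (EX y. pair x y \<E> f)) & (ALL x y z. pair x y \<E> f & pair x z \<E> f --> y = z)" (is "_ <-> ?R")
proof
 assume "isfun f A B"
 hence f: "fn f A" "!!x. x \<E> A ==> app f x \<E> B" unfolding isfun_def by blast+
 have "EX x y. x \<E> A & y \<E> B & p = pair x y" if "p \<E> f" for p using that f(2) unfolding fn_mem[OF f(1)] by blast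
 thus ?R unfolding fn_pair[OF f(1)] by blast
next
 assume R: ?R
 hence f: "fn f A" unfolding fn_def by blast
 moreover have "app f x \<E> B" if "x \<E> A" for x
 proof -
  have "pair x (app f x) \<E> f" using fn_pair[OF f] that by blast
  thus ?thesis using R by (metis pair_inj)
 qed
 ultimately show "isfun f A B" unfolding isfun_def by blast
qed

lemma sat_fun [simp]: "f < d ==> A < d ==> B < d ==> sat E e (is_fun f A B d) <-> isfun (V e d f) (V e d A) (V e d B)"
 by (simp add: is_fun_def isfun_iff)

lemma lep_iff: "(EX f. isfun f A B & (ALL x y z. pair x z \<E> f & pair y z \<E> f --> x = y)) <-> lep A B"
proof
 assume "EX f. isfun f A B & (ALL x y z. pair x z \<E> f & pair y z \<E> f --> x = y)"
 then obtain f where f: "fn f A" "!!x. x \<E> A ==> app f x \<E> B" "!!x y z. pair x z \<E> f ==> pair y z \<E> f ==> x = y" unfolding isfun_def by blast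
 show "lep A B" unfolding lep_def by (rule exI[of _ f]) (use f fn_pair[OF f(1)] in metis)
next
 assume "lep A B"
 then obtain f where f: "DF f" "!!x. x \<E> A ==> f x \<E> B" "!!x y. x \<E> A ==> y \<E> A ==> f x = f y ==> x = y" by (rule lepE) blast
 show "EX f. isfun f A B & (ALL x y z. pair x z \<E> f & pair y z \<E> f --> x = y)"
  by (rule exI[of _ "lam A f"]) (use f isfun_lam[OF f(1)] in "auto simp: mem_lam")
qed

lemma sat_card_le [simp]: "A < d ==> B < d ==> sat E e (card_le A B d) <-> lep (V e d A) (V e d B)"
 by (simp add: card_le_def is_injective_def lep_iff[symmetric])
lemma sat_card_eq: "A < d ==> B < d ==> sat E e (card_eq A B d) ==> lep (V e d A) (V e d B)"
 unfolding lep_iff[symmetric] by (simp add: card_eq_def is_injective_def) blast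
lemma sat_ordinal [simp]: "x < d ==> sat E e (is_ordinal x d) <-> Ord (V e d x)"
 by (auto simp: is_ordinal_def is_transitive_def Ord_def)
lemma sat_inductive [simp]: "x < d ==> sat E e (is_inductive x d) <-> indset (V e d x)"
 by (simp add: is_inductive_def indset_def)
lemma sat_omega [simp]: "x < d ==> sat E e (is_omega x d) <-> V e d x = omega"
 by (auto simp: is_omega_def mem_omega intro: ext)
lemma sat_countable [simp]: "x < d ==> sat E e (is_countable x d) <-> lep (V e d x) omega"
 by (simp add: is_countable_def)
lemma sat_continuum [simp]: "x < d ==> sat E e (is_continuum x d) <-> V e d x = Pow omega"
 by (simp add: is_continuum_def)

end

section \<open>The models of ZFC as instances of \<open>zfc\<close>, and conversely\<close>

lemma sat_zfc: assumes Z: "!!p. p \<in> ZFC ==> sat E e p" shows "zfc E"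
proof -
 have s: "sat E e (sentence F)" if "F \<in> {extensionality, foundation, pairing, union, power_set, infinity, choice}" for F
  using Z that unfolding ZFC_def by blast
 interpret zf E
 proof
  show "x = y" if "!!z. E z x <-> E z y" for x y
   using s[of extensionality] that by (simp add: sentence_def extensionality_def)
  show "EX y. E y x & (ALL z. E z x --> ~ E z y)" if "E y x" for x y
   using s[of foundation] that by (simp add: sentence_def foundation_def is_empty_def) blast
  show "EX p. ALL z. E z p <-> z = x | z = y" for x y
   using s[of pairing] by (simp add: sentence_def pairing_def is_upair_def)
  show "EX u. ALL z. E z u <-> (EX y. E y x & E z y)" for x
   using s[of union] by (simp add: sentence_def union_def)
  show "EX p. ALL z. E z p <-> (ALL w. E w z --> E w x)" for x
   using s[of power_set] by (simp add: sentence_def power_set_def is_power_def is_subset_def)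
  show "EX x. (EX z. (ALL w. ~ E w z) & E z x) & (ALL y. E y x --> (EX s. (ALL z. E z s <-> E z y | z = y) & E s x))"
   using s[of infinity] by (simp add: sentence_def infinity_def is_inductive_def is_empty_def is_succ_def)
  show "EX b. ALL x. E x b <-> E x a & P x" if P: "dfn E (%e. P (e 0))" for P a
  proof -
   obtain p \<alpha> where p: "!!x. P x = sat E (case_nat x \<alpha>) p" using DP_sat[OF P] by blast
   obtain n where n: "free_below (n + 1) p" using free_below_ex[of p] by (metis le_add1)
   have "sat E e (separation n p)" using Z n unfolding ZFC_def by blast
   thus ?thesis unfolding sat_separation[OF n] p by blast
  qed
  show "EX b. ALL y. E y b <-> (EX x. E x a & R x y)" if R: "dfn E (%e. R (e 0) (e (Suc 0)))" "!!x y z. R x y ==> R x z ==> y = z" for R a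
  proof -
   obtain p \<alpha> where p: "!!x y. R x y = sat E (case_nat x (case_nat y \<alpha>)) p" using DP2_sat[OF R(1)] by blast
   obtain n where n: "free_below (n + 2) p" using free_below_ex[of p] by (metis le_add1)
   have "sat E e (replacement n p)" using Z n unfolding ZFC_def by blast
   thus ?thesis unfolding sat_replacement[OF n] Let_def using R(2) unfolding p by blast
  qed
 qed
 show ?thesis
 proof
  fix a assume a: "!!x. E x a ==> EX y. E y x"
  have "EX f b. isfun f a b & (ALL x y. E (pair x y) f --> E y x)"
   using s[of choice] a by (simp add: sentence_def choice_def) (metis mem_emp)
  then obtain f b where f: "isfun f a b" "!!x y. E (pair x y) f ==> E y x" by blast
  hence "!!x. E x a ==> E (app f x) x" unfolding isfun_def using fn_pair by blast
  thus "EX f. ALL x. E x a --> E (app f x) x" by blast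
 qed
qed

lemma zfc_sat: assumes "zfc E" "p \<in> ZFC" shows "sat E e p"
proof -
 interpret zfc E by fact
 consider F where "p = sentence F" "F \<in> {extensionality, foundation, pairing, union, power_set, infinity, Defs.choice}"
  | n q where "p = separation n q" "free_below (n + 1) q" | n q where "p = replacement n q" "free_below (n + 2) q"
  using assms(2) unfolding ZFC_def by blast
 thus ?thesis
 proof cases
  case 1
  have "sat E e (sentence extensionality)" using ext by (simp add: sentence_def extensionality_def)
  moreover have "sat E e (sentence foundation)"
   using fnd empI by (simp add: sentence_def foundation_def) metis
  moreover have "sat E e (sentence pairing)" by (simp add: sentence_def pairing_def)
  moreover have "sat E e (sentence union)" using union_ax by (simp add: sentence_def union_def)
  moreover have "sat E e (sentence power_set)" by (simp add: sentence_def power_set_def)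
  moreover have "sat E e (sentence infinity)"
   by (simp add: sentence_def infinity_def) (rule exI[of _ omega], simp add: indset_def)
  moreover have "sat E e (sentence Defs.choice)"
  proof -
   have "EX f b. isfun f a b & (ALL x y. E (pair x y) f --> E y x)" if a: "ALL x. E x a --> x ~= emp" for a
   proof -
    obtain f where f: "!!x. E x a ==> E (app f x) x" using choice_ax[of a] a empI by metis
    have d: "DF (app f)" by (intro dfn)
    have "isfun (lam a (app f)) a (Union a)" by (rule isfun_lam[OF d]) (use f in auto)
    moreover have "E (pair x y) (lam a (app f)) --> E y x" for x y using f by (auto simp: mem_lam[OF d])
    ultimately show ?thesis by blast
   qed
   thus ?thesis by (simp add: sentence_def choice_def)
  qed
  ultimately show ?thesis using 1 by blast
 next
  case 2
  show ?thesis unfolding 2(1) sat_separation[OF 2(2)] using sep_ax[OF sat_DP] by blast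
 next
  case 3
  show ?thesis unfolding 3(1) sat_replacement[OF 3(2)] Let_def using repl_ax[OF sat_DP2] by blast
 qed
qed

lemma zfc_ex: assumes "consistent ZFC" shows "EX E :: nat => nat => bool. zfc E"
proof -
 obtain E :: "nat => nat => bool" and q e where q: "equivp q" and cong: "!!x x' y y'. q x x' ==> q y y' ==> E x y ==> E x' y'"
  and T: "!!p. p \<in> ZFC ==> satq E q e p" using completeness_aux[OF assms] by blast
 \<comment> \<open>Equality is not genuine yet, so pairing and infinity are read off directly; they
   provide the singletons and the empty set that \<open>satq_quotient\<close> asks for as
   \<open>s\<close> and \<open>z\<close>.\<close>
 have "satq E q e (sentence pairing)" "satq E q e (sentence infinity)" using T unfolding ZFC_def by blast+
 note ax = this[unfolded sentence_def pairing_def infinity_def is_upair_def is_inductive_def is_empty_def f_mem_def f_eq_def f_imp_def f_not_def f_or_def f_and_def f_iff_def f_all_def f_ex_def]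
 have pr: "ALL x y. EX p. ALL z. E z p <-> q z x | q z y" using ax(1) by simp blast
 have "EX z. ALL w. ~ E w z" using ax(2) by simp blast
 then obtain z where z: "!!w. ~ E w z" by blast
 have "ALL x. EX p. ALL z. E z p <-> q z x" using pr by metis
 then obtain s where s: "!!x z. E z (s x) <-> q z x" by metis
 have qr: "q x x" and qs: "q x y ==> q y x" for x y using q unfolding equivp_def by metis+
 have s1: "q (s x) (s y) ==> q x y" and z1: "~ q z (s x)" for x y using s z qr qs cong by metis+
 have "EX (E' :: nat => nat => bool) v. surj v & (ALL x y. v x = v y <-> q x y) &
   (ALL x y. E' (v x) (v y) <-> E x y) & (ALL e p. sat E' (%i. v (e i)) p <-> satq E q e p)"
  by (rule satq_quotient[OF q, of E s z]) (erule (2) cong | erule s1 | rule z1)+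
 then obtain E' :: "nat => nat => bool" and v where "!!e p. sat E' (%i. v (e i)) p <-> satq E q e p" by blast
 hence "zfc E'" using sat_zfc[of E' "%i. v (e i)"] T by blast
 thus ?thesis by blast
qed

context zfc begin

lemma omega1_iff: "x = omega1 <-> Ord x & ~ lep x omega & (ALL a. a \<E> x --> lep a omega)"
proof
 assume "x = omega1"
 thus "Ord x & ~ lep x omega & (ALL a. a \<E> x --> lep a omega)" using not_lep_hartogs by (auto simp: mem_hartogs)
next
 assume x: "Ord x & ~ lep x omega & (ALL a. a \<E> x --> lep a omega)"
 hence "el omega1 <= el x" using hartogs_le by blast
 moreover have "el x <= el omega1" using x Ord_mem by (auto simp: mem_hartogs)
 ultimately show "x = omega1" using el_inj by blast
qed

lemma sat_omega1 [simp]: "x < d ==> sat E e (is_omega1 x d) <-> V e d x = omega1"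
 unfolding omega1_iff by (simp add: is_omega1_def)
lemma sat_numeral [simp]: "x < d ==> sat E e (is_numeral k x d) <-> V e d x = num k"
 by (induction k arbitrary: x d e) auto
lemma sat_at_most [simp]: "x < d ==> sat E e (card_at_most x k d) <-> lep (V e d x) (num k)"
 by (simp add: card_at_most_def)
lemma sat_at_least [simp]: "x < d ==> sat E e (card_at_least x k d) <-> lep (num k) (V e d x)"
 by (simp add: card_at_least_def)

lemma sat_ccc [simp]: "P < d ==> r < d ==> sat E e (is_ccc P r d) <-> cccr (V e d P) (V e d r)"
 by (simp add: is_ccc_def is_antichain_def compatible_def cccr_def imp_conjL)
lemma sat_dense [simp]: "P < d ==> r < d ==> D < d ==> sat E e (is_dense P r D d) <-> densr (V e d P) (V e d r) (V e d D)"
 by (simp add: is_dense_def densr_def)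
lemma sat_filter [simp]: "P < d ==> r < d ==> G < d ==> sat E e (is_filter P r G d) <-> filtr (V e d P) (V e d r) (V e d G)"
proof -
 have ne: "x ~= emp <-> (EX y. y \<E> x)" for x using empI by auto
 show "P < d ==> r < d ==> G < d ==> ?thesis"
  by (simp add: is_filter_def) (simp only: filtr_def ne imp_conjL)
qed

lemma sat_MA_at: assumes "\<kappa> < d" "MA_for (V e d \<kappa>)" shows "sat E e (MA_at \<kappa> d)"
proof -
 have ne: "x ~= emp <-> (EX y. y \<E> x)" for x using empI by auto
 show ?thesis using assms(1)
  by (simp add: MA_at_def is_partial_order_def) (use assms(2) in "simp only: MA_for_def ne imp_conjL; blast")
qed

text \<open>A cardinal below the continuum is an element of \<open>w\<close> and hence of size at
  most \<omega>1. For \<open>w\<close> the old \<omega>2 is taken later.\<close>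

lemma sat_MA:
 assumes w: "Ord w" "lep (Pow omega) w" "!!\<beta>. \<beta> \<E> w ==> lep \<beta> omega1" and MA: "MA_for omega1"
 shows "sat E e (sentence MA)"
proof -
 have "MA_for \<kappa>" if k: "Ord \<kappa>" "~ lep (Pow omega) \<kappa>" for \<kappa>
 proof -
  have "\<kappa> \<E> w" using Ord_not_mem[OF k(1) w(1)] k(2) w(2) lep_subset lep_trans by blast
  thus ?thesis using MA MA_for_mono w(3) by blast
 qed
 thus ?thesis by (simp add: sentence_def MA_def is_cardinal_def card_less_def sat_MA_at)
qed

lemma sat_not_CH: "MA_for omega1 ==> ~ sat E e (sentence CH)"
proof
 assume MA: "MA_for omega1" and "sat E e (sentence CH)"
 then obtain c w where cw: "c = Pow omega" "w = omega1" "sat E (case_nat w (case_nat c e)) (card_eq 0 (Suc 0) (Suc (Suc 0)))"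
  by (auto simp: sentence_def CH_def)
 have "lep c w" using sat_card_eq[OF _ _ cw(3)] by simp
 thus False using MA_not_CH[OF MA] cw by simp
qed

lemma order_type_lep:
 assumes "isfun f omega1 A" "ALL x y u v. pair x u \<E> f & pair y v \<E> f --> (x \<E> y <-> u \<E> v)"
 shows "lep omega1 A"
 unfolding lep_def
proof (rule exI[of _ f], intro conjI allI impI)
 have f: "fn f omega1" "!!x. x \<E> omega1 ==> app f x \<E> A" using assms(1) unfolding isfun_def by blast+
 show "x \<E> omega1 ==> app f x \<E> A" for x by (rule f(2))
 fix x y assume xy: "x \<E> omega1" "y \<E> omega1" "app f x = app f y"
 have "x \<E> y <-> app f x \<E> app f y" "y \<E> x <-> app f y \<E> app f x" using assms(2) fn_pair[OF f(1)] xy by blast+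
 thus "x = y" using h_linear[OF xy(1) xy(2)] xy(3) by auto
qed

text \<open>Order type \<omega>1 enters only through \<open>lep omega1 A\<close>, by
  \<open>order_type_lep\<close>, so \<open>hit\<close> is asked for all uncountable \<open>A\<close>
  and \<open>B\<close>.\<close>

lemma sat_arrow:
 assumes c: "isfun c T D" and T: "!!s. s \<E> T <-> (EX x y. x \<E> omega1 & y \<E> omega1 & x ~= y & s = upair x y)"
  and bdd: "!!\<xi>. \<xi> \<E> D ==> lep (Sep T (%s. pair s \<xi> \<E> c)) (num k)"
  and hit: "!!A B. el A <= el omega1 ==> el B <= el omega1 ==> lep omega1 A ==> lep omega1 B ==>
    EX \<xi> f s. pair s \<xi> \<E> c & DF f & (ALL l. l \<E> num k --> pair (f l) \<xi> \<E> c & (EX \<alpha> \<beta>. \<alpha> \<E> A & \<beta> \<E> B & \<alpha> \<E> \<beta> & f l = upair \<alpha> \<beta>)) &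
     (ALL l l'. l \<E> num k --> l' \<E> num k --> f l = f l' --> l = l')"
 shows "sat E e (sentence (not_arrow_star k))"
proof -
 have cT: "pair s \<xi> \<E> c ==> s \<E> T" for s \<xi> using c fn_pair unfolding isfun_def by blast
 have dF: "DP (%s. pair s \<xi> \<E> c)" for \<xi> by (intro dfn)
 have F: "s \<E> Sep T (%s. pair s \<xi> \<E> c) <-> pair s \<xi> \<E> c" for s \<xi> unfolding mem_Sep[OF dF] using cT by blast
 have "EX \<xi>. (EX s. pair s \<xi> \<E> c) & (EX R F I. (ALL s. s \<E> R <-> (EX \<alpha> \<beta>. \<alpha> \<E> A & \<beta> \<E> B & \<alpha> \<E> \<beta> & s = upair \<alpha> \<beta>)) &
   (ALL s. s \<E> F <-> pair s \<xi> \<E> c) & (ALL z. z \<E> I <-> z \<E> R & z \<E> F) & lep (num k) I)"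
  if AB: "el A <= el omega1" "el B <= el omega1" "lep omega1 A" "lep omega1 B" for A B
 proof -
  from hit[OF AB] show ?thesis
  proof (elim exE conjE)
   fix \<xi> f s assume s: "pair s \<xi> \<E> c" and f: "DF f"
    "ALL l. l \<E> num k --> pair (f l) \<xi> \<E> c & (EX \<alpha> \<beta>. \<alpha> \<E> A & \<beta> \<E> B & \<alpha> \<E> \<beta> & f l = upair \<alpha> \<beta>)"
    "ALL l l'. l \<E> num k --> l' \<E> num k --> f l = f l' --> l = l'"
   let ?R = "Sep (Pow omega1) (%s. EX \<alpha> \<beta>. \<alpha> \<E> A & \<beta> \<E> B & \<alpha> \<E> \<beta> & s = upair \<alpha> \<beta>)"
   let ?F = "Sep T (%s. pair s \<xi> \<E> c)"
   let ?I = "Sep ?R (%s. s \<E> ?F)"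
   have dR: "DP (%s. EX \<alpha> \<beta>. \<alpha> \<E> A & \<beta> \<E> B & \<alpha> \<E> \<beta> & s = upair \<alpha> \<beta>)" and dI: "DP (%s. s \<E> ?F)" by (intro dfn)+
   have R: "s \<E> ?R <-> (EX \<alpha> \<beta>. \<alpha> \<E> A & \<beta> \<E> B & \<alpha> \<E> \<beta> & s = upair \<alpha> \<beta>)" for s
    unfolding mem_Sep[OF dR] using AB(1,2) by (auto simp: subset_eq)
   have mI: "s \<E> ?I <-> s \<E> ?R & s \<E> ?F" for s by (rule mem_Sep[OF dI])
   have "lep (num k) ?I"
   proof (rule lepI[OF f(1)])
    fix l assume l: "l \<E> num k"
    show "f l \<E> ?I" unfolding mI unfolding R F using f(2) l by blast
   qed (use f(3) in blast)
   show ?thesis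
    by (rule exI[of _ \<xi>], rule conjI, rule exI[of _ s], rule s, rule exI[of _ ?R], rule exI[of _ ?F], rule exI[of _ ?I])
      (intro conjI allI; fact R F mI \<open>lep (num k) ?I\<close>)
  qed
 qed
 note AB = this
 have "EX F. (ALL s. s \<E> F <-> pair s \<xi> \<E> c) & lep F (num k)" if "\<xi> \<E> D" for \<xi> using F bdd[OF that] by blast
 hence b: "EX T D. (ALL s. s \<E> T <-> (EX x y. x \<E> omega1 & y \<E> omega1 & x ~= y & s = upair x y)) & isfun c T D &
   (ALL \<xi>. \<xi> \<E> D --> (EX F. (ALL s. s \<E> F <-> pair s \<xi> \<E> c) & lep F (num k)))" using T c by blast
 show ?thesis unfolding sentence_def not_arrow_star_def sat_ex
 proof (rule exI[of _ omega1], rule exI[of _ c], unfold sat_f, intro conjI)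
  show "sat E (case_nat c (case_nat omega1 e)) (is_omega1 0 (Suc (Suc 0)))" by simp
  show "sat E (case_nat c (case_nat omega1 e)) (is_bounded_colouring k 0 (Suc 0) (Suc (Suc 0)))"
   using b by (simp add: is_bounded_colouring_def is_two_subsets_def is_fibre_def)
  show "sat E (case_nat c (case_nat omega1 e)) ((\<^bold>\<forall>A B. A \<^bold>\<subseteq> 0 \<^bold>\<and> B \<^bold>\<subseteq> 0 \<^bold>\<and> has_order_type A 0 \<^bold>\<and> has_order_type B 0 \<^bold>\<longrightarrow>
      (\<^bold>\<exists>\<xi>. in_range \<xi> (Suc 0) \<^bold>\<and>
       (\<^bold>\<exists>R F I. is_increasing_pairs A B R \<^bold>\<and> is_fibre (Suc 0) \<xi> F \<^bold>\<and> is_inter R F I \<^bold>\<and>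
         card_at_least I k))) (Suc (Suc 0)))"
  proof -
   have "sat E e' (has_order_type A 0 d) ==> A < d ==> V e' d 0 = omega1 ==> lep omega1 (V e' d A)" for e' A d
    using order_type_lep by (simp add: has_order_type_def) blast
   note ot = this[of "case_nat _ (case_nat _ (case_nat c (case_nat omega1 e)))" _ "Suc (Suc (Suc (Suc 0)))"]
   let ?H = "%A B. \<^bold>\<exists>\<xi>. in_range \<xi> (Suc 0) \<^bold>\<and> (\<^bold>\<exists>R F I. is_increasing_pairs A B R \<^bold>\<and> is_fibre (Suc 0) \<xi> F \<^bold>\<and>
    is_inter R F I \<^bold>\<and> card_at_least I k)"
   have hit: "sat E (case_nat B (case_nat A (case_nat c (case_nat omega1 e)))) (?H (Suc (Suc 0)) (Suc (Suc (Suc 0))) (Suc (Suc (Suc (Suc 0)))))"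
    if "el A <= el omega1" "el B <= el omega1" "lep omega1 A" "lep omega1 B" for A B
    using AB[OF that] by (simp add: in_range_def is_increasing_pairs_def is_fibre_def is_inter_def)
   show ?thesis unfolding sat_all
   proof (intro allI, unfold sat_f, intro impI, elim conjE, rule hit)
    fix A B
    show "lep omega1 A" if "sat E (case_nat B (case_nat A (case_nat c (case_nat omega1 e)))) (has_order_type (Suc (Suc 0)) 0 (Suc (Suc (Suc (Suc 0)))))"
     using ot[OF that] by simp
    show "lep omega1 B" if "sat E (case_nat B (case_nat A (case_nat c (case_nat omega1 e)))) (has_order_type (Suc (Suc (Suc 0))) 0 (Suc (Suc (Suc (Suc 0)))))"
     using ot[OF that] by simp
   qed simp_all
  qed
 qed
qed

end

context generic_ext begin

lemma j_num: "j (num k) = N.num k" by (induction k) (simp_all add: j_emp j_succ)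

text \<open>The witness is the image under \<open>j\<close> of the ground-model colouring. Its bound
  on the classes transfers because \<omega>1 and the numerals are preserved; for the large classes
  \<open>indestructible\<close> is used.\<close>

lemma sat_arrow_ext:
 assumes ccc: ccc and k: "k \<ge> 1" and cfd: "DF2 cf" "DF en" "DF2 \<iota>" and col: "colouring (num k) cf en \<iota>"
 shows "sat N e (sentence (not_arrow_star k))"
proof -
 note w1 = ccc_omega1[OF ccc]
 note [dfn] = DF2D[OF cfd(1)]
 let ?U = "Sep (prod omega1 omega1) (%t. p1 t \<E> p2 t)"
 have dU: "DP (%t. p1 t \<E> p2 t)" by (intro dfn)
 have U: "t \<E> ?U <-> (EX a b. a \<E> omega1 & b \<E> omega1 & a \<E> b & t = pair a b)" for t unfolding mem_Sep[OF dU] mem_prod by auto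
 define c where "c = Repl ?U (%t. pair (upair (p1 t) (p2 t)) (cf (p1 t) (p2 t)))"
 define T where "T = Repl ?U (%t. upair (p1 t) (p2 t))"
 define D where "D = Repl ?U (%t. cf (p1 t) (p2 t))"
 have dc: "DF (%t. pair (upair (p1 t) (p2 t)) (cf (p1 t) (p2 t)))" and dT: "DF (%t. upair (p1 t) (p2 t))"
  and dD: "DF (%t. cf (p1 t) (p2 t))" by (intro dfn)+
 have c: "z \<E> c <-> (EX a b. a \<E> omega1 & b \<E> omega1 & a \<E> b & z = pair (upair a b) (cf a b))" for z
  unfolding c_def mem_Repl[OF dc] U by force
 have T: "z \<E> T <-> (EX a b. a \<E> omega1 & b \<E> omega1 & a \<E> b & z = upair a b)" for z
  unfolding T_def mem_Repl[OF dT] U by force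
 have D: "z \<E> D <-> (EX a b. a \<E> omega1 & b \<E> omega1 & a \<E> b & z = cf a b)" for z
  unfolding D_def mem_Repl[OF dD] U by force
 \<comment> \<open>The order of the two ordinals is recovered from the unordered pair, so the colour
   of a pair is well-defined.\<close>
 have ue: "a = a' & b = b'" if "a \<E> b" "a' \<E> b'" "upair a b = upair a' b'" for a b a' b'
  using that not_sym unfolding upair_eq by blast
 have Tj: "N s (j T) <-> (EX x y. N x (j omega1) & N y (j omega1) & x ~= y & s = N.upair x y)" for s
 proof
  assume "N s (j T)"
  then obtain a b where ab: "a \<E> omega1" "b \<E> omega1" "a \<E> b" "s = j (upair a b)" unfolding j_mem T by blast
  hence "a ~= b" by auto
  thus "EX x y. N x (j omega1) & N y (j omega1) & x ~= y & s = N.upair x y"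
   using ab by (intro exI[of _ "j a"] exI[of _ "j b"]) (simp add: j_upair)
 next
  assume "EX x y. N x (j omega1) & N y (j omega1) & x ~= y & s = N.upair x y"
  then obtain a b where ab: "a \<E> omega1" "b \<E> omega1" "a ~= b" "s = j (upair a b)" unfolding j_mem j_upair by blast
  have "upair a b = upair b a" unfolding upair_eq by blast
  moreover have "a \<E> b | b \<E> a" using h_linear[OF ab(1) ab(2)] ab(3) by blast
  ultimately have "upair a b \<E> T" unfolding T using ab(1,2) by metis
  thus "N s (j T)" using ab(4) by simp
 qed
 have cj: "N (N.pair (j s) (j \<xi>)) (j c) <-> pair s \<xi> \<E> c" for s \<xi> by (simp add: j_pair[symmetric])
 have "N.isfun (j c) (j T) (j D)" unfolding N.isfun_iff
 proof (intro conjI allI impI)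
  fix p assume "N p (j c)"
  then obtain a b where "a \<E> omega1" "b \<E> omega1" "a \<E> b" "p = j (pair (upair a b) (cf a b))" unfolding j_mem c by blast
  thus "EX x y. N x (j T) & N y (j D) & p = N.pair x y"
   by (intro exI[of _ "j (upair a b)"] exI[of _ "j (cf a b)"]) (auto simp: T D j_pair)
 next
  fix x assume "N x (j T)"
  then obtain a b where "a \<E> omega1" "b \<E> omega1" "a \<E> b" "x = j (upair a b)" unfolding j_mem T by blast
  hence "N (N.pair x (j (cf a b))) (j c)" using cj c by blast
  thus "EX y. N (N.pair x y) (j c)" ..
 next
  fix x y z assume "N (N.pair x y) (j c) & N (N.pair x z) (j c)"
  then obtain t t' where t: "t \<E> c" "N.pair x y = j t" "t' \<E> c" "N.pair x z = j t'" unfolding j_mem by metis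
  obtain a b where ab: "a \<E> b" "t = pair (upair a b) (cf a b)" using t(1) c by blast
  obtain a' b' where ab': "a' \<E> b'" "t' = pair (upair a' b') (cf a' b')" using t(3) c by blast
  have "x = j (upair a b)" "y = j (cf a b)" "x = j (upair a' b')" "z = j (cf a' b')" using t ab ab' j_pair by auto
  thus "y = z" using ue[OF ab(1) ab'(1)] by auto
 qed
 moreover have "N.lep (N.Sep (j T) (%s. N (N.pair s \<xi>) (j c))) (N.num k)" if xD: "N \<xi> (j D)" for \<xi>
 proof -
  obtain a0 b0 where ab: "a0 \<E> omega1" "b0 \<E> omega1" "a0 \<E> b0" "\<xi> = j (cf a0 b0)" using xD unfolding j_mem D by blast
  let ?X = "Sep b0 (%a. cf a b0 = cf a0 b0)"
  have dX: "DP (%a. cf a b0 = cf a0 b0)" by (intro dfn)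
  have du: "DF (%a. upair a b0)" by (intro dfn)
  have "lep (Repl ?X (%a. upair a b0)) (num k)"
   using lep_trans[OF lep_Repl[OF du]] col ab(2) unfolding colouring_def by blast
  hence "N.lep (j (Repl ?X (%a. upair a b0))) (N.num k)" using j_lep j_num by metis
  moreover have "N.el (N.Sep (j T) (%s. N (N.pair s \<xi>) (j c))) <= N.el (j (Repl ?X (%a. upair a b0)))"
  proof
   have dS: "N.DP (%s. N (N.pair s \<xi>) (j c))" by (intro dfn)
   fix s assume "s \<in> N.el (N.Sep (j T) (%s. N (N.pair s \<xi>) (j c)))"
   hence s: "N s (j T)" "N (N.pair s \<xi>) (j c)" unfolding N.el_iff N.mem_Sep[OF dS] by blast+
   obtain t where t: "s = j t" using s(1) unfolding j_mem by blast
   then obtain a b where c': "a \<E> b" "t = upair a b" "cf a0 b0 = cf a b" using s(2) unfolding ab(4) t cj c pair_inj by blast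
   hence "b = b0" using col unfolding colouring_def by metis
   hence "t \<E> Repl ?X (%a. upair a b0)" unfolding mem_Repl[OF du] mem_Sep[OF dX] using c' by auto
   thus "s \<in> N.el (j (Repl ?X (%a. upair a b0)))" unfolding t by simp
  qed
  ultimately show ?thesis using N.lep_subset N.lep_trans by blast
 qed
 moreover have "EX \<xi> f s. N (N.pair s \<xi>) (j c) & N.DF f & (ALL l. N l (N.num k) --> N (N.pair (f l) \<xi>) (j c) & (EX \<alpha> \<beta>. N \<alpha> A & N \<beta> B & N \<alpha> \<beta> & f l = N.upair \<alpha> \<beta>)) &
     (ALL l l'. N l (N.num k) --> N l' (N.num k) --> f l = f l' --> l = l')"
  if AB: "N.el A <= N.el (j omega1)" "N.el B <= N.el (j omega1)" "N.lep (j omega1) A" "N.lep (j omega1) B" for A B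
 proof -
  have unb: "EX a. a \<E> omega1 & \<gamma> \<E> a & N (j a) A" if h: "N.lep (j omega1) A" "N.el A <= N.el (j omega1)" "\<gamma> \<E> omega1" for A \<gamma>
  proof -
   obtain z where z: "N z A" "N (j \<gamma>) z" using N.order_type_unbounded[of A "j \<gamma>"] h unfolding w1 by auto
   then obtain a where "a \<E> omega1" "z = j a" using h(2) unfolding N.sub_iff j_mem by blast
   thus ?thesis using z by auto
  qed
  have "EX b x v. b \<E> omega1 & N (j b) B & (ALL l. l \<E> num k --> app x l \<E> b & N (j (app x l)) A & cf (app x l) b = v) &
   (ALL l l'. l \<E> num k --> l' \<E> num k --> app x l = app x l' --> l = l')"
   by (rule indestructible[OF ccc num_omega cfd col]) (rule unb[OF AB(3,1)] unb[OF AB(4,2)], assumption)+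
  then obtain b x v where b: "b \<E> omega1" "N (j b) B" and x: "!!l. l \<E> num k ==> app x l \<E> b & N (j (app x l)) A & cf (app x l) b = v"
   "!!l l'. l \<E> num k ==> l' \<E> num k ==> app x l = app x l' ==> l = l'" by blast
  have dx: "DF (%l. upair (app x l) b)" by (intro dfn)
  let ?f = "N.app (j (lam (num k) (%l. upair (app x l) b)))"
  have f: "?f (j l) = j (upair (app x l) b)" if "l \<E> num k" for l
   using j_fn(2)[OF fn_lam[OF dx] that] app_lam[OF dx that] by simp
  have in_c: "N (N.pair (?f (j l)) (j v)) (j c)" if l: "l \<E> num k" for l
  proof -
   have "app x l \<E> omega1" using h_trans[OF b(1)] x(1)[OF l] by blast
   hence "pair (upair (app x l) b) v \<E> c" unfolding c using b(1) x(1)[OF l] by blast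
   thus ?thesis unfolding f[OF l] cj .
  qed
  \<comment> \<open>As \<open>k\<close> is positive there is an index \<open>num m\<close>, which
    shows that the colour is attained.\<close>
  obtain m where "k = Suc m" using k by (cases k) auto
  hence e0: "m' \<E> num k" if "m' = num m" for m' using that by simp
  show ?thesis
  proof (rule exI[of _ "j v"], rule exI[of _ ?f], rule exI[of _ "?f (j (num m))"], intro conjI allI impI)
   show "N (N.pair (?f (j (num m))) (j v)) (j c)" using in_c e0 by blast
   show "N.DF ?f" by (intro dfn)
   fix l assume "N l (N.num k)"
   then obtain l0 where l: "l0 \<E> num k" "l = j l0" unfolding j_num[symmetric] j_mem by blast
   show "N (N.pair (?f l) (j v)) (j c)" using in_c l by blast
   show "EX \<alpha> \<beta>. N \<alpha> A & N \<beta> B & N \<alpha> \<beta> & ?f l = N.upair \<alpha> \<beta>"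
    by (rule exI[of _ "j (app x l0)"], rule exI[of _ "j b"]) (use b x(1)[OF l(1)] f[OF l(1)] l(2) in "simp add: j_upair")
   fix l' assume "N l' (N.num k)" and eq: "?f l = ?f l'"
   then obtain l1 where l': "l1 \<E> num k" "l' = j l1" unfolding j_num[symmetric] j_mem by blast
   have "upair (app x l0) b = upair (app x l1) b" using eq f[OF l(1)] f[OF l'(1)] l(2) l'(2) by simp
   hence "app x l0 = app x l1" using ue x(1)[OF l(1)] x(1)[OF l'(1)] by blast
   thus "l = l'" using x(2)[OF l(1) l'(1)] l l' by simp
  qed
 qed
 ultimately show ?thesis by (intro N.sat_arrow[of "j c" "j T" "j D"]) (simp_all add: w1 Tj)
qed

end

lemma (in iter_ext) sat_MA_ext:
 assumes book: "!!\<beta> R. \<beta> \<E> omega2 ==> R \<E> Names ==> EX \<gamma>. \<gamma> \<E> omega2 & el \<beta> <= el \<gamma> & e \<gamma> = R"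
  and GCH: "lep (Pow omega1) omega2"
 shows "sat N e' (sentence MA) & sat N e' (sentence MA_aleph1) & ~ sat N e' (sentence CH)"
proof -
 have MA: "N.MA_for (N.hartogs N.omega)"
  by (rule N.MA_for_omega1, unfold N_omega1, rule MA_preorder[OF book]) (assumption | metis)+
 have "sat N e' (sentence MA)"
 proof (rule N.sat_MA[OF N_Ord[OF Ord_hartogs] continuum[OF GCH] _ MA])
  fix \<beta> assume "N \<beta> (j omega2)"
  then obtain \<alpha> where "\<alpha> \<E> omega2" "\<beta> = j \<alpha>" unfolding j_mem by blast
  thus "N.lep \<beta> (N.hartogs N.omega)" unfolding N_omega1 using j_lep by (auto simp: mem_hartogs)
 qed
 moreover have "sat N e' (sentence MA_aleph1)" using N.sat_MA_at MA by (simp add: sentence_def MA_aleph1_def)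
 ultimately show ?thesis using N.sat_not_CH[OF MA] by blast
qed

theorem corollary3p13:
  fixes k :: nat
  assumes "k \<ge> 1"
    and "consistent ZFC"
  shows "consistent (ZFC \<union> sentence ` {MA, MA_aleph1, not_arrow_star k}) &
         consistent (ZFC \<union> sentence ` {MA, \<^bold>\<not> CH, not_arrow_star k})"
proof -
  obtain E :: "nat => nat => bool" where "zfc E" and CH: "zf.lep E (zf.Pow E (zf.omega E)) (zfc.hartogs E (zf.omega E))"
    and GCH: "zf.lep E (zf.Pow E (zfc.hartogs E (zf.omega E))) (zfc.hartogs E (zfc.hartogs E (zf.omega E)))"
    using zfc_ex[OF assms(2)] force_CH force_CH_GCH by metis
  interpret zfc E by fact
  obtain m where m: "k = Suc m" using assms(1) by (cases k) auto
  \<comment> \<open>A point with a colour of its own must obey the bound \<open>k\<close>, so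
    \<open>num k\<close> has to be nonempty.\<close>
  have "E emp (num k)" unfolding m by (rule emp_mem[OF nat_Ord[OF num_omega]]) simp
  then obtain cf en \<iota> where col: "DF2 cf" "DF en" "DF2 \<iota>" "colouring (num k) cf en \<iota>" using colouring_ex[OF CH num_omega] by blast
  obtain e where de: "DF e" and book: "!!\<beta> R. E \<beta> omega2 ==> E R Names ==> EX \<gamma>. E \<gamma> omega2 & el \<beta> <= el \<gamma> & e \<gamma> = R"
    using bookkeeping[OF GCH] by blast
  obtain \<sigma> where \<sigma>: "!!\<beta>. E \<beta> omega2 ==> app \<sigma> \<beta> = Sset (ord \<sigma> \<beta>) (C \<beta>) (e \<beta>)" using iteration_ex[OF de] by blast
  interpret iter E \<sigma> e by unfold_locales (fact de \<sigma>)+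
  interpret poset E CC r2
  proof
    show "EX p. E p CC" using C_emp by blast
    show "E p CC ==> E (pair p p) r2" for p unfolding mem_ord using ple_sup by blast
    show "E (pair p q) r2 ==> E (pair q s) r2 ==> E (pair p s) r2" for p q s using preord_trans[OF r2(1)] .
  qed
  obtain G where "generic G" using generic_ex[OF C_emp] by blast
  then obtain N val where "generic_ext E CC r2 G N val" using generic_ext_ex by blast
  then interpret generic_ext E CC r2 G N val .
  interpret iter_ext E \<sigma> e CC r2 G N val by unfold_locales (rule refl)+
  have "sat N e' (sentence MA) & sat N e' (sentence MA_aleph1) & ~ sat N e' (sentence CH)" for e'
    by (rule sat_MA_ext[OF book GCH])
  moreover have "sat N e' (sentence (not_arrow_star k))" for e' by (rule sat_arrow_ext[OF ccc assms(1) col])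
  moreover have "sat N e' (sentence (\<^bold>\<not> CH)) <-> ~ sat N e' (sentence CH)" for e' by (simp add: sentence_def)
  moreover have "p \<in> ZFC ==> sat N e' p" for p e' by (rule zfc_sat[OF N.zfc_axioms])
  \<comment> \<open>The same extension \<open>N\<close> is a model of both theories.\<close>
  ultimately show ?thesis by (intro conjI consistentI[of _ N "%_. 0"]) auto
qed

end
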